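(* Let $\mathcal F_G$ denote the family of all non-Sylow $p$-subgroups of $G$ and let $\mathcal F_G/G$ denote the set of $G$-conjugacy classes in $\mathcal F_G$. Then the set $\{\Omega_{G/P}\mid [P]\in\mathcal F_G/G\}$ generates $D^\Omega(G)$.
   Context: $G$ is a finite group, $p$ a prime, $S$ a Sylow $p$-subgroup of $G$, $k$ an algebraically closed field of characteristic $p$. All $kG$-modules are finitely generated, and all $G$-sets are non-empty and finite. A $p$-permutation $kG$-module is a direct summand of a permutation $kG$-module. A $kG$-module $M$ is a Dade $kG$-module if $\mathrm{End}_k(M)\cong k^n\oplus W$ for some $n\ge 0$ and some $p$-permutation module $W$ all of whose indecomposable summands have vertices that are non-Sylow $p$-subgroups; it is capped if it has an indecomposable summand with vertex $S$. Dade modules $M,N$ are compatible if $M\oplus N$ is a Dade module; this is an equivalence relation on capped Dade modules. $D(G)$ is the abelian group of equivalence classes of capped Dade $kG$-modules with $[M]+[N]=[M\otimes_k N]$. For a $G$-set $X$, $\Delta(X)$ is the kernel of the augmentation map $kX\to k$. If $X^S=\emptyset$ then $\Delta(X)$ is a capped Dade module and $\Omega_X:=[\Delta(X)]\in D(G)$. $D^\Omega(G)$ is the subgroup of $D(G)$ generated by the $\Omega_X$ as $X$ runs over all $G$-sets with $X^S=\emptyset$. *)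

theory Defs
  imports
    "HOL-Library.Function_Algebras"
    "HOL-Library.Product_Plus"
    "HOL-Library.FuncSet"
    "HOL-Computational_Algebra.Primes"
    "HOL-Computational_Algebra.Polynomial"
    "HOL-Algebra.Group_Action"
    "HOL-Algebra.Left_Coset"
    "HOL-Algebra.Generated_Groups"
begin

section \<open>Finitely generated modules over a group algebra\<close>

text \<open>
  A module over the group algebra \<open>kG\<close> is a \<open>k\<close>-vector space with a linear action of \<open>G\<close>.
  The vector space is a subspace \<open>vecs M\<close> of an ambient type, whose addition comes from
  \<^class>\<open>ab_group_add\<close> and whose scalar multiplication is \<open>scl M\<close>. The behaviour of \<open>act M\<close> outside
  \<open>carrier G\<close> and \<open>vecs M\<close> is irrelevant.
\<close>

record ('g, 'k, 'v) gmod =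
  vecs :: "'v set"
  scl :: "'k \<Rightarrow> 'v \<Rightarrow> 'v"
  act :: "'g \<Rightarrow> 'v \<Rightarrow> 'v"

text \<open>
  Every finitely generated module has an isomorphic copy inside the type \<open>nat \<Rightarrow> 'k\<close>.
  Quantification over all modules is therefore quantification over the following type.
\<close>

type_synonym ('g, 'k) std_gmod = "('g, 'k, nat \<Rightarrow> 'k) gmod"

definition linear_map_on ::
    "'v set \<Rightarrow> ('k \<Rightarrow> 'v \<Rightarrow> 'v) \<Rightarrow> ('k \<Rightarrow> 'w \<Rightarrow> 'w) \<Rightarrow> ('v::plus \<Rightarrow> 'w::plus) \<Rightarrow> bool"
  where "linear_map_on V s t f \<longleftrightarrow>
    (\<forall>x\<in>V. \<forall>y\<in>V. f (x + y) = f x + f y) \<and> (\<forall>c. \<forall>x\<in>V. f (s c x) = t c (f x))"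

locale kG_module = group G + V: vector_space "scl M"
  for G :: "('g, 'm) monoid_scheme" (structure)
    and M :: "('g, 'k::field, 'v::ab_group_add) gmod" +
  assumes subspace_vecs: "V.subspace (vecs M)"
    and act_closed: "\<lbrakk>g \<in> carrier G; v \<in> vecs M\<rbrakk> \<Longrightarrow> act M g v \<in> vecs M"
    and act_linear: "g \<in> carrier G \<Longrightarrow> linear_map_on (vecs M) (scl M) (scl M) (act M g)"
    and act_one: "v \<in> vecs M \<Longrightarrow> act M \<one> v = v"
    and act_mult: "\<lbrakk>g \<in> carrier G; h \<in> carrier G; v \<in> vecs M\<rbrakk>
      \<Longrightarrow> act M (g \<otimes> h) v = act M g (act M h v)"
    and finitely_generated:
      "\<exists>B. finite B \<and> B \<subseteq> vecs M \<and> vecs M = V.span (\<Union>g\<in>carrier G. act M g ` B)"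

definition gmod_iso ::
    "('g, 'm) monoid_scheme \<Rightarrow> ('g, 'k, 'v::plus) gmod \<Rightarrow> ('g, 'k, 'w::plus) gmod \<Rightarrow> bool"
  where "gmod_iso G M N \<longleftrightarrow>
    (\<exists>f. bij_betw f (vecs M) (vecs N) \<and> linear_map_on (vecs M) (scl M) (scl N) f \<and>
         (\<forall>g\<in>carrier G. \<forall>v\<in>vecs M. f (act M g v) = act N g (f v)))"

definition direct_sum ::
    "('g, 'k, 'v) gmod \<Rightarrow> ('g, 'k, 'w) gmod \<Rightarrow> ('g, 'k, 'v \<times> 'w) gmod"
  where "direct_sum M N =
    \<lparr>vecs = vecs M \<times> vecs N,
     scl = (\<lambda>c (v, w). (scl M c v, scl N c w)),
     act = (\<lambda>g (v, w). (act M g v, act N g w))\<rparr>"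

text \<open>\<open>M\<close> is isomorphic to a direct summand of \<open>N\<close>. A complement can be taken inside \<open>N\<close>.\<close>

definition gmod_summand ::
    "('g, 'm) monoid_scheme \<Rightarrow> ('g, 'k::field, 'v::ab_group_add) gmod
      \<Rightarrow> ('g, 'k, 'w::ab_group_add) gmod \<Rightarrow> bool"
  where "gmod_summand G M N \<longleftrightarrow>
    kG_module G M \<and>
    (\<exists>N' :: ('g, 'k, 'w) gmod. kG_module G N' \<and> gmod_iso G N (direct_sum M N'))"

definition indecomposable ::
    "('g, 'm) monoid_scheme \<Rightarrow> ('g, 'k::field, 'v::ab_group_add) gmod \<Rightarrow> bool"
  where "indecomposable G M \<longleftrightarrow>
    kG_module G M \<and> vecs M \<noteq> {0} \<and>
    (\<forall>(A :: ('g, 'k, 'v) gmod) (B :: ('g, 'k, 'v) gmod).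
      kG_module G A \<and> kG_module G B \<and> gmod_iso G M (direct_sum A B)
        \<longrightarrow> vecs A = {0} \<or> vecs B = {0})"

text \<open>The trivial module \<open>k\<^sup>n\<close>.\<close>

definition trivial_gmod :: "nat \<Rightarrow> ('g, 'k::field) std_gmod"
  where "trivial_gmod n =
    \<lparr>vecs = {f. \<forall>i\<ge>n. f i = 0}, scl = (\<lambda>c f i. c * f i), act = (\<lambda>g f. f)\<rparr>"

text \<open>\<open>End\<^sub>k(M)\<close> with conjugation action; endomorphisms of \<open>vecs M\<close> are extended by zero.\<close>

definition End_gmod ::
    "('g, 'm) monoid_scheme \<Rightarrow> ('g, 'k, 'v::ab_group_add) gmod \<Rightarrow> ('g, 'k, 'v \<Rightarrow> 'v) gmod"
  where "End_gmod G M =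
    \<lparr>vecs = {f. f ` vecs M \<subseteq> vecs M \<and> linear_map_on (vecs M) (scl M) (scl M) f \<and>
                (\<forall>v. v \<notin> vecs M \<longrightarrow> f v = 0)},
     scl = (\<lambda>c f v. scl M c (f v)),
     act = (\<lambda>g f v. if v \<in> vecs M then act M g (f (act M (inv\<^bsub>G\<^esub> g) v)) else 0)\<rparr>"

subsection \<open>Tensor products\<close>

text \<open>
  The tensor product \<open>M \<otimes>\<^sub>k N\<close> is realised as in Halmos's textbook, inside the dual of the space of
  bilinear forms on \<open>M \<times> N\<close>: the pure tensor of \<open>v\<close> and \<open>w\<close> is evaluation at \<open>(v, w)\<close>.
  The action in \<open>tensor_gmod\<close> sends the pure tensor of \<open>v, w\<close> to that of \<open>g v, g w\<close>.
\<close>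

definition bilinear_form ::
    "('g, 'k::field, 'v::plus) gmod \<Rightarrow> ('g, 'k, 'w::plus) gmod \<Rightarrow> ('v \<Rightarrow> 'w \<Rightarrow> 'k) \<Rightarrow> bool"
  where "bilinear_form M N b \<longleftrightarrow>
    (\<forall>w\<in>vecs N. linear_map_on (vecs M) (scl M) (*) (\<lambda>v. b v w)) \<and>
    (\<forall>v\<in>vecs M. linear_map_on (vecs N) (scl N) (*) (\<lambda>w. b v w))"

definition pure_tensor ::
    "('g, 'k::field, 'v::plus) gmod \<Rightarrow> ('g, 'k, 'w::plus) gmod \<Rightarrow> 'v \<Rightarrow> 'w
      \<Rightarrow> (('v \<Rightarrow> 'w \<Rightarrow> 'k) \<Rightarrow> 'k)"
  where "pure_tensor M N v w = (\<lambda>b. if bilinear_form M N b then b v w else 0)"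

definition tensor_gmod ::
    "('g, 'k::field, 'v::plus) gmod \<Rightarrow> ('g, 'k, 'w::plus) gmod
      \<Rightarrow> ('g, 'k, ('v \<Rightarrow> 'w \<Rightarrow> 'k) \<Rightarrow> 'k) gmod"
  where "tensor_gmod M N =
    \<lparr>vecs = module.span (\<lambda>c t b. c * t b)
              {pure_tensor M N v w | v w. v \<in> vecs M \<and> w \<in> vecs N},
     scl = (\<lambda>c t b. c * t b),
     act = (\<lambda>g t b. t (\<lambda>v w. b (act M g v) (act N g w)))\<rparr>"

section \<open>Permutation modules\<close>

definition finite_gset :: "('g, 'm) monoid_scheme \<Rightarrow> 'x set \<Rightarrow> ('g \<Rightarrow> 'x \<Rightarrow> 'x) \<Rightarrow> bool"
  where "finite_gset G X \<phi> \<longleftrightarrow> group_action G X \<phi> \<and> finite X \<and> X \<noteq> {}"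

definition fixed_points :: "'g set \<Rightarrow> 'x set \<Rightarrow> ('g \<Rightarrow> 'x \<Rightarrow> 'x) \<Rightarrow> 'x set"
  where "fixed_points H X \<phi> = {x \<in> X. \<forall>h\<in>H. \<phi> h x = x}"

text \<open>\<open>kX\<close>: an element is its coefficient function, which vanishes outside \<open>X\<close>.\<close>

definition perm_gmod ::
    "('g, 'm) monoid_scheme \<Rightarrow> 'x set \<Rightarrow> ('g \<Rightarrow> 'x \<Rightarrow> 'x) \<Rightarrow> ('g, 'k::field, 'x \<Rightarrow> 'k) gmod"
  where "perm_gmod G X \<phi> =
    \<lparr>vecs = {f. \<forall>x. x \<notin> X \<longrightarrow> f x = 0},
     scl = (\<lambda>c f x. c * f x),
     act = (\<lambda>g f x. if x \<in> X then f (\<phi> (inv\<^bsub>G\<^esub> g) x) else 0)\<rparr>"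

text \<open>\<open>\<Delta>(X)\<close>, the kernel of the augmentation map.\<close>

definition Delta_gmod ::
    "('g, 'm) monoid_scheme \<Rightarrow> 'x set \<Rightarrow> ('g \<Rightarrow> 'x \<Rightarrow> 'x) \<Rightarrow> ('g, 'k::field, 'x \<Rightarrow> 'k) gmod"
  where "Delta_gmod G X \<phi> =
    (perm_gmod G X \<phi>)\<lparr>vecs := {f \<in> vecs (perm_gmod G X \<phi>). (\<Sum>x\<in>X. f x) = 0}\<rparr>"

text \<open>Every finite \<open>G\<close>-set is isomorphic to one on a set of natural numbers.\<close>

definition p_permutation ::
    "('g, 'm) monoid_scheme \<Rightarrow> ('g, 'k::field, 'v::ab_group_add) gmod \<Rightarrow> bool"
  where "p_permutation G M \<longleftrightarrow>
    (\<exists>(X :: nat set) \<phi>. finite_gset G X \<phi> \<and> gmod_summand G M (perm_gmod G X \<phi>))"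

section \<open>Vertices\<close>

text \<open>
  \<open>L\<close> is the module induced from the \<open>kH\<close>-submodule \<open>V\<close> of \<open>L\<close>: as a vector space, \<open>L\<close> is the
  internal direct sum of the translates \<open>gV\<close>, where \<open>gH\<close> runs over the left cosets of \<open>H\<close>.
  As \<open>V\<close> is \<open>H\<close>-stable, the union over \<open>g \<in> C\<close> below is the single translate belonging to \<open>C\<close>.
\<close>

definition induced_from ::
    "('g, 'm) monoid_scheme \<Rightarrow> 'g set \<Rightarrow> 'v set \<Rightarrow> ('g, 'k::field, 'v::ab_group_add) gmod \<Rightarrow> bool"
  where "induced_from G H V L \<longleftrightarrow>
    kG_module G L \<and> V \<subseteq> vecs L \<and> module.subspace (scl L) V \<and>
    (\<forall>h\<in>H. \<forall>v\<in>V. act L h v \<in> V) \<and>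
    (\<forall>x\<in>vecs L. \<exists>!f. f \<in> (\<Pi>\<^sub>E C\<in>lcosets\<^bsub>G\<^esub> H. \<Union>g\<in>C. act L g ` V) \<and>
                     x = (\<Sum>C\<in>lcosets\<^bsub>G\<^esub> H. f C))"

definition relatively_projective ::
    "('g, 'm) monoid_scheme \<Rightarrow> 'g set \<Rightarrow> ('g, 'k::field, 'v::ab_group_add) gmod \<Rightarrow> bool"
  where "relatively_projective G H M \<longleftrightarrow>
    (\<exists>(L :: ('g, 'k) std_gmod) V. induced_from G H V L \<and> gmod_summand G M L)"

definition is_vertex ::
    "('g, 'm) monoid_scheme \<Rightarrow> 'g set \<Rightarrow> ('g, 'k::field, 'v::ab_group_add) gmod \<Rightarrow> bool"
  where "is_vertex G Q M \<longleftrightarrow>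
    subgroup Q G \<and> relatively_projective G Q M \<and>
    (\<forall>H. subgroup H G \<and> H \<subseteq> Q \<and> relatively_projective G H M \<longrightarrow> H = Q)"

section \<open>Non-Sylow \<open>p\<close>-subgroups\<close>

definition p_subgroup :: "('g, 'm) monoid_scheme \<Rightarrow> nat \<Rightarrow> 'g set \<Rightarrow> bool"
  where "p_subgroup G p P \<longleftrightarrow> subgroup P G \<and> (\<exists>n. card P = p ^ n)"

definition sylow_subgroup :: "('g, 'm) monoid_scheme \<Rightarrow> nat \<Rightarrow> 'g set \<Rightarrow> bool"
  where "sylow_subgroup G p P \<longleftrightarrow>
    subgroup P G \<and> card P = p ^ multiplicity p (card (carrier G))"

definition non_sylow_p_subgroups :: "('g, 'm) monoid_scheme \<Rightarrow> nat \<Rightarrow> 'g set set"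
  where "non_sylow_p_subgroups G p = {P. p_subgroup G p P \<and> \<not> sylow_subgroup G p P}"

definition non_sylow_p_subgroup_classes :: "('g, 'm) monoid_scheme \<Rightarrow> nat \<Rightarrow> 'g set set set"
  where "non_sylow_p_subgroup_classes G p =
    orbits G (non_sylow_p_subgroups G p) (\<lambda>g P. g <#\<^bsub>G\<^esub> P #>\<^bsub>G\<^esub> inv\<^bsub>G\<^esub> g)"

section \<open>Dade modules and the Dade group\<close>

definition Dade_module ::
    "('g, 'm) monoid_scheme \<Rightarrow> nat \<Rightarrow> ('g, 'k::field, 'v::ab_group_add) gmod \<Rightarrow> bool"
  where "Dade_module G p M \<longleftrightarrow>
    kG_module G M \<and>
    (\<exists>n (W :: ('g, 'k) std_gmod).
      p_permutation G W \<and>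
      (\<forall>(U :: ('g, 'k) std_gmod) Q.
        indecomposable G U \<and> gmod_summand G U W \<and> is_vertex G Q U
          \<longrightarrow> Q \<in> non_sylow_p_subgroups G p) \<and>
      gmod_iso G (End_gmod G M) (direct_sum (trivial_gmod n) W))"

definition capped_Dade_module ::
    "('g, 'm) monoid_scheme \<Rightarrow> nat \<Rightarrow> 'g set \<Rightarrow> ('g, 'k::field, 'v::ab_group_add) gmod \<Rightarrow> bool"
  where "capped_Dade_module G p S M \<longleftrightarrow>
    Dade_module G p M \<and>
    (\<exists>U :: ('g, 'k, 'v) gmod. indecomposable G U \<and> gmod_summand G U M \<and> is_vertex G S U)"

definition compatible ::
    "('g, 'm) monoid_scheme \<Rightarrow> nat \<Rightarrow> ('g, 'k::field, 'v::ab_group_add) gmod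
      \<Rightarrow> ('g, 'k, 'w::ab_group_add) gmod \<Rightarrow> bool"
  where "compatible G p M N \<longleftrightarrow> Dade_module G p (direct_sum M N)"

text \<open>
  The class \<open>[M]\<close> consists of the representatives inside \<open>nat \<Rightarrow> 'k\<close>; \<open>M\<close> itself
  may live in any type.
\<close>

definition Dade_class ::
    "('g, 'm) monoid_scheme \<Rightarrow> nat \<Rightarrow> 'g set \<Rightarrow> ('g, 'k::field, 'v::ab_group_add) gmod
      \<Rightarrow> ('g, 'k) std_gmod set"
  where "Dade_class G p S M = {N. capped_Dade_module G p S N \<and> compatible G p M N}"

definition Dade_group ::
    "('g, 'm) monoid_scheme \<Rightarrow> nat \<Rightarrow> 'g set \<Rightarrow> ('g, 'k::field) std_gmod set monoid"
  where "Dade_group G p S =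
    \<lparr>carrier = {Dade_class G p S M | M :: ('g, 'k) std_gmod. capped_Dade_module G p S M},
     mult = (\<lambda>A B. \<Union>M\<in>A. \<Union>N\<in>B. Dade_class G p S (tensor_gmod M N)),
     one = Dade_class G p S (trivial_gmod 1 :: ('g, 'k) std_gmod)\<rparr>"

definition Omega ::
    "('g, 'm) monoid_scheme \<Rightarrow> nat \<Rightarrow> 'g set \<Rightarrow> 'x set \<Rightarrow> ('g \<Rightarrow> 'x \<Rightarrow> 'x)
      \<Rightarrow> ('g, 'k::field) std_gmod set"
  where "Omega G p S X \<phi> = Dade_class G p S (Delta_gmod G X \<phi> :: ('g, 'k, 'x \<Rightarrow> 'k) gmod)"

definition D_Omega ::
    "('g, 'm) monoid_scheme \<Rightarrow> nat \<Rightarrow> 'g set \<Rightarrow> ('g, 'k::field) std_gmod set set"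
  where "D_Omega G p S =
    generate (Dade_group G p S)
      {Omega G p S X \<phi> | (X :: nat set) \<phi>. finite_gset G X \<phi> \<and> fixed_points S X \<phi> = {}}"

text \<open>Left translation on \<open>G/P\<close>.\<close>

definition coset_action :: "('g, 'm) monoid_scheme \<Rightarrow> 'g set \<Rightarrow> 'g \<Rightarrow> 'g set \<Rightarrow> 'g set"
  where "coset_action G P g = (\<lambda>C\<in>lcosets\<^bsub>G\<^esub> P. g <#\<^bsub>G\<^esub> C)"

end

theory Submission
  imports Defs "HOL-Algebra.Sylow"
begin

text \<open>
  Call \<open>M\<close> and \<open>N\<close> linked if \<open>Hom\<^sub>k(M, N)\<close> is a direct summand of a permutation module whose basis
  elements fixed by \<open>S\<close> are fixed by \<open>G\<close>. A module is a Dade module iff it is linked to itself, and two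
  Dade modules are compatible iff they are linked. A Dade module is capped iff it has an endomorphism
  of nonzero trace, and composing with such an endomorphism makes linkedness transitive. All relations
  in \<open>D(G)\<close> that are needed therefore come from exhibiting families of linear maps permuted by \<open>G\<close>.

  Two facts about the \<open>\<Omega>\<^sub>X\<close> suffice. First, \<open>\<Omega>\<^sub>X\<close> depends only on the set \<open>F\<^sub>X\<close> of \<open>p\<close>-subgroups with a
  fixed point on \<open>X\<close>. Second, \<open>\<Omega>\<^bsub>X\<times>Y\<^esub> + \<Omega>\<^bsub>X\<squnion>Y\<^esub> = \<Omega>\<^sub>X + \<Omega>\<^sub>Y\<close>. Now induct on the size of \<open>F\<^sub>X\<close>. Let \<open>P\<close> be a
  member of maximal order, and let \<open>Y\<close> be the disjoint union of the \<open>G/Q\<close> over those \<open>Q\<close> in \<open>F\<^sub>X\<close> that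
  fix no point of \<open>G/P\<close>. If there is no such \<open>Q\<close>, then \<open>\<Omega>\<^sub>X = \<Omega>\<^bsub>G/P\<^esub>\<close>; otherwise
  \<open>\<Omega>\<^sub>X = \<Omega>\<^sub>Y + \<Omega>\<^bsub>G/P\<^esub> - \<Omega>\<^bsub>Y\<times>G/P\<^esub>\<close>, where all three terms belong to strictly smaller families.
\<close>

section \<open>Linear maps and frames\<close>

text \<open>The definition of a Dade module speaks of vertices of indecomposable summands, whereas
  relations in D(G) concern tensor products of whole modules. Both are rewritten as the existence of
  families of linear maps indexed by a finite G-set: a summand of kZ is a set of vectors and forms
  permuted by G, and relative projectivity is an expression of the identity as the sum of a permuted
  family. Such families can be composed, pushed along maps and restricted to summands without
  uniqueness of decompositions; locality of endomorphism rings serves only to pass to a single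
  orbit. Characteristic p enters in two ways. One can average over an orbit of length prime to p,
  which gives augmentation-preserving maps from kX to kY as soon as F_X is contained in F_Y. And a
  function constant on the orbits of a set without S-fixed points has sum 0, which is why a trace
  detects the vertex S. In the induction the families shrink for different reasons: F_Y loses P
  because P has maximal order, those of G/P and of Y x G/P lose every Q that fixes no point of
  G/P.\<close>

definition kmod :: "('g, 'k::field, 'k) gmod"
  where "kmod = \<lparr>vecs = UNIV, scl = (*), act = (\<lambda>g x. x)\<rparr>"

definition lin :: "('g, 'k, 'v::plus) gmod \<Rightarrow> ('g, 'k, 'w::plus) gmod \<Rightarrow> ('v \<Rightarrow> 'w) \<Rightarrow> bool"
  where "lin M N f \<longleftrightarrow> linear_map_on (vecs M) (scl M) (scl N) f \<and> f ` vecs M \<subseteq> vecs N"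

text \<open>
  The vectors \<open>e i\<close> need not be linearly independent; \<open>\<Sum>i. l i (A (e i))\<close> is the trace of \<open>A\<close> nevertheless.
\<close>

definition frame :: "('g, 'k::field, 'v::ab_group_add) gmod \<Rightarrow> 'i set \<Rightarrow> ('i \<Rightarrow> 'v) \<Rightarrow> ('i \<Rightarrow> 'v \<Rightarrow> 'k) \<Rightarrow> bool"
  where "frame M I e l \<longleftrightarrow> finite I \<and> (\<forall>i\<in>I. e i \<in> vecs M) \<and> (\<forall>i\<in>I. lin M kmod (l i)) \<and>
    (\<forall>v\<in>vecs M. v = (\<Sum>i\<in>I. scl M (l i v) (e i)))"

lemma kmod_simps [simp]: "vecs kmod = UNIV" "scl kmod = (*)" "act kmod g x = x"
  by (auto simp: kmod_def)

lemma linI: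
  assumes "\<And>x y. x \<in> vecs M \<Longrightarrow> y \<in> vecs M \<Longrightarrow> f (x + y) = f x + f y"
    "\<And>c x. x \<in> vecs M \<Longrightarrow> f (scl M c x) = scl N c (f x)"
    "\<And>x. x \<in> vecs M \<Longrightarrow> f x \<in> vecs N"
  shows "lin M N f"
  using assms by (auto simp: lin_def linear_map_on_def)

lemma lin_in: "lin M N f \<Longrightarrow> x \<in> vecs M \<Longrightarrow> f x \<in> vecs N"
  and lin_add: "lin M N f \<Longrightarrow> x \<in> vecs M \<Longrightarrow> y \<in> vecs M \<Longrightarrow> f (x + y) = f x + f y"
  and lin_scl: "lin M N f \<Longrightarrow> x \<in> vecs M \<Longrightarrow> f (scl M c x) = scl N c (f x)"
  by (auto simp: lin_def linear_map_on_def)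

lemma lin_id: "lin M M (\<lambda>x. x)"
  by (auto intro!: linI)

lemma lin_comp:
  assumes "lin M N f" "lin N L h" shows "lin M L (\<lambda>x. h (f x))"
proof (rule linI)
qed (simp_all add: lin_add[OF assms(1)] lin_scl[OF assms(1)] lin_in[OF assms(1)]
  lin_add[OF assms(2)] lin_scl[OF assms(2)] lin_in[OF assms(2)])

section \<open>Modules over the group algebra of a finite group\<close>

locale fgroup = group G for G (structure) +
  assumes finite_carrier: "finite (carrier G)"
begin

abbreviation mdl :: "('a, 'k::field, 'v::ab_group_add) gmod \<Rightarrow> bool"
  where "mdl M \<equiv> kG_module G M"

lemma mdl_vs: "mdl M \<Longrightarrow> vector_space (scl M)"
  by (simp add: kG_module_def)

context
  fixes M :: "('a, 'k::field, 'v::ab_group_add) gmod"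
  assumes M: "mdl M"
begin

interpretation M: kG_module G M by (rule M)

lemma mdl_0: "0 \<in> vecs M" using M.V.subspace_0 M.subspace_vecs by blast
lemma mdl_add: "x \<in> vecs M \<Longrightarrow> y \<in> vecs M \<Longrightarrow> x + y \<in> vecs M"
  using M.V.subspace_add M.subspace_vecs by blast
lemma mdl_scl: "x \<in> vecs M \<Longrightarrow> scl M c x \<in> vecs M"
  using M.V.subspace_scale M.subspace_vecs by blast
lemma mdl_diff: "x \<in> vecs M \<Longrightarrow> y \<in> vecs M \<Longrightarrow> x - y \<in> vecs M"
  using M.V.subspace_diff M.subspace_vecs by blast
lemma mdl_neg: "x \<in> vecs M \<Longrightarrow> - x \<in> vecs M"
  using M.V.subspace_neg M.subspace_vecs by blast
lemma mdl_sum: "(\<And>i. i \<in> I \<Longrightarrow> x i \<in> vecs M) \<Longrightarrow> (\<Sum>i\<in>I. x i) \<in> vecs M"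
  using M.V.subspace_sum M.subspace_vecs by blast
lemma mdl_act: "g \<in> carrier G \<Longrightarrow> x \<in> vecs M \<Longrightarrow> act M g x \<in> vecs M"
  by (rule M.act_closed)
lemma mdl_act_lin: "g \<in> carrier G \<Longrightarrow> lin M M (act M g)"
  using M.act_linear[of g] M.act_closed[of g] by (simp add: lin_def image_subset_iff)
lemma mdl_act_one: "x \<in> vecs M \<Longrightarrow> act M \<one> x = x" by (rule M.act_one)
lemma mdl_act_mult: "g \<in> carrier G \<Longrightarrow> h \<in> carrier G \<Longrightarrow> x \<in> vecs M \<Longrightarrow>
   act M (g \<otimes> h) x = act M g (act M h x)" by (rule M.act_mult)
lemma mdl_act_inv: "g \<in> carrier G \<Longrightarrow> x \<in> vecs M \<Longrightarrow> act M (inv g) (act M g x) = x"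
  and mdl_act_inv': "g \<in> carrier G \<Longrightarrow> x \<in> vecs M \<Longrightarrow> act M g (act M (inv g) x) = x"
  using M.act_mult[of "inv g" g x] M.act_mult[of g "inv g" x] M.act_one[of x] by simp_all

lemma scl_add: "scl M c (x + y) = scl M c x + scl M c y" by (rule M.V.scale_right_distrib)
lemma scl_add_left: "scl M (c + d) x = scl M c x + scl M d x" by (rule M.V.scale_left_distrib)
lemma scl_scl: "scl M c (scl M d x) = scl M (c * d) x" by simp
lemma scl_1: "scl M 1 x = x" by simp
lemma scl_0: "scl M 0 x = 0" by simp
lemma scl_0': "scl M c 0 = 0" by simp
lemma scl_diff: "scl M c (x - y) = scl M c x - scl M c y" by (rule M.V.scale_right_diff_distrib)
lemma scl_neg_left: "scl M (- c) x = - scl M c x" by simp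
lemma scl_sum: "scl M c (\<Sum>i\<in>I. x i) = (\<Sum>i\<in>I. scl M c (x i))" by (rule M.V.scale_sum_right)
lemma scl_sum_left: "scl M (\<Sum>i\<in>I. c i) x = (\<Sum>i\<in>I. scl M (c i) x)" by (rule M.V.scale_sum_left)

end

lemma lin_0:
  assumes "mdl M" "mdl N" "lin M N f" shows "f 0 = 0"
proof -
  have "f (scl M 0 0) = scl N 0 (f 0)" using lin_scl[OF assms(3)] mdl_0[OF assms(1)] .
  then show ?thesis using assms by (simp add: scl_0)
qed

lemma mdl_kmod: "mdl (kmod :: ('a, 'k::field, 'k) gmod)"
proof
  show "module.subspace (scl (kmod :: ('a, 'k, 'k) gmod)) (vecs kmod)"
    by (simp add: module.subspace_def module_iff_vector_space vector_space_def algebra_simps)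
  show "\<exists>B. finite B \<and> B \<subseteq> vecs (kmod :: ('a, 'k, 'k) gmod) \<and> vecs (kmod :: ('a, 'k, 'k) gmod) =
    module.span (scl (kmod :: ('a, 'k, 'k) gmod)) (\<Union>g\<in>carrier G. act kmod g ` B)"
  proof (intro exI conjI)
    interpret vector_space "(*) :: 'k \<Rightarrow> 'k \<Rightarrow> 'k" by unfold_locales (auto simp: algebra_simps)
    have "x \<in> span {1}" for x :: 'k using span_scale[OF span_base, of 1 "{1}" x] by simp
    then show "vecs (kmod :: ('a, 'k, 'k) gmod) =
      module.span (scl (kmod :: ('a, 'k, 'k) gmod)) (\<Union>g\<in>carrier G. act kmod g ` {1})" by auto
  qed auto
qed (auto simp: algebra_simps linear_map_on_def)

lemma lin_sum:
  assumes "mdl M" "mdl N" "lin M N f" "\<And>i. i \<in> I \<Longrightarrow> x i \<in> vecs M"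
  shows "f (\<Sum>i\<in>I. x i) = (\<Sum>i\<in>I. f (x i))"
  using assms(4)
proof (induction I rule: infinite_finite_induct)
  case (insert i I)
  then show ?case using lin_add[OF assms(3), of "x i" "sum x I"] mdl_sum[OF assms(1), of I x] by simp
qed (simp_all add: lin_0[OF assms(1-3)])

lemma lin_neg:
  assumes "mdl M" "mdl N" "lin M N f" "x \<in> vecs M" shows "f (- x) = - f x"
  using lin_scl[OF assms(3,4), of "-1"] by (simp add: scl_neg_left[OF assms(1)] scl_neg_left[OF assms(2)]
      scl_1[OF assms(1)] scl_1[OF assms(2)])

lemma lin_diff:
  assumes "mdl M" "mdl N" "lin M N f" "x \<in> vecs M" "y \<in> vecs M" shows "f (x - y) = f x - f y"
  using lin_add[OF assms(3,4) mdl_neg[OF assms(1,5)]] lin_neg[OF assms(1-3,5)] by simp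

lemma lin_lincomb:
  assumes "mdl M" "mdl N" "lin M N f" "\<And>i. i \<in> I \<Longrightarrow> x i \<in> vecs M"
  shows "f (\<Sum>i\<in>I. scl M (c i) (x i)) = (\<Sum>i\<in>I. scl N (c i) (f (x i)))"
  using assms by (simp add: lin_sum[OF assms(1-3)] lin_scl[OF assms(3)] mdl_scl[OF assms(1)])

lemma lin_plus:
  assumes "mdl N" "lin M N f" "lin M N h" shows "lin M N (\<lambda>x. f x + h x)"
  by (rule linI) (simp_all add: lin_add[OF assms(2)] lin_add[OF assms(3)] lin_scl[OF assms(2)]
     lin_scl[OF assms(3)] scl_add[OF assms(1)] mdl_add[OF assms(1)] lin_in[OF assms(2)] lin_in[OF assms(3)])

lemma lin_minus:
  assumes "mdl N" "lin M N f" "lin M N h" shows "lin M N (\<lambda>x. f x - h x)"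
  by (rule linI) (simp_all add: lin_add[OF assms(2)] lin_add[OF assms(3)] lin_scl[OF assms(2)]
     lin_scl[OF assms(3)] scl_diff[OF assms(1)] mdl_diff[OF assms(1)] lin_in[OF assms(2)] lin_in[OF assms(3)])

lemma lin_zero: "mdl N \<Longrightarrow> lin M N (\<lambda>x. 0)"
  by (rule linI) (simp_all add: scl_0' mdl_0)

lemma lin_sumf:
  assumes "mdl N" "\<And>i. i \<in> I \<Longrightarrow> lin M N (f i)" shows "lin M N (\<lambda>x. \<Sum>i\<in>I. f i x)"
  using assms(2)
  by (induction I rule: infinite_finite_induct) (simp_all add: lin_zero[OF assms(1)] lin_plus[OF assms(1)])

lemma lin_smult:
  assumes "mdl N" "lin M N f" shows "lin M N (\<lambda>x. scl N c (f x))"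
  by (rule linI) (simp_all add: lin_add[OF assms(2)] lin_scl[OF assms(2)] lin_in[OF assms(2)]
     scl_add[OF assms(1)] scl_scl[OF assms(1)] mdl_scl[OF assms(1)] mult.commute)

lemma lin_fscl:
  assumes "mdl N" "lin M kmod l" "w \<in> vecs N" shows "lin M N (\<lambda>x. scl N (l x) w)"
  using assms(3)
  by (intro linI) (simp_all add: lin_add[OF assms(2)] lin_scl[OF assms(2)]
     scl_add_left[OF assms(1)] scl_scl[OF assms(1)] mdl_scl[OF assms(1)])

lemma linK_cmult: "lin (M :: ('a, 'k::field, 'v::ab_group_add) gmod) kmod l \<Longrightarrow> lin M kmod (\<lambda>x. c * l x)"
  using lin_smult[OF mdl_kmod, of M l c] by simp

lemma frameD:
  assumes "frame M I e l"
  shows "finite I" "\<And>i. i \<in> I \<Longrightarrow> e i \<in> vecs M" "\<And>i. i \<in> I \<Longrightarrow> lin M kmod (l i)"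
    "\<And>v. v \<in> vecs M \<Longrightarrow> (\<Sum>i\<in>I. scl M (l i v) (e i)) = v"
  using assms by (auto simp: frame_def)

lemma lin_expand:
  assumes "mdl M" "mdl N" "frame M I e l" "lin M N f" "v \<in> vecs M"
  shows "f v = (\<Sum>i\<in>I. scl N (l i v) (f (e i)))"
  using lin_lincomb[OF assms(1,2,4), of I e "\<lambda>i. l i v"] frameD[OF assms(3)] assms(5) by simp

lemma linK_expand:
  assumes "mdl M" "frame M I e l" "lin M kmod f" "v \<in> vecs M"
  shows "f v = (\<Sum>i\<in>I. l i v * f (e i))"
  using lin_expand[OF assms(1) mdl_kmod assms(2-4)] by simp

text \<open>Finite generation is equivalent to the existence of a frame since \<open>G\<close> is finite.\<close>

lemma mdlI_frame:
  assumes vs: "vector_space (scl M)" and z: "0 \<in> vecs M"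
    and "\<And>x y. x \<in> vecs M \<Longrightarrow> y \<in> vecs M \<Longrightarrow> x + y \<in> vecs M"
    and "\<And>c x. x \<in> vecs M \<Longrightarrow> scl M c x \<in> vecs M"
    and act: "\<And>g. g \<in> carrier G \<Longrightarrow> lin M M (act M g)"
    and one: "\<And>v. v \<in> vecs M \<Longrightarrow> act M \<one> v = v"
    and mult: "\<And>g h v. g \<in> carrier G \<Longrightarrow> h \<in> carrier G \<Longrightarrow> v \<in> vecs M \<Longrightarrow>
      act M (g \<otimes> h) v = act M g (act M h v)"
    and fr: "frame M I e l"
  shows "mdl M"
proof -
  interpret V: vector_space "scl M" by (rule vs)
  have sub: "V.subspace (vecs M)" using assms by (simp add: V.subspace_def)
  show ?thesis
  proof
    show "V.subspace (vecs M)" by (rule sub)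
    show "linear_map_on (vecs M) (scl M) (scl M) (act M g)" if "g \<in> carrier G" for g
      using act[OF that] by (simp add: lin_def)
    show "act M g v \<in> vecs M" if "g \<in> carrier G" "v \<in> vecs M" for g v
      using lin_in[OF act] that .
    show "\<exists>B. finite B \<and> B \<subseteq> vecs M \<and> vecs M = V.span (\<Union>g\<in>carrier G. act M g ` B)"
    proof (intro exI conjI)
      show "finite (e ` I)" using frameD(1)[OF fr] by simp
      show "e ` I \<subseteq> vecs M" using frameD(2)[OF fr] by auto
      have "e i \<in> (\<Union>g\<in>carrier G. act M g ` e ` I)" if "i \<in> I" for i
        using one[OF frameD(2)[OF fr that]] that one_closed by (intro UN_I[of \<one>]) force+
      then have sp: "(\<Sum>i\<in>I. scl M (l i v) (e i)) \<in> V.span (\<Union>g\<in>carrier G. act M g ` e ` I)" for v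
        by (intro V.span_sum V.span_scale V.span_base)
      have "vecs M \<subseteq> V.span (\<Union>g\<in>carrier G. act M g ` e ` I)"
      proof
        fix v assume "v \<in> vecs M"
        then show "v \<in> V.span (\<Union>g\<in>carrier G. act M g ` e ` I)"
          using frameD(4)[OF fr, of v] sp[of v] by simp
      qed
      moreover have "(\<Union>g\<in>carrier G. act M g ` e ` I) \<subseteq> vecs M"
        using lin_in[OF act] frameD(2)[OF fr] by auto
      ultimately show "vecs M = V.span (\<Union>g\<in>carrier G. act M g ` e ` I)"
        using V.span_minimal[OF _ sub] by blast
    qed
  qed (use one mult in auto)
qed

lemma ex_frame:
  fixes M :: "('a, 'k::field, 'v::ab_group_add) gmod"
  assumes "mdl M" shows "\<exists>(I::nat set) e l. frame M I e l"
proof -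
  interpret M: kG_module G M by (rule assms)
  obtain B where B: "finite B" "B \<subseteq> vecs M" "vecs M = M.V.span (\<Union>g\<in>carrier G. act M g ` B)"
    using M.finitely_generated by blast
  \<comment> \<open>The translates of the generators are finitely many because G is finite, so a
    finite basis can be extracted from them; \<open>l\<close> gives the coordinates in that
    basis.\<close>
  define T where "T = (\<Union>g\<in>carrier G. act M g ` B)"
  have "finite T" using B(1) finite_carrier by (simp add: T_def)
  obtain C where C: "C \<subseteq> T" "M.V.independent C" "T \<subseteq> M.V.span C"
    using M.V.maximal_independent_subset by blast
  have fC: "finite C" using C(1) \<open>finite T\<close> finite_subset by blast
  have sp: "M.V.span C = vecs M"
    using C B(3) T_def M.V.span_mono[of C T] M.V.span_minimal[OF C(3) M.V.subspace_span] by simp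
  obtain e where e: "bij_betw e {0..<card C} C" using ex_bij_betw_nat_finite[OF fC] by blast
  define l where "l = (\<lambda>i v. M.V.representation C v (e i))"
  have "frame M {0..<card C} e l"
    unfolding frame_def
  proof (intro conjI ballI)
    show "e i \<in> vecs M" if "i \<in> {0..<card C}" for i
      using bij_betwE[OF e] that M.V.span_base sp by blast
    show "lin M kmod (l i)" for i
      using sp by (intro linI) (simp_all add: l_def M.V.representation_add[OF C(2)] M.V.representation_scale[OF C(2)])
    show "v = (\<Sum>i\<in>{0..<card C}. scl M (l i v) (e i))" if "v \<in> vecs M" for v
      using sum.reindex_bij_betw[OF e, of "\<lambda>b. scl M (M.V.representation C v b) b"]
        M.V.sum_representation_eq[OF C(2) _ fC subset_refl, of v] that sp by (simp add: l_def)
  qed simp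
  then show ?thesis by blast
qed

end

text \<open>The ambient space may have infinite dimension, so the comparison is made inside the span
  of the finite set \<open>B\<close>: a basis of \<open>V\<close> stays independent after adding a
  vector of \<open>W\<close> outside \<open>V\<close>.\<close>

lemma (in vector_space) dim_psubset_fin:
  assumes "subspace V" "V \<subset> W" "finite B" "W \<subseteq> span B"
  shows "dim V < dim W"
proof -
  obtain C where C: "C \<subseteq> V" "independent C" "V \<subseteq> span C" "card C = dim V"
    using basis_exists by blast
  obtain x where x: "x \<in> W" "x \<notin> V" using assms(2) by blast
  have "x \<notin> span C" using x(2) span_minimal[OF C(1) assms(1)] by blast
  then have ind: "independent (insert x C)" "x \<notin> C" using C(2) independent_insertI span_base by blast+
  obtain D where D: "D \<subseteq> W" "independent D" "W \<subseteq> span D" "card D = dim W"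
    using basis_exists by blast
  have fD: "finite D" using independent_span_bound[OF assms(3) D(2)] D(1) assms(4) by blast
  moreover have "insert x C \<subseteq> span D" using C(1) x(1) assms(2) D(3) by blast
  ultimately have "finite (insert x C)" "card (insert x C) \<le> card D"
    using independent_span_bound[OF fD ind(1)] by simp_all
  then show ?thesis using ind(2) C(4) D(4) by simp
qed

section \<open>Equivariant maps and direct summands\<close>

lemma direct_sum_simps [simp]:
  "vecs (direct_sum M N) = vecs M \<times> vecs N"
  "scl (direct_sum M N) c vw = (scl M c (fst vw), scl N c (snd vw))"
  "act (direct_sum M N) g vw = (act M g (fst vw), act N g (snd vw))"
  by (auto simp: direct_sum_def split: prod.splits)

context fgroup
begin

definition ghom :: "('a, 'k::field, 'v::ab_group_add) gmod \<Rightarrow> ('a, 'k, 'w::ab_group_add) gmod \<Rightarrow> ('v \<Rightarrow> 'w) \<Rightarrow> bool"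
  where "ghom M N f \<longleftrightarrow> lin M N f \<and> (\<forall>g\<in>carrier G. \<forall>x\<in>vecs M. f (act M g x) = act N g (f x))"

definition ginv :: "('a, 'k::field, 'v::ab_group_add) gmod \<Rightarrow> ('a, 'k, 'w::ab_group_add) gmod \<Rightarrow> ('v \<Rightarrow> 'w) \<Rightarrow> ('w \<Rightarrow> 'v) \<Rightarrow> bool"
  where "ginv M N f h \<longleftrightarrow> ghom M N f \<and> ghom N M h \<and> (\<forall>x\<in>vecs M. h (f x) = x) \<and> (\<forall>y\<in>vecs N. f (h y) = y)"

text \<open>Up to isomorphism, \<open>M\<close> is a direct summand of \<open>N\<close>
  (\<open>gmod_summand_iff\<close>). Keeping the two maps avoids carrying a complement
  along.\<close>

definition retr :: "('a, 'k::field, 'v::ab_group_add) gmod \<Rightarrow> ('a, 'k, 'w::ab_group_add) gmod \<Rightarrow> ('v \<Rightarrow> 'w) \<Rightarrow> ('w \<Rightarrow> 'v) \<Rightarrow> bool"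
  where "retr M N i q \<longleftrightarrow> ghom M N i \<and> ghom N M q \<and> (\<forall>x\<in>vecs M. q (i x) = x)"

lemma ghomD:
  assumes "ghom M N f"
  shows "lin M N f" "\<And>g x. g \<in> carrier G \<Longrightarrow> x \<in> vecs M \<Longrightarrow> f (act M g x) = act N g (f x)"
  using assms by (auto simp: ghom_def)

lemma ghom_id: "ghom M M (\<lambda>x. x)"
  by (simp add: ghom_def lin_id)

lemma ghom_comp:
  assumes "ghom M N f" "ghom N L h" shows "ghom M L (\<lambda>x. h (f x))"
  using lin_comp[OF ghomD(1)[OF assms(1)] ghomD(1)[OF assms(2)]]
  by (simp add: ghom_def ghomD(2)[OF assms(1)] ghomD(2)[OF assms(2)] lin_in[OF ghomD(1)[OF assms(1)]])

lemma retrD: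
  assumes "retr M N i q"
  shows "ghom M N i" "ghom N M q" "\<And>x. x \<in> vecs M \<Longrightarrow> q (i x) = x"
  using assms by (auto simp: retr_def)

lemma ginvD:
  assumes "ginv M N f h"
  shows "ghom M N f" "ghom N M h" "\<And>x. x \<in> vecs M \<Longrightarrow> h (f x) = x" "\<And>y. y \<in> vecs N \<Longrightarrow> f (h y) = y"
  using assms by (auto simp: ginv_def)

lemma ginv_retr: "ginv M N f h \<Longrightarrow> retr M N f h" and ginv_sym: "ginv M N f h \<Longrightarrow> ginv N M h f"
  by (auto simp: ginv_def retr_def)

lemma retr_id: "retr M M (\<lambda>x. x) (\<lambda>x. x)"
  by (simp add: retr_def ghom_id)

lemma retr_trans:
  assumes "retr M N i q" "retr N L j r" shows "retr M L (\<lambda>x. j (i x)) (\<lambda>x. q (r x))"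
  using ghom_comp[OF retrD(1)[OF assms(1)] retrD(1)[OF assms(2)]]
    ghom_comp[OF retrD(2)[OF assms(2)] retrD(2)[OF assms(1)]]
  by (simp add: retr_def retrD(3)[OF assms(1)] retrD(3)[OF assms(2)] lin_in[OF ghomD(1)[OF retrD(1)[OF assms(1)]]])

lemma ginv_trans:
  assumes "ginv M N f h" "ginv N L f' h'" shows "ginv M L (\<lambda>x. f' (f x)) (\<lambda>x. h (h' x))"
  using retr_trans[OF ginv_retr[OF assms(1)] ginv_retr[OF assms(2)]]
    retr_trans[OF ginv_retr[OF ginv_sym[OF assms(2)]] ginv_retr[OF ginv_sym[OF assms(1)]]]
  by (simp add: retr_def ginv_def)

lemma bij_ginv:
  assumes "mdl M" "mdl N" "ghom M N f" "bij_betw f (vecs M) (vecs N)"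
  shows "ginv M N f (inv_into (vecs M) f)"
proof -
  define h where "h = inv_into (vecs M) f"
  note lf = ghomD(1)[OF assms(3)] and f = ghomD(2)[OF assms(3)] and b = assms(4)
  have hf: "h (f x) = x" if "x \<in> vecs M" for x
    using that b by (simp add: h_def bij_betw_inv_into_left)
  have fh: "f (h y) = y" if "y \<in> vecs N" for y
    using that b by (simp add: h_def bij_betw_inv_into_right)
  have hin: "h y \<in> vecs M" if "y \<in> vecs N" for y
    using that b by (metis bij_betw_imp_surj_on h_def inv_into_into)
  have "lin N M h"
  proof (rule linI)
    fix x y assume "x \<in> vecs N" "y \<in> vecs N"
    then have "f (h x + h y) = x + y" using lin_add[OF lf hin hin] fh by simp
    then show "h (x + y) = h x + h y"
      using hf[OF mdl_add[OF assms(1) hin hin]] \<open>x \<in> vecs N\<close> \<open>y \<in> vecs N\<close> by metis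
  next
    fix c x assume "x \<in> vecs N"
    then have "f (scl M c (h x)) = scl N c x" using lin_scl[OF lf hin] fh by simp
    then show "h (scl N c x) = scl M c (h x)"
      using hf[OF mdl_scl[OF assms(1) hin]] \<open>x \<in> vecs N\<close> by metis
  qed (rule hin)
  moreover have "h (act N g y) = act M g (h y)" if "g \<in> carrier G" "y \<in> vecs N" for g y
    using f[OF that(1) hin[OF that(2)]] fh[OF that(2)] hf[OF mdl_act[OF assms(1) that(1) hin[OF that(2)]]] by simp
  ultimately show ?thesis using assms(3) hf fh unfolding h_def[symmetric] by (simp add: ginv_def ghom_def)
qed

lemma gmod_iso_iff:
  assumes "mdl M" "mdl N"
  shows "gmod_iso G M N \<longleftrightarrow> (\<exists>f h. ginv M N f h)"
proof
  assume "gmod_iso G M N"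
  then obtain f where f: "bij_betw f (vecs M) (vecs N)" "linear_map_on (vecs M) (scl M) (scl N) f"
    "\<And>g v. g \<in> carrier G \<Longrightarrow> v \<in> vecs M \<Longrightarrow> f (act M g v) = act N g (f v)"
    unfolding gmod_iso_def by blast
  have "lin M N f" using f(1,2) bij_betw_imp_surj_on by (fastforce simp: lin_def)
  then have "ghom M N f" using f(3) by (simp add: ghom_def)
  then show "\<exists>f h. ginv M N f h" using bij_ginv[OF assms _ f(1)] by blast
next
  assume "\<exists>f h. ginv M N f h"
  then obtain f h where fh: "ginv M N f h" by blast
  have "bij_betw f (vecs M) (vecs N)"
    using ginvD(3,4)[OF fh] lin_in[OF ghomD(1)[OF ginvD(1)[OF fh]]] lin_in[OF ghomD(1)[OF ginvD(2)[OF fh]]]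
    by (intro bij_betw_byWitness[where f' = h]) auto
  then show "gmod_iso G M N"
    using ghomD[OF ginvD(1)[OF fh]] unfolding gmod_iso_def lin_def by blast
qed

lemma vs_prod: "vector_space s \<Longrightarrow> vector_space t \<Longrightarrow> vector_space (\<lambda>c vw. (s c (fst vw), t c (snd vw)))"
  by (auto simp: vector_space_def)

lemma mdl_direct_sum:
  fixes M :: "('a, 'k::field, 'v::ab_group_add) gmod" and N :: "('a, 'k, 'w::ab_group_add) gmod"
  assumes M: "mdl M" and N: "mdl N" shows "mdl (direct_sum M N)"
proof -
  obtain I :: "nat set" and e l where F: "frame M I e l" using ex_frame[OF M] by blast
  obtain J :: "nat set" and e' l' where F': "frame N J e' l'" using ex_frame[OF N] by blast
  have [simp]: "scl (direct_sum M N) = (\<lambda>c vw. (scl M c (fst vw), scl N c (snd vw)))" by (intro ext) simp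
  show ?thesis
  proof (rule mdlI_frame)
    show "vector_space (scl (direct_sum M N))" using vs_prod[OF mdl_vs[OF M] mdl_vs[OF N]] by simp
    show "lin (direct_sum M N) (direct_sum M N) (act (direct_sum M N) g)" if "g \<in> carrier G" for g
      using that by (intro linI)
        (auto simp: lin_add[OF mdl_act_lin[OF M that]] lin_add[OF mdl_act_lin[OF N that]]
         lin_scl[OF mdl_act_lin[OF M that]] lin_scl[OF mdl_act_lin[OF N that]] mdl_act[OF M] mdl_act[OF N])
    show "frame (direct_sum M N) (I <+> J) (case_sum (\<lambda>i. (e i, 0)) (\<lambda>j. (0, e' j)))
       (case_sum (\<lambda>i vw. l i (fst vw)) (\<lambda>j vw. l' j (snd vw)))"
      unfolding frame_def
    proof (intro conjI ballI)
      show "finite (I <+> J)" using frameD(1)[OF F] frameD(1)[OF F'] by simp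
      show "case_sum (\<lambda>i. (e i, 0)) (\<lambda>j. (0, e' j)) i \<in> vecs (direct_sum M N)" if "i \<in> I <+> J" for i
        using that frameD(2)[OF F] frameD(2)[OF F'] mdl_0[OF M] mdl_0[OF N] by auto
      show "lin (direct_sum M N) kmod (case_sum (\<lambda>i vw. l i (fst vw)) (\<lambda>j vw. l' j (snd vw)) i)"
        if "i \<in> I <+> J" for i
        using that by (auto intro!: linI simp: lin_add[OF frameD(3)[OF F]] lin_add[OF frameD(3)[OF F']]
          lin_scl[OF frameD(3)[OF F]] lin_scl[OF frameD(3)[OF F']])
      show "v = (\<Sum>i\<in>I <+> J. scl (direct_sum M N) (case_sum (\<lambda>i vw. l i (fst vw)) (\<lambda>j vw. l' j (snd vw)) i v)
          (case_sum (\<lambda>i. (e i, 0)) (\<lambda>j. (0, e' j)) i))" if "v \<in> vecs (direct_sum M N)" for v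
        using that frameD(4)[OF F, of "fst v"] frameD(4)[OF F', of "snd v"] frameD(1)[OF F] frameD(1)[OF F']
        by (auto simp: sum.Plus prod_eq_iff fst_sum snd_sum scl_0'[OF M] scl_0'[OF N])
    qed
  qed (auto simp: zero_prod_def mdl_0[OF M] mdl_0[OF N] mdl_add[OF M] mdl_add[OF N] mdl_scl[OF M] mdl_scl[OF N]
      mdl_act_one[OF M] mdl_act_one[OF N] mdl_act_mult[OF M] mdl_act_mult[OF N])
qed

text \<open>Here frames pay off against bases: projecting the vectors and restricting the forms
  yields a frame of a summand with the same index set.\<close>

lemma frame_retract:
  assumes "mdl M" "mdl N" "lin M N i" "lin N M q" "\<And>x. x \<in> vecs M \<Longrightarrow> q (i x) = x" "frame N J e l"
  shows "frame M J (\<lambda>j. q (e j)) (\<lambda>j x. l j (i x))"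
  unfolding frame_def
proof (intro conjI ballI)
  show "v = (\<Sum>j\<in>J. scl M (l j (i v)) (q (e j)))" if "v \<in> vecs M" for v
    using lin_expand[OF assms(2,1,6,4), of "i v"] lin_in[OF assms(3)] assms(5) that by simp
qed (use frameD(1,2)[OF assms(6)] lin_in[OF assms(4)] lin_comp[OF assms(3) frameD(3)[OF assms(6)]] in auto)

text \<open>The linear projection \<open>r\<close> onto \<open>V\<close> serves to give
  \<open>V\<close> a frame and thereby finite generation.\<close>

lemma submdl:
  assumes N: "mdl N" and V: "V \<subseteq> vecs N" "0 \<in> V" "\<And>x y. x \<in> V \<Longrightarrow> y \<in> V \<Longrightarrow> x + y \<in> V"
    "\<And>c x. x \<in> V \<Longrightarrow> scl N c x \<in> V" "\<And>g x. g \<in> carrier G \<Longrightarrow> x \<in> V \<Longrightarrow> act N g x \<in> V"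
    and r: "lin N N r" "\<And>x. x \<in> vecs N \<Longrightarrow> r x \<in> V" "\<And>x. x \<in> V \<Longrightarrow> r x = x"
  shows "mdl (N\<lparr>vecs := V\<rparr>)"
proof -
  obtain I :: "nat set" and e l where F: "frame N I e l" using ex_frame[OF N] by blast
  show ?thesis
  proof (rule mdlI_frame)
    show "frame (N\<lparr>vecs := V\<rparr>) I (\<lambda>i. r (e i)) l"
      unfolding frame_def
    proof (intro conjI ballI)
      show "lin (N\<lparr>vecs := V\<rparr>) kmod (l i)" if "i \<in> I" for i
        using frameD(3)[OF F that] V(1) by (intro linI) (auto simp: lin_add subset_iff lin_scl)
      show "v = (\<Sum>i\<in>I. scl (N\<lparr>vecs := V\<rparr>) (l i v) (r (e i)))" if "v \<in> vecs (N\<lparr>vecs := V\<rparr>)" for v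
        using lin_expand[OF N N F r(1), of v] that r(3)[of v] V(1) by auto
    qed (use frameD[OF F] r(2) in auto)
    show "lin (N\<lparr>vecs := V\<rparr>) (N\<lparr>vecs := V\<rparr>) (act (N\<lparr>vecs := V\<rparr>) g)" if "g \<in> carrier G" for g
      using V(1) V(5)[OF that] lin_add[OF mdl_act_lin[OF N that]] lin_scl[OF mdl_act_lin[OF N that]]
      by (intro linI) (auto simp: subset_iff)
  qed (use V mdl_vs[OF N] mdl_act_one[OF N] mdl_act_mult[OF N] in auto)
qed

text \<open>Backwards, the complement is the kernel of \<open>q\<close>, with projection
  \<open>w - i (q w)\<close>; it lives in the type of \<open>N\<close>, as
  \<open>gmod_summand\<close> demands.\<close>

lemma gmod_summand_iff:
  assumes M: "mdl (M :: ('a, 'k::field, 'v::ab_group_add) gmod)" and N: "mdl (N :: ('a, 'k, 'w::ab_group_add) gmod)"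
  shows "gmod_summand G M N \<longleftrightarrow> (\<exists>i q. retr M N i q)"
proof
  assume "gmod_summand G M N"
  then obtain N' :: "('a, 'k, 'w) gmod" where N': "mdl N'" "gmod_iso G N (direct_sum M N')"
    unfolding gmod_summand_def by blast
  then obtain f h where fh: "ginv N (direct_sum M N') f h"
    using gmod_iso_iff[OF N mdl_direct_sum[OF M N'(1)]] by blast
  note f = ginvD(1)[OF fh] and h = ginvD(2)[OF fh]
  have 1: "ghom M (direct_sum M N') (\<lambda>x. (x, 0))"
    by (auto simp: ghom_def mdl_0[OF N'(1)] scl_0'[OF N'(1)] lin_0[OF N'(1) N'(1) mdl_act_lin[OF N'(1)]] intro!: linI)
  have 2: "ghom (direct_sum M N') M fst"
    by (auto simp: ghom_def intro!: linI)
  have "retr M N (\<lambda>x. h (x, 0)) (\<lambda>y. fst (f y))"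
    using ghom_comp[OF 1 h] ghom_comp[OF f 2] ginvD(4)[OF fh] mdl_0[OF N'(1)] by (simp add: retr_def)
  then show "\<exists>i q. retr M N i q" by blast
next
  assume "\<exists>i q. retr M N i q"
  then obtain i q where r: "retr M N i q" by blast
  note i = ghomD[OF retrD(1)[OF r]] and q = ghomD[OF retrD(2)[OF r]] and qi = retrD(3)[OF r]
  define V where "V = {w \<in> vecs N. q w = 0}"
  define N' where "N' = N\<lparr>vecs := V\<rparr>"
  have iq: "lin N N (\<lambda>w. w - i (q w))" by (rule lin_minus[OF N lin_id lin_comp[OF q(1) i(1)]])
  have inV: "w - i (q w) \<in> V" if "w \<in> vecs N" for w
    using that lin_in[OF iq that] lin_diff[OF N M q(1) that lin_in[OF i(1) lin_in[OF q(1) that]]] qi[OF lin_in[OF q(1) that]]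
    by (simp add: V_def)
  have i0: "i 0 = 0" by (rule lin_0[OF M N i(1)])
  have "mdl N'" unfolding N'_def
    by (rule submdl[OF N, of V "\<lambda>w. w - i (q w)"])
      (auto simp: V_def mdl_0[OF N] lin_0[OF N M q(1)] mdl_add[OF N] lin_add[OF q(1)] mdl_scl[OF N] lin_scl[OF q(1)]
         scl_0'[OF M] mdl_act[OF N] q(2) lin_0[OF M M mdl_act_lin[OF M]] iq i0 inV[unfolded V_def, simplified])
  moreover have "ginv N (direct_sum M N') (\<lambda>w. (q w, w - i (q w))) (\<lambda>vw. i (fst vw) + snd vw)"
  proof -
    have "ghom N (direct_sum M N') (\<lambda>w. (q w, w - i (q w)))"
      unfolding ghom_def
      using q i by (intro conjI linI)
       (auto simp: lin_add[OF q(1)] lin_add[OF iq] lin_scl[OF q(1)] lin_scl[OF iq] N'_def inV lin_in[OF q(1)] q(2) i(2)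
        lin_diff[OF N N mdl_act_lin[OF N]] lin_in[OF i(1)] lin_add[OF i(1)] lin_scl[OF i(1)] scl_diff[OF N])
    moreover have "ghom (direct_sum M N') N (\<lambda>vw. i (fst vw) + snd vw)"
      unfolding ghom_def
      by (intro conjI linI)
       (auto simp: lin_add[OF i(1)] lin_scl[OF i(1)] N'_def V_def scl_add[OF N] lin_in[OF i(1)] mdl_add[OF N] i(2)
        lin_add[OF mdl_act_lin[OF N]])
    ultimately show ?thesis
      by (auto simp: ginv_def N'_def V_def lin_add[OF q(1)] lin_in[OF i(1)] qi)
  qed
  ultimately show "gmod_summand G M N"
    unfolding gmod_summand_def using M gmod_iso_iff[OF N mdl_direct_sum[OF M]] by blast
qed

section \<open>Finite sets with a group action\<close>

text \<open>In contrast to \<open>group_action\<close>, nothing is prescribed off \<open>Z\<close>,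
  so that actions on products and disjoint unions are given by \<open>map_prod\<close> and
  \<open>map_sum\<close>. The empty set is allowed, in contrast to
  \<open>finite_gset\<close>.\<close>

definition gset :: "'z set \<Rightarrow> ('a \<Rightarrow> 'z \<Rightarrow> 'z) \<Rightarrow> bool"
  where "gset Z \<phi> \<longleftrightarrow> finite Z \<and> (\<forall>g\<in>carrier G. \<forall>z\<in>Z. \<phi> g z \<in> Z) \<and> (\<forall>z\<in>Z. \<phi> \<one> z = z) \<and>
     (\<forall>g\<in>carrier G. \<forall>h\<in>carrier G. \<forall>z\<in>Z. \<phi> (g \<otimes> h) z = \<phi> g (\<phi> h z))"

text \<open>
  An element of \<open>(Hom\<^sub>k(M, N) \<otimes> kZ)\<^sup>G\<close> when \<open>Z\<close> is finite.
\<close>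

definition fam :: "('a, 'k::field, 'v::ab_group_add) gmod \<Rightarrow> ('a, 'k, 'w::ab_group_add) gmod \<Rightarrow> 'z set \<Rightarrow>
    ('a \<Rightarrow> 'z \<Rightarrow> 'z) \<Rightarrow> ('z \<Rightarrow> 'v \<Rightarrow> 'w) \<Rightarrow> bool"
  where "fam M N Z \<phi> f \<longleftrightarrow> (\<forall>z\<in>Z. lin M N (f z)) \<and>
    (\<forall>g\<in>carrier G. \<forall>z\<in>Z. \<forall>v\<in>vecs M. f (\<phi> g z) (act M g v) = act N g (f z v))"

lemma gsetD:
  assumes "gset Z \<phi>"
  shows "finite Z" "\<And>g z. g \<in> carrier G \<Longrightarrow> z \<in> Z \<Longrightarrow> \<phi> g z \<in> Z" "\<And>z. z \<in> Z \<Longrightarrow> \<phi> \<one> z = z"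
    "\<And>g h z. g \<in> carrier G \<Longrightarrow> h \<in> carrier G \<Longrightarrow> z \<in> Z \<Longrightarrow> \<phi> (g \<otimes> h) z = \<phi> g (\<phi> h z)"
  using assms by (auto simp: gset_def)

lemma gset_inv:
  assumes "gset Z \<phi>" "g \<in> carrier G" "z \<in> Z"
  shows "\<phi> (inv g) (\<phi> g z) = z" "\<phi> g (\<phi> (inv g) z) = z"
  using assms gsetD(4)[OF assms(1), of "inv g" g z] gsetD(4)[OF assms(1), of g "inv g" z] gsetD(3)[OF assms(1)]
  by simp_all

lemma gset_bij: "gset Z \<phi> \<Longrightarrow> g \<in> carrier G \<Longrightarrow> bij_betw (\<phi> g) Z Z"
  by (rule bij_betw_byWitness[where f' = "\<phi> (inv g)"]) (auto simp: gset_inv gsetD)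

lemma gset_sum: "gset Z \<phi> \<Longrightarrow> g \<in> carrier G \<Longrightarrow> (\<Sum>z\<in>Z. F (\<phi> g z)) = (\<Sum>z\<in>Z. F z)"
  using sum.reindex_bij_betw[OF gset_bij] by blast

lemma famD:
  assumes "fam M N Z \<phi> f"
  shows "\<And>z. z \<in> Z \<Longrightarrow> lin M N (f z)"
    "\<And>g z v. g \<in> carrier G \<Longrightarrow> z \<in> Z \<Longrightarrow> v \<in> vecs M \<Longrightarrow> f (\<phi> g z) (act M g v) = act N g (f z v)"
  using assms by (auto simp: fam_def)

lemma famI:
  assumes "\<And>z. z \<in> Z \<Longrightarrow> lin M N (f z)"
    "\<And>g z v. g \<in> carrier G \<Longrightarrow> z \<in> Z \<Longrightarrow> v \<in> vecs M \<Longrightarrow> f (\<phi> g z) (act M g v) = act N g (f z v)"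
  shows "fam M N Z \<phi> f"
  using assms by (auto simp: fam_def)

lemma fam_comp:
  assumes "ghom L M i" "fam M N Z \<phi> f" "ghom N K q"
  shows "fam L K Z \<phi> (\<lambda>z x. q (f z (i x)))"
proof (rule famI)
  show "lin L K (\<lambda>x. q (f z (i x)))" if "z \<in> Z" for z
    using lin_comp[OF lin_comp[OF ghomD(1)[OF assms(1)] famD(1)[OF assms(2) that]] ghomD(1)[OF assms(3)]] .
  show "q (f (\<phi> g z) (i (act L g v))) = act K g (q (f z (i v)))" if "g \<in> carrier G" "z \<in> Z" "v \<in> vecs L" for g z v
    using that lin_in[OF ghomD(1)[OF assms(1)]] lin_in[OF famD(1)[OF assms(2)]]
    by (simp add: ghomD(2)[OF assms(1)] famD(2)[OF assms(2)] ghomD(2)[OF assms(3)])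
qed

lemma gset_Plus:
  assumes "gset Z \<phi>" "gset Y \<psi>" shows "gset (Z <+> Y) (\<lambda>g. map_sum (\<phi> g) (\<psi> g))"
  using gsetD[OF assms(1)] gsetD[OF assms(2)] unfolding gset_def by (intro conjI ballI) auto

lemma gset_Times:
  assumes "gset Z \<phi>" "gset Y \<psi>" shows "gset (Z \<times> Y) (\<lambda>g. map_prod (\<phi> g) (\<psi> g))"
  using gsetD[OF assms(1)] gsetD[OF assms(2)] unfolding gset_def by (intro conjI ballI) auto

lemma gset_point: "finite Z \<Longrightarrow> gset Z (\<lambda>g z. z)"
  by (simp add: gset_def)

lemma gset_subset: "gset Z \<phi> \<Longrightarrow> Y \<subseteq> Z \<Longrightarrow> (\<And>g z. g \<in> carrier G \<Longrightarrow> z \<in> Y \<Longrightarrow> \<phi> g z \<in> Y) \<Longrightarrow> gset Y \<phi>"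
  unfolding gset_def by (auto simp: finite_subset subset_iff)

text \<open>Existential definitions such as \<open>linked\<close> and \<open>p_permutation\<close>
  range over index sets of naturals; this moves any finite G-set there.\<close>

lemma gset_nat:
  assumes "gset Z \<phi>"
  obtains b and \<psi> :: "'a \<Rightarrow> nat \<Rightarrow> nat" where "bij_betw b {0..<card Z} Z" "gset {0..<card Z} \<psi>"
    "\<And>g n. g \<in> carrier G \<Longrightarrow> n \<in> {0..<card Z} \<Longrightarrow> b (\<psi> g n) = \<phi> g (b n)"
proof -
  obtain b where b: "bij_betw b {0..<card Z} Z" using ex_bij_betw_nat_finite gsetD(1)[OF assms] by blast
  define c where "c = inv_into {0..<card Z} b"
  have bc: "b (c z) = z" "c z \<in> {0..<card Z}" if "z \<in> Z" for z
    using that b unfolding c_def by (simp_all only: bij_betw_inv_into_right)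
      (metis bij_betw_imp_surj_on inv_into_into)
  have cb: "c (b n) = n" if "n \<in> {0..<card Z}" for n
    using that b by (simp add: c_def bij_betw_inv_into_left)
  have bn: "b n \<in> Z" if "n \<in> {0..<card Z}" for n using b that by (rule bij_betwE[THEN bspec])
  define \<psi> where "\<psi> = (\<lambda>g n. c (\<phi> g (b n)))"
  have *: "b (\<psi> g n) = \<phi> g (b n)" if "g \<in> carrier G" "n \<in> {0..<card Z}" for g n
    using bc(1)[OF gsetD(2)[OF assms that(1) bn[OF that(2)]]] by (simp add: \<psi>_def)
  have "gset {0..<card Z} \<psi>" unfolding gset_def
    using gsetD[OF assms] bn bc cb * by (intro conjI ballI) (simp_all add: \<psi>_def del: atLeastLessThan_iff)
  then show ?thesis using that b * by blast
qed

end

section \<open>Linked modules\<close>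

locale sylow_context = fgroup G for G (structure) +
  fixes p :: nat and S
  assumes prime_p: "prime p" and sylow_S: "sylow_subgroup G p S"
begin

lemma subgroup_S: "subgroup S G"
  using sylow_S by (simp add: sylow_subgroup_def)

lemma S_carrier: "s \<in> S \<Longrightarrow> s \<in> carrier G"
  using subgroup.mem_carrier[OF subgroup_S] .

text \<open>The shape of a permutation basis for k^n + W as in the definition of a Dade module: n
  points fixed by G, and orbits on which no Sylow p-subgroup fixes a point.\<close>

definition good :: "'z set \<Rightarrow> ('a \<Rightarrow> 'z \<Rightarrow> 'z) \<Rightarrow> bool"
  where "good Z \<phi> \<longleftrightarrow> gset Z \<phi> \<and> (\<forall>z\<in>Z. (\<forall>s\<in>S. \<phi> s z = z) \<longrightarrow> (\<forall>g\<in>carrier G. \<phi> g z = z))"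

definition nofix :: "'z set \<Rightarrow> ('a \<Rightarrow> 'z \<Rightarrow> 'z) \<Rightarrow> bool"
  where "nofix Z \<phi> \<longleftrightarrow> gset Z \<phi> \<and> (\<forall>z\<in>Z. \<exists>s\<in>S. \<phi> s z \<noteq> z)"

text \<open>
  \<open>linked M N\<close> says that \<open>Hom\<^sub>k(M, N)\<close> is a direct summand of a permutation module \<open>kZ\<close> all of whose
  \<open>S\<close>-fixed points are \<open>G\<close>-fixed. The maps \<open>Hom(M, N) \<rightarrow> kZ \<rightarrow> Hom(M, N)\<close> are
  \<open>t \<mapsto> (tr (h z \<circ> t))\<^sub>z\<close> and \<open>z \<mapsto> f z\<close>; the last condition evaluates their composition on the
  rank-one map \<open>v \<mapsto> \<lambda> v \<cdot> w\<close>.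
\<close>

definition linking :: "('a, 'k::field, 'v::ab_group_add) gmod \<Rightarrow> ('a, 'k, 'w::ab_group_add) gmod \<Rightarrow> 'z set \<Rightarrow>
    ('a \<Rightarrow> 'z \<Rightarrow> 'z) \<Rightarrow> ('z \<Rightarrow> 'v \<Rightarrow> 'w) \<Rightarrow> ('z \<Rightarrow> 'w \<Rightarrow> 'v) \<Rightarrow> bool"
  where "linking M N Z \<phi> f h \<longleftrightarrow> good Z \<phi> \<and> fam M N Z \<phi> f \<and> fam N M Z \<phi> h \<and>
    (\<forall>l v w. lin M kmod l \<longrightarrow> v \<in> vecs M \<longrightarrow> w \<in> vecs N \<longrightarrow>
      (\<Sum>z\<in>Z. scl N (l (h z w)) (f z v)) = scl N (l v) w)"

definition linked :: "('a, 'k::field, 'v::ab_group_add) gmod \<Rightarrow> ('a, 'k, 'w::ab_group_add) gmod \<Rightarrow> bool"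
  where "linked M N \<longleftrightarrow> (\<exists>(Z :: nat set) \<phi> f h. linking M N Z \<phi> f h)"

lemma linkingD:
  assumes "linking M N Z \<phi> f h"
  shows "good Z \<phi>" "fam M N Z \<phi> f" "fam N M Z \<phi> h"
    "\<And>l v w. lin M kmod l \<Longrightarrow> v \<in> vecs M \<Longrightarrow> w \<in> vecs N \<Longrightarrow>
      (\<Sum>z\<in>Z. scl N (l (h z w)) (f z v)) = scl N (l v) w"
  using assms by (auto simp: linking_def)

lemma good_gset: "good Z \<phi> \<Longrightarrow> gset Z \<phi>" and nofix_gset: "nofix Z \<phi> \<Longrightarrow> gset Z \<phi>"
  by (auto simp: good_def nofix_def)

lemma nofix_good: "nofix Z \<phi> \<Longrightarrow> good Z \<phi>"
  by (auto simp: good_def nofix_def)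

lemma good_point: "finite Z \<Longrightarrow> good Z (\<lambda>g z. z)"
  by (simp add: good_def gset_point)

lemma good_Plus: "good Z \<phi> \<Longrightarrow> good Y \<psi> \<Longrightarrow> good (Z <+> Y) (\<lambda>g. map_sum (\<phi> g) (\<psi> g))"
  unfolding good_def using gset_Plus[of Z \<phi> Y \<psi>] by auto

lemma good_Times: "good Z \<phi> \<Longrightarrow> good Y \<psi> \<Longrightarrow> good (Z \<times> Y) (\<lambda>g. map_prod (\<phi> g) (\<psi> g))"
  unfolding good_def using gset_Times[of Z \<phi> Y \<psi>] by auto

lemma nofix_Plus: "nofix Z \<phi> \<Longrightarrow> nofix Y \<psi> \<Longrightarrow> nofix (Z <+> Y) (\<lambda>g. map_sum (\<phi> g) (\<psi> g))"
  unfolding nofix_def using gset_Plus[of Z \<phi> Y \<psi>] by auto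

lemma nofix_Times1: "nofix Z \<phi> \<Longrightarrow> gset Y \<psi> \<Longrightarrow> nofix (Z \<times> Y) (\<lambda>g. map_prod (\<phi> g) (\<psi> g))"
  unfolding nofix_def using gset_Times[of Z \<phi> Y \<psi>] by force

lemma nofix_Times2: "gset Z \<phi> \<Longrightarrow> nofix Y \<psi> \<Longrightarrow> nofix (Z \<times> Y) (\<lambda>g. map_prod (\<phi> g) (\<psi> g))"
  unfolding nofix_def using gset_Times[of Z \<phi> Y \<psi>] by force

lemma good_transfer:
  assumes "good Z \<phi>" "bij_betw b Y Z" "gset Y \<psi>"
    "\<And>g n. g \<in> carrier G \<Longrightarrow> n \<in> Y \<Longrightarrow> b (\<psi> g n) = \<phi> g (b n)"
  shows "good Y \<psi>"
  unfolding good_def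
proof (intro conjI ballI impI)
  fix n g assume n: "n \<in> Y" and fx: "\<forall>s\<in>S. \<psi> s n = n" and g: "g \<in> carrier G"
  have "b n \<in> Z" using bij_betwE[OF assms(2)] n by blast
  moreover have "\<forall>s\<in>S. \<phi> s (b n) = b n" using fx assms(4)[OF S_carrier n] by simp
  ultimately have "\<phi> g (b n) = b n" using assms(1) g by (auto simp: good_def)
  then have "b (\<psi> g n) = b n" using assms(4)[OF g n] by simp
  then show "\<psi> g n = n"
    using bij_betw_imp_inj_on[OF assms(2)] n gsetD(2)[OF assms(3) g n] by (auto dest: inj_onD)
qed (rule assms(3))

lemma fam_reindex:
  assumes "fam M N Z \<phi> f" "\<And>n. n \<in> Y \<Longrightarrow> b n \<in> Z"
    "\<And>g n. g \<in> carrier G \<Longrightarrow> n \<in> Y \<Longrightarrow> b (\<psi> g n) = \<phi> g (b n)"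
  shows "fam M N Y \<psi> (\<lambda>n. f (b n))"
  by (rule famI) (simp_all add: assms(2,3) famD[OF assms(1)])

lemma linkedI:
  assumes "linking M N Z \<phi> f h" shows "linked M N"
proof -
  note g = good_gset[OF linkingD(1)[OF assms]]
  obtain b \<psi> where b: "bij_betw b {0..<card Z} Z" "gset {0..<card Z} \<psi>"
    "\<And>g n. g \<in> carrier G \<Longrightarrow> n \<in> {0..<card Z} \<Longrightarrow> b (\<psi> g n) = \<phi> g (b n)"
    using gset_nat[OF g] by blast
  have bin: "b n \<in> Z" if "n \<in> {0..<card Z}" for n using bij_betwE[OF b(1)] that by blast
  have "linking M N {0..<card Z} \<psi> (\<lambda>n. f (b n)) (\<lambda>n. h (b n))"
    unfolding linking_def
  proof (intro conjI allI impI)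
    show "good {0..<card Z} \<psi>" by (rule good_transfer[OF linkingD(1)[OF assms] b(1,2)]) (rule b(3))
    show "fam M N {0..<card Z} \<psi> (\<lambda>n. f (b n))" "fam N M {0..<card Z} \<psi> (\<lambda>n. h (b n))"
      by (rule fam_reindex[where b = b, OF linkingD(2)[OF assms]]; simp add: bin b(3) del: atLeastLessThan_iff)
        (rule fam_reindex[where b = b, OF linkingD(3)[OF assms]]; simp add: bin b(3) del: atLeastLessThan_iff)
    fix l v w assume lvw: "lin M kmod l" "v \<in> vecs M" "w \<in> vecs N"
    show "(\<Sum>z\<in>{0..<card Z}. scl N (l (h (b z) w)) (f (b z) v)) = scl N (l v) w"
      using sum.reindex_bij_betw[OF b(1), of "\<lambda>z. scl N (l (h z w)) (f z v)"] linkingD(4)[OF assms lvw]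
      by (rule trans)
  qed
  then show ?thesis unfolding linked_def by blast
qed

lemma linkedE:
  assumes "linked M N" obtains Z :: "nat set" and \<phi> f h where "linking M N Z \<phi> f h"
  using assms unfolding linked_def by blast

text \<open>Applying a form \<open>m\<close> on \<open>N\<close> to the linking identity gives that
  the sum of \<open>l (h z w) * m (f z v)\<close> equals \<open>l v * m w\<close>, which is
  symmetric in the two modules. A frame of \<open>M\<close> recovers the vector identity from its
  coordinates.\<close>

lemma linking_sym:
  assumes M: "mdl M" and N: "mdl N" and D: "linking M N Z \<phi> f h"
  shows "linking N M Z \<phi> h f"
  unfolding linking_def
proof (intro conjI allI impI)
  fix m w v assume m: "lin N kmod m" and w: "w \<in> vecs N" and v: "v \<in> vecs M"
  obtain I :: "nat set" and e l where F: "frame M I e l" using ex_frame[OF M] by blast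
  note f = famD(1)[OF linkingD(2)[OF D]] and h = famD(1)[OF linkingD(3)[OF D]]
  define x where "x = (\<Sum>z\<in>Z. scl M (m (f z v)) (h z w))"
  have x: "x \<in> vecs M" unfolding x_def by (intro mdl_sum[OF M] mdl_scl[OF M] lin_in[OF h w])
  have "l i x = l i v * m w" if i: "i \<in> I" for i
  proof -
    have "l i x = (\<Sum>z\<in>Z. m (f z v) * l i (h z w))" unfolding x_def
      using lin_lincomb[OF M mdl_kmod frameD(3)[OF F i], of Z "\<lambda>z. h z w"] lin_in[OF h w] by simp
    also have "\<dots> = m (\<Sum>z\<in>Z. scl N (l i (h z w)) (f z v))"
      using lin_lincomb[OF N mdl_kmod m, of Z "\<lambda>z. f z v"] lin_in[OF f v] by (simp add: mult.commute)
    finally show ?thesis using linkingD(4)[OF D frameD(3)[OF F i] v w] lin_scl[OF m w] by simp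
  qed
  then have "x = (\<Sum>i\<in>I. scl M (l i v * m w) (e i))"
    using frameD(4)[OF F x] by simp
  also have "\<dots> = scl M (m w) (\<Sum>i\<in>I. scl M (l i v) (e i))"
    by (simp add: scl_sum[OF M] scl_scl[OF M] mult.commute)
  finally show "(\<Sum>z\<in>Z. scl M (m (f z v)) (h z w)) = scl M (m w) v"
    using frameD(4)[OF F v] by (simp add: x_def)
qed (rule linkingD(1)[OF D] linkingD(2)[OF D] linkingD(3)[OF D])+

lemma linked_sym: "mdl M \<Longrightarrow> mdl N \<Longrightarrow> linked M N \<Longrightarrow> linked N M"
  by (metis linkedE linkedI linking_sym)

text \<open>The hypotheses make \<open>M\<close> a summand of the sum of \<open>M1\<close> and
  \<open>M2\<close>, hence Hom(M, N) a summand of the sum of the two Hom spaces. Since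
  \<open>M\<close> need not be the whole sum, relations between augmentation kernels can be proved
  by splitting an identity map into two pieces.\<close>

lemma linked_glue:
  fixes M :: "('a, 'k::field, 'v::ab_group_add) gmod" and N :: "('a, 'k, 'w::ab_group_add) gmod"
    and M1 :: "('a, 'k, 'v1::ab_group_add) gmod" and M2 :: "('a, 'k, 'v2::ab_group_add) gmod"
  assumes linked: "linked M1 N" "linked M2 N" and m: "mdl N"
    and h: "ghom M M1 \<pi>1" "ghom M1 M \<iota>1" "ghom M M2 \<pi>2" "ghom M2 M \<iota>2"
    and sum: "\<And>v. v \<in> vecs M \<Longrightarrow> \<iota>1 (\<pi>1 v) + \<iota>2 (\<pi>2 v) = v"
  shows "linked M N"
proof -
  obtain Z1 :: "nat set" and \<phi>1 f1 h1 where D1: "linking M1 N Z1 \<phi>1 f1 h1" using linkedE[OF linked(1)] by blast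
  obtain Z2 :: "nat set" and \<phi>2 f2 h2 where D2: "linking M2 N Z2 \<phi>2 f2 h2" using linkedE[OF linked(2)] by blast
  define F where "F = case_sum (\<lambda>z x. f1 z (\<pi>1 x)) (\<lambda>z x. f2 z (\<pi>2 x))"
  define H where "H = case_sum (\<lambda>z x. \<iota>1 (h1 z x)) (\<lambda>z x. \<iota>2 (h2 z x))"
  note c = fam_comp[OF h(1) linkingD(2)[OF D1] ghom_id] fam_comp[OF h(3) linkingD(2)[OF D2] ghom_id]
    fam_comp[OF ghom_id linkingD(3)[OF D1] h(2)] fam_comp[OF ghom_id linkingD(3)[OF D2] h(4)]
  have "linking M N (Z1 <+> Z2) (\<lambda>g. map_sum (\<phi>1 g) (\<phi>2 g)) F H"
    unfolding linking_def
  proof (intro conjI allI impI)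
    show "good (Z1 <+> Z2) (\<lambda>g. map_sum (\<phi>1 g) (\<phi>2 g))"
      using good_Plus[OF linkingD(1)[OF D1] linkingD(1)[OF D2]] .
    show "fam M N (Z1 <+> Z2) (\<lambda>g. map_sum (\<phi>1 g) (\<phi>2 g)) F"
      "fam N M (Z1 <+> Z2) (\<lambda>g. map_sum (\<phi>1 g) (\<phi>2 g)) H"
      using famD[OF c(1)] famD[OF c(2)] famD[OF c(3)] famD[OF c(4)]
      unfolding F_def H_def by (auto intro!: famI)
    fix l v w assume l: "lin M kmod l" and v: "v \<in> vecs M" and w: "w \<in> vecs N"
    note hl = ghomD(1)[OF h(1)] ghomD(1)[OF h(2)] ghomD(1)[OF h(3)] ghomD(1)[OF h(4)]
    have "(\<Sum>z\<in>Z1 <+> Z2. scl N (l (H z w)) (F z v)) =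
      (\<Sum>z\<in>Z1. scl N (l (\<iota>1 (h1 z w))) (f1 z (\<pi>1 v))) + (\<Sum>z\<in>Z2. scl N (l (\<iota>2 (h2 z w))) (f2 z (\<pi>2 v)))"
      using gsetD(1)[OF good_gset[OF linkingD(1)[OF D1]]] gsetD(1)[OF good_gset[OF linkingD(1)[OF D2]]]
      by (simp add: sum.Plus F_def H_def)
    also have "\<dots> = scl N (l (\<iota>1 (\<pi>1 v))) w + scl N (l (\<iota>2 (\<pi>2 v))) w"
      using linkingD(4)[OF D1 lin_comp[OF hl(2) l] lin_in[OF hl(1) v] w]
        linkingD(4)[OF D2 lin_comp[OF hl(4) l] lin_in[OF hl(3) v] w] by simp
    also have "\<dots> = scl N (l v) w"
      using sum[OF v] lin_add[OF l lin_in[OF hl(2) lin_in[OF hl(1) v]] lin_in[OF hl(4) lin_in[OF hl(3) v]]]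
      by (simp add: scl_add_left[OF m])
    finally show "(\<Sum>z\<in>Z1 <+> Z2. scl N (l (H z w)) (F z v)) = scl N (l v) w" .
  qed
  then show ?thesis by (rule linkedI)
qed

lemma linked_retr:
  assumes "retr M M' i q" "linked M' N" "mdl M" "mdl N" shows "linked M N"
proof -
  obtain Z :: "nat set" and \<phi> f h where D: "linking M' N Z \<phi> f h" using linkedE[OF assms(2)] by blast
  note i = retrD(1)[OF assms(1)] and q = retrD(2)[OF assms(1)]
  have "linking M N Z \<phi> (\<lambda>z x. f z (i x)) (\<lambda>z x. q (h z x))"
    unfolding linking_def
    using linkingD(1)[OF D] fam_comp[OF i linkingD(2)[OF D] ghom_id] fam_comp[OF ghom_id linkingD(3)[OF D] q]
      linkingD(4)[OF D lin_comp[OF ghomD(1)[OF q]] lin_in[OF ghomD(1)[OF i]]] retrD(3)[OF assms(1)] by simp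
  then show ?thesis by (rule linkedI)
qed

lemma linked_retr2:
  assumes "retr N N' i q" "linked M N'" "mdl M" "mdl N" "mdl N'" shows "linked M N"
  using linked_sym[OF assms(4,3) linked_retr[OF assms(1) linked_sym[OF assms(3,5,2)] assms(4,3)]] .

text \<open>Of the four blocks of End(M + N) the two mixed ones are exchanged by
  \<open>linked_sym\<close>. This turns compatibility, which is defined by a direct sum, into
  linkedness.\<close>

lemma linked_direct_sum:
  fixes M :: "('a, 'k::field, 'v::ab_group_add) gmod" and N :: "('a, 'k, 'w::ab_group_add) gmod"
  assumes M: "mdl M" and N: "mdl N"
  shows "linked (direct_sum M N) (direct_sum M N) \<longleftrightarrow> linked M M \<and> linked N N \<and> linked M N"
proof -
  note MN = mdl_direct_sum[OF M N]
  have i1: "ghom M (direct_sum M N) (\<lambda>x. (x, 0))"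
    by (auto simp: ghom_def mdl_0[OF N] scl_0'[OF N] lin_0[OF N N mdl_act_lin[OF N]] intro!: linI)
  have i2: "ghom N (direct_sum M N) (\<lambda>x. (0, x))"
    by (auto simp: ghom_def mdl_0[OF M] scl_0'[OF M] lin_0[OF M M mdl_act_lin[OF M]] intro!: linI)
  have p1: "ghom (direct_sum M N) M fst" and p2: "ghom (direct_sum M N) N snd"
    by (auto simp: ghom_def intro!: linI)
  have r1: "retr M (direct_sum M N) (\<lambda>x. (x, 0)) fst" and r2: "retr N (direct_sum M N) (\<lambda>x. (0, x)) snd"
    using i1 i2 p1 p2 by (auto simp: retr_def)
  have glue: "linked (direct_sum M N) L" if "linked M L" "linked N L" "mdl L" for L :: "('a, 'k, 'x::ab_group_add) gmod"
    using linked_glue[OF that p1 i1 p2 i2] by simp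
  show ?thesis
  proof
    assume linked: "linked (direct_sum M N) (direct_sum M N)"
    note a = linked_retr[OF r1 linked M MN] and b = linked_retr[OF r2 linked N MN]
    show "linked M M \<and> linked N N \<and> linked M N"
      using linked_retr2[OF r1 a M M MN] linked_retr2[OF r2 b N N MN] linked_retr2[OF r2 a M N MN] by simp
  next
    assume linked: "linked M M \<and> linked N N \<and> linked M N"
    have "linked (direct_sum M N) M" using glue[of M] linked linked_sym[OF M N] M by blast
    moreover have "linked (direct_sum M N) N" using glue[of N] linked N by blast
    ultimately show "linked (direct_sum M N) (direct_sum M N)"
      using glue[OF linked_sym[OF MN M] linked_sym[OF MN N] MN] by blast
  qed
qed

text \<open>This says that \<open>k\<close> is a direct summand of \<open>End\<^sub>k(M)\<close>.\<close>

definition traced :: "('a, 'k::field, 'v::ab_group_add) gmod \<Rightarrow> bool"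
  where "traced M \<longleftrightarrow> (\<exists>(I :: nat set) e l c. frame M I e l \<and> ghom M M c \<and> (\<Sum>i\<in>I. l i (c (e i))) \<noteq> 0)"

lemma tracedI:
  assumes "frame M I e l" "ghom M M c" "(\<Sum>i\<in>I. l i (c (e i))) \<noteq> 0" shows "traced M"
proof -
  obtain b where b: "bij_betw b {0..<card I} I"
    using ex_bij_betw_nat_finite frameD(1)[OF assms(1)] by blast
  have "frame M {0..<card I} (\<lambda>n. e (b n)) (\<lambda>n. l (b n))"
    unfolding frame_def
    using frameD[OF assms(1)] bij_betwE[OF b] sum.reindex_bij_betw[OF b, of "\<lambda>i. scl M (l i _) (e i)"] by auto
  moreover have "(\<Sum>n\<in>{0..<card I}. l (b n) (c (e (b n)))) \<noteq> 0"
    using sum.reindex_bij_betw[OF b, of "\<lambda>i. l i (c (e i))"] assms(3) by simp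
  ultimately show ?thesis using assms(2) unfolding traced_def by blast
qed

lemma traced_ginv:
  assumes "ginv M N f h" "mdl M" "mdl N" "traced M" shows "traced N"
proof -
  obtain I :: "nat set" and e l c where F: "frame M I e l" "ghom M M c" "(\<Sum>i\<in>I. l i (c (e i))) \<noteq> 0"
    using assms(4) unfolding traced_def by blast
  note gi = ginvD[OF assms(1)]
  have "frame N I (\<lambda>j. f (e j)) (\<lambda>j x. l j (h x))"
    by (rule frame_retract[OF assms(3,2) ghomD(1)[OF gi(2)] ghomD(1)[OF gi(1)] gi(4) F(1)])
  moreover have "ghom N N (\<lambda>x. f (c (h x)))" by (rule ghom_comp[OF gi(2) ghom_comp[OF F(2) gi(1)]])
  moreover have "(\<Sum>i\<in>I. l i (h (f (c (h (f (e i))))))) = (\<Sum>i\<in>I. l i (c (e i)))"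
    using frameD(2)[OF F(1)] gi(3) lin_in[OF ghomD(1)[OF F(2)]] by (intro sum.cong) auto
  ultimately show ?thesis using F(3) by (intro tracedI[of N I "\<lambda>j. f (e j)" "\<lambda>j x. l j (h x)" "\<lambda>x. f (c (h x))"]) simp_all
qed

text \<open>Hom(L, M) tensor Hom(M, N) is Hom(L, N) tensor End(M), and k splits off End(M) because
  \<open>M\<close> is traced. In terms of families: compose forwards, and compose backwards through
  an endomorphism of trace 1; the sum over the second family then produces that trace.\<close>

lemma linked_trans:
  fixes L :: "('a, 'k::field, 'u::ab_group_add) gmod" and M :: "('a, 'k, 'v::ab_group_add) gmod"
    and N :: "('a, 'k, 'w::ab_group_add) gmod"
  assumes m: "mdl L" "mdl M" "mdl N" and t: "traced M" and linked: "linked L M" "linked M N"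
  shows "linked L N"
proof -
  obtain Z :: "nat set" and \<phi> f h where D: "linking L M Z \<phi> f h" using linkedE[OF linked(1)] by blast
  obtain Y :: "nat set" and \<psi> f' h' where D': "linking M N Y \<psi> f' h'" using linkedE[OF linked(2)] by blast
  obtain I :: "nat set" and e \<mu> c where F: "frame M I e \<mu>" and c: "ghom M M c" and tr: "(\<Sum>i\<in>I. \<mu> i (c (e i))) \<noteq> 0"
    using t unfolding traced_def by blast
  define t where "t = (\<Sum>i\<in>I. \<mu> i (c (e i)))"
  \<comment> \<open>Division by the trace normalises it to 1.\<close>
  define c' where "c' = (\<lambda>x. scl M (inverse t) (c x))"
  have c': "ghom M M c'"
    using lin_smult[OF m(2) ghomD(1)[OF c], of "inverse t"] ghomD(2)[OF c] lin_in[OF ghomD(1)[OF c]]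
    by (simp add: ghom_def c'_def lin_scl[OF mdl_act_lin[OF m(2)]])
  have t1: "(\<Sum>i\<in>I. \<mu> i (c' (e i))) = 1"
  proof -
    have "\<mu> i (c' (e i)) = inverse t * \<mu> i (c (e i))" if "i \<in> I" for i
      unfolding c'_def using lin_scl[OF frameD(3)[OF F that] lin_in[OF ghomD(1)[OF c] frameD(2)[OF F that]]] by simp
    then show ?thesis using tr by (simp add: t_def sum_distrib_left[symmetric])
  qed
  note f = famD[OF linkingD(2)[OF D]] and h = famD[OF linkingD(3)[OF D]]
    and f' = famD[OF linkingD(2)[OF D']] and h' = famD[OF linkingD(3)[OF D']]
  define FF where "FF = (\<lambda>(z, y) x. f' y (f z x))"
  define HH where "HH = (\<lambda>(z, y) x. h z (c' (h' y x)))"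
  have "linking L N (Z \<times> Y) (\<lambda>g. map_prod (\<phi> g) (\<psi> g)) FF HH"
    unfolding linking_def
  proof (intro conjI allI impI)
    show "good (Z \<times> Y) (\<lambda>g. map_prod (\<phi> g) (\<psi> g))"
      using good_Times[OF linkingD(1)[OF D] linkingD(1)[OF D']] .
    show "fam L N (Z \<times> Y) (\<lambda>g. map_prod (\<phi> g) (\<psi> g)) FF"
      by (rule famI) (auto simp: FF_def f f' lin_in[OF f(1)] intro!: lin_comp[OF f(1) f'(1)])
    show "fam N L (Z \<times> Y) (\<lambda>g. map_prod (\<phi> g) (\<psi> g)) HH"
      using lin_in[OF h'(1)] lin_in[OF ghomD(1)[OF c']]
      by (intro famI) (auto simp: HH_def h h' ghomD(2)[OF c'] intro!: lin_comp[OF lin_comp[OF h'(1) ghomD(1)[OF c']] h(1)])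
    fix l v w assume l: "lin L kmod l" and v: "v \<in> vecs L" and w: "w \<in> vecs N"
    have hw: "c' (h' y w) \<in> vecs M" if "y \<in> Y" for y
      using that lin_in[OF ghomD(1)[OF c'] lin_in[OF h'(1) w]] by blast
    have *: "(\<Sum>z\<in>Z. scl N (l (h z (c' (h' y w)))) (f' y (f z v))) =
        scl N (l v) (\<Sum>i\<in>I. scl N (\<mu> i (c' (h' y w))) (f' y (e i)))" if y: "y \<in> Y" for y
    proof -
      have "(\<Sum>z\<in>Z. scl N (l (h z (c' (h' y w)))) (f' y (f z v))) =
        f' y (\<Sum>z\<in>Z. scl M (l (h z (c' (h' y w)))) (f z v))"
        using lin_lincomb[OF m(2,3) f'(1)[OF y], of Z "\<lambda>z. f z v"] lin_in[OF f(1) v] by simp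
      also have "\<dots> = f' y (scl M (l v) (c' (h' y w)))" using linkingD(4)[OF D l v hw[OF y]] by simp
      also have "\<dots> = scl N (l v) (f' y (c' (h' y w)))" by (rule lin_scl[OF f'(1)[OF y] hw[OF y]])
      also have "f' y (c' (h' y w)) = (\<Sum>i\<in>I. scl N (\<mu> i (c' (h' y w))) (f' y (e i)))"
        by (rule lin_expand[OF m(2,3) F f'(1)[OF y] hw[OF y]])
      finally show ?thesis .
    qed
    have "(\<Sum>z\<in>Z \<times> Y. scl N (l (HH z w)) (FF z v)) =
       (\<Sum>y\<in>Y. \<Sum>z\<in>Z. scl N (l (h z (c' (h' y w)))) (f' y (f z v)))"
      by (subst sum.swap) (simp add: sum.cartesian_product HH_def FF_def split_def)
    also have "\<dots> = scl N (l v) (\<Sum>y\<in>Y. \<Sum>i\<in>I. scl N (\<mu> i (c' (h' y w))) (f' y (e i)))"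
      using * by (simp add: scl_sum[OF m(3)])
    also have "(\<Sum>y\<in>Y. \<Sum>i\<in>I. scl N (\<mu> i (c' (h' y w))) (f' y (e i))) =
       (\<Sum>i\<in>I. \<Sum>y\<in>Y. scl N (\<mu> i (c' (h' y w))) (f' y (e i)))" by (rule sum.swap)
    also have "\<dots> = (\<Sum>i\<in>I. scl N (\<mu> i (c' (e i))) w)"
      using linkingD(4)[OF D' lin_comp[OF ghomD(1)[OF c'] frameD(3)[OF F]] frameD(2)[OF F] w] by (intro sum.cong) auto
    also have "\<dots> = w" using t1 by (simp add: scl_sum_left[OF m(3), symmetric] scl_1[OF m(3)])
    finally show "(\<Sum>z\<in>Z \<times> Y. scl N (l (HH z w)) (FF z v)) = scl N (l v) w" .
  qed
  then show ?thesis by (rule linkedI)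
qed

end

section \<open>Constructions of modules\<close>

context fgroup
begin

lemma frame_reindex:
  assumes "frame M J e l" "bij_betw b I J" shows "frame M I (\<lambda>n. e (b n)) (\<lambda>n. l (b n))"
  unfolding frame_def
  using frameD[OF assms(1)] bij_betwE[OF assms(2)] bij_betw_finite[OF assms(2)]
    sum.reindex_bij_betw[OF assms(2), of "\<lambda>i. scl M (l i _) (e i)"] by auto

lemma vec_eqI:
  assumes "frame M I e l" "x \<in> vecs M" "y \<in> vecs M" "\<And>i. i \<in> I \<Longrightarrow> l i x = l i y" shows "x = y"
  using frameD(4)[OF assms(1,2)] frameD(4)[OF assms(1,3)] assms(4) by (metis (no_types, lifting) sum.cong)

text \<open>The matrices of the group elements in a frame determine the module, although the frame
  vectors may be dependent: the matrix for g = 1 is an idempotent whose image is a copy of the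
  module. This yields all canonical isomorphisms below by comparing matrices.\<close>

lemma ginv_frames:
  fixes M :: "('a, 'k::field, 'v::ab_group_add) gmod" and N :: "('a, 'k, 'w::ab_group_add) gmod"
  assumes M: "mdl M" and N: "mdl N" and F: "frame M I e l" and F': "frame N I e' l'"
    and eq: "\<And>g i j. g \<in> carrier G \<Longrightarrow> i \<in> I \<Longrightarrow> j \<in> I \<Longrightarrow> l i (act M g (e j)) = l' i (act N g (e' j))"
  shows "\<exists>f h. ginv M N f h"
proof -
  have half: "ghom A B (\<lambda>v. \<Sum>i\<in>I. scl B (la i v) (eb i)) \<and>
      (\<forall>v\<in>vecs A. (\<Sum>i\<in>I. scl A (lb i (\<Sum>i\<in>I. scl B (la i v) (eb i))) (ea i)) = v)"
    if A: "mdl A" and B: "mdl B" and FA: "frame A I ea la" and FB: "frame B I eb lb"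
     and eq: "\<And>g i j. g \<in> carrier G \<Longrightarrow> i \<in> I \<Longrightarrow> j \<in> I \<Longrightarrow> la i (act A g (ea j)) = lb i (act B g (eb j))"
    for A :: "('a, 'k, 'x::ab_group_add) gmod" and B :: "('a, 'k, 'y::ab_group_add) gmod" and ea la eb lb
  proof -
    define f where "f = (\<lambda>v. \<Sum>i\<in>I. scl B (la i v) (eb i))"
    have lf: "lin A B f" unfolding f_def
      by (intro lin_sumf[OF B] lin_fscl[OF B] frameD(3)[OF FA] frameD(2)[OF FB])
    have fe: "f (act A g (ea j)) = act B g (eb j)" if "g \<in> carrier G" "j \<in> I" for g j
      using eq[OF that(1) _ that(2)] frameD(4)[OF FB mdl_act[OF B that(1) frameD(2)[OF FB that(2)]]]
      by (simp add: f_def)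
    have "f (act A g v) = act B g (f v)" if g: "g \<in> carrier G" and v: "v \<in> vecs A" for g v
    proof -
      have "f (act A g v) = (\<Sum>i\<in>I. scl B (la i v) (f (act A g (ea i))))"
        using lin_expand[OF A B FA lin_comp[OF mdl_act_lin[OF A g] lf] v] .
      also have "\<dots> = act B g (f v)"
        using lin_lincomb[OF B B mdl_act_lin[OF B g], of I eb] frameD(2)[OF FB] fe[OF g] by (simp add: f_def)
      finally show ?thesis .
    qed
    moreover have "(\<Sum>i\<in>I. scl A (lb i (f v)) (ea i)) = v" if v: "v \<in> vecs A" for v
    proof -
      have "lb i (f v) = la i v" if i: "i \<in> I" for i
      proof -
        have "lb i (f v) = (\<Sum>j\<in>I. la j v * lb i (eb j))" unfolding f_def
          using lin_lincomb[OF B mdl_kmod frameD(3)[OF FB i], of I eb "\<lambda>i. la i v"] frameD(2)[OF FB] by simp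
        also have "\<dots> = (\<Sum>j\<in>I. la j v * la i (ea j))"
          using eq[OF one_closed i] frameD(2)[OF FA] frameD(2)[OF FB]
          by (simp add: mdl_act_one[OF A] mdl_act_one[OF B])
        also have "\<dots> = la i v" using linK_expand[OF A FA frameD(3)[OF FA i] v] by simp
        finally show ?thesis .
      qed
      then show ?thesis using frameD(4)[OF FA v] by simp
    qed
    ultimately show ?thesis using lf unfolding f_def ghom_def by blast
  qed
  show ?thesis
    using half[OF M N F F' eq] half[OF N M F' F eq[symmetric]] unfolding ginv_def by blast
qed

lemma vs_fun: "vector_space (\<lambda>(c::'k::field) (f::'i \<Rightarrow> 'k) i. c * f i)"
  by (auto simp: vector_space_def algebra_simps fun_eq_iff)

lemma vs_fun_scl: "vector_space s \<Longrightarrow> vector_space (\<lambda>c (f::'i \<Rightarrow> 'v::ab_group_add) i. s c (f i))"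
  by (auto simp: vector_space_def fun_eq_iff)

text \<open>The coordinates with respect to a frame embed \<open>M\<close> into
  \<open>nat => 'k\<close>; the structure is carried over along this embedding and its left inverse
  \<open>d\<close>.\<close>

lemma std_copy:
  fixes M :: "('a, 'k::field, 'v::ab_group_add) gmod"
  assumes M: "mdl M"
  obtains N :: "('a, 'k) std_gmod" and f h where "mdl N" "ginv M N f h"
proof -
  obtain I :: "nat set" and e l where F: "frame M I e l" using ex_frame[OF M] by blast
  define c where "c = (\<lambda>v i. if i \<in> I then l i v else 0)"
  define d where "d = (\<lambda>x. \<Sum>i\<in>I. scl M (x i) (e i))"
  define N :: "('a, 'k) std_gmod" where
    "N = \<lparr>vecs = c ` vecs M, scl = (\<lambda>a f i. a * f i), act = (\<lambda>g x. c (act M g (d x)))\<rparr>"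
  have dc: "d (c v) = v" if "v \<in> vecs M" for v
    using frameD(4)[OF F that] by (simp add: c_def d_def)
  have cadd: "c (v + w) = c v + c w" if "v \<in> vecs M" "w \<in> vecs M" for v w
    using that by (auto simp: c_def fun_eq_iff lin_add[OF frameD(3)[OF F]])
  have cscl: "c (scl M a v) = (\<lambda>i. a * c v i)" if "v \<in> vecs M" for v a
    using that by (auto simp: c_def fun_eq_iff lin_scl[OF frameD(3)[OF F]])
  have [simp]: "vecs N = c ` vecs M" "scl N = (\<lambda>a f i. a * f i)" "act N = (\<lambda>g x. c (act M g (d x)))"
    by (simp_all add: N_def)
  have c0: "c 0 = 0" using lin_0[OF M mdl_kmod frameD(3)[OF F]] by (auto simp: c_def)
  have csum: "c (\<Sum>j\<in>J. x j) = (\<Sum>j\<in>J. c (x j))" if "\<And>j. j \<in> J \<Longrightarrow> x j \<in> vecs M" for J and x :: "nat \<Rightarrow> _"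
    using that by (induction J rule: infinite_finite_induct) (simp_all add: c0 cadd mdl_sum[OF M])
  have N: "mdl N"
  proof (rule mdlI_frame)
    show "vector_space (scl N)" using vs_fun by simp
    show "0 \<in> vecs N" using c0 mdl_0[OF M] by (metis \<open>vecs N = c ` vecs M\<close> imageI)
    show "x + y \<in> vecs N" if "x \<in> vecs N" "y \<in> vecs N" for x y
      using that by (auto simp: cadd[symmetric] mdl_add[OF M])
    show "scl N a x \<in> vecs N" if "x \<in> vecs N" for x a
      using that by (auto simp: cscl[symmetric] mdl_scl[OF M])
    show "lin N N (act N g)" if g: "g \<in> carrier G" for g
    proof (rule linI)
      fix x y assume "x \<in> vecs N" "y \<in> vecs N"
      then obtain v w where vw: "x = c v" "y = c w" "v \<in> vecs M" "w \<in> vecs M" by auto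
      have "d (x + y) = v + w" using dc[OF mdl_add[OF M vw(3,4)]] vw(1,2) cadd[OF vw(3,4)] by simp
      then show "act N g (x + y) = act N g x + act N g y"
        using vw dc lin_add[OF mdl_act_lin[OF M g]] cadd mdl_act[OF M g] by simp
    next
      fix a x assume "x \<in> vecs N"
      then obtain v where v: "x = c v" "v \<in> vecs M" by auto
      have "d (scl N a x) = scl M a v" using dc[OF mdl_scl[OF M v(2)]] v(1) cscl[OF v(2)] by simp
      then show "act N g (scl N a x) = scl N a (act N g x)"
        using v dc[OF v(2)] lin_scl[OF mdl_act_lin[OF M g] v(2)] cscl[OF mdl_act[OF M g v(2)]] by simp
    qed (use g mdl_act[OF M g] dc in auto)
    show "frame N I (\<lambda>i. c (e i)) (\<lambda>i x. x i)"
      unfolding frame_def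
    proof (intro conjI ballI)
      fix x assume "x \<in> vecs N"
      then obtain v where v: "x = c v" "v \<in> vecs M" by auto
      have "x = c (\<Sum>i\<in>I. scl M (l i v) (e i))" using frameD(4)[OF F v(2)] v(1) by simp
      also have "\<dots> = (\<Sum>i\<in>I. c (scl M (l i v) (e i)))"
        by (rule csum) (use frameD(2)[OF F] mdl_scl[OF M] in auto)
      also have "\<dots> = (\<Sum>i\<in>I. scl N (x i) (c (e i)))"
      proof (rule sum.cong[OF refl])
        fix i assume i: "i \<in> I"
        then have "x i = l i v" by (simp add: v(1) c_def)
        then show "c (scl M (l i v) (e i)) = scl N (x i) (c (e i))"
          using cscl[OF frameD(2)[OF F i]] by simp
      qed
      finally show "x = (\<Sum>i\<in>I. scl N (x i) (c (e i)))" .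
    qed (use frameD(1,2)[OF F] in \<open>auto intro!: linI\<close>)
  qed (auto simp: dc mdl_act_one[OF M] mdl_act_mult[OF M] mdl_act[OF M])
  have "ghom M N c" unfolding ghom_def
    using dc cadd cscl by (intro conjI linI ballI) simp_all
  moreover have "ghom N M d" unfolding ghom_def
  proof (intro conjI linI ballI)
    show "d (x + y) = d x + d y" for x y
      by (simp add: d_def scl_add_left[OF M] sum.distrib)
    show "d (scl N a x) = scl M a (d x)" for a x
      by (simp add: d_def scl_sum[OF M] scl_scl[OF M])
  qed (use dc mdl_act[OF M] in auto)
  ultimately have "ginv M N c d" using dc by (simp add: ginv_def)
  then show ?thesis using N that by blast
qed

subsection \<open>Endomorphisms\<close>

lemma End_vecs: "t \<in> vecs (End_gmod G M) \<longleftrightarrow> lin M M t \<and> (\<forall>v. v \<notin> vecs M \<longrightarrow> t v = 0)"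
  by (auto simp: End_gmod_def lin_def)

lemma End_scl: "scl (End_gmod G M) = (\<lambda>c f v. scl M c (f v))"
  and End_act: "act (End_gmod G M) g f = (\<lambda>v. if v \<in> vecs M then act M g (f (act M (inv g) v)) else 0)"
  by (simp_all add: End_gmod_def)

definition rk1 :: "('a, 'k::field, 'v::ab_group_add) gmod \<Rightarrow> ('v \<Rightarrow> 'k) \<Rightarrow> 'v \<Rightarrow> 'v \<Rightarrow> 'v"
  where "rk1 M l w = (\<lambda>v. if v \<in> vecs M then scl M (l v) w else 0)"

context
  fixes M :: "('a, 'k::field, 'v::ab_group_add) gmod"
  assumes M: "mdl M"
begin

lemma End_I:
  assumes "lin M M f" shows "(\<lambda>v. if v \<in> vecs M then f v else 0) \<in> vecs (End_gmod G M)"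
  unfolding End_vecs
  by (auto intro!: linI simp: lin_add[OF assms] lin_scl[OF assms] lin_in[OF assms] mdl_add[OF M] mdl_scl[OF M])

lemma rk1_End: "lin M kmod l \<Longrightarrow> w \<in> vecs M \<Longrightarrow> rk1 M l w \<in> vecs (End_gmod G M)"
  unfolding rk1_def by (rule End_I[OF lin_fscl[OF M]])

lemma End_sum_apply: "(\<Sum>z\<in>Z. scl (End_gmod G M) (c z) (t z)) v = (\<Sum>z\<in>Z. scl M (c z) (t z v))"
  by (induction Z rule: infinite_finite_induct) (simp_all add: End_scl)

lemma End_frame:
  assumes F: "frame M I e l"
  shows "frame (End_gmod G M) (I \<times> I) (\<lambda>(j, i). rk1 M (l j) (e i)) (\<lambda>(j, i) t. l i (t (e j)))"
  unfolding frame_def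
proof (intro conjI ballI)
  show "finite (I \<times> I)" using frameD(1)[OF F] by simp
  show "(case ij of (j, i) \<Rightarrow> rk1 M (l j) (e i)) \<in> vecs (End_gmod G M)" if "ij \<in> I \<times> I" for ij
    using that rk1_End frameD[OF F] by auto
  show "lin (End_gmod G M) kmod (case ij of (j, i) \<Rightarrow> \<lambda>t. l i (t (e j)))" if "ij \<in> I \<times> I" for ij
    using that frameD(2)[OF F]
    by (auto intro!: linI simp: End_vecs End_scl lin_add[OF frameD(3)[OF F]] lin_scl[OF frameD(3)[OF F]] lin_in)
  show "t = (\<Sum>ij\<in>I \<times> I. scl (End_gmod G M) ((case ij of (j, i) \<Rightarrow> \<lambda>t. l i (t (e j))) t)
      (case ij of (j, i) \<Rightarrow> rk1 M (l j) (e i)))" if t: "t \<in> vecs (End_gmod G M)" for t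
  proof
    fix v
    have tl: "lin M M t" using t by (simp add: End_vecs)
    show "t v = (\<Sum>ij\<in>I \<times> I. scl (End_gmod G M) ((case ij of (j, i) \<Rightarrow> \<lambda>t. l i (t (e j))) t)
      (case ij of (j, i) \<Rightarrow> rk1 M (l j) (e i))) v"
    proof (cases "v \<in> vecs M")
      case True
      have "t v = (\<Sum>j\<in>I. scl M (l j v) (t (e j)))" by (rule lin_expand[OF M M F tl True])
      also have "\<dots> = (\<Sum>j\<in>I. scl M (l j v) (\<Sum>i\<in>I. scl M (l i (t (e j))) (e i)))"
        using frameD(4)[OF F lin_in[OF tl frameD(2)[OF F]]] by simp
      also have "\<dots> = (\<Sum>ij\<in>I \<times> I. scl M (l (snd ij) (t (e (fst ij)))) (scl M (l (fst ij) v) (e (snd ij))))"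
        by (simp add: scl_sum[OF M] scl_scl[OF M] sum.cartesian_product split_def mult.commute)
      finally show ?thesis using True by (simp add: End_sum_apply split_def rk1_def)
    next
      case False
      then show ?thesis using t
        by (simp add: End_sum_apply split_def rk1_def End_vecs scl_0'[OF M])
    qed
  qed
qed

lemma mdl_End: "mdl (End_gmod G M)"
proof -
  obtain I :: "nat set" and e l where F: "frame M I e l" using ex_frame[OF M] by blast
  show ?thesis
  proof (rule mdlI_frame[OF _ _ _ _ _ _ _ End_frame[OF F]])
    show "vector_space (scl (End_gmod G M))" unfolding End_scl by (rule vs_fun_scl[OF mdl_vs[OF M]])
    show "0 \<in> vecs (End_gmod G M)" using lin_zero[OF M] by (simp add: End_vecs zero_fun_def)
    show "x + y \<in> vecs (End_gmod G M)" if "x \<in> vecs (End_gmod G M)" "y \<in> vecs (End_gmod G M)" for x y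
      using that lin_plus[OF M, of M x y] by (simp add: End_vecs plus_fun_def)
    show "scl (End_gmod G M) c x \<in> vecs (End_gmod G M)" if "x \<in> vecs (End_gmod G M)" for c x
      using that lin_smult[OF M, of M x c] by (simp add: End_vecs End_scl scl_0'[OF M])
    show "lin (End_gmod G M) (End_gmod G M) (act (End_gmod G M) g)" if g: "g \<in> carrier G" for g
    proof (rule linI)
      have g': "inv g \<in> carrier G" using g by simp
      note a = mdl_act_lin[OF M g]
      show "act (End_gmod G M) g (x + y) = act (End_gmod G M) g x + act (End_gmod G M) g y"
        if "x \<in> vecs (End_gmod G M)" "y \<in> vecs (End_gmod G M)" for x y
        using that by (auto simp: End_act End_vecs fun_eq_iff lin_add[OF a] lin_in mdl_act[OF M g'])
      show "act (End_gmod G M) g (scl (End_gmod G M) c x) = scl (End_gmod G M) c (act (End_gmod G M) g x)"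
        if "x \<in> vecs (End_gmod G M)" for c x
        using that by (auto simp: End_act End_scl End_vecs fun_eq_iff lin_scl[OF a] lin_in mdl_act[OF M g'] scl_0'[OF M])
      show "act (End_gmod G M) g x \<in> vecs (End_gmod G M)" if "x \<in> vecs (End_gmod G M)" for x
        using that unfolding End_act
        by (intro End_I lin_comp[OF lin_comp[OF mdl_act_lin[OF M g']] a]) (simp add: End_vecs)
    qed
    show "act (End_gmod G M) \<one> t = t" if "t \<in> vecs (End_gmod G M)" for t
      using that by (auto simp: End_act End_vecs fun_eq_iff mdl_act_one[OF M] lin_in)
    show "act (End_gmod G M) (g \<otimes> h) t = act (End_gmod G M) g (act (End_gmod G M) h t)"
      if "g \<in> carrier G" "h \<in> carrier G" "t \<in> vecs (End_gmod G M)" for g h t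
      using that by (auto simp: End_act End_vecs fun_eq_iff mdl_act_mult[OF M] lin_in inv_mult_group mdl_act[OF M])
  qed
qed

end

subsection \<open>Permuted frames\<close>

text \<open>Exhibits \<open>V\<close> as a summand of kZ: \<open>v\<close> goes to the element with
  coefficients \<open>l z v\<close>, and the basis element \<open>z\<close> goes to
  \<open>e z\<close>. It is the working form of \<open>p_permutation\<close>.\<close>

definition perm_frame :: "('a, 'k::field, 'v::ab_group_add) gmod \<Rightarrow> 'z set \<Rightarrow> ('a \<Rightarrow> 'z \<Rightarrow> 'z) \<Rightarrow> ('z \<Rightarrow> 'v) \<Rightarrow> ('z \<Rightarrow> 'v \<Rightarrow> 'k) \<Rightarrow> bool"
  where "perm_frame V Z \<phi> e l \<longleftrightarrow> gset Z \<phi> \<and> frame V Z e l \<and>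
    (\<forall>g\<in>carrier G. \<forall>z\<in>Z. e (\<phi> g z) = act V g (e z)) \<and> fam V kmod Z \<phi> l"

lemma perm_frameD:
  assumes "perm_frame V Z \<phi> e l"
  shows "gset Z \<phi>" "frame V Z e l" "\<And>g z. g \<in> carrier G \<Longrightarrow> z \<in> Z \<Longrightarrow> e (\<phi> g z) = act V g (e z)"
    "fam V kmod Z \<phi> l"
    "\<And>g z v. g \<in> carrier G \<Longrightarrow> z \<in> Z \<Longrightarrow> v \<in> vecs V \<Longrightarrow> l (\<phi> g z) (act V g v) = l z v"
  using assms famD(2)[of V kmod Z \<phi> l] by (auto simp: perm_frame_def)

lemma perm_frame_retr:
  assumes "retr V W i q" "mdl V" "mdl W" "perm_frame W Z \<phi> e l"
  shows "perm_frame V Z \<phi> (\<lambda>z. q (e z)) (\<lambda>z v. l z (i v))"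
proof -
  note i = retrD(1)[OF assms(1)] and q = retrD(2)[OF assms(1)]
  show ?thesis unfolding perm_frame_def
  proof (intro conjI ballI)
    show "frame V Z (\<lambda>z. q (e z)) (\<lambda>z v. l z (i v))"
      by (rule frame_retract[OF assms(2,3) ghomD(1)[OF i] ghomD(1)[OF q] retrD(3)[OF assms(1)] perm_frameD(2)[OF assms(4)]])
    show "fam V kmod Z \<phi> (\<lambda>z v. l z (i v))"
      using fam_comp[OF i perm_frameD(4)[OF assms(4)] ghom_id] .
    show "q (e (\<phi> g z)) = act V g (q (e z))" if "g \<in> carrier G" "z \<in> Z" for g z
      using perm_frameD(3)[OF assms(4) that] ghomD(2)[OF q that(1)] frameD(2)[OF perm_frameD(2)[OF assms(4)] that(2)] by simp
  qed (rule perm_frameD(1)[OF assms(4)])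
qed

text \<open>Both sides are the trace of the square matrix obtained by expanding \<open>A\<close> and \<open>B\<close>.\<close>

lemma trace_commute:
  assumes M: "mdl M" and N: "mdl N" and F: "frame M I e l" and F': "frame N J e' l'"
    and A: "lin M N A" and B: "lin N M B"
  shows "(\<Sum>i\<in>I. l i (B (A (e i)))) = (\<Sum>j\<in>J. l' j (A (B (e' j))))"
proof -
  have "(\<Sum>i\<in>I. l i (B (A (e i)))) = (\<Sum>i\<in>I. \<Sum>j\<in>J. l' j (A (e i)) * l i (B (e' j)))"
    using linK_expand[OF N F' lin_comp[OF B frameD(3)[OF F]] lin_in[OF A frameD(2)[OF F]]]
    by (intro sum.cong) simp_all
  also have "\<dots> = (\<Sum>j\<in>J. \<Sum>i\<in>I. l i (B (e' j)) * l' j (A (e i)))"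
    by (subst sum.swap) (simp add: mult.commute)
  also have "\<dots> = (\<Sum>j\<in>J. l' j (A (B (e' j))))"
    using linK_expand[OF M F lin_comp[OF A frameD(3)[OF F']] lin_in[OF B frameD(2)[OF F']]]
    by (intro sum.cong) simp_all
  finally show ?thesis .
qed

text \<open>\<open>f (\<phi> g z)\<close> is the conjugate of \<open>f z\<close> under the action of
  \<open>g\<close>, and conjugate maps have equal trace.\<close>

lemma trace_fam:
  assumes M: "mdl M" and F: "frame M I e l" and f: "fam M M Z \<phi> f" and g: "g \<in> carrier G" and z: "z \<in> Z" and gz: "\<phi> g z \<in> Z"
  shows "(\<Sum>i\<in>I. l i (f (\<phi> g z) (e i))) = (\<Sum>i\<in>I. l i (f z (e i)))"
proof -
  have g': "inv g \<in> carrier G" using g by simp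
  have "(\<Sum>i\<in>I. l i (f (\<phi> g z) (e i))) = (\<Sum>i\<in>I. l i (act M g (f z (act M (inv g) (e i)))))"
    using famD(2)[OF f g z mdl_act[OF M g' frameD(2)[OF F]]] frameD(2)[OF F] by (simp add: mdl_act_inv'[OF M g])
  also have "\<dots> = (\<Sum>i\<in>I. l i (f z (act M (inv g) (act M g (e i)))))"
    by (rule trace_commute[OF M M F F lin_comp[OF mdl_act_lin[OF M g'] famD(1)[OF f z]] mdl_act_lin[OF M g]])
  also have "\<dots> = (\<Sum>i\<in>I. l i (f z (e i)))"
    using frameD(2)[OF F] by (simp add: mdl_act_inv[OF M g])
  finally show ?thesis .
qed

end

subsection \<open>Tensor products and duals\<close>

lemma bilinear_form_iff:
  "bilinear_form M N b \<longleftrightarrow> (\<forall>w\<in>vecs N. lin M kmod (\<lambda>v. b v w)) \<and> (\<forall>v\<in>vecs M. lin N kmod (\<lambda>w. b v w))"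
  by (auto simp: bilinear_form_def lin_def linear_map_on_def)

lemma tensor_scl: "scl (tensor_gmod M N) = (\<lambda>c t b. c * t b)"
  and tensor_act: "act (tensor_gmod M N) g t = (\<lambda>b. t (\<lambda>v w. b (act M g v) (act N g w)))"
  by (simp_all add: tensor_gmod_def)

lemma sum_fun_apply: "(\<Sum>i\<in>I. f i) b = (\<Sum>i\<in>I. f i b)"
  by (induction I rule: infinite_finite_induct) simp_all

context fgroup
begin

context
  fixes M :: "('a, 'k::field, 'v::ab_group_add) gmod" and N :: "('a, 'k, 'w::ab_group_add) gmod"
  assumes M: "mdl M" and N: "mdl N"
begin

text \<open>\<open>pure_tensor\<close> is 0 at functions that are not bilinear, so the action takes
  pure tensors to pure tensors only if translation by \<open>g\<close> preserves and reflects
  bilinearity.\<close>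

lemma bilinear_act:
  assumes g: "g \<in> carrier G"
  shows "bilinear_form M N (\<lambda>v w. b (act M g v) (act N g w)) \<longleftrightarrow> bilinear_form M N b"
proof -
  have *: "bilinear_form M N (\<lambda>v w. b (act M g v) (act N g w))" if b: "bilinear_form M N b" and g: "g \<in> carrier G" for b g
    unfolding bilinear_form_iff
  proof (intro conjI ballI)
    show "lin M kmod (\<lambda>v. b (act M g v) (act N g w))" if "w \<in> vecs N" for w
      using b mdl_act[OF N g that] lin_comp[OF mdl_act_lin[OF M g], of kmod "\<lambda>v. b v (act N g w)"] by (simp add: bilinear_form_iff)
    show "lin N kmod (\<lambda>w. b (act M g v) (act N g w))" if "v \<in> vecs M" for v
      using b mdl_act[OF M g that] lin_comp[OF mdl_act_lin[OF N g], of kmod "b (act M g v)"] by (simp add: bilinear_form_iff)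
  qed
  \<comment> \<open>Translating by \<open>g\<close> and back restores \<open>b\<close> on the two
    modules, but not necessarily elsewhere in the ambient types.\<close>
  have cong: "bilinear_form M N b \<longleftrightarrow> bilinear_form M N b'"
    if "\<And>v w. v \<in> vecs M \<Longrightarrow> w \<in> vecs N \<Longrightarrow> b v w = b' v w" for b b'
    using that by (auto simp: bilinear_form_def linear_map_on_def mdl_add[OF M] mdl_add[OF N] mdl_scl[OF M] mdl_scl[OF N])
  show ?thesis
    using *[OF _ g, of b] *[OF _ inv_closed[OF g], of "\<lambda>v w. b (act M g v) (act N g w)"]
      cong[of "\<lambda>v w. b (act M g (act M (inv g) v)) (act N g (act N (inv g) w))" b]
    by (auto simp: mdl_act_inv'[OF M g] mdl_act_inv'[OF N g])
qed

lemma tensor_act_pure: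
  "g \<in> carrier G \<Longrightarrow> act (tensor_gmod M N) g (pure_tensor M N v w) = pure_tensor M N (act M g v) (act N g w)"
  by (simp add: tensor_act pure_tensor_def fun_eq_iff bilinear_act)

lemma pure_lin1: "w \<in> vecs N \<Longrightarrow> lin M (tensor_gmod M N) (\<lambda>v. pure_tensor M N v w)"
  and pure_lin2: "v \<in> vecs M \<Longrightarrow> lin N (tensor_gmod M N) (\<lambda>w. pure_tensor M N v w)"
  and pure_in: "v \<in> vecs M \<Longrightarrow> w \<in> vecs N \<Longrightarrow> pure_tensor M N v w \<in> vecs (tensor_gmod M N)"
proof -
  interpret vector_space "\<lambda>(c::'k) (t :: ('v \<Rightarrow> 'w \<Rightarrow> 'k) \<Rightarrow> 'k) b. c * t b" by (rule vs_fun)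
  show *: "pure_tensor M N v w \<in> vecs (tensor_gmod M N)" if "v \<in> vecs M" "w \<in> vecs N" for v w
    using that by (auto simp: tensor_gmod_def intro!: span_base)
  show "lin M (tensor_gmod M N) (\<lambda>v. pure_tensor M N v w)" if w: "w \<in> vecs N"
  proof (rule linI)
    have l: "bilinear_form M N b \<Longrightarrow> lin M kmod (\<lambda>v. b v w)" for b using w by (simp add: bilinear_form_iff)
    show "pure_tensor M N (x + y) w = pure_tensor M N x w + pure_tensor M N y w" if "x \<in> vecs M" "y \<in> vecs M" for x y
      using lin_add[OF l that] by (auto simp: pure_tensor_def)
    show "pure_tensor M N (scl M c x) w = scl (tensor_gmod M N) c (pure_tensor M N x w)" if "x \<in> vecs M" for c x
      using lin_scl[OF l that] by (auto simp: pure_tensor_def tensor_scl)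
  qed (use * w in auto)
  show "lin N (tensor_gmod M N) (\<lambda>w. pure_tensor M N v w)" if v: "v \<in> vecs M"
  proof (rule linI)
    have l: "bilinear_form M N b \<Longrightarrow> lin N kmod (\<lambda>w. b v w)" for b using v by (simp add: bilinear_form_iff)
    show "pure_tensor M N v (x + y) = pure_tensor M N v x + pure_tensor M N v y" if "x \<in> vecs N" "y \<in> vecs N" for x y
      using lin_add[OF l that] by (auto simp: pure_tensor_def)
    show "pure_tensor M N v (scl N c x) = scl (tensor_gmod M N) c (pure_tensor M N v x)" if "x \<in> vecs N" for c x
      using lin_scl[OF l that] by (auto simp: pure_tensor_def tensor_scl)
  qed (use * v in auto)
qed

lemma tensor_span_induct [consumes 1, case_names zero step]:
  assumes t: "t \<in> vecs (tensor_gmod M N)" and z: "P 0"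
    and step: "\<And>c v w t. v \<in> vecs M \<Longrightarrow> w \<in> vecs N \<Longrightarrow> t \<in> vecs (tensor_gmod M N) \<Longrightarrow> P t \<Longrightarrow>
       P ((\<lambda>b. c * pure_tensor M N v w b) + t)"
  shows "P t"
proof -
  interpret vector_space "\<lambda>(c::'k) (t :: ('v \<Rightarrow> 'w \<Rightarrow> 'k) \<Rightarrow> 'k) b. c * t b" by (rule vs_fun)
  define X where "X = {pure_tensor M N v w | v w. v \<in> vecs M \<and> w \<in> vecs N}"
  have "t \<in> span X" using t by (simp add: tensor_gmod_def X_def)
  then have "t \<in> span X \<and> P t"
  proof (induction t rule: span_induct_alt)
    case base
    then show ?case using z span_zero[of X] by (simp add: zero_fun_def)
  next
    case (step c x y)
    then have *: "(\<lambda>b. c * x b) + y \<in> span X" using span_add[OF span_scale[OF span_base]] by blast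
    moreover have "P ((\<lambda>b. c * x b) + y)" using step assms(3)[of _ _ y c] by (auto simp: X_def tensor_gmod_def)
    ultimately show ?case by (rule conjI)
  qed
  then show ?thesis by simp
qed

text \<open>Tensors are functionals on bilinear forms, so the coordinate with index (i, j) is
  evaluation at the product of the forms \<open>l i\<close> and \<open>l' j\<close>.\<close>

definition tframe :: "('i \<Rightarrow> 'v \<Rightarrow> 'k) \<Rightarrow> ('j \<Rightarrow> 'w \<Rightarrow> 'k) \<Rightarrow> 'i \<times> 'j \<Rightarrow> (('v \<Rightarrow> 'w \<Rightarrow> 'k) \<Rightarrow> 'k) \<Rightarrow> 'k"
  where "tframe l l' = (\<lambda>(i, j) t. t (\<lambda>v w. l i v * l' j w))"

lemma tframe_pure:
  assumes "lin M kmod (l i)" "lin N kmod (l' j)" "v \<in> vecs M" "w \<in> vecs N"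
  shows "tframe l l' (i, j) (pure_tensor M N v w) = l i v * l' j w"
proof -
  have "bilinear_form M N (\<lambda>v w. l i v * l' j w)"
    unfolding bilinear_form_iff
    using linK_cmult[OF assms(1), of "l' j _"] linK_cmult[OF assms(2), of "l i _"] by (simp add: mult.commute)
  then show ?thesis by (simp add: tframe_def pure_tensor_def)
qed

lemma pure_expand:
  assumes F: "frame M I e l" and F': "frame N J e' l'" and v: "v \<in> vecs M" and w: "w \<in> vecs N"
  shows "pure_tensor M N v w = (\<Sum>ij\<in>I \<times> J. (\<lambda>b. (l (fst ij) v * l' (snd ij) w) * pure_tensor M N (e (fst ij)) (e' (snd ij)) b))"
proof
  fix b
  show "pure_tensor M N v w b = (\<Sum>ij\<in>I \<times> J. (\<lambda>b. (l (fst ij) v * l' (snd ij) w) * pure_tensor M N (e (fst ij)) (e' (snd ij)) b)) b"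
  proof (cases "bilinear_form M N b")
    case True
    then have l1: "\<And>w. w \<in> vecs N \<Longrightarrow> lin M kmod (\<lambda>v. b v w)" and l2: "\<And>v. v \<in> vecs M \<Longrightarrow> lin N kmod (\<lambda>w. b v w)"
      by (auto simp: bilinear_form_iff)
    have "b v w = (\<Sum>i\<in>I. l i v * b (e i) w)" by (rule linK_expand[OF M F l1[OF w] v])
    also have "\<dots> = (\<Sum>i\<in>I. l i v * (\<Sum>j\<in>J. l' j w * b (e i) (e' j)))"
      using linK_expand[OF N F' l2[OF frameD(2)[OF F]] w] by simp
    also have "\<dots> = (\<Sum>ij\<in>I \<times> J. (l (fst ij) v * l' (snd ij) w) * b (e (fst ij)) (e' (snd ij)))"
      by (simp add: sum_distrib_left sum.cartesian_product split_def mult.assoc)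
    finally show ?thesis using True by (simp add: pure_tensor_def sum_fun_apply)
  qed (simp add: pure_tensor_def sum_fun_apply)
qed

lemma tensor_frame:
  assumes F: "frame M I e l" and F': "frame N J e' l'"
  shows "frame (tensor_gmod M N) (I \<times> J) (\<lambda>(i, j). pure_tensor M N (e i) (e' j)) (tframe l l')"
  unfolding frame_def
proof (intro conjI ballI)
  show "finite (I \<times> J)" using frameD(1)[OF F] frameD(1)[OF F'] by simp
  show "(case ij of (i, j) \<Rightarrow> pure_tensor M N (e i) (e' j)) \<in> vecs (tensor_gmod M N)" if "ij \<in> I \<times> J" for ij
    using that pure_in frameD(2)[OF F] frameD(2)[OF F'] by auto
  show "lin (tensor_gmod M N) kmod (tframe l l' ij)" for ij
    by (rule linI) (auto simp: tframe_def tensor_scl split: prod.splits)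
  fix t assume t: "t \<in> vecs (tensor_gmod M N)"
  then have "t = (\<Sum>ij\<in>I \<times> J. (\<lambda>b. tframe l l' ij t * pure_tensor M N (e (fst ij)) (e' (snd ij)) b))"
  proof (induction t rule: tensor_span_induct)
    case zero
    then show ?case by (auto simp: tframe_def split_def sum_fun_apply fun_eq_iff)
  next
    case (step c v w t)
    have *: "tframe l l' ij ((\<lambda>b. c * pure_tensor M N v w b) + t) = c * (l (fst ij) v * l' (snd ij) w) + tframe l l' ij t"
      if "ij \<in> I \<times> J" for ij
    proof -
      have "tframe l l' ij ((\<lambda>b. c * pure_tensor M N v w b) + t) = c * tframe l l' (fst ij, snd ij) (pure_tensor M N v w) + tframe l l' ij t"
        by (simp add: tframe_def split_def)
      then show ?thesis
        using tframe_pure[where l = l and l' = l' and i = "fst ij" and j = "snd ij", OF frameD(3)[OF F] frameD(3)[OF F'] step(1,2)] that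
        by (simp add: mem_Times_iff)
    qed
    have "(\<lambda>b. c * pure_tensor M N v w b) + t = (\<lambda>b. (\<Sum>ij\<in>I \<times> J. c * ((l (fst ij) v * l' (snd ij) w) * pure_tensor M N (e (fst ij)) (e' (snd ij)) b))
       + (\<Sum>ij\<in>I \<times> J. tframe l l' ij t * pure_tensor M N (e (fst ij)) (e' (snd ij)) b))"
    proof
      fix b
      have "t b = (\<Sum>ij\<in>I \<times> J. tframe l l' ij t * pure_tensor M N (e (fst ij)) (e' (snd ij)) b)"
        using fun_cong[OF step(4), of b] by (simp only: sum_fun_apply)
      moreover have "pure_tensor M N v w b = (\<Sum>ij\<in>I \<times> J. ((l (fst ij) v * l' (snd ij) w) * pure_tensor M N (e (fst ij)) (e' (snd ij)) b))"
        using fun_cong[OF pure_expand[OF F F' step(1,2)], of b] by (simp only: sum_fun_apply)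
      ultimately show "((\<lambda>b. c * pure_tensor M N v w b) + t) b = (\<Sum>ij\<in>I \<times> J. c * ((l (fst ij) v * l' (snd ij) w) * pure_tensor M N (e (fst ij)) (e' (snd ij)) b))
       + (\<Sum>ij\<in>I \<times> J. tframe l l' ij t * pure_tensor M N (e (fst ij)) (e' (snd ij)) b)"
        by (simp only: plus_fun_apply sum_distrib_left)
    qed
    also have "\<dots> = (\<lambda>b. (\<Sum>ij\<in>I \<times> J. tframe l l' ij ((\<lambda>b. c * pure_tensor M N v w b) + t) * pure_tensor M N (e (fst ij)) (e' (snd ij)) b))"
      by (simp add: * sum.distrib[symmetric] distrib_right mult.assoc)
    finally show ?case by (rule trans) (rule ext, simp only: sum_fun_apply)
  qed
  then show "t = (\<Sum>ij\<in>I \<times> J. scl (tensor_gmod M N) (tframe l l' ij t) (case ij of (i, j) \<Rightarrow> pure_tensor M N (e i) (e' j)))"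
    by (simp add: tensor_scl split_def)
qed

lemma mdl_tensor: "mdl (tensor_gmod M N)"
proof -
  obtain I :: "nat set" and e l where F: "frame M I e l" using ex_frame[OF M] by blast
  obtain J :: "nat set" and e' l' where F': "frame N J e' l'" using ex_frame[OF N] by blast
  interpret vector_space "\<lambda>(c::'k) (t :: ('v \<Rightarrow> 'w \<Rightarrow> 'k) \<Rightarrow> 'k) b. c * t b" by (rule vs_fun)
  have add: "x + y \<in> vecs (tensor_gmod M N)" if "x \<in> vecs (tensor_gmod M N)" "y \<in> vecs (tensor_gmod M N)" for x y
    using that span_add by (simp add: tensor_gmod_def)
  have scl: "(\<lambda>b. c * x b) \<in> vecs (tensor_gmod M N)" if "x \<in> vecs (tensor_gmod M N)" for c x
    using span_scale[of x] that by (simp add: tensor_gmod_def)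
  have z: "0 \<in> vecs (tensor_gmod M N)" using span_zero by (simp add: tensor_gmod_def)
  have act_add: "act (tensor_gmod M N) g ((\<lambda>b. c * x b) + y) = (\<lambda>b. c * act (tensor_gmod M N) g x b) + act (tensor_gmod M N) g y" for g c x y
    by (auto simp: tensor_act)
  have act0: "act (tensor_gmod M N) g 0 = 0" for g by (auto simp: tensor_act)
  show ?thesis
  proof (rule mdlI_frame[OF _ z add _ _ _ _ tensor_frame[OF F F']])
    show "vector_space (scl (tensor_gmod M N))" unfolding tensor_scl by (rule vs_fun)
    show "scl (tensor_gmod M N) c x \<in> vecs (tensor_gmod M N)" if "x \<in> vecs (tensor_gmod M N)" for c x
      using scl[OF that] by (simp add: tensor_scl)
    show "lin (tensor_gmod M N) (tensor_gmod M N) (act (tensor_gmod M N) g)" if g: "g \<in> carrier G" for g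
    proof (rule linI)
      show "act (tensor_gmod M N) g x \<in> vecs (tensor_gmod M N)" if "x \<in> vecs (tensor_gmod M N)" for x
        using that
      proof (induction x rule: tensor_span_induct)
        case zero
        show ?case unfolding act0 by (rule z)
      next
        case (step c v w t)
        then show ?case unfolding act_add tensor_act_pure[OF g]
          by (intro add scl pure_in mdl_act[OF M g] mdl_act[OF N g])
      qed
    qed (auto simp: tensor_act tensor_scl)
    show "act (tensor_gmod M N) \<one> t = t" if "t \<in> vecs (tensor_gmod M N)" for t
      using that
    proof (induction t rule: tensor_span_induct)
      case (step c v w t)
      then show ?case unfolding act_add tensor_act_pure[OF one_closed] by (simp only: mdl_act_one[OF M] mdl_act_one[OF N])
    qed (rule act0)
    show "act (tensor_gmod M N) (g \<otimes> h) t = act (tensor_gmod M N) g (act (tensor_gmod M N) h t)"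
      if g: "g \<in> carrier G" and h: "h \<in> carrier G" and t: "t \<in> vecs (tensor_gmod M N)" for g h t
      using t
    proof (induction t rule: tensor_span_induct)
      case (step c v w t)
      then show ?case unfolding act_add tensor_act_pure[OF g] tensor_act_pure[OF h] tensor_act_pure[OF m_closed[OF g h]]
        by (simp only: mdl_act_mult[OF M g h] mdl_act_mult[OF N g h])
    qed (simp only: act0)
  qed
qed

lemma tensor_lin_eq:
  fixes L :: "('a, 'k, 'u::ab_group_add) gmod"
  assumes L: "mdl L" and f: "lin (tensor_gmod M N) L f" and h: "lin (tensor_gmod M N) L h"
    and eq: "\<And>v w. v \<in> vecs M \<Longrightarrow> w \<in> vecs N \<Longrightarrow> f (pure_tensor M N v w) = h (pure_tensor M N v w)"
    and t: "t \<in> vecs (tensor_gmod M N)"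
  shows "f t = h t"
proof -
  obtain I :: "nat set" and e l where F: "frame M I e l" using ex_frame[OF M] by blast
  obtain J :: "nat set" and e' l' where F': "frame N J e' l'" using ex_frame[OF N] by blast
  show ?thesis
    unfolding lin_expand[OF mdl_tensor L tensor_frame[OF F F'] f t] lin_expand[OF mdl_tensor L tensor_frame[OF F F'] h t]
    using eq[OF frameD(2)[OF F] frameD(2)[OF F']] by (intro sum.cong) auto
qed

end

text \<open>\<open>T\<close> is prescribed through frame coordinates. As the frame vectors may be
  dependent, its value at an arbitrary pure tensor has to be checked, by expanding both
  arguments.\<close>

lemma ex_tensor_map:
  fixes M :: "('a, 'k::field, 'v::ab_group_add) gmod" and N :: "('a, 'k, 'w::ab_group_add) gmod"
    and M' :: "('a, 'k, 'v1::ab_group_add) gmod" and N' :: "('a, 'k, 'w1::ab_group_add) gmod"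
  assumes m: "mdl M" "mdl N" "mdl M'" "mdl N'" and f: "lin M M' f" and h: "lin N N' h"
  shows "\<exists>T. lin (tensor_gmod M N) (tensor_gmod M' N') T \<and>
    (\<forall>v\<in>vecs M. \<forall>w\<in>vecs N. T (pure_tensor M N v w) = pure_tensor M' N' (f v) (h w))"
proof -
  obtain I :: "nat set" and e l where F: "frame M I e l" using ex_frame[OF m(1)] by blast
  obtain J :: "nat set" and e' l' where F': "frame N J e' l'" using ex_frame[OF m(2)] by blast
  note tm = mdl_tensor[OF m(3,4)] and tf = tensor_frame[OF m(1,2) F F']
  define T where "T = (\<lambda>t. \<Sum>ij\<in>I \<times> J. scl (tensor_gmod M' N') (tframe l l' ij t) (pure_tensor M' N' (f (e (fst ij))) (h (e' (snd ij)))))"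
  have "lin (tensor_gmod M N) (tensor_gmod M' N') T" unfolding T_def
    by (intro lin_sumf[OF tm] lin_fscl[OF tm] frameD(3)[OF tf] pure_in[OF m(3,4)])
      (auto intro!: lin_in[OF f] lin_in[OF h] frameD(2)[OF F] frameD(2)[OF F'])
  moreover have "T (pure_tensor M N v w) = pure_tensor M' N' (f v) (h w)" if v: "v \<in> vecs M" and w: "w \<in> vecs N" for v w
  proof -
    have 1: "lin M (tensor_gmod M' N') (\<lambda>v. pure_tensor M' N' (f v) (h w))"
      using lin_comp[OF f pure_lin1[OF m(3,4) lin_in[OF h w]]] .
    have 2: "lin N (tensor_gmod M' N') (\<lambda>w. pure_tensor M' N' (f (e i)) (h w))" if "i \<in> I" for i
      using lin_comp[OF h pure_lin2[OF m(3,4) lin_in[OF f frameD(2)[OF F that]]]] .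
    have "pure_tensor M' N' (f v) (h w) = (\<Sum>i\<in>I. scl (tensor_gmod M' N') (l i v) (pure_tensor M' N' (f (e i)) (h w)))"
      by (rule lin_expand[OF m(1) tm F 1 v])
    also have "\<dots> = (\<Sum>i\<in>I. scl (tensor_gmod M' N') (l i v) (\<Sum>j\<in>J. scl (tensor_gmod M' N') (l' j w) (pure_tensor M' N' (f (e i)) (h (e' j)))))"
      using lin_expand[OF m(2) tm F' 2 w] by (intro sum.cong) simp_all
    also have "\<dots> = (\<Sum>ij\<in>I \<times> J. scl (tensor_gmod M' N') (l (fst ij) v * l' (snd ij) w) (pure_tensor M' N' (f (e (fst ij))) (h (e' (snd ij)))))"
      by (simp add: scl_sum[OF tm] scl_scl[OF tm] sum.cartesian_product split_def)
    also have "\<dots> = T (pure_tensor M N v w)" unfolding T_def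
    proof (rule sum.cong[OF refl])
      fix ij assume ij: "ij \<in> I \<times> J"
      have "tframe l l' (fst ij, snd ij) (pure_tensor M N v w) = l (fst ij) v * l' (snd ij) w"
        using ij by (intro tframe_pure[OF m(1,2) _ _ v w] frameD(3)[OF F] frameD(3)[OF F']) auto
      then show "scl (tensor_gmod M' N') (l (fst ij) v * l' (snd ij) w) (pure_tensor M' N' (f (e (fst ij))) (h (e' (snd ij)))) =
        scl (tensor_gmod M' N') (tframe l l' ij (pure_tensor M N v w)) (pure_tensor M' N' (f (e (fst ij))) (h (e' (snd ij))))" by simp
    qed
    finally show ?thesis by simp
  qed
  ultimately show ?thesis by blast
qed

text \<open>The choice is harmless: on the tensor product, a linear map is determined by its values
  at pure tensors (\<open>tensor_lin_eq\<close>).\<close>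

definition tmap :: "('a, 'k::field, 'v::ab_group_add) gmod \<Rightarrow> ('a, 'k, 'w::ab_group_add) gmod \<Rightarrow>
    ('a, 'k, 'v1::ab_group_add) gmod \<Rightarrow> ('a, 'k, 'w1::ab_group_add) gmod \<Rightarrow> ('v \<Rightarrow> 'v1) \<Rightarrow> ('w \<Rightarrow> 'w1) \<Rightarrow>
    (('v \<Rightarrow> 'w \<Rightarrow> 'k) \<Rightarrow> 'k) \<Rightarrow> (('v1 \<Rightarrow> 'w1 \<Rightarrow> 'k) \<Rightarrow> 'k)"
  where "tmap M N M' N' f h = (SOME T. lin (tensor_gmod M N) (tensor_gmod M' N') T \<and>
    (\<forall>v\<in>vecs M. \<forall>w\<in>vecs N. T (pure_tensor M N v w) = pure_tensor M' N' (f v) (h w)))"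

context
  fixes M :: "('a, 'k::field, 'v::ab_group_add) gmod" and N :: "('a, 'k, 'w::ab_group_add) gmod"
    and M' :: "('a, 'k, 'v1::ab_group_add) gmod" and N' :: "('a, 'k, 'w1::ab_group_add) gmod"
  assumes m: "mdl M" "mdl N" "mdl M'" "mdl N'"
begin

lemma tmap_lin: "lin M M' f \<Longrightarrow> lin N N' h \<Longrightarrow> lin (tensor_gmod M N) (tensor_gmod M' N') (tmap M N M' N' f h)"
  and tmap_pure: "lin M M' f \<Longrightarrow> lin N N' h \<Longrightarrow> v \<in> vecs M \<Longrightarrow> w \<in> vecs N \<Longrightarrow>
    tmap M N M' N' f h (pure_tensor M N v w) = pure_tensor M' N' (f v) (h w)"
  using someI_ex[OF ex_tensor_map[OF m]] unfolding tmap_def by blast+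

lemma tmap_fam:
  assumes f: "fam M M' Z \<phi> f" and h: "fam N N' Y \<psi> h" and Z: "gset Z \<phi>" and Y: "gset Y \<psi>"
  shows "fam (tensor_gmod M N) (tensor_gmod M' N') (Z \<times> Y) (\<lambda>g. map_prod (\<phi> g) (\<psi> g)) (\<lambda>(z, y). tmap M N M' N' (f z) (h y))"
proof (rule famI)
  note tm = mdl_tensor[OF m(1,2)] mdl_tensor[OF m(3,4)]
  show "lin (tensor_gmod M N) (tensor_gmod M' N') (case zy of (z, y) \<Rightarrow> tmap M N M' N' (f z) (h y))" if "zy \<in> Z \<times> Y" for zy
    using that tmap_lin famD(1)[OF f] famD(1)[OF h] by auto
  show "(case map_prod (\<phi> g) (\<psi> g) zy of (z, y) \<Rightarrow> tmap M N M' N' (f z) (h y)) (act (tensor_gmod M N) g t) =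
      act (tensor_gmod M' N') g ((case zy of (z, y) \<Rightarrow> tmap M N M' N' (f z) (h y)) t)"
    if g: "g \<in> carrier G" and zy: "zy \<in> Z \<times> Y" and t: "t \<in> vecs (tensor_gmod M N)" for g zy t
  proof -
    obtain z y where [simp]: "zy = (z, y)" and z: "z \<in> Z" and y: "y \<in> Y" using zy by auto
    note z' = gsetD(2)[OF Z g z] and y' = gsetD(2)[OF Y g y]
    have "tmap M N M' N' (f (\<phi> g z)) (h (\<psi> g y)) (act (tensor_gmod M N) g t) = act (tensor_gmod M' N') g (tmap M N M' N' (f z) (h y) t)"
    proof (rule tensor_lin_eq[OF m(1,2) tm(2) _ _ _ t])
      show "lin (tensor_gmod M N) (tensor_gmod M' N') (\<lambda>t. tmap M N M' N' (f (\<phi> g z)) (h (\<psi> g y)) (act (tensor_gmod M N) g t))"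
        by (rule lin_comp[OF mdl_act_lin[OF tm(1) g] tmap_lin[OF famD(1)[OF f z'] famD(1)[OF h y']]])
      show "lin (tensor_gmod M N) (tensor_gmod M' N') (\<lambda>t. act (tensor_gmod M' N') g (tmap M N M' N' (f z) (h y) t))"
        by (rule lin_comp[OF tmap_lin[OF famD(1)[OF f z] famD(1)[OF h y]] mdl_act_lin[OF tm(2) g]])
      show "tmap M N M' N' (f (\<phi> g z)) (h (\<psi> g y)) (act (tensor_gmod M N) g (pure_tensor M N v w)) =
         act (tensor_gmod M' N') g (tmap M N M' N' (f z) (h y) (pure_tensor M N v w))" if v: "v \<in> vecs M" and w: "w \<in> vecs N" for v w
        using mdl_act[OF m(1) g v] mdl_act[OF m(2) g w]
        by (simp add: tensor_act_pure[OF m(1,2) g] tensor_act_pure[OF m(3,4) g] v w tmap_pure[OF famD(1)[OF f z] famD(1)[OF h y]]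
            tmap_pure[OF famD(1)[OF f z'] famD(1)[OF h y']] famD(2)[OF f g z] famD(2)[OF h g y])
    qed
    then show ?thesis by simp
  qed
qed

end

text \<open>The trace of the tensor product of \<open>c\<close> and \<open>c'\<close> is the product
  of their traces.\<close>

lemma traced_tensor:
  fixes M :: "('a, 'k::field, 'v::ab_group_add) gmod" and N :: "('a, 'k, 'w::ab_group_add) gmod"
  assumes m: "mdl M" "mdl N" and F: "frame M I e l" "ghom M M c" "(\<Sum>i\<in>I. l i (c (e i))) \<noteq> 0"
     and F': "frame N J e' l'" "ghom N N c'" "(\<Sum>j\<in>J. l' j (c' (e' j))) \<noteq> 0"
  shows "\<exists>T. ghom (tensor_gmod M N) (tensor_gmod M N) T \<and>
     (\<Sum>ij\<in>I \<times> J. tframe l l' ij (T (case ij of (i, j) \<Rightarrow> pure_tensor M N (e i) (e' j)))) \<noteq> 0"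
proof (intro exI conjI)
  let ?T = "tmap M N M N c c'"
  note c = ghomD[OF F(2)] and c' = ghomD[OF F'(2)]
  have f: "fam M M {()} (\<lambda>g z. z) (\<lambda>_. c)" "fam N N {()} (\<lambda>g z. z) (\<lambda>_. c')"
    using c c' by (auto intro!: famI)
  show "ghom (tensor_gmod M N) (tensor_gmod M N) ?T"
    using famD(1)[OF tmap_fam[OF m m f gset_point gset_point], of "((), ())"]
      famD(2)[OF tmap_fam[OF m m f gset_point gset_point], of _ "((), ())"] by (auto simp: ghom_def)
  have "(\<Sum>ij\<in>I \<times> J. tframe l l' ij (?T (case ij of (i, j) \<Rightarrow> pure_tensor M N (e i) (e' j)))) =
     (\<Sum>ij\<in>I \<times> J. l (fst ij) (c (e (fst ij))) * l' (snd ij) (c' (e' (snd ij))))"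
  proof (rule sum.cong[OF refl])
    fix ij assume "ij \<in> I \<times> J"
    then obtain i j where ij: "ij = (i, j)" "i \<in> I" "j \<in> J" by auto
    have "?T (pure_tensor M N (e i) (e' j)) = pure_tensor M N (c (e i)) (c' (e' j))"
      using tmap_pure[OF m m c(1) c'(1)] frameD(2)[OF F(1) ij(2)] frameD(2)[OF F'(1) ij(3)] by blast
    then show "tframe l l' ij (?T (case ij of (i, j) \<Rightarrow> pure_tensor M N (e i) (e' j))) = l (fst ij) (c (e (fst ij))) * l' (snd ij) (c' (e' (snd ij)))"
      using tframe_pure[where l = l and l' = l' and i = i and j = j, OF m frameD(3)[OF F(1) ij(2)] frameD(3)[OF F'(1) ij(3)]] lin_in[OF c(1) frameD(2)[OF F(1) ij(2)]] lin_in[OF c'(1) frameD(2)[OF F'(1) ij(3)]] ij(1)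
      by simp
  qed
  also have "\<dots> = (\<Sum>i\<in>I. l i (c (e i))) * (\<Sum>j\<in>J. l' j (c' (e' j)))"
    by (simp add: sum_product sum.cartesian_product split_def)
  finally show "(\<Sum>ij\<in>I \<times> J. tframe l l' ij (?T (case ij of (i, j) \<Rightarrow> pure_tensor M N (e i) (e' j)))) \<noteq> 0"
    using F(3) F'(3) by simp
qed

text \<open>The matrix of \<open>g\<close> on a tensor product is a Kronecker product; this is the
  input for \<open>ginv_frames\<close> in the isomorphisms that follow.\<close>

lemma tensor_matrix:
  fixes M :: "('a, 'k::field, 'v::ab_group_add) gmod" and N :: "('a, 'k, 'w::ab_group_add) gmod"
  assumes m: "mdl M" "mdl N" and F: "frame M I e l" and F': "frame N J e' l'"
    and g: "g \<in> carrier G" and ij: "i \<in> I" "j \<in> J" "i' \<in> I" "j' \<in> J"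
  shows "tframe l l' (i, j) (act (tensor_gmod M N) g (pure_tensor M N (e i') (e' j'))) = l i (act M g (e i')) * l' j (act N g (e' j'))"
  using tframe_pure[where l = l and l' = l' and i = i and j = j, OF m frameD(3)[OF F ij(1)] frameD(3)[OF F' ij(2)] mdl_act[OF m(1) g frameD(2)[OF F ij(3)]] mdl_act[OF m(2) g frameD(2)[OF F' ij(4)]]]
  by (simp add: tensor_act_pure[OF m g])

lemma tensor_assoc:
  fixes L :: "('a, 'k::field, 'u::ab_group_add) gmod" and M :: "('a, 'k, 'v::ab_group_add) gmod" and N :: "('a, 'k, 'w::ab_group_add) gmod"
  assumes m: "mdl L" "mdl M" "mdl N"
  shows "\<exists>f h. ginv (tensor_gmod (tensor_gmod L M) N) (tensor_gmod L (tensor_gmod M N)) f h"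
proof -
  obtain I :: "nat set" and e1 l1 where F1: "frame L I e1 l1" using ex_frame[OF m(1)] by blast
  obtain J :: "nat set" and e2 l2 where F2: "frame M J e2 l2" using ex_frame[OF m(2)] by blast
  obtain K :: "nat set" and e3 l3 where F3: "frame N K e3 l3" using ex_frame[OF m(3)] by blast
  note LM = tensor_frame[OF m(1,2) F1 F2] and MN = tensor_frame[OF m(2,3) F2 F3]
  note mLM = mdl_tensor[OF m(1,2)] and mMN = mdl_tensor[OF m(2,3)]
  define b where "b = (\<lambda>((i::nat, j::nat), k::nat). (i, (j, k)))"
  have b: "bij_betw b ((I \<times> J) \<times> K) (I \<times> (J \<times> K))"
    by (rule bij_betw_byWitness[where f' = "\<lambda>(i, (j, k)). ((i, j), k)"]) (auto simp: b_def)
  show ?thesis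
    by (rule ginv_frames[OF mdl_tensor[OF mLM m(3)] mdl_tensor[OF m(1) mMN] tensor_frame[OF mLM m(3) LM F3]
          frame_reindex[OF tensor_frame[OF m(1) mMN F1 MN] b]])
      (auto simp: b_def tensor_matrix[OF mLM m(3) LM F3, where i = "(_, _)" and i' = "(_, _)", simplified]
         tensor_matrix[OF m(1) mMN F1 MN, where j = "(_, _)" and j' = "(_, _)", simplified]
         tensor_matrix[OF m(1,2) F1 F2] tensor_matrix[OF m(2,3) F2 F3] mult.assoc)
qed

lemma tensor_comm:
  fixes M :: "('a, 'k::field, 'v::ab_group_add) gmod" and N :: "('a, 'k, 'w::ab_group_add) gmod"
  assumes m: "mdl M" "mdl N"
  shows "\<exists>f h. ginv (tensor_gmod M N) (tensor_gmod N M) f h"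
proof -
  obtain J :: "nat set" and e2 l2 where F2: "frame M J e2 l2" using ex_frame[OF m(1)] by blast
  obtain K :: "nat set" and e3 l3 where F3: "frame N K e3 l3" using ex_frame[OF m(2)] by blast
  have b: "bij_betw prod.swap (J \<times> K) (K \<times> J)"
    by (rule bij_betw_byWitness[where f' = prod.swap]) auto
  show ?thesis
    by (rule ginv_frames[OF mdl_tensor[OF m] mdl_tensor[OF m(2,1)] tensor_frame[OF m F2 F3]
          frame_reindex[OF tensor_frame[OF m(2,1) F3 F2] b]])
      (auto simp: tensor_matrix[OF m F2 F3] tensor_matrix[OF m(2,1) F3 F2])
qed

lemma trivial_gmod_simps: "vecs (trivial_gmod n) = {f. \<forall>i\<ge>n. f i = 0}" "scl (trivial_gmod n) = (\<lambda>c f i. c * f i)"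
   "act (trivial_gmod n) g f = f"
  by (simp_all add: trivial_gmod_def)

lemma trivial_frame: "frame (trivial_gmod n :: ('a, 'k::field) std_gmod) {..<n} (\<lambda>i j. if j = i then 1 else 0) (\<lambda>i f. f i)"
  by (auto simp: frame_def trivial_gmod_simps fun_eq_iff sum_fun_apply if_distrib cong: if_cong intro!: linI)

lemma mdl_trivial: "mdl (trivial_gmod n :: ('a, 'k::field) std_gmod)"
  by (rule mdlI_frame[OF _ _ _ _ _ _ _ trivial_frame]) (auto simp: trivial_gmod_simps vs_fun intro!: linI)

lemma tensor_unit:
  fixes M :: "('a, 'k::field, 'v::ab_group_add) gmod"
  assumes m: "mdl M"
  shows "\<exists>f h. ginv (tensor_gmod (trivial_gmod 1 :: ('a, 'k) std_gmod) M) M f h"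
proof -
  obtain J :: "nat set" and e l where F: "frame M J e l" using ex_frame[OF m] by blast
  have b: "bij_betw snd ({..<1::nat} \<times> J) J"
    by (rule bij_betw_byWitness[where f' = "\<lambda>j. (0, j)"]) auto
  show ?thesis
    by (rule ginv_frames[OF mdl_tensor[OF mdl_trivial m] m tensor_frame[OF mdl_trivial m trivial_frame F] frame_reindex[OF F b]])
      (auto simp: tensor_matrix[OF mdl_trivial m trivial_frame F] trivial_gmod_simps)
qed

lemma ginv_trivial_kmod: "\<exists>f h. ginv (trivial_gmod 1 :: ('a, 'k::field) std_gmod) kmod f h"
proof (rule exI[of _ "\<lambda>f. f 0"], rule exI[of _ "\<lambda>c i. if i = 0 then c else 0"])
  show "ginv (trivial_gmod 1 :: ('a, 'k::field) std_gmod) kmod (\<lambda>f. f 0) (\<lambda>c i. if i = 0 then c else 0)"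
    unfolding ginv_def ghom_def by (auto intro!: linI simp: trivial_gmod_simps fun_eq_iff)
qed

definition dual_gmod :: "('a, 'k::field, 'v::ab_group_add) gmod \<Rightarrow> ('a, 'k, 'v \<Rightarrow> 'k) gmod"
  where "dual_gmod M =
    \<lparr>vecs = {l. lin M kmod l \<and> (\<forall>v. v \<notin> vecs M \<longrightarrow> l v = 0)}, scl = (\<lambda>c l v. c * l v),
     act = (\<lambda>g l v. if v \<in> vecs M then l (act M (inv g) v) else 0)\<rparr>"

lemma dual_simps: "l \<in> vecs (dual_gmod M) \<longleftrightarrow> lin M kmod l \<and> (\<forall>v. v \<notin> vecs M \<longrightarrow> l v = 0)"
  "scl (dual_gmod M) = (\<lambda>c l v. c * l v)"
  "act (dual_gmod M) g l = (\<lambda>v. if v \<in> vecs M then l (act M (inv g) v) else 0)"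
  by (simp_all add: dual_gmod_def)

context
  fixes M :: "('a, 'k::field, 'v::ab_group_add) gmod"
  assumes M: "mdl M"
begin

lemma dual_I: "lin M kmod l \<Longrightarrow> (\<lambda>v. if v \<in> vecs M then l v else 0) \<in> vecs (dual_gmod M)"
  unfolding dual_simps by (auto intro!: linI simp: lin_add lin_scl mdl_add[OF M] mdl_scl[OF M])

lemma dual_frame:
  assumes F: "frame M I e l"
  shows "frame (dual_gmod M) I (\<lambda>i v. if v \<in> vecs M then l i v else 0) (\<lambda>i m. m (e i))"
  unfolding frame_def
proof (intro conjI ballI)
  show "m = (\<Sum>i\<in>I. scl (dual_gmod M) (m (e i)) (\<lambda>v. if v \<in> vecs M then l i v else 0))" if m: "m \<in> vecs (dual_gmod M)" for m
  proof
    fix v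
    show "m v = (\<Sum>i\<in>I. scl (dual_gmod M) (m (e i)) (\<lambda>v. if v \<in> vecs M then l i v else 0)) v"
    proof (cases "v \<in> vecs M")
      case True
      then show ?thesis using linK_expand[OF M F _ True, of m] m by (simp add: dual_simps sum_fun_apply mult.commute)
    qed (use m in \<open>simp add: dual_simps sum_fun_apply\<close>)
  qed
qed (use frameD(1)[OF F] dual_I[OF frameD(3)[OF F]] in \<open>auto intro!: linI simp: dual_simps(2)\<close>)

lemma mdl_dual: "mdl (dual_gmod M)"
proof -
  obtain I :: "nat set" and e l where F: "frame M I e l" using ex_frame[OF M] by blast
  show ?thesis
  proof (rule mdlI_frame[OF _ _ _ _ _ _ _ dual_frame[OF F]])
    show "vector_space (scl (dual_gmod M))" unfolding dual_simps by (rule vs_fun)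
    show "0 \<in> vecs (dual_gmod M)" using lin_zero[OF mdl_kmod] by (simp add: dual_simps zero_fun_def)
    show "x + y \<in> vecs (dual_gmod M)" if "x \<in> vecs (dual_gmod M)" "y \<in> vecs (dual_gmod M)" for x y
      using that lin_plus[OF mdl_kmod, of M x y] by (simp add: dual_simps plus_fun_def)
    show "scl (dual_gmod M) c x \<in> vecs (dual_gmod M)" if "x \<in> vecs (dual_gmod M)" for c x
      using that linK_cmult[of M x c] by (simp add: dual_simps)
    show "lin (dual_gmod M) (dual_gmod M) (act (dual_gmod M) g)" if g: "g \<in> carrier G" for g
    proof (rule linI)
      show "act (dual_gmod M) g x \<in> vecs (dual_gmod M)" if "x \<in> vecs (dual_gmod M)" for x
        using that dual_I[OF lin_comp[OF mdl_act_lin[OF M inv_closed[OF g]], of kmod x]] by (simp add: dual_simps)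
    qed (auto simp: dual_simps(2,3))
  qed (auto simp: dual_simps mdl_act_one[OF M] mdl_act_mult[OF M] mdl_act[OF M] inv_mult_group fun_eq_iff)
qed

text \<open>For one frame of \<open>M\<close>, the index (j, i) stands for the pure tensor of
  \<open>l j\<close> and \<open>e i\<close> on one side and for the rank-one map
  \<open>rk1 M (l j) (e i)\<close> on the other; the matrix entries agree.\<close>

lemma dual_tensor_End: "\<exists>f h. ginv (tensor_gmod (dual_gmod M) M) (End_gmod G M) f h"
proof -
  obtain I :: "nat set" and e l where F: "frame M I e l" using ex_frame[OF M] by blast
  have *: "(case (j, i) of (j, i) \<Rightarrow> \<lambda>t. l i (t (e j))) (act (End_gmod G M) g (case (j', i') of (j, i) \<Rightarrow> rk1 M (l j) (e i))) =
     l j' (act M (inv g) (e j)) * l i (act M g (e i'))" if "g \<in> carrier G" "i \<in> I" "j \<in> I" "i' \<in> I" "j' \<in> I" for g i j i' j'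
    using that frameD(2)[OF F] lin_scl[OF lin_comp[OF mdl_act_lin[OF M that(1)] frameD(3)[OF F that(2)]] frameD(2)[OF F that(4)]] mdl_act[OF M inv_closed[OF that(1)]]
    by (simp add: End_act rk1_def)
  show ?thesis
    by (rule ginv_frames[OF mdl_tensor[OF mdl_dual M] mdl_End[OF M] tensor_frame[OF mdl_dual M dual_frame[OF F] F] End_frame[OF M F]])
      (use * frameD(2)[OF F] mdl_act[OF M] in \<open>auto simp: tensor_matrix[OF mdl_dual M dual_frame[OF F] F] dual_simps(3)\<close>)
qed

end
end

section \<open>Linkedness of tensor products, duals and endomorphism modules\<close>

context sylow_context
begin

text \<open>Hom between the tensor products is the tensor product of the two Hom spaces, so products
  of the families work. The identity is verified for pure tensors, one factor at a time, and then
  extended linearly in \<open>t\<close> and in \<open>s\<close>.\<close>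

lemma linked_tensor:
  fixes M :: "('a, 'k::field, 'v::ab_group_add) gmod" and N :: "('a, 'k, 'w::ab_group_add) gmod"
    and M' :: "('a, 'k, 'v1::ab_group_add) gmod" and N' :: "('a, 'k, 'w1::ab_group_add) gmod"
  assumes m: "mdl M" "mdl N" "mdl M'" "mdl N'" and linked: "linked M M'" "linked N N'"
  shows "linked (tensor_gmod M N) (tensor_gmod M' N')"
proof -
  obtain Z :: "nat set" and \<phi> f h where D: "linking M M' Z \<phi> f h" using linkedE[OF linked(1)] by blast
  obtain Y :: "nat set" and \<psi> f' h' where D': "linking N N' Y \<psi> f' h'" using linkedE[OF linked(2)] by blast
  note gZ = good_gset[OF linkingD(1)[OF D]] and gY = good_gset[OF linkingD(1)[OF D']]
  note f = famD(1)[OF linkingD(2)[OF D]] and h = famD(1)[OF linkingD(3)[OF D]]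
    and f' = famD(1)[OF linkingD(2)[OF D']] and h' = famD(1)[OF linkingD(3)[OF D']]
  define F where "F = (\<lambda>(z, y). tmap M N M' N' (f z) (f' y))"
  define H where "H = (\<lambda>(z, y). tmap M' N' M N (h z) (h' y))"
  note tm = mdl_tensor[OF m(1,2)] mdl_tensor[OF m(3,4)]
  have Ff: "fam (tensor_gmod M N) (tensor_gmod M' N') (Z \<times> Y) (\<lambda>g. map_prod (\<phi> g) (\<psi> g)) F"
    unfolding F_def by (rule tmap_fam[OF m linkingD(2)[OF D] linkingD(2)[OF D'] gZ gY])
  have Hf: "fam (tensor_gmod M' N') (tensor_gmod M N) (Z \<times> Y) (\<lambda>g. map_prod (\<phi> g) (\<psi> g)) H"
    unfolding H_def by (rule tmap_fam[OF m(3,4,1,2) linkingD(3)[OF D] linkingD(3)[OF D'] gZ gY])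
  have "linking (tensor_gmod M N) (tensor_gmod M' N') (Z \<times> Y) (\<lambda>g. map_prod (\<phi> g) (\<psi> g)) F H"
    unfolding linking_def
  proof (intro conjI allI impI)
    show "good (Z \<times> Y) (\<lambda>g. map_prod (\<phi> g) (\<psi> g))" by (rule good_Times[OF linkingD(1)[OF D] linkingD(1)[OF D']])
    show "fam (tensor_gmod M N) (tensor_gmod M' N') (Z \<times> Y) (\<lambda>g. map_prod (\<phi> g) (\<psi> g)) F" by (rule Ff)
    show "fam (tensor_gmod M' N') (tensor_gmod M N) (Z \<times> Y) (\<lambda>g. map_prod (\<phi> g) (\<psi> g)) H" by (rule Hf)
    fix l t s assume l: "lin (tensor_gmod M N) kmod l" and t: "t \<in> vecs (tensor_gmod M N)" and s: "s \<in> vecs (tensor_gmod M' N')"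
    let ?p = "pure_tensor M N" and ?p' = "pure_tensor M' N'" and ?s = "scl (tensor_gmod M' N')"
    have pure: "(\<Sum>zy\<in>Z \<times> Y. ?s (l (H zy (?p' v' w'))) (F zy (?p v w))) = ?s (l (?p v w)) (?p' v' w')"
      if v: "v \<in> vecs M" and w: "w \<in> vecs N" and v': "v' \<in> vecs M'" and w': "w' \<in> vecs N'" for v w v' w'
    proof -
      have l1: "lin M kmod (\<lambda>x. l (?p x (h' y w')))" if "y \<in> Y" for y
        by (rule lin_comp[OF pure_lin1[OF m(1,2) lin_in[OF h'[OF that] w']] l])
      have l2: "lin N kmod (\<lambda>x. l (?p v x))"
        by (rule lin_comp[OF pure_lin2[OF m(1,2) v] l])
      have "(\<Sum>zy\<in>Z \<times> Y. ?s (l (H zy (?p' v' w'))) (F zy (?p v w))) =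
        (\<Sum>zy\<in>Z \<times> Y. ?s (l (?p (h (fst zy) v') (h' (snd zy) w'))) (?p' (f (fst zy) v) (f' (snd zy) w)))"
        using tmap_pure[OF m f f' v w] tmap_pure[OF m(3,4,1,2) h h' v' w'] by (intro sum.cong) (auto simp: F_def H_def)
      also have "\<dots> = (\<Sum>y\<in>Y. \<Sum>z\<in>Z. ?s (l (?p (h z v') (h' y w'))) (?p' (f z v) (f' y w)))"
        by (subst sum.swap) (simp add: sum.cartesian_product split_def)
      also have "\<dots> = (\<Sum>y\<in>Y. ?s (l (?p v (h' y w'))) (?p' v' (f' y w)))"
      proof (rule sum.cong[OF refl])
        fix y assume y: "y \<in> Y"
        note q = pure_lin1[OF m(3,4) lin_in[OF f'[OF y] w]]
        have "(\<Sum>z\<in>Z. ?s (l (?p (h z v') (h' y w'))) (?p' (f z v) (f' y w))) =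
          ?p' (\<Sum>z\<in>Z. scl M' (l (?p (h z v') (h' y w'))) (f z v)) (f' y w)"
          using lin_lincomb[OF m(3) tm(2) q, of Z "\<lambda>z. f z v"] lin_in[OF f v] by simp
        also have "\<dots> = ?p' (scl M' (l (?p v (h' y w'))) v') (f' y w)"
          using linkingD(4)[OF D l1[OF y] v v'] by simp
        also have "\<dots> = ?s (l (?p v (h' y w'))) (?p' v' (f' y w))"
          using lin_scl[OF q v'] by simp
        finally show "(\<Sum>z\<in>Z. ?s (l (?p (h z v') (h' y w'))) (?p' (f z v) (f' y w))) = ?s (l (?p v (h' y w'))) (?p' v' (f' y w))" .
      qed
      also have "\<dots> = ?p' v' (\<Sum>y\<in>Y. scl N' (l (?p v (h' y w'))) (f' y w))"
        using lin_lincomb[OF m(4) tm(2) pure_lin2[OF m(3,4) v'], of Y "\<lambda>y. f' y w"] lin_in[OF f' w] by simp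
      also have "\<dots> = ?p' v' (scl N' (l (?p v w)) w')"
        using linkingD(4)[OF D' l2 w w'] by simp
      also have "\<dots> = ?s (l (?p v w)) (?p' v' w')"
        by (rule lin_scl[OF pure_lin2[OF m(3,4) v'] w'])
      finally show ?thesis .
    qed
    have step: "(\<Sum>zy\<in>Z \<times> Y. ?s (l (H zy (?p' v' w'))) (F zy t)) = ?s (l t) (?p' v' w')"
      if v': "v' \<in> vecs M'" and w': "w' \<in> vecs N'" for v' w'
    proof (rule tensor_lin_eq[OF m(1,2) tm(2) _ _ _ t])
      show "lin (tensor_gmod M N) (tensor_gmod M' N') (\<lambda>t. \<Sum>zy\<in>Z \<times> Y. ?s (l (H zy (?p' v' w'))) (F zy t))"
        by (intro lin_sumf[OF tm(2)] lin_smult[OF tm(2)] famD(1)[OF Ff])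
      show "lin (tensor_gmod M N) (tensor_gmod M' N') (\<lambda>t. ?s (l t) (?p' v' w'))"
        by (intro lin_fscl[OF tm(2) l] pure_in[OF m(3,4)] v' w')
    qed (rule pure[OF _ _ v' w'])
    show "(\<Sum>zy\<in>Z \<times> Y. ?s (l (H zy s)) (F zy t)) = ?s (l t) s"
    proof (rule tensor_lin_eq[OF m(3,4) tm(2) _ _ _ s])
      show "lin (tensor_gmod M' N') (tensor_gmod M' N') (\<lambda>s. \<Sum>zy\<in>Z \<times> Y. ?s (l (H zy s)) (F zy t))"
        by (intro lin_sumf[OF tm(2)] lin_fscl[OF tm(2)] lin_comp[OF famD(1)[OF Hf] l] lin_in[OF famD(1)[OF Ff] t])
      show "lin (tensor_gmod M' N') (tensor_gmod M' N') (?s (l t))"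
        by (rule lin_smult[OF tm(2) lin_id])
    qed (rule step)
  qed
  then show ?thesis by (rule linkedI)
qed

lemma traced_tensor_gmod:
  assumes m: "mdl M" "mdl N" and t: "traced M" "traced N" shows "traced (tensor_gmod M N)"
proof -
  obtain I :: "nat set" and e l c where F: "frame M I e l" "ghom M M c" "(\<Sum>i\<in>I. l i (c (e i))) \<noteq> 0"
    using t(1) unfolding traced_def by blast
  obtain J :: "nat set" and e' l' c' where F': "frame N J e' l'" "ghom N N c'" "(\<Sum>i\<in>J. l' i (c' (e' i))) \<noteq> 0"
    using t(2) unfolding traced_def by blast
  show ?thesis using traced_tensor[OF m F F'] tracedI[OF tensor_frame[OF m F(1) F'(1)]] by blast
qed

text \<open>The transpose of an endomorphism has the same trace.\<close>

lemma traced_dual: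
  fixes M :: "('a, 'k::field, 'v::ab_group_add) gmod"
  assumes M: "mdl M" and t: "traced M" shows "traced (dual_gmod M)"
proof -
  obtain I :: "nat set" and e l c where F: "frame M I e l" "ghom M M c" "(\<Sum>i\<in>I. l i (c (e i))) \<noteq> 0"
    using t unfolding traced_def by blast
  define c' where "c' = (\<lambda>(m :: 'v \<Rightarrow> 'k) v. if v \<in> vecs M then m (c v) else 0)"
  note c = ghomD[OF F(2)]
  have "lin (dual_gmod M) (dual_gmod M) c'"
  proof (rule linI)
    show "c' x \<in> vecs (dual_gmod M)" if "x \<in> vecs (dual_gmod M)" for x
      unfolding c'_def using that by (intro dual_I[OF M] lin_comp[OF c(1)]) (simp add: dual_simps)
  qed (auto simp: c'_def dual_simps(2))
  then have A: "ghom (dual_gmod M) (dual_gmod M) c'"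
    using lin_in[OF c(1)] by (auto simp: ghom_def c'_def dual_simps fun_eq_iff mdl_act[OF M] c(2))
  have eq: "(\<Sum>i\<in>I. c' (\<lambda>v. if v \<in> vecs M then l i v else 0) (e i)) = (\<Sum>i\<in>I. l i (c (e i)))"
    using frameD(2)[OF F(1)] lin_in[OF c(1)] by (intro sum.cong) (auto simp: c'_def)
  show ?thesis
    by (rule tracedI[OF dual_frame[OF M F(1)] A], subst eq) (rule F(3))
qed

text \<open>Transposing both families keeps their index set and, because the dual action uses
  inverses, their equivariance.\<close>

lemma linked_dual:
  fixes M :: "('a, 'k::field, 'v::ab_group_add) gmod"
  assumes M: "mdl M" and linked: "linked M M" shows "linked (dual_gmod M) (dual_gmod M)"
proof -
  obtain Z :: "nat set" and \<phi> f h where D: "linking M M Z \<phi> f h" using linkedE[OF linked] by blast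
  obtain I :: "nat set" and e l where F: "frame M I e l" using ex_frame[OF M] by blast
  note gZ = good_gset[OF linkingD(1)[OF D]]
  define T where "T = (\<lambda>(f :: nat \<Rightarrow> 'v \<Rightarrow> 'v) z (m :: 'v \<Rightarrow> 'k) v. if v \<in> vecs M then m (f z v) else 0)"
  have T: "fam (dual_gmod M) (dual_gmod M) Z \<phi> (T f)" if f: "fam M M Z \<phi> f" for f
  proof (rule famI)
    show "lin (dual_gmod M) (dual_gmod M) (T f z)" if z: "z \<in> Z" for z
    proof (rule linI)
      show "T f z x \<in> vecs (dual_gmod M)" if "x \<in> vecs (dual_gmod M)" for x
        unfolding T_def using that by (intro dual_I[OF M] lin_comp[OF famD(1)[OF f z]]) (simp add: dual_simps)
    qed (auto simp: T_def dual_simps(2))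
    show "T f (\<phi> g z) (act (dual_gmod M) g m) = act (dual_gmod M) g (T f z m)"
      if g: "g \<in> carrier G" and z: "z \<in> Z" and m: "m \<in> vecs (dual_gmod M)" for g z m
    proof
      fix v
      note g' = inv_closed[OF g]
      have "act M (inv g) (f (\<phi> g z) v) = f z (act M (inv g) v)" if v: "v \<in> vecs M"
        using famD(2)[OF f g z mdl_act[OF M g' v]] lin_in[OF famD(1)[OF f z] mdl_act[OF M g' v]]
        by (simp add: mdl_act_inv'[OF M g v] mdl_act_inv[OF M g])
      then show "T f (\<phi> g z) (act (dual_gmod M) g m) v = act (dual_gmod M) g (T f z m) v"
        using lin_in[OF famD(1)[OF f gsetD(2)[OF gZ g z]]] by (simp add: T_def dual_simps(3) mdl_act[OF M g'])
    qed
  qed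
  have "linking (dual_gmod M) (dual_gmod M) Z \<phi> (T f) (T h)"
    unfolding linking_def
  proof (intro conjI allI impI T linkingD[OF D])
    fix L a b assume L: "lin (dual_gmod M) kmod L" and a: "a \<in> vecs (dual_gmod M)" and b: "b \<in> vecs (dual_gmod M)"
    \<comment> \<open>Reflexivity: the form \<open>L\<close> on the dual is evaluation at the vector
      \<open>x\<close>.\<close>
    define x where "x = (\<Sum>i\<in>I. scl M (L (\<lambda>v. if v \<in> vecs M then l i v else 0)) (e i))"
    have x: "x \<in> vecs M" unfolding x_def by (intro mdl_sum[OF M] mdl_scl[OF M] frameD(2)[OF F])
    have Lx: "L m = m x" if m: "m \<in> vecs (dual_gmod M)" for m
    proof -
      have "lin M kmod m" using m by (simp add: dual_simps)
      then show ?thesis unfolding x_def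
        using linK_expand[OF mdl_dual[OF M] dual_frame[OF M F] L m] lin_lincomb[OF M mdl_kmod _ frameD(2)[OF F], of m I]
        by (simp add: mult.commute)
    qed
    note la = a[unfolded dual_simps(1), THEN conjunct1] and lb = b[unfolded dual_simps(1), THEN conjunct1]
    show "(\<Sum>z\<in>Z. scl (dual_gmod M) (L (T h z b)) (T f z a)) = scl (dual_gmod M) (L a) b"
    proof
      fix v
      show "(\<Sum>z\<in>Z. scl (dual_gmod M) (L (T h z b)) (T f z a)) v = scl (dual_gmod M) (L a) b v"
      proof (cases "v \<in> vecs M")
        case True
        have "L (T h z b) = b (h z x)" if z: "z \<in> Z" for z
          using Lx[OF lin_in[OF famD(1)[OF T[OF linkingD(3)[OF D]] z] b]] x by (simp add: T_def)
        then have "(\<Sum>z\<in>Z. scl (dual_gmod M) (L (T h z b)) (T f z a)) v = (\<Sum>z\<in>Z. b (h z x) * a (f z v))"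
          using True by (simp add: dual_simps(2) sum_fun_apply T_def)
        also have "\<dots> = a (\<Sum>z\<in>Z. scl M (b (h z x)) (f z v))"
          using lin_lincomb[OF M mdl_kmod la, of Z "\<lambda>z. f z v"] lin_in[OF famD(1)[OF linkingD(2)[OF D]] True] by simp
        also have "\<dots> = b v * a x"
          using linkingD(4)[OF D lb True x] lin_scl[OF la x] by simp
        finally show ?thesis using Lx[OF a] by (simp add: dual_simps(2) mult.commute)
      next
        case False
        then show ?thesis using b by (simp add: dual_simps sum_fun_apply T_def)
      qed
    qed
  qed
  then show ?thesis by (rule linkedI)
qed

text \<open>Hom(k, V) is \<open>V\<close> itself, so a permuted frame of \<open>V\<close> is already
  a linking.\<close>

lemma linked_kmod:
  fixes V :: "('a, 'k::field, 'v::ab_group_add) gmod"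
  assumes V: "mdl V" and p: "perm_frame V Z \<phi> e l" and g: "good Z \<phi>"
  shows "linked kmod V"
proof (rule linkedI)
  note F = perm_frameD(2)[OF p]
  show "linking kmod V Z \<phi> (\<lambda>z c. scl V c (e z)) l"
    unfolding linking_def
  proof (intro conjI allI impI)
    show "fam kmod V Z \<phi> (\<lambda>z c. scl V c (e z))"
      by (rule famI) (auto intro!: lin_fscl[OF V] lin_id frameD(2)[OF F] simp: perm_frameD(3)[OF p] lin_scl[OF mdl_act_lin[OF V] frameD(2)[OF F]])
    fix m :: "'k \<Rightarrow> 'k" and v w assume m: "lin (kmod :: ('a, 'k, 'k) gmod) kmod m" and w: "w \<in> vecs V"
    have m1: "m x = x * m 1" for x using lin_scl[OF m, of 1 x] by simp
    have "(\<Sum>z\<in>Z. scl V (m (l z w)) (scl V v (e z))) = (\<Sum>z\<in>Z. scl V (m v) (scl V (l z w) (e z)))"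
      by (rule sum.cong[OF refl], subst m1, subst (2) m1) (simp add: scl_scl[OF V] mult_ac)
    then show "(\<Sum>z\<in>Z. scl V (m (l z w)) (scl V v (e z))) = scl V (m v) w"
      using frameD(4)[OF F w] by (simp add: scl_sum[OF V, symmetric])
  qed (rule g perm_frameD(4)[OF p])+
qed

text \<open>The vectors of the frame are the maps \<open>f z\<close> of the linking. Each form
  \<open>m z\<close> on End(M) is the trace of the composition with an endomorphism
  \<open>h z\<close>, and these endomorphisms are the other half.\<close>

lemma linked_of_End:
  fixes M :: "('a, 'k::field, 'v::ab_group_add) gmod"
  assumes M: "mdl M" and p: "perm_frame (End_gmod G M) Z \<phi> e m" and gd: "good Z \<phi>"
  shows "linked M M"
proof -
  obtain I :: "nat set" and u l where F: "frame M I u l" using ex_frame[OF M] by blast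
  note P = perm_frameD(2)[OF p] and gZ = good_gset[OF gd] and mE = mdl_End[OF M]
  \<comment> \<open>Represents \<open>m z\<close>: by \<open>lh\<close>, a form \<open>q\<close>
    applied to \<open>h z w\<close> gives the value of \<open>m z\<close> at the rank-one map of
    \<open>q\<close> and \<open>w\<close>.\<close>
  define h where "h = (\<lambda>z w. \<Sum>i\<in>I. scl M (m z (rk1 M (l i) w)) (u i))"
  have rlin: "lin M (End_gmod G M) (rk1 M l)" if "lin M kmod l" for l
    using rk1_End[OF M that]
    by (intro linI) (auto simp: rk1_def fun_eq_iff End_scl scl_add[OF M] scl_scl[OF M] scl_0'[OF M] mult.commute)
  have mr: "lin M kmod (\<lambda>w. m z (rk1 M l w))" if "z \<in> Z" "lin M kmod l" for z l
    by (rule lin_comp[OF rlin[OF that(2)] frameD(3)[OF P that(1)]])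
  have h: "lin M M (h z)" if "z \<in> Z" for z
    unfolding h_def by (intro lin_sumf[OF M] lin_fscl[OF M] mr that frameD(2,3)[OF F])
  have lh: "q (h z w) = m z (rk1 M q w)" if z: "z \<in> Z" and l': "lin M kmod q" and w: "w \<in> vecs M" for z w q
  proof -
    have "q (h z w) = (\<Sum>i\<in>I. q (u i) * m z (rk1 M (l i) w))" unfolding h_def
      using lin_lincomb[OF M mdl_kmod l' frameD(2)[OF F], of I] by (simp add: mult.commute)
    also have "\<dots> = m z (\<Sum>i\<in>I. scl (End_gmod G M) (q (u i)) (rk1 M (l i) w))"
      using lin_lincomb[OF mE mdl_kmod frameD(3)[OF P z], of I] rk1_End[OF M frameD(3)[OF F] w] by simp
    also have "(\<Sum>i\<in>I. scl (End_gmod G M) (q (u i)) (rk1 M (l i) w)) = rk1 M q w"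
    proof
      fix v
      show "(\<Sum>i\<in>I. scl (End_gmod G M) (q (u i)) (rk1 M (l i) w)) v = rk1 M q w v"
        using linK_expand[OF M F l', of v]
        by (cases "v \<in> vecs M") (simp_all add: End_sum_apply[OF M] rk1_def scl_0'[OF M] scl_scl[OF M] scl_sum_left[OF M, symmetric] mult.commute)
    qed
    finally show ?thesis .
  qed
  have "linking M M Z \<phi> e h"
    unfolding linking_def
  proof (intro conjI allI impI)
    show "good Z \<phi>" by (rule gd)
    show "fam M M Z \<phi> e"
    proof (rule famI)
      show "lin M M (e z)" if "z \<in> Z" for z using frameD(2)[OF P that] by (simp add: End_vecs)
      show "e (\<phi> g z) (act M g v) = act M g (e z v)" if "g \<in> carrier G" "z \<in> Z" "v \<in> vecs M" for g z v
        using that by (simp add: perm_frameD(3)[OF p] End_act mdl_act[OF M] mdl_act_inv[OF M])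
    qed
    show "fam M M Z \<phi> h"
    proof (rule famI)
      fix g z w assume g: "g \<in> carrier G" and z: "z \<in> Z" and w: "w \<in> vecs M"
      note gz = gsetD(2)[OF gZ g z] and gw = mdl_act[OF M g w]
      show "h (\<phi> g z) (act M g w) = act M g (h z w)"
      proof (rule vec_eqI[OF F lin_in[OF h[OF gz] gw] mdl_act[OF M g lin_in[OF h[OF z] w]]])
        fix i assume i: "i \<in> I"
        note lg = lin_comp[OF mdl_act_lin[OF M g] frameD(3)[OF F i]]
        have "l i (act M g (h z w)) = m z (rk1 M (\<lambda>x. l i (act M g x)) w)" by (rule lh[OF z lg w])
        also have "\<dots> = m (\<phi> g z) (act (End_gmod G M) g (rk1 M (\<lambda>x. l i (act M g x)) w))"
          using perm_frameD(5)[OF p g z rk1_End[OF M lg w]] by simp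
        also have "act (End_gmod G M) g (rk1 M (\<lambda>x. l i (act M g x)) w) = rk1 M (l i) (act M g w)"
          using lin_scl[OF mdl_act_lin[OF M g] w]
          by (auto simp: End_act rk1_def fun_eq_iff mdl_act[OF M inv_closed[OF g]] mdl_act_inv'[OF M g])
        also have "m (\<phi> g z) (rk1 M (l i) (act M g w)) = l i (h (\<phi> g z) (act M g w))"
          using lh[OF gz frameD(3)[OF F i] gw] by simp
        finally show "l i (h (\<phi> g z) (act M g w)) = l i (act M g (h z w))" by simp
      qed
    qed (rule h)
    fix l' v w assume l': "lin M kmod l'" and v: "v \<in> vecs M" and w: "w \<in> vecs M"
    have "(\<Sum>z\<in>Z. scl M (l' (h z w)) (e z v)) = (\<Sum>z\<in>Z. scl (End_gmod G M) (m z (rk1 M l' w)) (e z)) v"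
      using lh[OF _ l' w] by (simp add: End_sum_apply[OF M])
    also have "\<dots> = rk1 M l' w v" using frameD(4)[OF P rk1_End[OF M l' w]] by simp
    finally show "(\<Sum>z\<in>Z. scl M (l' (h z w)) (e z v)) = scl M (l' v) w" using v by (simp add: rk1_def)
  qed
  then show ?thesis by (rule linkedI)
qed

text \<open>Converse of \<open>linked_of_End\<close>: the form belonging to \<open>z\<close> is the
  trace of \<open>h z\<close> after \<open>t\<close>, written in the frame of \<open>M\<close>. Its
  invariance is invariance of the trace under conjugation.\<close>

lemma End_of_linking:
  fixes M :: "('a, 'k::field, 'v::ab_group_add) gmod"
  assumes M: "mdl M" and D: "linking M M Z \<phi> f h" and F: "frame M I e l"
  shows "perm_frame (End_gmod G M) Z \<phi> (\<lambda>z v. if v \<in> vecs M then f z v else 0) (\<lambda>z t. \<Sum>i\<in>I. l i (h z (t (e i))))"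
proof -
  note gZ = good_gset[OF linkingD(1)[OF D]] and f = famD[OF linkingD(2)[OF D]] and h = famD[OF linkingD(3)[OF D]]
  have tl: "lin (End_gmod G M) kmod (\<lambda>t. l i (h z (t (e i))))" if "z \<in> Z" "i \<in> I" for z i
  proof -
    have "lin (End_gmod G M) M (\<lambda>t. t (e i))"
    proof (rule linI)
      show "t (e i) \<in> vecs M" if "t \<in> vecs (End_gmod G M)" for t
        using that lin_in[of M M t, OF _ frameD(2)[OF F \<open>i \<in> I\<close>]] by (simp add: End_vecs)
    qed (simp_all add: End_scl)
    from lin_comp[OF this lin_comp[OF h(1)[OF that(1)] frameD(3)[OF F that(2)]]] show ?thesis .
  qed
  show ?thesis unfolding perm_frame_def frame_def
  proof (intro conjI ballI)
    show "gset Z \<phi>" "finite Z" using gZ gsetD(1) by auto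
    show fE: "(\<lambda>v. if v \<in> vecs M then f z v else 0) \<in> vecs (End_gmod G M)" if "z \<in> Z" for z
      by (rule End_I[OF M f(1)[OF that]])
    show lE: "lin (End_gmod G M) kmod (\<lambda>t. \<Sum>i\<in>I. l i (h z (t (e i))))" if "z \<in> Z" for z
      by (intro lin_sumf[OF mdl_kmod] tl that)
    show "t = (\<Sum>z\<in>Z. scl (End_gmod G M) (\<Sum>i\<in>I. l i (h z (t (e i)))) (\<lambda>v. if v \<in> vecs M then f z v else 0))"
      if t: "t \<in> vecs (End_gmod G M)" for t
    proof
      fix v
      have tt: "lin M M t" using t by (simp add: End_vecs)
      show "t v = (\<Sum>z\<in>Z. scl (End_gmod G M) (\<Sum>i\<in>I. l i (h z (t (e i)))) (\<lambda>v. if v \<in> vecs M then f z v else 0)) v"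
      proof (cases "v \<in> vecs M")
        case True
        have "t v = (\<Sum>i\<in>I. scl M (l i v) (t (e i)))" by (rule lin_expand[OF M M F tt True])
        also have "\<dots> = (\<Sum>i\<in>I. \<Sum>z\<in>Z. scl M (l i (h z (t (e i)))) (f z v))"
          using linkingD(4)[OF D frameD(3)[OF F] True lin_in[OF tt frameD(2)[OF F]]] by (intro sum.cong) simp_all
        also have "\<dots> = (\<Sum>z\<in>Z. scl M (\<Sum>i\<in>I. l i (h z (t (e i)))) (f z v))"
          by (subst sum.swap) (simp add: scl_sum_left[OF M])
        finally show ?thesis using True by (simp add: End_sum_apply[OF M])
      next
        case False
        then show ?thesis using t by (simp add: End_sum_apply[OF M] End_vecs scl_0'[OF M])
      qed
    qed
    show "(\<lambda>v. if v \<in> vecs M then f (\<phi> g z) v else 0) = act (End_gmod G M) g (\<lambda>v. if v \<in> vecs M then f z v else 0)"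
      if g: "g \<in> carrier G" and z: "z \<in> Z" for g z
      using f(2)[OF g z mdl_act[OF M inv_closed[OF g]]]
      by (auto simp: End_act fun_eq_iff mdl_act[OF M inv_closed[OF g]] mdl_act_inv'[OF M g])
    show "fam (End_gmod G M) kmod Z \<phi> (\<lambda>z t. \<Sum>i\<in>I. l i (h z (t (e i))))"
    proof (rule famI)
      fix g z t assume g: "g \<in> carrier G" and z: "z \<in> Z" and t: "t \<in> vecs (End_gmod G M)"
      have tt: "lin M M t" using t by (simp add: End_vecs)
      note g' = inv_closed[OF g]
      have "fam M M {()} (\<lambda>g z. z) (\<lambda>_ x. x)" by (rule famI) (simp_all add: lin_id)
      have "(\<Sum>i\<in>I. l i (h (\<phi> g z) (act (End_gmod G M) g t (e i)))) = (\<Sum>i\<in>I. l i (act M g (h z (t (act M (inv g) (e i))))))"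
        using frameD(2)[OF F] h(2)[OF g z lin_in[OF tt mdl_act[OF M g']]] by (intro sum.cong) (simp_all add: End_act)
      also have "\<dots> = (\<Sum>i\<in>I. l i (h z (t (act M (inv g) (act M g (e i))))))"
        by (rule trace_commute[OF M M F F lin_comp[OF lin_comp[OF mdl_act_lin[OF M g'] tt] h(1)[OF z]] mdl_act_lin[OF M g]])
      finally show "(\<Sum>i\<in>I. l i (h (\<phi> g z) (act (End_gmod G M) g t (e i)))) = act kmod g (\<Sum>i\<in>I. l i (h z (t (e i))))"
        using frameD(2)[OF F] by (simp add: mdl_act_inv[OF M g])
    qed (rule lE)
  qed
qed

end

section \<open>Actions of finite groups and Sylow subgroups\<close>

context fgroup
begin

definition stab :: "('a \<Rightarrow> 'x \<Rightarrow> 'x) \<Rightarrow> 'x \<Rightarrow> 'a set"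
  where "stab \<phi> x = {g \<in> carrier G. \<phi> g x = x}"

definition orb :: "('a \<Rightarrow> 'x \<Rightarrow> 'x) \<Rightarrow> 'x \<Rightarrow> 'x set"
  where "orb \<phi> x = (\<lambda>g. \<phi> g x) ` carrier G"

lemma gset_group_action:
  assumes "gset X \<phi>" shows "group_action G X (\<lambda>g. restrict (\<phi> g) X)"
proof -
  have b: "restrict (\<phi> g) X \<in> Bij X" if "g \<in> carrier G" for g
    using bij_betw_cong[of X "restrict (\<phi> g) X" "\<phi> g" X] gset_bij[OF assms that] by (simp add: Bij_def)
  have "(\<lambda>g. restrict (\<phi> g) X) \<in> hom G (BijGroup X)"
    unfolding hom_def using b gsetD(2,4)[OF assms]
    by (auto simp: BijGroup_def compose_def restrict_def fun_eq_iff)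
  then show ?thesis
    unfolding group_action_def group_hom_def group_hom_axioms_def using group_BijGroup is_group by blast
qed

lemma group_action_gset:
  assumes "group_action G X \<phi>" "finite X" shows "gset X \<phi>"
proof -
  interpret group_action G X \<phi> by (rule assms(1))
  show ?thesis unfolding gset_def
  proof (intro conjI ballI)
    show "\<phi> \<one> z = z" if "z \<in> X" for z using fun_cong[OF id_eq_one, of z] that by simp
    show "\<phi> (g \<otimes> h) z = \<phi> g (\<phi> h z)" if "g \<in> carrier G" "h \<in> carrier G" "z \<in> X" for g h z
      using composition_rule that by blast
    show "\<phi> g z \<in> X" if "g \<in> carrier G" "z \<in> X" for g z using element_image[OF that] by blast
  qed (rule assms(2))
qed

lemma subgroup_stab: "gset X \<phi> \<Longrightarrow> x \<in> X \<Longrightarrow> subgroup (stab \<phi> x) G"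
proof (rule subgroupI)
  assume g: "gset X \<phi>" "x \<in> X"
  show "stab \<phi> x \<noteq> {}" using gsetD(3)[OF g] by (auto simp: stab_def)
  show "inv a \<in> stab \<phi> x" if "a \<in> stab \<phi> x" for a using that gset_inv(1)[OF g(1) _ g(2), of a] by (simp add: stab_def)
  show "a \<otimes> b \<in> stab \<phi> x" if "a \<in> stab \<phi> x" "b \<in> stab \<phi> x" for a b
    using that gsetD(4)[OF g(1) _ _ g(2)] by (auto simp: stab_def)
qed (auto simp: stab_def)

lemma orbit_card:
  assumes g: "gset X \<phi>" and x: "x \<in> X"
  shows "card (orb \<phi> x) * card (stab \<phi> x) = card (carrier G)"
proof -
  interpret A: group_action G X "\<lambda>g. restrict (\<phi> g) X" by (rule gset_group_action[OF g])
  have "orbit G (\<lambda>g. restrict (\<phi> g) X) x = orb \<phi> x" "stabilizer G (\<lambda>g. restrict (\<phi> g) X) x = stab \<phi> x"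
    using x by (auto simp: orbit_def stabilizer_def orb_def stab_def)
  then show ?thesis using A.orbit_stabilizer_theorem[OF x] by (simp add: order_def)
qed

lemma orb_subset: "gset X \<phi> \<Longrightarrow> x \<in> X \<Longrightarrow> orb \<phi> x \<subseteq> X"
  and orb_self: "gset X \<phi> \<Longrightarrow> x \<in> X \<Longrightarrow> x \<in> orb \<phi> x"
  using gsetD(2)[of X \<phi>] gsetD(3)[of X \<phi> x] by (auto simp: orb_def intro: rev_image_eqI)

lemma orb_closed: "gset X \<phi> \<Longrightarrow> x \<in> X \<Longrightarrow> g \<in> carrier G \<Longrightarrow> y \<in> orb \<phi> x \<Longrightarrow> \<phi> g y \<in> orb \<phi> x"
  unfolding orb_def by (auto simp: gsetD(4)[symmetric])

lemma orb_compl_closed: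
  assumes "gset X \<phi>" "x \<in> X" "g \<in> carrier G" "y \<in> X - orb \<phi> x" shows "\<phi> g y \<in> X - orb \<phi> x"
  using assms orb_closed[OF assms(1,2), of "inv g" "\<phi> g y"] gset_inv(1)[OF assms(1,3), of y] gsetD(2)[OF assms(1,3)]
  by auto

lemma gset_orb: "gset X \<phi> \<Longrightarrow> x \<in> X \<Longrightarrow> gset (orb \<phi> x) \<phi>"
  by (rule gset_subset[OF _ orb_subset]) (simp_all add: orb_closed)

lemma gset_orb_compl:
  assumes "gset X \<phi>" "x \<in> X" shows "gset (X - orb \<phi> x) \<phi>"
proof (rule gset_subset[OF assms(1) Diff_subset])
  show "\<phi> g z \<in> X - orb \<phi> x" if "g \<in> carrier G" "z \<in> X - orb \<phi> x" for g z
    by (rule orb_compl_closed[OF assms that])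
qed

lemma orb_eq:
  assumes "gset X \<phi>" "x \<in> X" "g \<in> carrier G" shows "orb \<phi> (\<phi> g x) = orb \<phi> x"
proof
  note gx = gsetD(2)[OF assms(1,3,2)]
  show "orb \<phi> (\<phi> g x) \<subseteq> orb \<phi> x"
    using gsetD(4)[OF assms(1) _ assms(3,2), symmetric] assms(3) by (auto simp: orb_def)
  have *: "\<phi> h x = \<phi> (h \<otimes> inv g) (\<phi> g x)" if h: "h \<in> carrier G" for h
    using gsetD(4)[OF assms(1) h inv_closed[OF assms(3)] gx] gset_inv(1)[OF assms(1,3,2)] by simp
  show "orb \<phi> x \<subseteq> orb \<phi> (\<phi> g x)"
    unfolding orb_def by (rule image_subsetI, rule image_eqI, rule *) (use assms(3) in simp_all)
qed

text \<open>Orbits have lengths dividing \<open>p ^ n\<close> and different from 1, and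
  \<open>w\<close> is constant on each of them, so every orbit contributes a multiple of p to both
  sums. The induction removes one orbit at a time.\<close>

lemma p_group_nofix:
  fixes w :: "'x \<Rightarrow> 'k::comm_semiring_1"
  assumes p: "prime p" and c: "card (carrier G) = p ^ n" and g: "gset X \<phi>"
    and nf: "\<And>x. x \<in> X \<Longrightarrow> \<exists>g\<in>carrier G. \<phi> g x \<noteq> x"
    and w: "\<And>g x. g \<in> carrier G \<Longrightarrow> x \<in> X \<Longrightarrow> w (\<phi> g x) = w x"
  shows "p dvd card X" "CHAR('k) = p \<Longrightarrow> (\<Sum>x\<in>X. w x) = 0"
proof -
  have "p dvd card X \<and> (CHAR('k) = p \<longrightarrow> (\<Sum>x\<in>X. w x) = 0)"
    using g nf w
  proof (induction "card X" arbitrary: X rule: less_induct)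
    case less
    show ?case
    proof (cases "X = {}")
      case False
      then obtain x where x: "x \<in> X" by blast
      let ?O = "orb \<phi> x" and ?Y = "X - orb \<phi> x"
      have fX: "finite X" using gsetD(1)[OF less(2)] .
      have O: "?O \<subseteq> X" "x \<in> ?O" using orb_subset[OF less(2) x] orb_self[OF less(2) x] by auto
      have "card ?O dvd p ^ n" using orbit_card[OF less(2) x] c by (metis dvd_triv_left)
      moreover have "card ?O \<noteq> 1"
      proof
        assume "card ?O = 1"
        then obtain y where "?O = {y}" by (rule card_1_singletonE)
        then show False using less(3)[OF x] O(2) by (auto simp: orb_def)
      qed
      ultimately have pO: "p dvd card ?O"
        using p by (metis divides_primepow_nat dvd_triv_left power_0 power_Suc not0_implies_Suc)
      have IH: "p dvd card ?Y \<and> (CHAR('k) = p \<longrightarrow> (\<Sum>x\<in>?Y. w x) = 0)"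
      proof (rule less(1))
        show "card ?Y < card X" using O x fX by (intro psubset_card_mono) auto
        show "gset ?Y \<phi>" by (rule gset_orb_compl[OF less(2) x])
      qed (use less(3,4) in auto)
      have "card X = card ?O + card ?Y" using O fX by (metis card_Diff_subset finite_subset le_add_diff_inverse card_mono)
      moreover have "(\<Sum>x\<in>X. w x) = (\<Sum>y\<in>?O. w y) + (\<Sum>y\<in>?Y. w y)"
        using O fX by (metis sum.subset_diff add.commute)
      moreover have "(\<Sum>y\<in>?O. w y) = of_nat (card ?O) * w x"
      proof -
        have "(\<Sum>y\<in>?O. w y) = (\<Sum>y\<in>?O. w x)" using less(4) x by (intro sum.cong) (auto simp: orb_def)
        then show ?thesis by simp
      qed
      ultimately show ?thesis using IH pO by (auto simp: of_nat_eq_0_iff_char_dvd)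
    qed simp
  qed
  then show "p dvd card X" "CHAR('k) = p \<Longrightarrow> (\<Sum>x\<in>X. w x) = 0" by auto
qed

lemma fgroup_subgroup: "subgroup H G \<Longrightarrow> fgroup (G\<lparr>carrier := H\<rparr>)"
  by (simp add: fgroup_def fgroup_axioms_def subgroup.subgroup_is_group[OF _ is_group] finite_subset[OF subgroup.subset finite_carrier])

lemma gset_restrict:
  assumes "gset X \<phi>" "subgroup H G" shows "fgroup.gset (G\<lparr>carrier := H\<rparr>) X \<phi>"
  using gsetD[OF assms(1)] subgroup.mem_carrier[OF assms(2)]
  by (auto simp: fgroup.gset_def[OF fgroup_subgroup[OF assms(2)]])

text \<open>Apply \<open>p_group_nofix\<close> to \<open>H\<close>, regarded as a group of its
  own.\<close>

lemma p_subgroup_nofix: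
  fixes w :: "'x \<Rightarrow> 'k::comm_semiring_1"
  assumes p: "prime p" and H: "subgroup H G" and c: "card H = p ^ n" and g: "gset X \<phi>"
    and nf: "\<And>x. x \<in> X \<Longrightarrow> \<exists>g\<in>H. \<phi> g x \<noteq> x"
    and w: "\<And>g x. g \<in> carrier G \<Longrightarrow> x \<in> X \<Longrightarrow> w (\<phi> g x) = w x"
  shows "p dvd card X" "CHAR('k) = p \<Longrightarrow> (\<Sum>x\<in>X. w x) = 0"
  using fgroup.p_group_nofix[OF fgroup_subgroup[OF H] p _ gset_restrict[OF g H], of n w] c nf w subgroup.mem_carrier[OF H]
  by auto

lemma p_subgroup_fix:
  assumes "prime p" "subgroup H G" "card H = p ^ n" "gset X \<phi>" "\<not> p dvd card X"
  shows "\<exists>x\<in>X. \<forall>g\<in>H. \<phi> g x = x"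
  using p_subgroup_nofix(1)[OF assms(1-4), of "\<lambda>_. 0 :: nat"] assms(5) by auto

section \<open>Left cosets and their stabilisers\<close>

lemma lcosetsI: "g \<in> carrier G \<Longrightarrow> g <# H \<in> lcosets H" and lcosetsE: "C \<in> lcosets H \<Longrightarrow> \<exists>g\<in>carrier G. C = g <# H"
  by (auto simp: LCOSETS_def)

lemma lcoset_self: "subgroup H G \<Longrightarrow> H \<in> lcosets H"
  using lcosetsI[of \<one> H] lcos_mult_one[OF subgroup.subset] by simp

lemma lcoset_sub: "subgroup H G \<Longrightarrow> C \<in> lcosets H \<Longrightarrow> C \<subseteq> carrier G"
  using subgroup.lcosets_carrier[OF _ is_group] .

lemma lcoset_act: "subgroup H G \<Longrightarrow> g \<in> carrier G \<Longrightarrow> C \<in> lcosets H \<Longrightarrow> g <# C \<in> lcosets H"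
  using lcosetsE[of C H] lcos_m_assoc[OF subgroup.subset[of H G], of g] lcosetsI[OF m_closed, of g _ H] by fastforce

lemma finite_lcosets: "subgroup H G \<Longrightarrow> finite (lcosets H)"
  using lcosets_subset_PowG finite_carrier finite_subset by blast

lemma gset_lcosets: "subgroup H G \<Longrightarrow> gset (lcosets H) (\<lambda>g C. g <# C)"
  unfolding gset_def
  by (intro conjI ballI)
    (simp_all add: finite_lcosets lcoset_act lcos_mult_one[OF lcoset_sub] lcos_m_assoc[OF lcoset_sub])

lemma lcoset_fix_iff:
  assumes "subgroup H G" "a \<in> carrier G" "r \<in> carrier G"
  shows "r <# (a <# H) = a <# H \<longleftrightarrow> inv a \<otimes> r \<otimes> a \<in> H"
proof -
  note hs = subgroup.subset[OF assms(1)]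
  have "r <# (a <# H) = (r \<otimes> a) <# H" using lcos_m_assoc[OF hs assms(3,2)] .
  moreover have "(r \<otimes> a) <# H = a <# H \<longleftrightarrow> r \<otimes> a \<in> a <# H"
    using lcos_self[OF _ assms(1), of "r \<otimes> a"] l_repr_independence[OF _ assms(2,1), of "r \<otimes> a"] assms(2,3) by auto
  moreover have "r \<otimes> a \<in> a <# H \<longleftrightarrow> inv a \<otimes> (r \<otimes> a) \<in> H"
    using subgroup.lcos_module_imp[OF assms(1) is_group assms(2), of "r \<otimes> a"] assms
     subgroup.lcos_module_rev[OF assms(1) is_group assms(2), of "r \<otimes> a"] by auto
  ultimately show ?thesis using assms(2,3) by (simp add: m_assoc)
qed

lemma lcoset_fix_self:
  assumes "subgroup H G" "r \<in> carrier G" shows "r <# H = H \<longleftrightarrow> r \<in> H"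
  using lcoset_fix_iff[OF assms(1) one_closed assms(2)] assms(2) lcos_mult_one[OF subgroup.subset[OF assms(1)]] by simp

section \<open>Sylow subgroups and averaging over orbits of length prime to p\<close>

lemma ex_sylow:
  assumes "prime p"
  shows "\<exists>P n. subgroup P G \<and> card P = p ^ n \<and> \<not> p dvd card (lcosets P)"
proof -
  let ?a = "multiplicity p (order G)"
  have o: "order G \<noteq> 0" using finite_carrier one_closed by (auto simp: order_def)
  obtain m where m: "order G = p ^ ?a * m" "\<not> p dvd m"
    using multiplicity_decompose'[OF o, of p] assms by (auto simp: prime_nat_iff)
  obtain P where P: "subgroup P G" "card P = p ^ ?a"
    using sylow_thm[OF assms is_group m(1) finite_carrier] by blast
  have "card (lcosets P) * p ^ ?a = m * p ^ ?a" using l_lagrange[OF finite_carrier P(1)] m(1) P(2) by (metis mult.commute)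
  then have "card (lcosets P) = m" using assms by (simp add: prime_gt_0_nat)
  then show ?thesis using P m(2) by auto
qed

text \<open>
  The point \<open>y\<close> is fixed by a Sylow \<open>p\<close>-subgroup of the stabiliser of \<open>x\<close>; this makes the length of
  its orbit under that stabiliser prime to \<open>p\<close>.
\<close>

lemma prime_to_p_orbit:
  assumes p: "prime p" and X: "gset X \<phi>" and Y: "gset Y \<psi>"
    and fam: "\<And>Q x. p_subgroup G p Q \<Longrightarrow> x \<in> X \<Longrightarrow> \<forall>q\<in>Q. \<phi> q x = x \<Longrightarrow> \<exists>y\<in>Y. \<forall>q\<in>Q. \<psi> q y = y"
    and x: "x \<in> X"
  shows "\<exists>y\<in>Y. \<not> p dvd card ((\<lambda>h. \<psi> h y) ` stab \<phi> x)"
proof -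
  let ?H = "stab \<phi> x"
  have H: "subgroup ?H G" by (rule subgroup_stab[OF X x])
  interpret H: fgroup "G\<lparr>carrier := ?H\<rparr>" by (rule fgroup_subgroup[OF H])
  obtain P n where P: "subgroup P (G\<lparr>carrier := ?H\<rparr>)" "card P = p ^ n" "\<not> p dvd card (lcosets\<^bsub>G\<lparr>carrier := ?H\<rparr>\<^esub> P)"
    using H.ex_sylow[OF p] by blast
  have PH: "P \<subseteq> ?H" using subgroup.subset[OF P(1)] by simp
  have "subgroup P G" using incl_subgroup[OF H P(1)] .
  then have "p_subgroup G p P" using P(2) by (auto simp: p_subgroup_def)
  then obtain y where y: "y \<in> Y" "\<forall>q\<in>P. \<psi> q y = y" using fam[OF _ x] PH by (force simp: stab_def)
  have YH: "H.gset Y \<psi>" by (rule gset_restrict[OF Y H])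
  let ?K = "H.stab \<psi> y"
  have K: "subgroup ?K (G\<lparr>carrier := ?H\<rparr>)" by (rule H.subgroup_stab[OF YH y(1)])
  have PK: "P \<subseteq> ?K" using PH y(2) by (auto simp: H.stab_def)
  have orb: "H.orb \<psi> y = (\<lambda>h. \<psi> h y) ` ?H" by (simp add: H.orb_def)
  have 1: "card ((\<lambda>h. \<psi> h y) ` ?H) * card ?K = card ?H"
    using H.orbit_card[OF YH y(1)] by (simp add: orb)
  have 2: "card (lcosets\<^bsub>G\<lparr>carrier := ?H\<rparr>\<^esub> P) * card P = card ?H"
    using H.l_lagrange[OF H.finite_carrier P(1)] by (simp add: order_def)
  interpret K: fgroup "G\<lparr>carrier := ?K\<rparr>"
    using H.fgroup_subgroup[OF K] by simp
  have "subgroup P (G\<lparr>carrier := ?K\<rparr>)"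
    using H.subgroup_incl[OF P(1) K PK] by simp
  then have 3: "card P dvd card ?K"
    using K.l_lagrange[OF K.finite_carrier] by (metis dvd_triv_right order_def partial_object.select_convs(1) partial_object.update_convs(1) partial_object.surjective)
  show ?thesis
  proof (intro bexI[OF _ y(1)] notI)
    assume "p dvd card ((\<lambda>h. \<psi> h y) ` ?H)"
    then have "p * card P dvd card ((\<lambda>h. \<psi> h y) ` ?H) * card ?K" using 3 by (rule mult_dvd_mono)
    then have "p * card P dvd card (lcosets\<^bsub>G\<lparr>carrier := ?H\<rparr>\<^esub> P) * card P" using 1 2 by simp
    then show False using P(2,3) p by (simp add: prime_gt_0_nat)
  qed
qed

text \<open>Over \<open>x\<close>, take the uniform distribution on an orbit of the stabiliser of
  \<open>x\<close> in \<open>Y\<close> whose length is prime to p and hence invertible in the field.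
  Such an orbit is chosen for one representative \<open>r x\<close> of each orbit in
  \<open>X\<close> only and then transported, which makes \<open>U\<close> equivariant.\<close>

lemma ex_weights:
  assumes p: "prime p" and ch: "CHAR('k::field) = p" and X: "gset X \<phi>" and Y: "gset Y \<psi>"
    and fam: "\<And>Q x. p_subgroup G p Q \<Longrightarrow> x \<in> X \<Longrightarrow> \<forall>q\<in>Q. \<phi> q x = x \<Longrightarrow> \<exists>y\<in>Y. \<forall>q\<in>Q. \<psi> q y = y"
  shows "\<exists>U :: 'y \<Rightarrow> 'x \<Rightarrow> 'k. (\<forall>g\<in>carrier G. \<forall>y\<in>Y. \<forall>x\<in>X. U (\<psi> g y) (\<phi> g x) = U y x) \<and>
     (\<forall>x\<in>X. (\<Sum>y\<in>Y. U y x) = 1)"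
proof -
  have "\<forall>x\<in>X. \<exists>y\<in>Y. \<not> p dvd card ((\<lambda>h. \<psi> h y) ` stab \<phi> x)"
    using prime_to_p_orbit[OF p X Y] fam by blast
  then obtain yy where yy: "\<And>x. x \<in> X \<Longrightarrow> yy x \<in> Y" "\<And>x. x \<in> X \<Longrightarrow> \<not> p dvd card ((\<lambda>h. \<psi> h (yy x)) ` stab \<phi> x)"
    by metis
  define r where "r = (\<lambda>x. SOME z. z \<in> orb \<phi> x)"
  have r: "r x \<in> orb \<phi> x" "r x \<in> X" if "x \<in> X" for x
  proof -
    show "r x \<in> orb \<phi> x" unfolding r_def using orb_self[OF X that] by (rule someI)
    then show "r x \<in> X" using orb_subset[OF X that] by blast
  qed
  have r_act: "r (\<phi> g x) = r x" if "g \<in> carrier G" "x \<in> X" for g x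
    unfolding r_def using orb_eq[OF X that(2,1)] by simp
  \<comment> \<open>The translate, by any \<open>g\<close> carrying \<open>r x\<close> to
    \<open>x\<close>, of the stabiliser orbit chosen at \<open>r x\<close>; different
    \<open>g\<close> give the same set.\<close>
  define Ob where "Ob = (\<lambda>x. {\<psi> g (yy (r x)) | g. g \<in> carrier G \<and> \<phi> g (r x) = x})"
  have OY: "Ob x \<subseteq> Y" if "x \<in> X" for x using gsetD(2)[OF Y _ yy(1)[OF r(2)[OF that]]] by (auto simp: Ob_def)
  have Ob_sub: "\<psi> h y \<in> Ob (\<phi> h x)" if h: "h \<in> carrier G" and x: "x \<in> X" and y: "y \<in> Ob x" for h x y
  proof -
    obtain g where g: "y = \<psi> g (yy (r x))" "g \<in> carrier G" "\<phi> g (r x) = x" using y by (auto simp: Ob_def)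
    have "\<psi> h y = \<psi> (h \<otimes> g) (yy (r (\<phi> h x)))" "\<phi> (h \<otimes> g) (r (\<phi> h x)) = \<phi> h x"
      using g gsetD(4)[OF Y h g(2) yy(1)[OF r(2)[OF x]]] gsetD(4)[OF X h g(2) r(2)[OF x]] r_act[OF h x] by simp_all
    then show ?thesis using m_closed[OF h g(2)] unfolding Ob_def by blast
  qed
  have Ob_act: "\<psi> h y \<in> Ob (\<phi> h x) \<longleftrightarrow> y \<in> Ob x" if h: "h \<in> carrier G" and x: "x \<in> X" and y: "y \<in> Y" for h x y
    using Ob_sub[OF h x, of y] Ob_sub[OF inv_closed[OF h] gsetD(2)[OF X h x], of "\<psi> h y"]
      gset_inv(1)[OF X h x] gset_inv(1)[OF Y h y] by auto
  have Ob_img: "Ob (\<phi> h x) = \<psi> h ` Ob x" if h: "h \<in> carrier G" and x: "x \<in> X" for h x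
  proof
    show "\<psi> h ` Ob x \<subseteq> Ob (\<phi> h x)" using Ob_sub[OF h x] by blast
    show "Ob (\<phi> h x) \<subseteq> \<psi> h ` Ob x"
    proof
      fix y assume y: "y \<in> Ob (\<phi> h x)"
      have yY: "y \<in> Y" using OY[OF gsetD(2)[OF X h x]] y by blast
      then have "\<psi> (inv h) y \<in> Ob x"
        using Ob_sub[OF inv_closed[OF h] gsetD(2)[OF X h x] y] gset_inv(1)[OF X h x] by simp
      then show "y \<in> \<psi> h ` Ob x" using gset_inv(2)[OF Y h yY] by (metis imageI)
    qed
  qed
  have card_act: "card (Ob (\<phi> h x)) = card (Ob x)" if h: "h \<in> carrier G" and x: "x \<in> X" for h x
    unfolding Ob_img[OF that]
    by (rule card_image, rule inj_on_subset[OF bij_betw_imp_inj_on[OF gset_bij[OF Y h]] OY[OF x]])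
  \<comment> \<open>At the representative, \<open>Ob\<close> is the chosen stabiliser orbit;
    elsewhere it has the same size by transport.\<close>
  have nz: "of_nat (card (Ob x)) \<noteq> (0::'k)" if x: "x \<in> X" for x
  proof -
    obtain g where g: "g \<in> carrier G" "r x = \<phi> g x" using r(1)[OF x] by (auto simp: orb_def)
    have "r (r x) = r x" using r_act[OF g(1) x] g(2) by simp
    then have "Ob (r x) = (\<lambda>h. \<psi> h (yy (r x))) ` stab \<phi> (r x)" by (auto simp: Ob_def stab_def)
    then have "\<not> p dvd card (Ob (r x))" using yy(2)[OF r(2)[OF x]] by simp
    then show ?thesis using card_act[OF g(1) x] g(2) ch by (simp add: of_nat_eq_0_iff_char_dvd)
  qed
  define U :: "'y \<Rightarrow> 'x \<Rightarrow> 'k" where "U = (\<lambda>y x. if y \<in> Ob x then inverse (of_nat (card (Ob x))) else 0)"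
  have "(\<Sum>y\<in>Y. U y x) = 1" if x: "x \<in> X" for x
  proof -
    have "(\<Sum>y\<in>Y. U y x) = (\<Sum>y\<in>Ob x. inverse (of_nat (card (Ob x))))"
      unfolding U_def using OY[OF x] gsetD(1)[OF Y] by (simp add: sum.If_cases Int_absorb1)
    then show ?thesis using nz[OF x] by simp
  qed
  moreover have "U (\<psi> g y) (\<phi> g x) = U y x" if "g \<in> carrier G" "y \<in> Y" "x \<in> X" for g y x
    using that by (simp add: U_def Ob_act card_act)
  ultimately show ?thesis by blast
qed

end

section \<open>Relative projectivity\<close>

context fgroup
begin

text \<open>
  By Higman's criterion this is projectivity relative to the point stabilisers of \<open>X\<close>; for \<open>X = G/H\<close>
  it is relative \<open>H\<close>-projectivity.
\<close>

definition proj :: "('a, 'k::field, 'v::ab_group_add) gmod \<Rightarrow> 'x set \<Rightarrow> ('a \<Rightarrow> 'x \<Rightarrow> 'x) \<Rightarrow> bool"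
  where "proj M X \<phi> \<longleftrightarrow> gset X \<phi> \<and> (\<exists>\<alpha>. fam M M X \<phi> \<alpha> \<and> (\<forall>v\<in>vecs M. (\<Sum>x\<in>X. \<alpha> x v) = v))"

lemma projE:
  assumes "proj M X \<phi>"
  obtains \<alpha> where "gset X \<phi>" "fam M M X \<phi> \<alpha>" "\<And>v. v \<in> vecs M \<Longrightarrow> (\<Sum>x\<in>X. \<alpha> x v) = v"
  using assms by (auto simp: proj_def)

lemma projI: "gset X \<phi> \<Longrightarrow> fam M M X \<phi> \<alpha> \<Longrightarrow> (\<And>v. v \<in> vecs M \<Longrightarrow> (\<Sum>x\<in>X. \<alpha> x v) = v) \<Longrightarrow> proj M X \<phi>"
  by (auto simp: proj_def)

lemma proj_glue:
  fixes M :: "('a, 'k::field, 'v::ab_group_add) gmod"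
    and M1 :: "('a, 'k, 'v1::ab_group_add) gmod" and M2 :: "('a, 'k, 'v2::ab_group_add) gmod"
  assumes m: "mdl M" "mdl M1" "mdl M2" and p: "proj M1 X \<phi>" "proj M2 X \<phi>"
    and h: "ghom M M1 \<pi>1" "ghom M1 M \<iota>1" "ghom M M2 \<pi>2" "ghom M2 M \<iota>2"
    and sum: "\<And>v. v \<in> vecs M \<Longrightarrow> \<iota>1 (\<pi>1 v) + \<iota>2 (\<pi>2 v) = v"
  shows "proj M X \<phi>"
proof -
  obtain \<alpha> where g: "gset X \<phi>" and a: "fam M1 M1 X \<phi> \<alpha>" "\<And>v. v \<in> vecs M1 \<Longrightarrow> (\<Sum>x\<in>X. \<alpha> x v) = v"
    using projE[OF p(1)] by blast
  obtain \<beta> where b: "fam M2 M2 X \<phi> \<beta>" "\<And>v. v \<in> vecs M2 \<Longrightarrow> (\<Sum>x\<in>X. \<beta> x v) = v"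
    using projE[OF p(2)] by blast
  note fa = famD[OF fam_comp[OF h(1) a(1) h(2)]] and fb = famD[OF fam_comp[OF h(3) b(1) h(4)]]
  note hl = ghomD(1)[OF h(1)] ghomD(1)[OF h(2)] ghomD(1)[OF h(3)] ghomD(1)[OF h(4)]
  show ?thesis
  proof (rule projI[OF g])
    show "fam M M X \<phi> (\<lambda>x v. \<iota>1 (\<alpha> x (\<pi>1 v)) + \<iota>2 (\<beta> x (\<pi>2 v)))"
      by (rule famI) (simp_all add: lin_plus[OF m(1) fa(1) fb(1)] fa(2) fb(2)
         lin_add[OF mdl_act_lin[OF m(1)] lin_in[OF fa(1)] lin_in[OF fb(1)]])
    fix v assume v: "v \<in> vecs M"
    note v1 = lin_in[OF hl(1) v] and v2 = lin_in[OF hl(3) v]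
    have "(\<Sum>x\<in>X. \<iota>1 (\<alpha> x (\<pi>1 v))) = \<iota>1 (\<pi>1 v)"
      using lin_sum[OF m(2,1) hl(2), of X "\<lambda>x. \<alpha> x (\<pi>1 v)"] lin_in[OF famD(1)[OF a(1)] v1] a(2)[OF v1] by simp
    moreover have "(\<Sum>x\<in>X. \<iota>2 (\<beta> x (\<pi>2 v))) = \<iota>2 (\<pi>2 v)"
      using lin_sum[OF m(3,1) hl(4), of X "\<lambda>x. \<beta> x (\<pi>2 v)"] lin_in[OF famD(1)[OF b(1)] v2] b(2)[OF v2] by simp
    ultimately show "(\<Sum>x\<in>X. \<iota>1 (\<alpha> x (\<pi>1 v)) + \<iota>2 (\<beta> x (\<pi>2 v))) = v"
      using sum[OF v] by (simp add: sum.distrib)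
  qed
qed

lemma proj_retr:
  assumes m: "mdl M" "mdl N" and r: "retr M N i q" and p: "proj N X \<phi>"
  shows "proj M X \<phi>"
proof -
  obtain \<alpha> where g: "gset X \<phi>" and a: "fam N N X \<phi> \<alpha>" "\<And>v. v \<in> vecs N \<Longrightarrow> (\<Sum>x\<in>X. \<alpha> x v) = v"
    using projE[OF p] by blast
  note i = retrD(1)[OF r] and q = retrD(2)[OF r]
  show ?thesis
  proof (rule projI[OF g fam_comp[OF i a(1) q]])
    fix v assume v: "v \<in> vecs M"
    note v1 = lin_in[OF ghomD(1)[OF i] v]
    show "(\<Sum>x\<in>X. q (\<alpha> x (i v))) = v"
      using lin_sum[OF m(2,1) ghomD(1)[OF q], of X "\<lambda>x. \<alpha> x (i v)"] lin_in[OF famD(1)[OF a(1)] v1] a(2)[OF v1] retrD(3)[OF r v] by simp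
  qed
qed

text \<open>The new family at \<open>y\<close> is the sum of the maps \<open>\<alpha> x\<close>
  weighted by \<open>U y x\<close>. Column sums 1 keep the total equal to the identity.\<close>

lemma proj_weights:
  fixes M :: "('a, 'k::field, 'v::ab_group_add) gmod" and U :: "'y \<Rightarrow> 'x \<Rightarrow> 'k"
  assumes M: "mdl M" and p: "proj M X \<phi>" and Y: "gset Y \<psi>"
    and U: "\<And>g y x. g \<in> carrier G \<Longrightarrow> y \<in> Y \<Longrightarrow> x \<in> X \<Longrightarrow> U (\<psi> g y) (\<phi> g x) = U y x"
    "\<And>x. x \<in> X \<Longrightarrow> (\<Sum>y\<in>Y. U y x) = 1"
  shows "proj M Y \<psi>"
proof -
  obtain \<alpha> where g: "gset X \<phi>" and a: "fam M M X \<phi> \<alpha>" "\<And>v. v \<in> vecs M \<Longrightarrow> (\<Sum>x\<in>X. \<alpha> x v) = v"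
    using projE[OF p] by blast
  note a1 = famD[OF a(1)]
  show ?thesis
  proof (rule projI[OF Y])
    show "fam M M Y \<psi> (\<lambda>y v. \<Sum>x\<in>X. scl M (U y x) (\<alpha> x v))"
    proof (rule famI)
      show "lin M M (\<lambda>v. \<Sum>x\<in>X. scl M (U y x) (\<alpha> x v))" for y
        by (intro lin_sumf[OF M] lin_smult[OF M] a1(1))
      fix h y v assume h: "h \<in> carrier G" and y: "y \<in> Y" and v: "v \<in> vecs M"
      have "(\<Sum>x\<in>X. scl M (U (\<psi> h y) x) (\<alpha> x (act M h v))) = (\<Sum>x\<in>X. scl M (U (\<psi> h y) (\<phi> h x)) (\<alpha> (\<phi> h x) (act M h v)))"
        by (rule gset_sum[OF g h, symmetric])
      also have "\<dots> = (\<Sum>x\<in>X. scl M (U y x) (act M h (\<alpha> x v)))"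
        using U(1)[OF h y] a1(2)[OF h _ v] by simp
      also have "\<dots> = act M h (\<Sum>x\<in>X. scl M (U y x) (\<alpha> x v))"
        using lin_lincomb[OF M M mdl_act_lin[OF M h], of X "\<lambda>x. \<alpha> x v"] lin_in[OF a1(1) v] by simp
      finally show "(\<Sum>x\<in>X. scl M (U (\<psi> h y) x) (\<alpha> x (act M h v))) = act M h (\<Sum>x\<in>X. scl M (U y x) (\<alpha> x v))" .
    qed
    fix v assume v: "v \<in> vecs M"
    have "(\<Sum>y\<in>Y. \<Sum>x\<in>X. scl M (U y x) (\<alpha> x v)) = (\<Sum>x\<in>X. scl M (\<Sum>y\<in>Y. U y x) (\<alpha> x v))"
      by (subst sum.swap) (simp add: scl_sum_left[OF M])
    then show "(\<Sum>y\<in>Y. \<Sum>x\<in>X. scl M (U y x) (\<alpha> x v)) = v"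
      using a(2)[OF v] U(2) by (simp add: scl_1[OF M])
  qed
qed

text \<open>In characteristic p, relative projectivity depends only on which p-subgroups have fixed
  points. In particular it passes from a subgroup to its Sylow p-subgroups, which is how vertices
  turn out to be p-groups.\<close>

lemma proj_family:
  fixes M :: "('a, 'k::field, 'v::ab_group_add) gmod" and X :: "'x set" and Y :: "'y set"
  assumes "prime p" "CHAR('k) = p" "mdl M" "proj M X \<phi>" "gset Y \<psi>"
    "\<And>Q x. p_subgroup G p Q \<Longrightarrow> x \<in> X \<Longrightarrow> \<forall>q\<in>Q. \<phi> q x = x \<Longrightarrow> \<exists>y\<in>Y. \<forall>q\<in>Q. \<psi> q y = y"
  shows "proj M Y \<psi>"
proof -
  have "gset X \<phi>" using assms(4) by (simp add: proj_def)
  then obtain U :: "'y \<Rightarrow> 'x \<Rightarrow> 'k" where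
    "\<forall>g\<in>carrier G. \<forall>y\<in>Y. \<forall>x\<in>X. U (\<psi> g y) (\<phi> g x) = U y x" "\<forall>x\<in>X. (\<Sum>y\<in>Y. U y x) = 1"
    using ex_weights[OF assms(1,2) _ assms(5), of X \<phi>] assms(6) by blast
  then show ?thesis by (intro proj_weights[OF assms(3-5), of U]) auto
qed

text \<open>Multiply the two expressions of the identity. The point stabilisers of the product are
  intersections of stabilisers, so this is the device for intersecting subgroups in a Mackey
  argument.\<close>

lemma proj_Times:
  fixes M :: "('a, 'k::field, 'v::ab_group_add) gmod"
  assumes M: "mdl M" and p: "proj M X \<phi>" "proj M Y \<psi>"
  shows "proj M (X \<times> Y) (\<lambda>g. map_prod (\<phi> g) (\<psi> g))"
proof -
  obtain \<alpha> where g: "gset X \<phi>" and a: "fam M M X \<phi> \<alpha>" "\<And>v. v \<in> vecs M \<Longrightarrow> (\<Sum>x\<in>X. \<alpha> x v) = v"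
    using projE[OF p(1)] by blast
  obtain \<beta> where g': "gset Y \<psi>" and b: "fam M M Y \<psi> \<beta>" "\<And>v. v \<in> vecs M \<Longrightarrow> (\<Sum>x\<in>Y. \<beta> x v) = v"
    using projE[OF p(2)] by blast
  note a1 = famD[OF a(1)] and b1 = famD[OF b(1)]
  show ?thesis
  proof (rule projI[OF gset_Times[OF g g']])
    show "fam M M (X \<times> Y) (\<lambda>g. map_prod (\<phi> g) (\<psi> g)) (\<lambda>(x, y) v. \<alpha> x (\<beta> y v))"
      by (rule famI) (auto simp: a1(2) b1(2) lin_in[OF b1(1)] intro!: lin_comp[OF b1(1) a1(1)])
    fix v assume v: "v \<in> vecs M"
    have "(\<Sum>xy\<in>X \<times> Y. (case xy of (x, y) \<Rightarrow> \<lambda>v. \<alpha> x (\<beta> y v)) v) = (\<Sum>y\<in>Y. \<Sum>x\<in>X. \<alpha> x (\<beta> y v))"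
      by (subst sum.swap) (simp add: sum.cartesian_product split_def)
    then show "(\<Sum>xy\<in>X \<times> Y. (case xy of (x, y) \<Rightarrow> \<lambda>v. \<alpha> x (\<beta> y v)) v) = v"
      using a(2)[OF lin_in[OF b1(1) v]] b(2)[OF v] by simp
  qed
qed

lemma perm_frame_proj:
  assumes M: "mdl M" and p: "perm_frame M X \<phi> e l" shows "proj M X \<phi>"
proof (rule projI[OF perm_frameD(1)[OF p]])
  note F = perm_frameD(2)[OF p]
  show "fam M M X \<phi> (\<lambda>x v. scl M (l x v) (e x))"
    by (rule famI) (simp_all add: lin_fscl[OF M frameD(3)[OF F] frameD(2)[OF F]] perm_frameD(3,5)[OF p]
       lin_scl[OF mdl_act_lin[OF M] frameD(2)[OF F]])
  show "(\<Sum>x\<in>X. scl M (l x v) (e x)) = v" if "v \<in> vecs M" for v by (rule frameD(4)[OF F that])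
qed

text \<open>Replacing each frame vector by its components under the family \<open>\<beta>\<close>
  refines the index set to a product. If \<open>Y\<close> has no S-fixed points, neither has the
  product.\<close>

lemma perm_frame_Times:
  assumes M: "mdl M" and p: "perm_frame M X \<phi> e l" and q: "proj M Y \<psi>"
  shows "\<exists>e l. perm_frame M (X \<times> Y) (\<lambda>g. map_prod (\<phi> g) (\<psi> g)) e l"
proof -
  obtain \<beta> where g': "gset Y \<psi>" and b: "fam M M Y \<psi> \<beta>" "\<And>v. v \<in> vecs M \<Longrightarrow> (\<Sum>x\<in>Y. \<beta> x v) = v"
    using projE[OF q] by blast
  note F = perm_frameD(2)[OF p] and g = perm_frameD(1)[OF p] and b1 = famD[OF b(1)]
  have "perm_frame M (X \<times> Y) (\<lambda>g. map_prod (\<phi> g) (\<psi> g)) (\<lambda>(x, y). \<beta> y (e x)) (\<lambda>(x, y). l x)"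
    unfolding perm_frame_def frame_def
  proof (intro conjI ballI)
    show "gset (X \<times> Y) (\<lambda>g. map_prod (\<phi> g) (\<psi> g))" by (rule gset_Times[OF g g'])
    then show "finite (X \<times> Y)" by (rule gsetD(1))
    show "(case xy of (x, y) \<Rightarrow> \<beta> y (e x)) \<in> vecs M" if "xy \<in> X \<times> Y" for xy
      using that by (auto intro!: lin_in[OF b1(1)] frameD(2)[OF F])
    show "lin M kmod (case xy of (x, y) \<Rightarrow> l x)" if "xy \<in> X \<times> Y" for xy
      using that by (auto intro!: frameD(3)[OF F])
    show "(case map_prod (\<phi> g) (\<psi> g) xy of (x, y) \<Rightarrow> \<beta> y (e x)) = act M g (case xy of (x, y) \<Rightarrow> \<beta> y (e x))"
      if "g \<in> carrier G" "xy \<in> X \<times> Y" for g xy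
      using that by (auto simp: perm_frameD(3)[OF p] b1(2) frameD(2)[OF F])
    show "fam M kmod (X \<times> Y) (\<lambda>g. map_prod (\<phi> g) (\<psi> g)) (\<lambda>(x, y). l x)"
      by (rule famI) (auto simp: perm_frameD(5)[OF p] intro!: frameD(3)[OF F])
    fix v assume v: "v \<in> vecs M"
    have "(\<Sum>y\<in>Y. scl M (l x v) (\<beta> y (e x))) = scl M (l x v) (e x)" if "x \<in> X" for x
      using b(2)[OF frameD(2)[OF F that]] by (simp add: scl_sum[OF M, symmetric])
    then have "(\<Sum>xy\<in>X \<times> Y. scl M (l (fst xy) v) (\<beta> (snd xy) (e (fst xy)))) = (\<Sum>x\<in>X. scl M (l x v) (e x))"
      using sum.cartesian_product[of "\<lambda>x y. scl M (l x v) (\<beta> y (e x))" Y X] by (simp add: split_def)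
    then show "v = (\<Sum>xy\<in>X \<times> Y. scl M ((case xy of (x, y) \<Rightarrow> l x) v) (case xy of (x, y) \<Rightarrow> \<beta> y (e x)))"
      using frameD(4)[OF F v] by (simp add: split_def)
  qed
  then show ?thesis by blast
qed

text \<open>A group element merely permutes the summands; over a set of cosets G/H this is the
  relative trace from H.\<close>

lemma fam_sum_ghom:
  assumes m: "mdl M" "mdl N" and g: "gset X \<phi>" and f: "fam M N X \<phi> f"
  shows "ghom M N (\<lambda>v. \<Sum>x\<in>X. f x v)"
  unfolding ghom_def
proof (intro conjI ballI)
  show "lin M N (\<lambda>v. \<Sum>x\<in>X. f x v)" by (intro lin_sumf[OF m(2)] famD(1)[OF f])
  fix h v assume h: "h \<in> carrier G" and v: "v \<in> vecs M"
  have "(\<Sum>x\<in>X. f x (act M h v)) = (\<Sum>x\<in>X. f (\<phi> h x) (act M h v))" by (rule gset_sum[OF g h, symmetric])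
  also have "\<dots> = (\<Sum>x\<in>X. act N h (f x v))" using famD(2)[OF f h _ v] by simp
  also have "\<dots> = act N h (\<Sum>x\<in>X. f x v)"
    using lin_sum[OF m(2,2) mdl_act_lin[OF m(2) h], of X "\<lambda>x. f x v"] lin_in[OF famD(1)[OF f] v] by simp
  finally show "(\<Sum>x\<in>X. f x (act M h v)) = act N h (\<Sum>x\<in>X. f x v)" .
qed

subsection \<open>Idempotents and Fitting's lemma\<close>

text \<open>For an idempotent \<open>r\<close> this is its image. The same formula gives the
  complement, from \<open>v - r v\<close>, and both stay in the type of \<open>M\<close>.\<close>

definition fixm :: "('a, 'k::field, 'v::ab_group_add) gmod \<Rightarrow> ('v \<Rightarrow> 'v) \<Rightarrow> ('a, 'k, 'v) gmod"
  where "fixm M r = M\<lparr>vecs := {v \<in> vecs M. r v = v}\<rparr>"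

lemma fixm_simps [simp]: "vecs (fixm M r) = {v \<in> vecs M. r v = v}" "scl (fixm M r) = scl M" "act (fixm M r) = act M"
  by (simp_all add: fixm_def)

context
  fixes M :: "('a, 'k::field, 'v::ab_group_add) gmod" and r
  assumes M: "mdl M" and r: "ghom M M r" and idem: "\<And>v. v \<in> vecs M \<Longrightarrow> r (r v) = r v"
begin

lemma mdl_fixm: "mdl (fixm M r)"
  unfolding fixm_def
  by (rule submdl[OF M, of _ r])
    (auto simp: mdl_0[OF M] lin_0[OF M M ghomD(1)[OF r]] mdl_add[OF M] lin_add[OF ghomD(1)[OF r]] mdl_scl[OF M]
      lin_scl[OF ghomD(1)[OF r]] mdl_act[OF M] ghomD[OF r] lin_in[OF ghomD(1)[OF r]] idem)

lemma retr_fixm: "retr (fixm M r) M (\<lambda>x. x) r"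
  unfolding retr_def ghom_def
  by (auto intro!: linI simp: lin_add[OF ghomD(1)[OF r]] lin_scl[OF ghomD(1)[OF r]] ghomD(2)[OF r] idem lin_in[OF ghomD(1)[OF r]])

lemma ghom_compl: "ghom M M (\<lambda>v. v - r v)"
  unfolding ghom_def
  using lin_minus[OF M lin_id ghomD(1)[OF r]] ghomD(2)[OF r]
  by (simp add: lin_diff[OF M M mdl_act_lin[OF M]] lin_in[OF ghomD(1)[OF r]])

lemma idem_compl: "v \<in> vecs M \<Longrightarrow> (v - r v) - r (v - r v) = v - r v"
  by (simp add: lin_diff[OF M M ghomD(1)[OF r]] lin_in[OF ghomD(1)[OF r]] idem)

end

lemma ginv_fixm:
  fixes M :: "('a, 'k::field, 'v::ab_group_add) gmod"
  assumes M: "mdl M" and r: "ghom M M r" and idem: "\<And>v. v \<in> vecs M \<Longrightarrow> r (r v) = r v"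
  shows "ginv M (direct_sum (fixm M r) (fixm M (\<lambda>v. v - r v))) (\<lambda>v. (r v, v - r v)) (\<lambda>vw. fst vw + snd vw)"
proof -
  note rl = ghomD(1)[OF r] and c = ghom_compl[OF M r idem]
  show ?thesis unfolding ginv_def ghom_def
    by (auto intro!: linI simp: lin_add[OF rl] lin_scl[OF rl] lin_in[OF rl] idem lin_in[OF ghomD(1)[OF c]]
       mdl_add[OF M] mdl_scl[OF M] scl_add[OF M] scl_diff[OF M] ghomD(2)[OF r] mdl_act[OF M] mdl_diff[OF M]
       lin_diff[OF M M rl] lin_diff[OF M M mdl_act_lin[OF M]] lin_add[OF mdl_act_lin[OF M]])
qed

lemma indec_idem:
  fixes M :: "('a, 'k::field, 'v::ab_group_add) gmod"
  assumes "indecomposable G M" and r: "ghom M M r" and idem: "\<And>v. v \<in> vecs M \<Longrightarrow> r (r v) = r v"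
  shows "(\<forall>v\<in>vecs M. r v = 0) \<or> (\<forall>v\<in>vecs M. r v = v)"
proof -
  have M: "mdl M" using assms(1) by (simp add: indecomposable_def)
  let ?A = "fixm M r" and ?B = "fixm M (\<lambda>v. v - r v)"
  have mA: "mdl ?A" by (rule mdl_fixm[OF M r idem])
  have mB: "mdl ?B" by (rule mdl_fixm[OF M ghom_compl[OF M r idem] idem_compl[OF M r idem]])
  have "gmod_iso G M (direct_sum ?A ?B)"
    using gmod_iso_iff[OF M mdl_direct_sum[OF mA mB]] ginv_fixm[OF M r idem] by blast
  then have *: "vecs ?A = {0} \<or> vecs ?B = {0}"
    using assms(1) mA mB unfolding indecomposable_def by blast
  have rA: "r v \<in> vecs ?A" "v - r v \<in> vecs ?B" if "v \<in> vecs M" for v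
    using that lin_in[OF ghomD(1)[OF r]] mdl_diff[OF M] by (auto simp: idem lin_diff[OF M M ghomD(1)[OF r]])
  from * show ?thesis
  proof
    assume "vecs ?A = {0}"
    then show ?thesis using rA(1) by blast
  next
    assume "vecs ?B = {0}"
    then have "v - r v = 0" if "v \<in> vecs M" for v using rA(2)[OF that] by blast
    then show ?thesis by simp
  qed
qed

lemma not_indec:
  fixes M :: "('a, 'k::field, 'v::ab_group_add) gmod"
  assumes M: "mdl M" and nz: "vecs M \<noteq> {0}" and ni: "\<not> indecomposable G M"
  obtains r where "ghom M M r" "\<And>v. v \<in> vecs M \<Longrightarrow> r (r v) = r v" "\<exists>v\<in>vecs M. r v \<noteq> v" "\<exists>v\<in>vecs M. r v \<noteq> 0"
proof -
  obtain A B :: "('a, 'k, 'v) gmod" where A: "mdl A" and B: "mdl B" and iso: "gmod_iso G M (direct_sum A B)"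
    and nzA: "vecs A \<noteq> {0}" and nzB: "vecs B \<noteq> {0}"
    using ni nz M unfolding indecomposable_def by blast
  obtain f h where fh: "ginv M (direct_sum A B) f h"
    using iso gmod_iso_iff[OF M mdl_direct_sum[OF A B]] by blast
  note f = ginvD(1)[OF fh] and h = ginvD(2)[OF fh]
  have s: "ghom (direct_sum A B) (direct_sum A B) (\<lambda>x. (fst x, 0))"
    using lin_0[OF B B mdl_act_lin[OF B]] by (auto simp: ghom_def mdl_0[OF B] scl_0'[OF B] intro!: linI)
  define r where "r = (\<lambda>v. h (fst (f v), 0))"
  have fv: "(fst (f v), 0) \<in> vecs (direct_sum A B)" if "v \<in> vecs M" for v
    using lin_in[OF ghomD(1)[OF f] that] mdl_0[OF B] by auto
  have "ghom M M r" unfolding r_def by (rule ghom_comp[OF ghom_comp[OF f s] h])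
  moreover have "r (r v) = r v" if "v \<in> vecs M" for v
    using ginvD(4)[OF fh fv[OF that]] by (simp add: r_def)
  moreover have "\<exists>v\<in>vecs M. r v \<noteq> v"
  proof -
    obtain b where b: "b \<in> vecs B" "b \<noteq> 0" using nzB mdl_0[OF B] by blast
    then have in2: "(0, b) \<in> vecs (direct_sum A B)" using mdl_0[OF A] by simp
    have "f (r (h (0, b))) \<noteq> f (h (0, b))"
      using ginvD(4)[OF fh in2] ginvD(4)[OF fh, of "(0, 0)"] b(2) mdl_0[OF A] mdl_0[OF B] by (simp add: r_def)
    then show ?thesis using lin_in[OF ghomD(1)[OF h] in2] by metis
  qed
  moreover have "\<exists>v\<in>vecs M. r v \<noteq> 0"
  proof -
    obtain a where a: "a \<in> vecs A" "a \<noteq> 0" using nzA mdl_0[OF A] by blast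
    then have in2: "(a, 0) \<in> vecs (direct_sum A B)" using mdl_0[OF B] by simp
    have "f (r (h (a, 0))) \<noteq> f 0"
      using ginvD(4)[OF fh in2] a(2) lin_0[OF M mdl_direct_sum[OF A B] ghomD(1)[OF f]] by (simp add: r_def zero_prod_def)
    then show ?thesis using lin_in[OF ghomD(1)[OF h] in2] by metis
  qed
  ultimately show ?thesis using that by blast
qed

definition gmod_dim :: "('a, 'k::field, 'v::ab_group_add) gmod \<Rightarrow> 'v set \<Rightarrow> nat"
  where "gmod_dim M V = vector_space.dim (scl M) V"

lemma gmod_dim_less:
  fixes M :: "('a, 'k::field, 'v::ab_group_add) gmod"
  assumes M: "mdl M" and V: "module.subspace (scl M) V" "V \<subset> W" "W \<subseteq> vecs M"
  shows "gmod_dim M V < gmod_dim M W"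
proof -
  interpret V: vector_space "scl M" by (rule mdl_vs[OF M])
  obtain I :: "nat set" and e l where F: "frame M I e l" using ex_frame[OF M] by blast
  have "v \<in> V.span (e ` I)" if "v \<in> vecs M" for v
  proof -
    have "(\<Sum>i\<in>I. scl M (l i v) (e i)) \<in> V.span (e ` I)"
      by (intro V.span_sum V.span_scale V.span_base) auto
    then show ?thesis using frameD(4)[OF F that] by simp
  qed
  then show ?thesis unfolding gmod_dim_def
    using V.dim_psubset_fin[OF V(1,2), of "e ` I"] V(3) frameD(1)[OF F] by blast
qed

lemma subspace_fixm:
  assumes M: "mdl M" and r: "ghom M M r" shows "module.subspace (scl M) {v \<in> vecs M. r v = v}"
proof -
  interpret V: vector_space "scl M" by (rule mdl_vs[OF M])
  show ?thesis
    by (auto simp: V.subspace_def mdl_0[OF M] lin_0[OF M M ghomD(1)[OF r]] mdl_add[OF M] lin_add[OF ghomD(1)[OF r]] mdl_scl[OF M] lin_scl[OF ghomD(1)[OF r]])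
qed

lemma fixm_gdim:
  assumes M: "mdl M" and r: "ghom M M r" and nr: "\<exists>v\<in>vecs M. r v \<noteq> v"
  shows "gmod_dim (fixm M r) (vecs (fixm M r)) < gmod_dim M (vecs M)"
  using gmod_dim_less[OF M subspace_fixm[OF M r], of "vecs M"] nr by (auto simp: gmod_dim_def)

lemma ghom_funpow: "ghom M M a \<Longrightarrow> ghom M M (a ^^ n)"
  by (induction n) (auto simp: ghom_id id_def o_def dest: ghom_comp)

text \<open>Images and kernels of the powers of \<open>a\<close> stabilise by dimension, so
  \<open>M\<close> is the direct sum of the image and the kernel of a high power. The projection
  onto that image is an equivariant idempotent, hence 0 or 1.\<close>

lemma fitting:
  fixes M :: "('a, 'k::field, 'v::ab_group_add) gmod"
  assumes ind: "indecomposable G M" and a: "ghom M M a"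
  shows "bij_betw a (vecs M) (vecs M) \<or> (\<exists>n. \<forall>v\<in>vecs M. (a ^^ n) v = 0)"
proof -
  have M: "mdl M" using ind by (simp add: indecomposable_def)
  interpret V: vector_space "scl M" by (rule mdl_vs[OF M])
  note an = ghomD(1)[OF ghom_funpow[OF a]]
  note al = ghomD(1)[OF a]
  define W where "W = (\<lambda>n. (a ^^ n) ` vecs M)"
  define K where "K = (\<lambda>n. {v \<in> vecs M. (a ^^ n) v = 0})"
  have sW: "V.subspace (W n)" for n
    unfolding V.subspace_def W_def
  proof (intro conjI ballI allI)
    show "0 \<in> (a ^^ n) ` vecs M" using lin_0[OF M M an] mdl_0[OF M] by (metis imageI)
  qed (auto simp: lin_add[OF an, symmetric] lin_scl[OF an, symmetric] mdl_add[OF M] mdl_scl[OF M])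
  have sK: "V.subspace (K n)" for n
    by (auto simp: V.subspace_def K_def mdl_0[OF M] lin_0[OF M M an] mdl_add[OF M] lin_add[OF an] mdl_scl[OF M] lin_scl[OF an])
  have Wsub: "W n \<subseteq> vecs M" "K n \<subseteq> vecs M" for n using lin_in[OF an] by (auto simp: W_def K_def)
  have Wdec: "W (Suc n) \<subseteq> W n" for n
    unfolding W_def using lin_in[OF al] by (auto simp: funpow_swap1)
  have Kinc: "K n \<subseteq> K (Suc n)" for n
    unfolding K_def using lin_0[OF M M al] by auto
  have "\<exists>n. W (Suc n) = W n"
  proof (rule ccontr)
    assume *: "\<nexists>n. W (Suc n) = W n"
    have "gmod_dim M (W n) + n \<le> gmod_dim M (W 0)" for n
    proof (induction n)
      case (Suc n)
      have "gmod_dim M (W (Suc n)) < gmod_dim M (W n)"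
        using gmod_dim_less[OF M sW _ Wsub(1)] Wdec[of n] * by blast
      then show ?case using Suc by simp
    qed simp
    from this[of "Suc (gmod_dim M (W 0))"] show False by simp
  qed
  then obtain n1 where n1: "W (Suc n1) = W n1" by blast
  have "\<exists>n. K (Suc n) = K n"
  proof (rule ccontr)
    assume *: "\<nexists>n. K (Suc n) = K n"
    have lt: "gmod_dim M (K n) < gmod_dim M (K (Suc n))" for n
      using gmod_dim_less[OF M sK _ Wsub(2)] Kinc[of n] * by blast
    have "n \<le> gmod_dim M (K n)" for n
    proof (induction n)
      case (Suc n)
      then show ?case using lt[of n] by simp
    qed simp
    moreover have "gmod_dim M (K n) < gmod_dim M (vecs M)" for n
    proof (rule gmod_dim_less[OF M sK _ subset_refl])
      show "K n \<subset> vecs M" using Kinc[of n] * Wsub(2)[of "Suc n"] by blast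
    qed
    ultimately show False using not_less by blast
  qed
  then obtain n2 where n2: "K (Suc n2) = K n2" by blast
  have Wst: "W (n1 + m) = W n1" for m
  proof (induction m)
    case (Suc m)
    have "W (Suc k) = a ` W k" for k by (auto simp: W_def image_image)
    then show ?case using Suc n1 by simp
  qed simp
  have Kst: "K (n2 + m) = K n2" for m
  proof (induction m)
    case (Suc m)
    have "v \<in> K (n2 + m)" if v: "v \<in> K (Suc (n2 + m))" for v
    proof -
      have vM: "v \<in> vecs M" and "(a ^^ Suc n2) ((a ^^ m) v) = 0"
        using v by (auto simp: K_def funpow_add)
      then have "(a ^^ m) v \<in> K (Suc n2)" using lin_in[OF an] by (auto simp: K_def)
      then show ?thesis using n2 vM by (auto simp: K_def funpow_add)
    qed
    then show ?case using Suc Kinc[of "n2 + m"] by auto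
  qed simp
  \<comment> \<open>Beyond both thresholds, so that images and kernels agree at \<open>N\<close> and
    \<open>N + N\<close>; positive, so that \<open>W N\<close> lies in the image of \<open>a\<close>
    and \<open>K N\<close> contains its kernel.\<close>
  define N where "N = Suc (n1 + n2)"
  define w where "w = a ^^ N"
  have ww: "w (w v) = (a ^^ (N + N)) v" for v by (simp add: w_def funpow_add)
  have wl: "lin M M w" and wg: "ghom M M w" using an ghom_funpow[OF a] by (simp_all add: w_def)
  have WN: "W N = w ` vecs M" "W (N + N) = W N"
    using Wst[of "Suc n2"] Wst[of "Suc n2 + N"] by (simp_all add: W_def w_def N_def add_ac)
  have KN: "K N = {v \<in> vecs M. w v = 0}" "K (N + N) = K N"
    using Kst[of "Suc n1"] Kst[of "Suc n1 + N"] by (simp_all add: K_def w_def N_def add_ac)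
  have ex: "\<exists>u. u \<in> W N \<and> v - u \<in> K N" if v: "v \<in> vecs M" for v
  proof -
    have "w v \<in> W (N + N)" using WN v by simp
    then obtain u where u: "u \<in> vecs M" "w v = w (w u)" by (auto simp: W_def ww)
    have "w (v - w u) = 0" using lin_diff[OF M M wl v lin_in[OF wl u(1)]] u(2) by simp
    then show ?thesis using u(1) v mdl_diff[OF M v lin_in[OF wl u(1)]] by (auto simp: WN(1) KN(1))
  qed
  have inter: "u = 0" if u1: "u \<in> W N" and u2: "u \<in> K N" for u
  proof -
    obtain x where x: "x \<in> vecs M" "u = w x" using u1 WN(1) by auto
    then have "w (w x) = 0" using u2 KN(1) by simp
    then have "x \<in> K (N + N)" using x(1) by (simp add: K_def ww)
    then show ?thesis using KN x by auto
  qed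
  have uniq: "u = u'" if u: "u \<in> W N" "v - u \<in> K N" "u' \<in> W N" "v - u' \<in> K N" for u u' v
  proof -
    have "u - u' \<in> W N" using V.subspace_diff[OF sW u(1,3)] .
    moreover have "u - u' \<in> K N" using V.subspace_diff[OF sK u(4,2)] by simp
    ultimately show ?thesis using inter[of "u - u'"] by simp
  qed
  \<comment> \<open>The component of \<open>v\<close> in the stable image. By \<open>uniq\<close>,
    each property of \<open>r\<close> follows once the expected value satisfies the two
    memberships.\<close>
  define r where "r = (\<lambda>v. SOME u. u \<in> W N \<and> v - u \<in> K N)"
  have r: "r v \<in> W N" "v - r v \<in> K N" if "v \<in> vecs M" for v
    using someI_ex[OF ex[OF that]] by (auto simp: r_def)
  have rl: "lin M M r"
  proof (rule linI)
    show "r (x + y) = r x + r y" if x: "x \<in> vecs M" and y: "y \<in> vecs M" for x y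
    proof (rule uniq[of _ "x + y", OF r[OF mdl_add[OF M x y]]])
      show "r x + r y \<in> W N" by (rule V.subspace_add[OF sW r(1)[OF x] r(1)[OF y]])
      show "x + y - (r x + r y) \<in> K N" using V.subspace_add[OF sK r(2)[OF x] r(2)[OF y]] by (simp add: algebra_simps)
    qed
    show "r (scl M c x) = scl M c (r x)" if x: "x \<in> vecs M" for c x
    proof (rule uniq[of _ "scl M c x", OF r[OF mdl_scl[OF M x]]])
      show "scl M c (r x) \<in> W N" by (rule V.subspace_scale[OF sW r(1)[OF x]])
      show "scl M c x - scl M c (r x) \<in> K N" using V.subspace_scale[OF sK r(2)[OF x], of c] by (simp add: scl_diff[OF M])
    qed
  qed (use r(1) Wsub(1) in blast)
  have rg: "ghom M M r" unfolding ghom_def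
  proof (intro conjI ballI rl)
    fix g v assume g: "g \<in> carrier G" and v: "v \<in> vecs M"
    show "r (act M g v) = act M g (r v)"
    proof (rule uniq[of _ "act M g v", OF r[OF mdl_act[OF M g v]]])
      obtain x where x: "x \<in> vecs M" "r v = w x" using r(1)[OF v] WN(1) by auto
      show "act M g (r v) \<in> W N" using ghomD(2)[OF wg g x(1)] mdl_act[OF M g x(1)] x(2) WN(1) by (metis imageI)
      have "act M g (v - r v) \<in> K N"
        using r(2)[OF v] ghomD(2)[OF wg g] mdl_act[OF M g] lin_0[OF M M mdl_act_lin[OF M g]] by (auto simp: KN(1))
      then show "act M g v - act M g (r v) \<in> K N"
        using lin_diff[OF M M mdl_act_lin[OF M g] v lin_in[OF rl v]] by simp
    qed
  qed
  have rr: "r (r v) = r v" if v: "v \<in> vecs M" for v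
  proof (rule uniq[of _ "r v", OF r[OF lin_in[OF rl v]] r(1)[OF v]])
    show "r v - r v \<in> K N" using V.subspace_0[OF sK] by simp
  qed
  from indec_idem[OF ind rg rr] show ?thesis
  proof
    assume 0: "\<forall>v\<in>vecs M. r v = 0"
    have "(a ^^ N) v = 0" if v: "v \<in> vecs M" for v
      using r(2)[OF v] 0 v by (simp add: K_def)
    then show ?thesis by blast
  next
    assume 1: "\<forall>v\<in>vecs M. r v = v"
    have "vecs M \<subseteq> W N" using r(1) 1 by force
    moreover have "W N \<subseteq> W 1" unfolding W_def N_def using lin_in[OF an] by auto
    ultimately have "a ` vecs M = vecs M" using Wsub(1)[of 1] by (auto simp: W_def)
    moreover have "inj_on a (vecs M)"
    proof (rule inj_onI)
      fix x y assume x: "x \<in> vecs M" and y: "y \<in> vecs M" and eq: "a x = a y"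
      have "a (x - y) = 0" using lin_diff[OF M M al x y] eq by simp
      then have "w (x - y) = 0" using lin_0[OF M M an] by (simp add: w_def N_def funpow_swap1)
      then have "x - y \<in> K N" "x - y \<in> W N" using mdl_diff[OF M x y] \<open>vecs M \<subseteq> W N\<close> by (auto simp: KN(1))
      then show "x = y" using inter by force
    qed
    ultimately show ?thesis by (simp add: bij_betw_def)
  qed
qed

text \<open>The endomorphism ring is local: if \<open>a\<close> is not bijective it is nilpotent,
  and then \<open>b\<close>, which is 1 - a, has an inverse.\<close>

lemma indec_local:
  fixes M :: "('a, 'k::field, 'v::ab_group_add) gmod"
  assumes ind: "indecomposable G M" and a: "ghom M M a" and b: "ghom M M b"
    and ab: "\<And>v. v \<in> vecs M \<Longrightarrow> a v + b v = v"
  shows "\<exists>c. ghom M M c \<and> ((\<forall>v\<in>vecs M. a (c v) = v) \<or> (\<forall>v\<in>vecs M. b (c v) = v))"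
proof -
  have M: "mdl M" using ind by (simp add: indecomposable_def)
  from fitting[OF ind a] show ?thesis
  proof
    assume "bij_betw a (vecs M) (vecs M)"
    from ginvD(2,4)[OF bij_ginv[OF M M a this]] show ?thesis by blast
  next
    assume "\<exists>n. \<forall>v\<in>vecs M. (a ^^ n) v = 0"
    then obtain n where n: "\<And>v. v \<in> vecs M \<Longrightarrow> (a ^^ n) v = 0" by blast
    \<comment> \<open>The geometric series, inverse to 1 - a because \<open>a ^^ n\<close>
      vanishes.\<close>
    define c where "c = (\<lambda>v. \<Sum>i<n. (a ^^ i) v)"
    note an = ghomD[OF ghom_funpow[OF a]]
    have "fam M M {..<n} (\<lambda>g z. z) (\<lambda>i. a ^^ i)" by (rule famI) (simp_all add: an)
    then have c: "ghom M M c" unfolding c_def using fam_sum_ghom[OF M M gset_point[of "{..<n}"]] by simp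
    have "b (c v) = v" if v: "v \<in> vecs M" for v
    proof -
      have "a (c v) = (\<Sum>i<n. (a ^^ Suc i) v)"
        unfolding c_def using lin_sum[OF M M ghomD(1)[OF a], of "{..<n}" "\<lambda>i. (a ^^ i) v"] lin_in[OF an(1) v] by simp
      moreover have "(\<Sum>i<n. (a ^^ Suc i) v) - (\<Sum>i<n. (a ^^ i) v) = - v"
        using sum_lessThan_telescope[of "\<lambda>i. (a ^^ i) v" n] n[OF v] by (simp add: sum_subtractf)
      ultimately have "a (c v) + v = c v" unfolding c_def by (simp add: algebra_simps)
      then show ?thesis using ab[OF lin_in[OF ghomD(1)[OF c] v]] by (metis add_left_cancel)
    qed
    then show ?thesis using c by blast
  qed
qed

text \<open>Split the identity into the sum over one orbit and the sum over the rest. One of the two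
  has a right inverse by locality, and composing the family with that inverse makes its sum the
  identity again.\<close>

lemma proj_orbit:
  fixes M :: "('a, 'k::field, 'v::ab_group_add) gmod"
  assumes ind: "indecomposable G M" and p: "proj M X \<phi>"
  shows "\<exists>x\<in>X. proj M (orb \<phi> x) \<phi>"
  using p
proof (induction "card X" arbitrary: X rule: less_induct)
  case less
  have M: "mdl M" using ind by (simp add: indecomposable_def)
  obtain \<alpha> where g: "gset X \<phi>" and \<alpha>: "fam M M X \<phi> \<alpha>" "\<And>v. v \<in> vecs M \<Longrightarrow> (\<Sum>x\<in>X. \<alpha> x v) = v"
    using projE[OF less(2)] by blast
  have "X \<noteq> {}"
  proof
    assume "X = {}"
    then have "v = 0" if "v \<in> vecs M" for v using \<alpha>(2)[OF that] by simp
    then show False using ind mdl_0[OF M] by (auto simp: indecomposable_def)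
  qed
  then obtain x where x: "x \<in> X" by blast
  let ?A = "orb \<phi> x" and ?B = "X - orb \<phi> x"
  have fA: "fam M M ?A \<phi> \<alpha>" and fB: "fam M M ?B \<phi> \<alpha>"
    using \<alpha>(1) orb_subset[OF g x] by (auto simp: fam_def)
  note gA = gset_orb[OF g x] and gB = gset_orb_compl[OF g x]
  have "(\<Sum>x\<in>?A. \<alpha> x v) + (\<Sum>x\<in>?B. \<alpha> x v) = v" if "v \<in> vecs M" for v
    using \<alpha>(2)[OF that] sum.subset_diff[OF orb_subset[OF g x] gsetD(1)[OF g], of "\<lambda>x. \<alpha> x v"] by (simp add: add.commute)
  from indec_local[OF ind fam_sum_ghom[OF M M gA fA] fam_sum_ghom[OF M M gB fB] this]
  obtain c where c: "ghom M M c" and d: "(\<forall>v\<in>vecs M. (\<Sum>x\<in>?A. \<alpha> x (c v)) = v) \<or> (\<forall>v\<in>vecs M. (\<Sum>x\<in>?B. \<alpha> x (c v)) = v)"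
    by blast
  from d show ?case
  proof
    assume "\<forall>v\<in>vecs M. (\<Sum>x\<in>?A. \<alpha> x (c v)) = v"
    then have "proj M ?A \<phi>" using projI[OF gA fam_comp[OF c fA ghom_id]] by simp
    then show ?thesis using x by blast
  next
    assume "\<forall>v\<in>vecs M. (\<Sum>x\<in>?B. \<alpha> x (c v)) = v"
    then have "proj M ?B \<phi>" using projI[OF gB fam_comp[OF c fB ghom_id]] by simp
    moreover have "card ?B < card X" using x orb_self[OF g x] gsetD(1)[OF g] by (intro psubset_card_mono) auto
    ultimately show ?thesis using less(1) by blast
  qed
qed

end

subsection \<open>Induced modules and vertices\<close>

context fgroup
begin

text \<open>The maps \<open>\<alpha> C\<close> are orthogonal idempotents permuted by the group, and
  the translate belonging to \<open>C\<close> of the image of \<open>\<alpha> H\<close> is the image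
  of \<open>\<alpha> C\<close>.\<close>

lemma induced_fromI:
  fixes L :: "('a, 'k::field, 'v::ab_group_add) gmod"
  assumes L: "mdl L" and H: "subgroup H G" and f: "fam L L (lcosets H) (\<lambda>g C. g <# C) \<alpha>"
    and sum: "\<And>v. v \<in> vecs L \<Longrightarrow> (\<Sum>C\<in>lcosets H. \<alpha> C v) = v"
    and orth: "\<And>C D v. C \<in> lcosets H \<Longrightarrow> D \<in> lcosets H \<Longrightarrow> v \<in> vecs L \<Longrightarrow> \<alpha> C (\<alpha> D v) = (if C = D then \<alpha> D v else 0)"
  shows "induced_from G H (\<alpha> H ` vecs L) L"
  unfolding induced_from_def
proof (intro conjI ballI)
  interpret V: vector_space "scl L" by (rule mdl_vs[OF L])
  note f1 = famD[OF f]
  note HH = lcoset_self[OF H]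
  show "mdl L" by (rule L)
  show "\<alpha> H ` vecs L \<subseteq> vecs L" using lin_in[OF f1(1)[OF HH]] by blast
  show "V.subspace (\<alpha> H ` vecs L)"
    unfolding V.subspace_def
  proof (intro conjI ballI allI)
    show "0 \<in> \<alpha> H ` vecs L" using lin_0[OF L L f1(1)[OF HH]] mdl_0[OF L] by (metis imageI)
  qed (auto simp: lin_add[OF f1(1)[OF HH], symmetric] lin_scl[OF f1(1)[OF HH], symmetric] mdl_add[OF L] mdl_scl[OF L])
  show "act L h v \<in> \<alpha> H ` vecs L" if h: "h \<in> H" and v: "v \<in> \<alpha> H ` vecs L" for h v
  proof -
    have hG: "h \<in> carrier G" using h subgroup.mem_carrier[OF H] by blast
    obtain x where x: "x \<in> vecs L" "v = \<alpha> H x" using v by blast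
    have "act L h v = \<alpha> H (act L h x)" using f1(2)[OF hG HH x(1)] lcoset_fix_self[OF H hG] h x(2) by simp
    then show ?thesis using mdl_act[OF L hG x(1)] by blast
  qed
  have rep: "\<exists>g\<in>carrier G. g \<in> C \<and> C = g <# H" if "C \<in> lcosets H" for C
    using lcosetsE[OF that] lcos_self[OF _ H] by blast
  show "\<exists>!F. F \<in> (\<Pi>\<^sub>E C\<in>lcosets H. \<Union>g\<in>C. act L g ` \<alpha> H ` vecs L) \<and> x = (\<Sum>C\<in>lcosets H. F C)"
    if x: "x \<in> vecs L" for x
  proof (rule ex1I[of _ "\<lambda>C\<in>lcosets H. \<alpha> C x"], intro conjI)
    show "(\<lambda>C\<in>lcosets H. \<alpha> C x) \<in> (\<Pi>\<^sub>E C\<in>lcosets H. \<Union>g\<in>C. act L g ` \<alpha> H ` vecs L)"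
    proof (rule restrict_PiE_iff[THEN iffD2], intro ballI)
      fix C assume C: "C \<in> lcosets H"
      obtain g where g: "g \<in> carrier G" "g \<in> C" "C = g <# H" using rep[OF C] by blast
      have "\<alpha> C x = act L g (\<alpha> H (act L (inv g) x))"
        using f1(2)[OF g(1) HH mdl_act[OF L inv_closed[OF g(1)] x]] g(3) by (simp add: mdl_act_inv'[OF L g(1) x])
      then show "\<alpha> C x \<in> (\<Union>g\<in>C. act L g ` \<alpha> H ` vecs L)"
        using g(2) mdl_act[OF L inv_closed[OF g(1)] x] by blast
    qed
    show "x = (\<Sum>C\<in>lcosets H. (\<lambda>C\<in>lcosets H. \<alpha> C x) C)" using sum[OF x] by simp
  next
    fix F assume F: "F \<in> (\<Pi>\<^sub>E C\<in>lcosets H. \<Union>g\<in>C. act L g ` \<alpha> H ` vecs L) \<and> x = (\<Sum>C\<in>lcosets H. F C)"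
    have FC: "\<exists>w\<in>vecs L. F C = \<alpha> C w" if C: "C \<in> lcosets H" for C
    proof -
      obtain g v where g: "g \<in> C" "v \<in> vecs L" "F C = act L g (\<alpha> H v)" using F C by (auto dest!: PiE_mem)
      obtain a where a: "a \<in> carrier G" "C = a <# H" using rep[OF C] by blast
      have gG: "g \<in> carrier G" using g(1) lcoset_sub[OF H C] by blast
      have "C = g <# H" using a g(1) l_repr_independence[OF _ a(1) H, of g] by simp
      then show ?thesis using f1(2)[OF gG HH g(2)] g(3) mdl_act[OF L gG g(2)] by metis
    qed
    show "F = (\<lambda>C\<in>lcosets H. \<alpha> C x)"
    proof (rule PiE_ext[of _ "lcosets H" "\<lambda>_. UNIV"])
      show "F \<in> lcosets H \<rightarrow>\<^sub>E UNIV" "(\<lambda>C\<in>lcosets H. \<alpha> C x) \<in> lcosets H \<rightarrow>\<^sub>E UNIV" using F by (auto simp: PiE_def)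
      fix D assume D: "D \<in> lcosets H"
      have Fin: "F C \<in> vecs L" if "C \<in> lcosets H" for C using FC[OF that] lin_in[OF f1(1)[OF that]] by auto
      have "\<alpha> D x = (\<Sum>C\<in>lcosets H. \<alpha> D (F C))"
        using lin_sum[OF L L f1(1)[OF D], of "lcosets H" F] Fin F by simp
      also have "\<dots> = (\<Sum>C\<in>lcosets H. if D = C then F C else 0)"
      proof (rule sum.cong[OF refl])
        fix C assume C: "C \<in> lcosets H"
        obtain w where "w \<in> vecs L" "F C = \<alpha> C w" using FC[OF C] by blast
        then show "\<alpha> D (F C) = (if D = C then F C else 0)" using orth[OF D C] by simp
      qed
      also have "\<dots> = F D" using D finite_lcosets[OF H] by simp
      finally show "F D = (\<lambda>C\<in>lcosets H. \<alpha> C x) D" using D by simp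
    qed
  qed
qed

text \<open>The family consists of the projections onto the translates. Uniqueness of the
  decomposition, in the form \<open>uniq\<close>, gives linearity and equivariance.\<close>

lemma induced_from_proj:
  fixes L :: "('a, 'k::field, 'v::ab_group_add) gmod"
  assumes H: "subgroup H G" and ind: "induced_from G H V L"
  shows "proj L (lcosets H) (\<lambda>g C. g <# C)"
proof -
  have L: "mdl L" and V: "V \<subseteq> vecs L" and sV: "module.subspace (scl L) V"
    and hV: "\<And>h v. h \<in> H \<Longrightarrow> v \<in> V \<Longrightarrow> act L h v \<in> V"
    using ind by (auto simp: induced_from_def)
  define P where "P = (\<lambda>C. \<Union>g\<in>C. act L g ` V)"
  have ex1: "\<exists>!F. F \<in> (\<Pi>\<^sub>E C\<in>lcosets H. P C) \<and> x = (\<Sum>C\<in>lcosets H. F C)" if "x \<in> vecs L" for x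
    using ind that unfolding induced_from_def P_def by blast
  interpret V: vector_space "scl L" by (rule mdl_vs[OF L])
  have Pa: "P (a <# H) = act L a ` V" if a: "a \<in> carrier G" for a
  proof
    show "act L a ` V \<subseteq> P (a <# H)" unfolding P_def using lcos_self[OF a H] by blast
    show "P (a <# H) \<subseteq> act L a ` V"
    proof
      fix y assume "y \<in> P (a <# H)"
      then obtain h v where h: "h \<in> H" "v \<in> V" "y = act L (a \<otimes> h) v" by (auto simp: P_def l_coset_def)
      then have "y = act L a (act L h v)" using mdl_act_mult[OF L a, of h v] subgroup.mem_carrier[OF H] V by auto
      then show "y \<in> act L a ` V" using hV[OF h(1,2)] by blast
    qed
  qed
  have Psub: "P C \<subseteq> vecs L" "\<And>x y. x \<in> P C \<Longrightarrow> y \<in> P C \<Longrightarrow> x + y \<in> P C" "\<And>c x. x \<in> P C \<Longrightarrow> scl L c x \<in> P C"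
    if C: "C \<in> lcosets H" for C
  proof -
    obtain a where a: "a \<in> carrier G" "C = a <# H" using lcosetsE[OF C] by blast
    note la = mdl_act_lin[OF L a(1)]
    show "P C \<subseteq> vecs L" unfolding a(2) Pa[OF a(1)] using lin_in[OF la] V by blast
    show "x + y \<in> P C" if xy: "x \<in> P C" "y \<in> P C" for x y
    proof -
      obtain v w where vw: "v \<in> V" "w \<in> V" "x = act L a v" "y = act L a w" using xy unfolding a(2) Pa[OF a(1)] by blast
      then have "x + y = act L a (v + w)" using lin_add[OF la, of v w] V by (auto simp: subset_iff)
      then show ?thesis using V.subspace_add[OF sV vw(1,2)] unfolding a(2) Pa[OF a(1)] by blast
    qed
    show "scl L c x \<in> P C" if x: "x \<in> P C" for c x
    proof -
      obtain v where v: "v \<in> V" "x = act L a v" using x unfolding a(2) Pa[OF a(1)] by blast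
      then have "scl L c x = act L a (scl L c v)" using lin_scl[OF la, of v c] V by (auto simp: subset_iff)
      then show ?thesis using V.subspace_scale[OF sV v(1)] unfolding a(2) Pa[OF a(1)] by blast
    qed
  qed
  have Pact: "act L g x \<in> P (g <# C)" if g: "g \<in> carrier G" and C: "C \<in> lcosets H" and x: "x \<in> P C" for g C x
  proof -
    obtain a where a: "a \<in> carrier G" "C = a <# H" using lcosetsE[OF C] by blast
    obtain v where v: "v \<in> V" "x = act L a v" using x unfolding a(2) Pa[OF a(1)] by blast
    have "act L g x = act L (g \<otimes> a) v" using v mdl_act_mult[OF L g a(1)] V by auto
    moreover have "g <# C = (g \<otimes> a) <# H" using lcos_m_assoc[OF subgroup.subset[OF H] g a(1)] a(2) by simp
    ultimately show ?thesis using Pa[OF m_closed[OF g a(1)]] v(1) by auto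
  qed
  define \<alpha> where "\<alpha> = (\<lambda>C x. (THE F. F \<in> (\<Pi>\<^sub>E C\<in>lcosets H. P C) \<and> x = (\<Sum>C\<in>lcosets H. F C)) C)"
  have \<alpha>: "C \<in> lcosets H \<Longrightarrow> \<alpha> C x \<in> P C" "(\<Sum>C\<in>lcosets H. \<alpha> C x) = x" if x: "x \<in> vecs L" for C x
    using theI'[OF ex1[OF x]] unfolding \<alpha>_def by (auto dest: PiE_mem)
  have uniq: "\<alpha> C x = F C" if x: "x \<in> vecs L" and F: "\<And>C. C \<in> lcosets H \<Longrightarrow> F C \<in> P C"
     and s: "(\<Sum>C\<in>lcosets H. F C) = x" and C: "C \<in> lcosets H" for x F C
  proof -
    have "(THE F. F \<in> (\<Pi>\<^sub>E C\<in>lcosets H. P C) \<and> x = (\<Sum>C\<in>lcosets H. F C)) = restrict F (lcosets H)"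
      by (rule the1_equality[OF ex1[OF x]]) (use F s in auto)
    then show ?thesis using C by (simp add: \<alpha>_def)
  qed
  have gs: "gset (lcosets H) (\<lambda>g C. g <# C)" by (rule gset_lcosets[OF H])
  have \<alpha>L: "\<alpha> C x \<in> vecs L" if "C \<in> lcosets H" "x \<in> vecs L" for C x
    using \<alpha>(1)[OF that(2,1)] Psub(1)[OF that(1)] by blast
  show ?thesis
  proof (rule projI[OF gs])
    show "fam L L (lcosets H) (\<lambda>g C. g <# C) \<alpha>"
    proof (rule famI)
      fix C assume C: "C \<in> lcosets H"
      show "lin L L (\<alpha> C)"
      proof (rule linI)
        show "\<alpha> C (x + y) = \<alpha> C x + \<alpha> C y" if "x \<in> vecs L" "y \<in> vecs L" for x y
          using \<alpha> that Psub(2) by (intro uniq[OF mdl_add[OF L that] _ _ C]) (auto simp: sum.distrib)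
        show "\<alpha> C (scl L c x) = scl L c (\<alpha> C x)" if "x \<in> vecs L" for c x
          using \<alpha> that Psub(3) by (intro uniq[OF mdl_scl[OF L that] _ _ C]) (auto simp: scl_sum[OF L, symmetric])
      qed (rule \<alpha>L[OF C])
    next
      fix g C x assume g: "g \<in> carrier G" and C: "C \<in> lcosets H" and x: "x \<in> vecs L"
      note g' = inv_closed[OF g]
      have "\<alpha> (g <# C) (act L g x) = act L g (\<alpha> (inv g <# (g <# C)) x)"
      proof (rule uniq[OF mdl_act[OF L g x] _ _ gsetD(2)[OF gs g C]])
        show "act L g (\<alpha> (inv g <# D) x) \<in> P D" if D: "D \<in> lcosets H" for D
          using Pact[OF g gsetD(2)[OF gs g' D] \<alpha>(1)[OF x gsetD(2)[OF gs g' D]]] gset_inv(2)[OF gs g D] by simp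
        have "(\<Sum>D\<in>lcosets H. act L g (\<alpha> (inv g <# D) x)) = (\<Sum>D\<in>lcosets H. act L g (\<alpha> D x))"
          using gset_sum[OF gs g', of "\<lambda>D. act L g (\<alpha> D x)"] .
        also have "\<dots> = act L g (\<Sum>D\<in>lcosets H. \<alpha> D x)"
          using lin_sum[OF L L mdl_act_lin[OF L g], of "lcosets H" "\<lambda>D. \<alpha> D x"] \<alpha>L[OF _ x] by simp
        finally show "(\<Sum>D\<in>lcosets H. act L g (\<alpha> (inv g <# D) x)) = act L g x" using \<alpha>(2)[OF x] by simp
      qed
      then show "\<alpha> (g <# C) (act L g x) = act L g (\<alpha> C x)" using gset_inv(1)[OF gs g C] by simp
    qed
    show "(\<Sum>C\<in>lcosets H. \<alpha> C v) = v" if "v \<in> vecs L" for v by (rule \<alpha>(2)[OF that])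
  qed
qed

text \<open>This is kX tensor M with diagonal action. For X = G/H it is the restriction of
  \<open>M\<close> to \<open>H\<close> induced back to G; for \<open>M = kmod\<close> it is the
  permutation module.\<close>

definition Ind :: "'x set \<Rightarrow> ('a \<Rightarrow> 'x \<Rightarrow> 'x) \<Rightarrow> ('a, 'k::field, 'v::ab_group_add) gmod \<Rightarrow> ('a, 'k, 'x \<Rightarrow> 'v) gmod"
  where "Ind X \<phi> M =
    \<lparr>vecs = {F. \<forall>x. (x \<in> X \<longrightarrow> F x \<in> vecs M) \<and> (x \<notin> X \<longrightarrow> F x = 0)}, scl = (\<lambda>c F x. scl M c (F x)),
     act = (\<lambda>g F x. if x \<in> X then act M g (F (\<phi> (inv g) x)) else 0)\<rparr>"

lemma Ind_simps: "F \<in> vecs (Ind X \<phi> M) \<longleftrightarrow> (\<forall>x. (x \<in> X \<longrightarrow> F x \<in> vecs M) \<and> (x \<notin> X \<longrightarrow> F x = 0))"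
  "scl (Ind X \<phi> M) = (\<lambda>c F x. scl M c (F x))"
  "act (Ind X \<phi> M) g F = (\<lambda>x. if x \<in> X then act M g (F (\<phi> (inv g) x)) else 0)"
  by (simp_all add: Ind_def)

context
  fixes M :: "('a, 'k::field, 'v::ab_group_add) gmod" and X :: "'x set" and \<phi>
  assumes M: "mdl M" and X: "gset X \<phi>"
begin

lemma mdl_Ind: "mdl (Ind X \<phi> M)"
proof -
  obtain I :: "nat set" and e l where F: "frame M I e l" using ex_frame[OF M] by blast
  have fX: "finite X" by (rule gsetD(1)[OF X])
  show ?thesis
  proof (rule mdlI_frame)
    show "vector_space (scl (Ind X \<phi> M))" unfolding Ind_simps by (rule vs_fun_scl[OF mdl_vs[OF M]])
    show "lin (Ind X \<phi> M) (Ind X \<phi> M) (act (Ind X \<phi> M) g)" if g: "g \<in> carrier G" for g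
      using gsetD(2)[OF X inv_closed[OF g]]
      by (intro linI) (auto simp: Ind_simps fun_eq_iff lin_add[OF mdl_act_lin[OF M g]] lin_scl[OF mdl_act_lin[OF M g]] mdl_act[OF M g] scl_0'[OF M])
    show "frame (Ind X \<phi> M) (X \<times> I) (\<lambda>(x, i) y. if y = x then e i else 0) (\<lambda>(x, i) F. l i (F x))"
      unfolding frame_def
    proof (intro conjI ballI)
      show "finite (X \<times> I)" using fX frameD(1)[OF F] by simp
      show "(case xi of (x, i) \<Rightarrow> \<lambda>y. if y = x then e i else 0) \<in> vecs (Ind X \<phi> M)" if "xi \<in> X \<times> I" for xi
        using that frameD(2)[OF F] mdl_0[OF M] by (auto simp: Ind_simps)
      show "lin (Ind X \<phi> M) kmod (case xi of (x, i) \<Rightarrow> \<lambda>F. l i (F x))" if "xi \<in> X \<times> I" for xi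
        using that by (auto intro!: linI simp: Ind_simps lin_add[OF frameD(3)[OF F]] lin_scl[OF frameD(3)[OF F]])
      fix v assume v: "v \<in> vecs (Ind X \<phi> M)"
      show "v = (\<Sum>xi\<in>X \<times> I. scl (Ind X \<phi> M) ((case xi of (x, i) \<Rightarrow> \<lambda>F. l i (F x)) v) (case xi of (x, i) \<Rightarrow> \<lambda>y. if y = x then e i else 0))"
      proof
        fix y
        have "(\<Sum>xi\<in>X \<times> I. scl (Ind X \<phi> M) ((case xi of (x, i) \<Rightarrow> \<lambda>F. l i (F x)) v) (case xi of (x, i) \<Rightarrow> \<lambda>y. if y = x then e i else 0)) y
          = (\<Sum>x\<in>X. \<Sum>i\<in>I. if y = x then scl M (l i (v x)) (e i) else 0)"
          by (simp add: sum_fun_apply Ind_simps split_def sum.cartesian_product if_distrib scl_0'[OF M] cong: if_cong)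
        also have "\<dots> = (\<Sum>x\<in>X. if y = x then v x else 0)"
          using frameD(4)[OF F] v by (intro sum.cong) (auto simp: Ind_simps)
        also have "\<dots> = v y" using v fX by (simp add: Ind_simps)
        finally show "v y = (\<Sum>xi\<in>X \<times> I. scl (Ind X \<phi> M) ((case xi of (x, i) \<Rightarrow> \<lambda>F. l i (F x)) v) (case xi of (x, i) \<Rightarrow> \<lambda>y. if y = x then e i else 0)) y" by simp
      qed
    qed
    show "act (Ind X \<phi> M) (g \<otimes> h) v = act (Ind X \<phi> M) g (act (Ind X \<phi> M) h v)"
      if g: "g \<in> carrier G" and h: "h \<in> carrier G" and v: "v \<in> vecs (Ind X \<phi> M)" for g h v
      using v gsetD(2,4)[OF X] by (auto simp: Ind_simps fun_eq_iff g h inv_mult_group mdl_act_mult[OF M])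
    show "act (Ind X \<phi> M) \<one> v = v" if "v \<in> vecs (Ind X \<phi> M)" for v
      using that gsetD(3)[OF X] by (auto simp: Ind_simps fun_eq_iff mdl_act_one[OF M])
  qed (auto simp: Ind_simps mdl_0[OF M] mdl_add[OF M] mdl_scl[OF M] scl_0'[OF M])
qed

lemma Ind_fam: "fam (Ind X \<phi> M) (Ind X \<phi> M) X \<phi> (\<lambda>x F y. if y = x then F y else 0)"
proof (rule famI)
  show "lin (Ind X \<phi> M) (Ind X \<phi> M) (\<lambda>F y. if y = x then F y else 0)" if "x \<in> X" for x
    using that mdl_0[OF M] by (intro linI) (auto simp: Ind_simps fun_eq_iff scl_0'[OF M])
  show "(\<lambda>y. if y = \<phi> g x then act (Ind X \<phi> M) g F y else 0) = act (Ind X \<phi> M) g (\<lambda>y. if y = x then F y else 0)"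
    if g: "g \<in> carrier G" and x: "x \<in> X" for g x F
    using gset_inv[OF X g] x lin_0[OF M M mdl_act_lin[OF M g]] by (auto simp: Ind_simps fun_eq_iff)
qed

lemma Ind_sum: "F \<in> vecs (Ind X \<phi> M) \<Longrightarrow> (\<Sum>x\<in>X. (\<lambda>y. if y = x then F y else 0)) = F"
  using gsetD(1)[OF X] by (auto simp: fun_eq_iff sum_fun_apply Ind_simps)

text \<open>The components \<open>\<alpha> x v\<close> of \<open>v\<close> form a function on
  \<open>X\<close>, and summing its values recovers \<open>v\<close>.\<close>

lemma proj_Ind_retr:
  assumes "proj M X \<phi>" shows "\<exists>i q. retr M (Ind X \<phi> M) i q"
proof -
  obtain \<alpha> where a: "fam M M X \<phi> \<alpha>" "\<And>v. v \<in> vecs M \<Longrightarrow> (\<Sum>x\<in>X. \<alpha> x v) = v"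
    using projE[OF assms] by blast
  note a1 = famD[OF a(1)]
  have "ghom M (Ind X \<phi> M) (\<lambda>v x. if x \<in> X then \<alpha> x v else 0)"
    unfolding ghom_def
  proof (intro conjI ballI)
    show "lin M (Ind X \<phi> M) (\<lambda>v x. if x \<in> X then \<alpha> x v else 0)"
      by (rule linI) (auto simp: Ind_simps fun_eq_iff lin_add[OF a1(1)] lin_scl[OF a1(1)] lin_in[OF a1(1)] scl_0'[OF M])
    show "(\<lambda>x. if x \<in> X then \<alpha> x (act M g v) else 0) = act (Ind X \<phi> M) g (\<lambda>x. if x \<in> X then \<alpha> x v else 0)"
      if g: "g \<in> carrier G" and v: "v \<in> vecs M" for g v
      using a1(2)[OF g gsetD(2)[OF X inv_closed[OF g]] v] gset_inv(2)[OF X g] gsetD(2)[OF X inv_closed[OF g]]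
      by (auto simp: Ind_simps fun_eq_iff)
  qed
  moreover have "ghom (Ind X \<phi> M) M (\<lambda>F. \<Sum>x\<in>X. F x)"
    unfolding ghom_def
  proof (intro conjI ballI)
    show "lin (Ind X \<phi> M) M (\<lambda>F. \<Sum>x\<in>X. F x)"
      by (rule linI) (auto simp: Ind_simps sum.distrib scl_sum[OF M] intro!: mdl_sum[OF M])
    fix g F assume g: "g \<in> carrier G" and F: "F \<in> vecs (Ind X \<phi> M)"
    have "(\<Sum>x\<in>X. act (Ind X \<phi> M) g F x) = (\<Sum>x\<in>X. act M g (F (\<phi> (inv g) x)))" by (simp add: Ind_simps)
    also have "\<dots> = (\<Sum>x\<in>X. act M g (F x))" using gset_sum[OF X inv_closed[OF g], of "\<lambda>x. act M g (F x)"] .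
    also have "\<dots> = act M g (\<Sum>x\<in>X. F x)"
      using lin_sum[OF M M mdl_act_lin[OF M g], of X F] F by (simp add: Ind_simps)
    finally show "(\<Sum>x\<in>X. act (Ind X \<phi> M) g F x) = act M g (\<Sum>x\<in>X. F x)" .
  qed
  ultimately have "retr M (Ind X \<phi> M) (\<lambda>v x. if x \<in> X then \<alpha> x v else 0) (\<lambda>F. \<Sum>x\<in>X. F x)"
    using a(2) by (simp add: retr_def)
  then show ?thesis by blast
qed

end

text \<open>Forwards, restrict the family of the induced module to its summand. Backwards,
  \<open>M\<close> is a summand of \<open>Ind\<close> over the cosets of \<open>H\<close>; a copy
  \<open>L\<close> of the latter is taken because \<open>relatively_projective\<close> asks for a
  module inside \<open>nat => 'k\<close>.\<close>

lemma relatively_projective_iff: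
  fixes M :: "('a, 'k::field, 'v::ab_group_add) gmod"
  assumes M: "mdl M" and H: "subgroup H G"
  shows "relatively_projective G H M \<longleftrightarrow> proj M (lcosets H) (\<lambda>g C. g <# C)"
proof
  assume "relatively_projective G H M"
  then obtain L :: "('a, 'k) std_gmod" and V where L: "induced_from G H V L" "gmod_summand G M L"
    unfolding relatively_projective_def by blast
  have mL: "mdl L" using L(1) by (simp add: induced_from_def)
  then obtain i q where "retr M L i q" using gmod_summand_iff[OF M mL] L(2) by blast
  then show "proj M (lcosets H) (\<lambda>g C. g <# C)"
    using proj_retr[OF M mL _ induced_from_proj[OF H L(1)]] by blast
next
  assume p: "proj M (lcosets H) (\<lambda>g C. g <# C)"
  note gs = gset_lcosets[OF H]
  let ?I = "Ind (lcosets H) (\<lambda>g C. g <# C) M"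
  have mI: "mdl ?I" by (rule mdl_Ind[OF M gs])
  obtain L :: "('a, 'k) std_gmod" and f h where L: "mdl L" "ginv ?I L f h" using std_copy[OF mI] .
  note f = ginvD(1)[OF L(2)] and h = ginvD(2)[OF L(2)]
  note fl = ghomD(1)[OF f] and hl = ghomD(1)[OF h]
  define \<beta> where "\<beta> = (\<lambda>(C :: 'a set) (F :: 'a set \<Rightarrow> 'v) D. if D = C then F D else (0 :: 'v))"
  have bf: "fam ?I ?I (lcosets H) (\<lambda>g C. g <# C) \<beta>" unfolding \<beta>_def by (rule Ind_fam[OF M gs])
  define \<alpha> where "\<alpha> = (\<lambda>C v. f (\<beta> C (h v)))"
  have \<alpha>: "fam L L (lcosets H) (\<lambda>g C. g <# C) \<alpha>"
    unfolding \<alpha>_def by (rule fam_comp[OF h bf f])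
  have "induced_from G H (\<alpha> H ` vecs L) L"
  proof (rule induced_fromI[OF L(1) H \<alpha>])
    show "(\<Sum>C\<in>lcosets H. \<alpha> C v) = v" if v: "v \<in> vecs L" for v
    proof -
      have "(\<Sum>C\<in>lcosets H. \<alpha> C v) = f (\<Sum>C\<in>lcosets H. \<beta> C (h v))"
        unfolding \<alpha>_def using lin_sum[OF mI L(1) fl, of "lcosets H" "\<lambda>C. \<beta> C (h v)"] lin_in[OF famD(1)[OF bf] lin_in[OF hl v]] by simp
      then show ?thesis using Ind_sum[OF M gs lin_in[OF hl v]] ginvD(4)[OF L(2) v] by (simp add: \<beta>_def)
    qed
    show "\<alpha> C (\<alpha> D v) = (if C = D then \<alpha> D v else 0)" if C: "C \<in> lcosets H" and D: "D \<in> lcosets H" and v: "v \<in> vecs L" for C D v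
    proof -
      have "\<alpha> C (\<alpha> D v) = f (\<beta> C (\<beta> D (h v)))"
        unfolding \<alpha>_def using ginvD(3)[OF L(2) lin_in[OF famD(1)[OF bf D] lin_in[OF hl v]]] by simp
      moreover have "\<beta> C (\<beta> D F) = (if C = D then \<beta> D F else 0)" for F by (auto simp: \<beta>_def fun_eq_iff)
      ultimately show ?thesis using lin_0[OF mI L(1) fl] by (simp add: \<alpha>_def)
    qed
  qed
  moreover obtain i q where "retr M ?I i q" using proj_Ind_retr[OF M gs p] by blast
  then have "gmod_summand G M L"
    using gmod_summand_iff[OF M L(1)] retr_trans[OF _ ginv_retr[OF L(2)]] by blast
  ultimately show "relatively_projective G H M" unfolding relatively_projective_def by blast
qed

lemma ex_vertex:
  fixes M :: "('a, 'k::field, 'v::ab_group_add) gmod"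
  assumes M: "mdl M" and H: "subgroup H G" and p: "relatively_projective G H M"
  shows "\<exists>Q. Q \<subseteq> H \<and> is_vertex G Q M"
proof -
  let ?P = "\<lambda>Q. subgroup Q G \<and> Q \<subseteq> H \<and> relatively_projective G Q M"
  obtain Q where Q: "?P Q" "\<And>Q'. ?P Q' \<Longrightarrow> card Q \<le> card Q'"
    using ex_has_least_nat[of ?P H card] H p by blast
  have "is_vertex G Q M" unfolding is_vertex_def
  proof (intro conjI allI impI)
    fix K assume K: "subgroup K G \<and> K \<subseteq> Q \<and> relatively_projective G K M"
    then have "card Q \<le> card K" using Q by blast
    moreover have "finite Q" using Q(1) finite_subset[OF subgroup.subset finite_carrier] by blast
    ultimately show "K = Q" using K by (metis card_seteq)
  qed (use Q in auto)
  then show ?thesis using Q(1) by blast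
qed

text \<open>In this lemma \<open>linked\<close> is a variable for a subgroup, unrelated to the
  relation between modules.\<close>

lemma conj_subgroup:
  assumes linked: "subgroup linked G" and a: "a \<in> carrier G"
  shows "subgroup ((\<lambda>r. a \<otimes> r \<otimes> inv a) ` linked) G" "card ((\<lambda>r. a \<otimes> r \<otimes> inv a) ` linked) = card linked"
proof -
  note Rc = subgroup.mem_carrier[OF linked]
  have eq: "(a \<otimes> r \<otimes> inv a) \<otimes> (a \<otimes> s \<otimes> inv a) = a \<otimes> (r \<otimes> s) \<otimes> inv a" if "r \<in> linked" "s \<in> linked" for r s
    using Rc that a by (simp add: m_assoc) (simp add: m_assoc[symmetric])
  show "subgroup ((\<lambda>r. a \<otimes> r \<otimes> inv a) ` linked) G"
  proof (rule subgroupI)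
    show "(\<lambda>r. a \<otimes> r \<otimes> inv a) ` linked \<subseteq> carrier G" using Rc a by auto
    show "(\<lambda>r. a \<otimes> r \<otimes> inv a) ` linked \<noteq> {}" using subgroup.one_closed[OF linked] by blast
    fix x assume "x \<in> (\<lambda>r. a \<otimes> r \<otimes> inv a) ` linked"
    then obtain r where r: "r \<in> linked" "x = a \<otimes> r \<otimes> inv a" by blast
    then have "inv x = a \<otimes> inv r \<otimes> inv a" using Rc a by (simp add: inv_mult_group m_assoc)
    then show "inv x \<in> (\<lambda>r. a \<otimes> r \<otimes> inv a) ` linked" using subgroup.m_inv_closed[OF linked r(1)] by blast
    fix y assume "y \<in> (\<lambda>r. a \<otimes> r \<otimes> inv a) ` linked"
    then obtain s where s: "s \<in> linked" "y = a \<otimes> s \<otimes> inv a" by blast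
    then show "x \<otimes> y \<in> (\<lambda>r. a \<otimes> r \<otimes> inv a) ` linked" using eq r subgroup.m_closed[OF linked r(1) s(1)] by auto
  qed
  have "inj_on (\<lambda>r. a \<otimes> r \<otimes> inv a) linked"
    using Rc a by (auto intro!: inj_onI)
  then show "card ((\<lambda>r. a \<otimes> r \<otimes> inv a) ` linked) = card linked" by (rule card_image)
qed

end

section \<open>Dade modules in terms of permuted frames\<close>

context fgroup
begin

lemma perm_gmod_Ind: "perm_gmod G X \<phi> = Ind X \<phi> kmod"
  by (auto simp: perm_gmod_def Ind_def fun_eq_iff)

lemma mdl_perm: "gset X \<phi> \<Longrightarrow> mdl (perm_gmod G X \<phi> :: ('a, 'k::field, 'x \<Rightarrow> 'k) gmod)"
  unfolding perm_gmod_Ind by (rule mdl_Ind[OF mdl_kmod])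

lemma perm_gmod_simps: "f \<in> vecs (perm_gmod G X \<phi>) \<longleftrightarrow> (\<forall>x. x \<notin> X \<longrightarrow> f x = 0)"
  "scl (perm_gmod G X \<phi>) = (\<lambda>c f x. c * f x)"
  "act (perm_gmod G X \<phi>) g f = (\<lambda>x. if x \<in> X then f (\<phi> (inv g) x) else 0)"
  by (simp_all add: perm_gmod_def)

lemma perm_frame_perm_gmod:
  assumes X: "gset X \<phi>"
  shows "perm_frame (perm_gmod G X \<phi> :: ('a, 'k::field, 'x \<Rightarrow> 'k) gmod) X \<phi> (\<lambda>x y. if y = x then 1 else 0) (\<lambda>x f. f x)"
  unfolding perm_frame_def frame_def
proof (intro conjI ballI)
  show "v = (\<Sum>x\<in>X. scl (perm_gmod G X \<phi>) (v x) (\<lambda>y. if y = x then 1 else 0))" if "v \<in> vecs (perm_gmod G X \<phi>)" for v :: "'x \<Rightarrow> 'k"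
    using that gsetD(1)[OF X] by (auto simp: perm_gmod_simps fun_eq_iff sum_fun_apply if_distrib cong: if_cong)
  show "(\<lambda>y. if y = \<phi> g x then 1 else 0) = act (perm_gmod G X \<phi> :: ('a, 'k, 'x \<Rightarrow> 'k) gmod) g (\<lambda>y. if y = x then 1 else 0)"
    if "g \<in> carrier G" "x \<in> X" for g x
    using gset_inv[OF X that(1)] gsetD(2)[OF X that] that(2) by (auto simp: perm_gmod_simps fun_eq_iff)
  show "fam (perm_gmod G X \<phi> :: ('a, 'k, 'x \<Rightarrow> 'k) gmod) kmod X \<phi> (\<lambda>x f. f x)"
    using gsetD(2)[OF X] gset_inv(1)[OF X] by (auto intro!: famI linI simp: perm_gmod_simps)
qed (use X gsetD(1)[OF X] in \<open>auto simp: perm_gmod_simps intro!: linI\<close>)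

lemma p_permutation_perm_frame:
  assumes W: "mdl (W :: ('a, 'k::field, 'v::ab_group_add) gmod)" and p: "p_permutation G W"
  shows "\<exists>(X :: nat set) \<phi> e l. perm_frame W X \<phi> e l"
proof -
  obtain X :: "nat set" and \<phi> where X: "finite_gset G X \<phi>" "gmod_summand G W (perm_gmod G X \<phi> :: ('a, 'k, nat \<Rightarrow> 'k) gmod)"
    using p unfolding p_permutation_def by blast
  have g: "gset X \<phi>" using X(1) group_action_gset by (auto simp: finite_gset_def)
  obtain i q where "retr W (perm_gmod G X \<phi>) i q" using gmod_summand_iff[OF W mdl_perm[OF g]] X(2) by blast
  from perm_frame_retr[OF this W mdl_perm[OF g] perm_frame_perm_gmod[OF g]] show ?thesis by blast
qed

lemma perm_frame_p_permutation:
  fixes W :: "('a, 'k::field, 'v::ab_group_add) gmod" and X :: "nat set"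
  assumes W: "mdl W" and p: "perm_frame W X \<phi> e l"
  shows "p_permutation G W"
proof -
  have ne: "p_permutation G W" if p: "perm_frame W X \<phi> e l" and "X \<noteq> {}" for X :: "nat set" and \<phi> e l
  proof -
    note X = perm_frameD(1)[OF p] and F = perm_frameD(2)[OF p]
    \<comment> \<open>\<open>group_action\<close> demands functions that are undefined off
      \<open>X\<close>.\<close>
    define \<psi> where "\<psi> = (\<lambda>g. restrict (\<phi> g) X)"
    have fg: "finite_gset G X \<psi>"
      using gset_group_action[OF X] gsetD(1)[OF X] \<open>X \<noteq> {}\<close> by (simp add: finite_gset_def \<psi>_def)
    then have Y: "gset X \<psi>" using group_action_gset by (auto simp: finite_gset_def)
    let ?P = "perm_gmod G X \<psi> :: ('a, 'k, nat \<Rightarrow> 'k) gmod"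
    have "ghom W ?P (\<lambda>v x. if x \<in> X then l x v else 0)" unfolding ghom_def
    proof (intro conjI ballI)
      show "lin W ?P (\<lambda>v x. if x \<in> X then l x v else 0)"
        by (rule linI) (auto simp: perm_gmod_simps fun_eq_iff lin_add[OF frameD(3)[OF F]] lin_scl[OF frameD(3)[OF F]])
      show "(\<lambda>x. if x \<in> X then l x (act W g v) else 0) = act ?P g (\<lambda>x. if x \<in> X then l x v else 0)"
        if g: "g \<in> carrier G" and v: "v \<in> vecs W" for g v
        using perm_frameD(5)[OF p g gsetD(2)[OF X inv_closed[OF g]] v] gset_inv(2)[OF X g] gsetD(2)[OF X inv_closed[OF g]]
        by (auto simp: perm_gmod_simps \<psi>_def fun_eq_iff)
    qed
    moreover have "ghom ?P W (\<lambda>f. \<Sum>x\<in>X. scl W (f x) (e x))" unfolding ghom_def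
    proof (intro conjI ballI)
      show "lin ?P W (\<lambda>f. \<Sum>x\<in>X. scl W (f x) (e x))"
        by (intro lin_sumf[OF W] lin_fscl[OF W] frameD(2)[OF F] frameD(3)[OF perm_frameD(2)[OF perm_frame_perm_gmod[OF Y]]])
      fix g f assume g: "g \<in> carrier G" and f: "f \<in> vecs ?P"
      have "(\<Sum>x\<in>X. scl W (act ?P g f x) (e x)) = (\<Sum>x\<in>X. scl W (act ?P g f (\<phi> g x)) (e (\<phi> g x)))"
        by (rule gset_sum[OF X g, symmetric])
      also have "\<dots> = (\<Sum>x\<in>X. scl W (f x) (act W g (e x)))"
        using gsetD(2)[OF X g] gset_inv(1)[OF X g] perm_frameD(3)[OF p g] by (intro sum.cong) (auto simp: perm_gmod_simps \<psi>_def)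
      also have "\<dots> = act W g (\<Sum>x\<in>X. scl W (f x) (e x))"
        using lin_lincomb[OF W W mdl_act_lin[OF W g] frameD(2)[OF F], of X] by simp
      finally show "(\<Sum>x\<in>X. scl W (act ?P g f x) (e x)) = act W g (\<Sum>x\<in>X. scl W (f x) (e x))" .
    qed
    ultimately have "retr W ?P (\<lambda>v x. if x \<in> X then l x v else 0) (\<lambda>f. \<Sum>x\<in>X. scl W (f x) (e x))"
      using frameD(4)[OF F] by (simp add: retr_def)
    then show ?thesis unfolding p_permutation_def using gmod_summand_iff[OF W mdl_perm[OF Y]] fg by blast
  qed
  show ?thesis
  proof (cases "X = {}")
    case True
    then have "v = 0" if "v \<in> vecs W" for v using frameD(4)[OF perm_frameD(2)[OF p] that] by simp
    \<comment> \<open>\<open>finite_gset\<close> excludes the empty set, so the zero module is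
      regarded as a summand of the permutation module on one point.\<close>
    then have "perm_frame W {0::nat} (\<lambda>g z. z) (\<lambda>_. 0) (\<lambda>_ _. 0)"
      unfolding perm_frame_def frame_def
      using lin_zero[OF mdl_kmod, of W] lin_0[OF W W mdl_act_lin[OF W]]
      by (auto simp: gset_point mdl_0[OF W] scl_0'[OF W] intro!: famI)
    then show ?thesis using ne by blast
  qed (use ne p in blast)
qed

lemma perm_frame_direct_sum:
  assumes M: "mdl M" and N: "mdl N" and p: "perm_frame M X \<phi> e l" and q: "perm_frame N Y \<psi> e' l'"
  shows "\<exists>e l. perm_frame (direct_sum M N) (X <+> Y) (\<lambda>g. map_sum (\<phi> g) (\<psi> g)) e l"
proof -
  note F = perm_frameD(2)[OF p] and F' = perm_frameD(2)[OF q]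
  have "perm_frame (direct_sum M N) (X <+> Y) (\<lambda>g. map_sum (\<phi> g) (\<psi> g)) (case_sum (\<lambda>i. (e i, 0)) (\<lambda>j. (0, e' j)))
       (case_sum (\<lambda>i vw. l i (fst vw)) (\<lambda>j vw. l' j (snd vw)))"
    unfolding perm_frame_def frame_def
  proof (intro conjI ballI)
    show "gset (X <+> Y) (\<lambda>g. map_sum (\<phi> g) (\<psi> g))" by (rule gset_Plus[OF perm_frameD(1)[OF p] perm_frameD(1)[OF q]])
    show "finite (X <+> Y)" using frameD(1)[OF F] frameD(1)[OF F'] by simp
    show "case_sum (\<lambda>i. (e i, 0)) (\<lambda>j. (0, e' j)) i \<in> vecs (direct_sum M N)" if "i \<in> X <+> Y" for i
      using that frameD(2)[OF F] frameD(2)[OF F'] mdl_0[OF M] mdl_0[OF N] by auto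
    show *: "lin (direct_sum M N) kmod (case_sum (\<lambda>i vw. l i (fst vw)) (\<lambda>j vw. l' j (snd vw)) i)"
      if "i \<in> X <+> Y" for i
      using that by (auto intro!: linI simp: lin_add[OF frameD(3)[OF F]] lin_add[OF frameD(3)[OF F']]
        lin_scl[OF frameD(3)[OF F]] lin_scl[OF frameD(3)[OF F']])
    show "v = (\<Sum>i\<in>X <+> Y. scl (direct_sum M N) (case_sum (\<lambda>i vw. l i (fst vw)) (\<lambda>j vw. l' j (snd vw)) i v)
        (case_sum (\<lambda>i. (e i, 0)) (\<lambda>j. (0, e' j)) i))" if "v \<in> vecs (direct_sum M N)" for v
      using that frameD(4)[OF F, of "fst v"] frameD(4)[OF F', of "snd v"] frameD(1)[OF F] frameD(1)[OF F']
      by (auto simp: sum.Plus prod_eq_iff fst_sum snd_sum scl_0'[OF M] scl_0'[OF N])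
    show "case_sum (\<lambda>i. (e i, 0)) (\<lambda>j. (0, e' j)) (map_sum (\<phi> g) (\<psi> g) i) = act (direct_sum M N) g (case_sum (\<lambda>i. (e i, 0)) (\<lambda>j. (0, e' j)) i)"
      if "g \<in> carrier G" "i \<in> X <+> Y" for g i
      using that lin_0[OF M M mdl_act_lin[OF M]] lin_0[OF N N mdl_act_lin[OF N]]
      by (auto simp: perm_frameD(3)[OF p] perm_frameD(3)[OF q])
    show "fam (direct_sum M N) kmod (X <+> Y) (\<lambda>g. map_sum (\<phi> g) (\<psi> g)) (case_sum (\<lambda>i vw. l i (fst vw)) (\<lambda>j vw. l' j (snd vw)))"
      by (rule famI, rule *) (auto simp: perm_frameD(5)[OF p] perm_frameD(5)[OF q])
  qed
  then show ?thesis by blast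
qed

text \<open>Induction on the dimension takes the place of a decomposition into indecomposables: a
  decomposable \<open>M\<close> is glued from the images of an idempotent and of its complement.
  Both images stay in the type of \<open>M\<close>, over which the hypothesis on \<open>U\<close>
  ranges.\<close>

lemma proj_of_summands:
  fixes M :: "('a, 'k::field, 'v::ab_group_add) gmod"
  assumes M: "mdl M" and Y: "gset Y \<psi>"
    and s: "\<And>U :: ('a, 'k, 'v) gmod. indecomposable G U \<Longrightarrow> gmod_summand G U M \<Longrightarrow> proj U Y \<psi>"
  shows "proj M Y \<psi>"
  using M s
proof (induction "gmod_dim M (vecs M)" arbitrary: M rule: less_induct)
  case less
  note M = less(2)
  show ?case
  proof (cases "vecs M = {0}")
    case True
    have f0: "fam M M Y \<psi> (\<lambda>y v. 0)"
    proof (rule famI)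
      show "lin M M (\<lambda>v. 0)" by (rule lin_zero[OF M])
      show "0 = act M g 0" if "g \<in> carrier G" for g
        by (rule lin_0[OF M M mdl_act_lin[OF M that], symmetric])
    qed
    show ?thesis by (rule projI[OF Y f0]) (use True in simp)
  next
    case nz: False
    show ?thesis
    proof (cases "indecomposable G M")
      case True
      have "gmod_summand G M M" unfolding gmod_summand_iff[OF M M] by (intro exI) (rule retr_id)
      then show ?thesis by (rule less(3)[OF True])
    next
      case False
      obtain r where r: "ghom M M r" and idem: "\<And>v. v \<in> vecs M \<Longrightarrow> r (r v) = r v" and n1: "\<exists>v\<in>vecs M. r v \<noteq> v" and n2: "\<exists>v\<in>vecs M. r v \<noteq> 0"
        using not_indec[OF M nz False] by blast
      let ?c = "\<lambda>v. v - r v"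
      note c = ghom_compl[OF M r idem] and ci = idem_compl[OF M r idem]
      have sub: "proj (fixm M t) Y \<psi>"
        if t: "ghom M M t" and ti: "\<And>v. v \<in> vecs M \<Longrightarrow> t (t v) = t v" and tn: "\<exists>v\<in>vecs M. t v \<noteq> v" for t
      proof (rule less(1)[OF fixm_gdim[OF M t tn] mdl_fixm[OF M t ti]])
        fix U :: "('a, 'k, 'v) gmod" assume U: "indecomposable G U" "gmod_summand G U (fixm M t)"
        have mU: "mdl U" using U(1) by (simp add: indecomposable_def)
        obtain i q where "retr U (fixm M t) i q" using gmod_summand_iff[OF mU mdl_fixm[OF M t ti]] U(2) by blast
        then have "gmod_summand G U M" using retr_trans[OF _ retr_fixm[OF M t ti]] gmod_summand_iff[OF mU M] by blast
        then show "proj U Y \<psi>" by (rule less(3)[OF U(1)])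
      qed
      have "proj (fixm M r) Y \<psi>" by (rule sub[OF r idem n1])
      moreover have "proj (fixm M ?c) Y \<psi>" by (rule sub[OF c ci]) (use n2 in auto)
      ultimately show ?thesis
        using retrD(1,2)[OF retr_fixm[OF M r idem]] retrD(1,2)[OF retr_fixm[OF M c ci]]
        by (intro proj_glue[OF M mdl_fixm[OF M r idem] mdl_fixm[OF M c ci], of _ _ r "\<lambda>x. x" ?c "\<lambda>x. x"]) simp_all
    qed
  qed
qed

text \<open>An invariant vector and an invariant form that do not annihilate each other split off a
  copy of k. Repeating this leaves a module in which all such pairings vanish, the condition that
  \<open>perm_frame_nofix\<close> requires.\<close>

lemma split_trivial:
  fixes V :: "('a, 'k::field, 'v::ab_group_add) gmod"
  assumes V: "mdl V"
  shows "\<exists>n (W :: ('a, 'k) std_gmod) f h. mdl W \<and> ginv V (direct_sum (trivial_gmod n) W) f h \<and>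
    (\<forall>a\<in>vecs W. \<forall>b. (\<forall>g\<in>carrier G. act W g a = a) \<longrightarrow> ghom W kmod b \<longrightarrow> b a = 0)"
  using V
proof (induction "gmod_dim V (vecs V)" arbitrary: V rule: less_induct)
  case less
  note V = less(2)
  show ?case
  proof (cases "\<forall>a\<in>vecs V. \<forall>b. (\<forall>g\<in>carrier G. act V g a = a) \<longrightarrow> ghom V kmod b \<longrightarrow> b a = 0")
    case True
    obtain W :: "('a, 'k) std_gmod" and f h where W: "mdl W" "ginv V W f h" using std_copy[OF V] .
    note f = ginvD(1)[OF W(2)] and h = ginvD(2)[OF W(2)]
    have "ghom W (direct_sum (trivial_gmod 0) W) (\<lambda>w. (0, w))" "ghom (direct_sum (trivial_gmod 0 :: ('a, 'k) std_gmod) W) W snd"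
      by (auto simp: ghom_def trivial_gmod_simps fun_eq_iff intro!: linI)
    then have "ginv W (direct_sum (trivial_gmod 0 :: ('a, 'k) std_gmod) W) (\<lambda>w. (0, w)) snd"
      by (auto simp: ginv_def trivial_gmod_simps)
    from ginv_trans[OF W(2) this] have "\<exists>f h. ginv V (direct_sum (trivial_gmod 0 :: ('a, 'k) std_gmod) W) f h" by blast
    moreover have "b a = 0" if "a \<in> vecs W" "\<forall>g\<in>carrier G. act W g a = a" "ghom W kmod b" for a b
    proof -
      have "act V g (h a) = h a" if "g \<in> carrier G" for g
        using ghomD(2)[OF h that \<open>a \<in> vecs W\<close>] \<open>\<forall>g\<in>carrier G. act W g a = a\<close> that by simp
      then have "b (f (h a)) = 0"
        using True ghom_comp[OF f that(3)] lin_in[OF ghomD(1)[OF h] that(1)] by blast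
      then show ?thesis using ginvD(4)[OF W(2) that(1)] by simp
    qed
    ultimately show ?thesis using W(1) by blast
  next
    case False
    then obtain a0 b where a0: "a0 \<in> vecs V" "\<And>g. g \<in> carrier G \<Longrightarrow> act V g a0 = a0" and b: "ghom V kmod b" and nz: "b a0 \<noteq> 0"
      by blast
    note bl = ghomD(1)[OF b]
    define a where "a = scl V (inverse (b a0)) a0"
    have a: "a \<in> vecs V" unfolding a_def by (rule mdl_scl[OF V a0(1)])
    have ga: "act V g a = a" if "g \<in> carrier G" for g
      unfolding a_def using lin_scl[OF mdl_act_lin[OF V that] a0(1)] a0(2)[OF that] by simp
    have ba: "b a = 1" unfolding a_def using lin_scl[OF bl a0(1)] nz by simp
    \<comment> \<open>As \<open>b a = 1\<close>, this is the projection onto the line of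
      \<open>a\<close> along the kernel of \<open>b\<close>.\<close>
    define r where "r = (\<lambda>v. scl V (b v) a)"
    have r: "ghom V V r" unfolding ghom_def r_def
      using lin_fscl[OF V bl a] ghomD(2)[OF b] ga lin_scl[OF mdl_act_lin[OF V] a] by simp
    have rr: "r (r v) = r v" if "v \<in> vecs V" for v
      by (simp add: r_def lin_scl[OF bl a] ba)
    let ?c = "\<lambda>v. v - r v"
    note c = ghom_compl[OF V r rr] and cc = idem_compl[OF V r rr]
    have ra: "r a = a" by (simp add: r_def ba scl_1[OF V])
    have "a \<noteq> 0" using ba lin_0[OF V mdl_kmod bl] by auto
    then have "\<exists>v\<in>vecs V. ?c v \<noteq> v" using a ra by (intro bexI[of _ a]) auto
    note less_c = fixm_gdim[OF V c this] and mC = mdl_fixm[OF V c cc]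
    obtain n and W :: "('a, 'k) std_gmod" and f h where W: "mdl W" "ginv (fixm V ?c) (direct_sum (trivial_gmod n) W) f h"
      and nt: "\<forall>a\<in>vecs W. \<forall>b. (\<forall>g\<in>carrier G. act W g a = a) \<longrightarrow> ghom W kmod b \<longrightarrow> b a = 0"
      using less(1)[OF less_c mC] by blast
    note f = ginvD(1)[OF W(2)] and h = ginvD(2)[OF W(2)] and ci = retrD(1,2)[OF retr_fixm[OF V c cc]]
    have bc: "b v = 0" if "v \<in> vecs (fixm V ?c)" for v
    proof -
      have v: "v \<in> vecs V" "r v = 0" using that by auto
      then show ?thesis using lin_scl[OF bl a, of "b v"] ba lin_0[OF V mdl_kmod bl] by (simp add: r_def)
    qed
    let ?T = "direct_sum (trivial_gmod (Suc n)) W" and ?B = "direct_sum (trivial_gmod n) W"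
    \<comment> \<open>Coordinate \<open>n\<close> is the first one left free by the trivial part of
      the complement and receives the new copy of k; \<open>t\<close> erases it again.\<close>
    define F where "F = (\<lambda>v. (\<lambda>i. if i = n then b v else fst (f (?c v)) i, snd (f (?c v))))"
    define t where "t = (\<lambda>xw :: (nat \<Rightarrow> 'k) \<times> (nat \<Rightarrow> 'k). (\<lambda>i. if i < n then fst xw i else 0, snd xw))"
    define H where "H = (\<lambda>xw. h (t xw) + scl V (fst xw n) a)"
    have fc: "ghom V ?B (\<lambda>v. f (?c v))" by (rule ghom_comp[OF ci(2) f])
    note fcl = ghomD(1)[OF fc]
    have mT0: "mdl ?B" by (rule mdl_direct_sum[OF mdl_trivial W(1)])
    have t: "ghom ?T ?B t"
      by (auto simp: ghom_def t_def trivial_gmod_simps fun_eq_iff intro!: linI)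
    have ht: "ghom ?T V (\<lambda>xw. h (t xw))" using ghom_comp[OF ghom_comp[OF t h] ci(1)] .
    have gF: "ghom V ?T F" unfolding ghom_def
    proof (intro conjI ballI linI)
      show "F (x + y) = F x + F y" if "x \<in> vecs V" "y \<in> vecs V" for x y
        using lin_add[OF fcl that] lin_add[OF bl that] by (simp add: F_def fun_eq_iff)
      show "F (scl V k x) = scl ?T k (F x)" if "x \<in> vecs V" for k x
        using lin_scl[OF fcl that, of k] lin_scl[OF bl that, of k] by (simp add: F_def fun_eq_iff trivial_gmod_simps)
      show "F x \<in> vecs ?T" if "x \<in> vecs V" for x
      proof -
        have "(\<forall>i\<ge>n. fst (f (?c x)) i = 0) \<and> snd (f (?c x)) \<in> vecs W"
          using lin_in[OF fcl that] by (simp add: mem_Times_iff trivial_gmod_simps)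
        moreover from this have "\<forall>i\<ge>Suc n. (if i = n then b x else fst (f (?c x)) i) = 0" by simp
        ultimately show ?thesis by (simp only: F_def trivial_gmod_simps direct_sum_simps mem_Times_iff fst_conv snd_conv mem_Collect_eq)
      qed
      show "F (act V g x) = act ?T g (F x)" if "g \<in> carrier G" "x \<in> vecs V" for g x
        using ghomD(2)[OF fc that] ghomD(2)[OF b that] by (simp add: F_def trivial_gmod_simps fun_eq_iff)
    qed
    have gH: "ghom ?T V H" unfolding ghom_def
    proof (intro conjI ballI)
      have "lin ?T V (\<lambda>xw. scl V (fst xw n) a)"
        by (rule lin_fscl[OF V _ a]) (auto simp: trivial_gmod_simps intro!: linI)
      then show "lin ?T V H" unfolding H_def by (rule lin_plus[OF V ghomD(1)[OF ht]])
      show "H (act ?T g x) = act V g (H x)" if g: "g \<in> carrier G" and x: "x \<in> vecs ?T" for g x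
        using ghomD(2)[OF ht g x] lin_in[OF ghomD(1)[OF ht] x] lin_add[OF mdl_act_lin[OF V g] _ mdl_scl[OF V a]]
          lin_scl[OF mdl_act_lin[OF V g] a] ga[OF g]
        by (simp add: H_def trivial_gmod_simps)
    qed
    have "H (F v) = v" if v: "v \<in> vecs V" for v
    proof -
      have cv: "?c v \<in> vecs (fixm V ?c)" using lin_in[OF ghomD(1)[OF ci(2)] v] .
      have "t (F v) = f (?c v)" using lin_in[OF ghomD(1)[OF f] cv]
        by (auto simp: t_def F_def trivial_gmod_simps prod_eq_iff fun_eq_iff)
      then have "h (t (F v)) = ?c v" using ginvD(3)[OF W(2) cv] by simp
      then show ?thesis by (simp add: H_def F_def r_def)
    qed
    moreover have "F (H xw) = xw" if xw: "xw \<in> vecs ?T" for xw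
    proof -
      have u: "h (t xw) \<in> vecs (fixm V ?c)" using lin_in[OF ghomD(1)[OF ghom_comp[OF t h]] xw] .
      then have uV: "h (t xw) \<in> vecs V" "?c (h (t xw)) = h (t xw)" by auto
      have sa: "scl V (fst xw n) a \<in> vecs V" by (rule mdl_scl[OF V a])
      have "?c (scl V (fst xw n) a) = 0" using lin_scl[OF ghomD(1)[OF r] a] ra by simp
      then have cH: "?c (H xw) = h (t xw)"
        unfolding H_def using lin_add[OF ghomD(1)[OF c] uV(1) sa] uV(2) by simp
      have bH: "b (H xw) = fst xw n"
        unfolding H_def using lin_add[OF bl uV(1) sa] bc[OF u] lin_scl[OF bl a] ba by simp
      have "f (h (t xw)) = t xw" by (rule ginvD(4)[OF W(2) lin_in[OF ghomD(1)[OF t] xw]])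
      then show ?thesis using xw
        by (auto simp: F_def cH bH t_def prod_eq_iff fun_eq_iff trivial_gmod_simps)
    qed
    ultimately have "ginv V ?T F H" using gF gH by (simp add: ginv_def)
    then show ?thesis using W(1) nt by blast
  qed
qed

end

section \<open>Non-Sylow p-subgroups, vertices and the reformulation of Dade modules\<close>

context sylow_context
begin

lemma p_subgroupD: "p_subgroup G p Q \<Longrightarrow> subgroup Q G" "p_subgroup G p Q \<Longrightarrow> \<exists>n. card Q = p ^ n"
  by (auto simp: p_subgroup_def)

lemma sylow_index:
  assumes "sylow_subgroup G p Q" shows "\<not> p dvd card (lcosets Q)"
proof -
  have Q: "subgroup Q G" "card Q = p ^ multiplicity p (card (carrier G))" using assms by (auto simp: sylow_subgroup_def)
  have o: "card (carrier G) \<noteq> 0" using finite_carrier one_closed by auto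
  obtain m where m: "card (carrier G) = p ^ multiplicity p (card (carrier G)) * m" "\<not> p dvd m"
    using multiplicity_decompose'[OF o, of p] prime_p by (auto simp: prime_nat_iff)
  have "card (lcosets Q) * card Q = m * card Q"
    using l_lagrange[OF finite_carrier Q(1)] m(1) Q(2) by (metis mult.commute order_def)
  then show ?thesis using m(2) Q(2) prime_p by (simp add: prime_gt_0_nat)
qed

lemma sylow_fix:
  assumes "sylow_subgroup G p Q" "p_subgroup G p B"
  shows "\<exists>C\<in>lcosets Q. \<forall>r\<in>B. r <# C = C"
proof -
  obtain n where "card B = p ^ n" using p_subgroupD(2)[OF assms(2)] by blast
  then show ?thesis
    using p_subgroup_fix[OF prime_p p_subgroupD(1)[OF assms(2)] _ gset_lcosets sylow_index[OF assms(1)]] assms(1)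
    by (auto simp: sylow_subgroup_def)
qed

lemma p_subgroup_S: "p_subgroup G p S"
  using sylow_S by (auto simp: sylow_subgroup_def p_subgroup_def)

lemma finite_subgroup: "subgroup H G \<Longrightarrow> finite H"
  using finite_subset[OF subgroup.subset finite_carrier] .

lemma card_subgroup_dvd: "subgroup K G \<Longrightarrow> subgroup H G \<Longrightarrow> K \<subseteq> H \<Longrightarrow> card K dvd card H"
proof -
  assume K: "subgroup K G" and H: "subgroup H G" and KH: "K \<subseteq> H"
  interpret H: fgroup "G\<lparr>carrier := H\<rparr>" by (rule fgroup_subgroup[OF H])
  have "subgroup K (G\<lparr>carrier := H\<rparr>)" by (rule subgroup_incl[OF K H KH])
  from H.l_lagrange[OF H.finite_carrier this] show ?thesis by (metis dvd_triv_right order_def partial_object.select_convs(1) partial_object.update_convs(1) partial_object.surjective)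
qed

lemma p_subgroup_sub:
  assumes "p_subgroup G p P" "subgroup Q G" "Q \<subseteq> P" shows "p_subgroup G p Q"
proof -
  obtain n where "card P = p ^ n" using p_subgroupD(2)[OF assms(1)] by blast
  then have "card Q dvd p ^ n" using card_subgroup_dvd[OF assms(2) p_subgroupD(1)[OF assms(1)] assms(3)] by simp
  then show ?thesis using assms(2) prime_p divides_primepow_nat[of p "card Q" n] by (auto simp: p_subgroup_def)
qed

lemma p_subgroup_card_le:
  assumes "p_subgroup G p Q" shows "card Q \<le> card S"
proof -
  obtain n where n: "card Q = p ^ n" using p_subgroupD(2)[OF assms] by blast
  have o: "card (carrier G) \<noteq> 0" using finite_carrier one_closed by auto
  have "p ^ n dvd card (carrier G)"
    using card_subgroup_dvd[OF p_subgroupD(1)[OF assms] subgroup_self subgroup.subset[OF p_subgroupD(1)[OF assms]]] n by simp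
  then have "n \<le> multiplicity p (card (carrier G))"
    using o prime_p by (intro multiplicity_geI) (auto simp: prime_nat_iff)
  then show ?thesis using n sylow_S prime_p by (auto simp: sylow_subgroup_def prime_nat_iff intro: power_increasing)
qed

lemma sylow_iff_card: "p_subgroup G p Q \<Longrightarrow> sylow_subgroup G p Q \<longleftrightarrow> card Q = card S"
  using sylow_S by (auto simp: sylow_subgroup_def p_subgroup_def)

lemma non_sylow_iff: "Q \<in> non_sylow_p_subgroups G p \<longleftrightarrow> p_subgroup G p Q \<and> card Q < card S"
  using sylow_iff_card[of Q] p_subgroup_card_le[of Q] by (auto simp: non_sylow_p_subgroups_def)

text \<open>Its point stabilisers are exactly the non-Sylow p-subgroups, so projectivity relative to
  this set is projectivity relative to that whole family.\<close>

definition non_sylow_cosets :: "'a set set"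
  where "non_sylow_cosets = (\<Union>Q\<in>non_sylow_p_subgroups G p. lcosets Q)"

lemma non_sylow_subgroup: "Q \<in> non_sylow_p_subgroups G p \<Longrightarrow> subgroup Q G"
  by (auto simp: non_sylow_p_subgroups_def p_subgroup_def)

lemma gset_cosets_family:
  assumes "\<And>Q. Q \<in> F \<Longrightarrow> subgroup Q G" shows "gset (\<Union>Q\<in>F. lcosets Q) (\<lambda>g C. g <# C)"
proof -
  have "F \<subseteq> Pow (carrier G)" using subgroup.subset[OF assms] by blast
  then have "finite F" using finite_carrier finite_subset by blast
  show ?thesis unfolding gset_def
  proof (intro conjI ballI)
    show "finite (\<Union>Q\<in>F. lcosets Q)" using \<open>finite F\<close> finite_lcosets[OF assms] by simp
    fix C assume "C \<in> (\<Union>Q\<in>F. lcosets Q)"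
    then obtain Q where Q: "Q \<in> F" "C \<in> lcosets Q" by blast
    note D = gsetD[OF gset_lcosets[OF assms[OF Q(1)]]]
    show "\<one> <# C = C" by (rule D(3)[OF Q(2)])
    fix g assume g: "g \<in> carrier G"
    show "g <# C \<in> (\<Union>Q\<in>F. lcosets Q)" using D(2)[OF g Q(2)] Q(1) by blast
    show "(g \<otimes> h) <# C = g <# (h <# C)" if "h \<in> carrier G" for h by (rule D(4)[OF g that Q(2)])
  qed
qed

lemma lcoset_fix_card:
  assumes Q: "subgroup Q G" and C: "C \<in> lcosets Q" and B: "subgroup B G" and fx: "\<forall>r\<in>B. r <# C = C"
  shows "\<exists>a\<in>carrier G. C = a <# Q \<and> (\<lambda>r. inv a \<otimes> r \<otimes> a) ` B \<subseteq> Q \<and> card ((\<lambda>r. inv a \<otimes> r \<otimes> a) ` B) = card B"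
proof -
  obtain a where a: "a \<in> carrier G" "C = a <# Q" using lcosetsE[OF C] by blast
  have "inv a \<otimes> r \<otimes> a \<in> Q" if "r \<in> B" for r
    using lcoset_fix_iff[OF Q a(1) subgroup.mem_carrier[OF B that]] fx that a(2) by simp
  then show ?thesis using conj_subgroup(2)[OF B inv_closed[OF a(1)]] a by (intro bexI[of _ a]) auto
qed

text \<open>If \<open>S\<close> fixed a coset of \<open>Q\<close>, a conjugate of \<open>S\<close>
  would lie in the smaller group \<open>Q\<close>.\<close>

lemma nofix_cosets_family:
  assumes F: "F \<subseteq> non_sylow_p_subgroups G p" shows "nofix (\<Union>Q\<in>F. lcosets Q) (\<lambda>g C. g <# C)"
  unfolding nofix_def
proof (intro conjI ballI)
  show "gset (\<Union>Q\<in>F. lcosets Q) (\<lambda>g C. g <# C)" using gset_cosets_family[of F] F non_sylow_subgroup by blast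
  fix C assume "C \<in> (\<Union>Q\<in>F. lcosets Q)"
  then obtain Q where Q: "Q \<in> non_sylow_p_subgroups G p" "C \<in> lcosets Q" using F by blast
  show "\<exists>s\<in>S. s <# C \<noteq> C"
  proof (rule ccontr)
    assume "\<not> (\<exists>s\<in>S. s <# C \<noteq> C)"
    then obtain a where "(\<lambda>r. inv a \<otimes> r \<otimes> a) ` S \<subseteq> Q" "card ((\<lambda>r. inv a \<otimes> r \<otimes> a) ` S) = card S"
      using lcoset_fix_card[OF non_sylow_subgroup[OF Q(1)] Q(2) subgroup_S] by blast
    then have "card S \<le> card Q" using card_mono[OF finite_subgroup[OF non_sylow_subgroup[OF Q(1)]]] by metis
    then show False using Q(1) by (simp add: non_sylow_iff)
  qed
qed

lemma nofix_non_sylow_cosets: "nofix non_sylow_cosets (\<lambda>g C. g <# C)"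
  unfolding non_sylow_cosets_def by (rule nofix_cosets_family) simp

context
  fixes M :: "('a, 'k::field, 'v::ab_group_add) gmod"
  assumes M: "mdl M" and ch: "CHAR('k) = p"
begin

text \<open>Every module is projective relative to a one-point set, and every p-subgroup fixes a
  coset of \<open>S\<close>, whose index is prime to p.\<close>

lemma proj_lcosets_S: "proj M (lcosets S) (\<lambda>g C. g <# C)"
proof (rule proj_family[OF prime_p ch M _ gset_lcosets[OF subgroup_S]])
  show "proj M {0 :: nat} (\<lambda>g z. z)"
    by (rule projI[of _ _ _ "\<lambda>_ v. v"]) (auto simp: gset_point lin_id intro: famI)
qed (use sylow_fix[OF sylow_S] in blast)

lemma proj_non_sylow_cosets: "Q \<in> non_sylow_p_subgroups G p \<Longrightarrow> proj M (lcosets Q) (\<lambda>g C. g <# C) \<Longrightarrow> proj M non_sylow_cosets (\<lambda>g C. g <# C)"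
  by (rule proj_family[OF prime_p ch M _ nofix_gset[OF nofix_non_sylow_cosets]]) (auto simp: non_sylow_cosets_def)

text \<open>Minimality of the vertex is used twice, each time for a subgroup of \<open>Q\<close>
  relative to which \<open>M\<close> is shown to be projective: once to see that \<open>Q\<close> is
  a p-group, once to exclude that it is Sylow.\<close>

lemma vertex_non_sylow:
  assumes ind: "indecomposable G M" and X: "nofix X \<phi>" and p: "proj M X \<phi>" and v: "is_vertex G Q M"
  shows "Q \<in> non_sylow_p_subgroups G p"
proof -
  have Q: "subgroup Q G" and pQ: "proj M (lcosets Q) (\<lambda>g C. g <# C)"
    using v relatively_projective_iff[OF M] by (auto simp: is_vertex_def)
  have min: "H = Q" if "subgroup H G" "H \<subseteq> Q" "proj M (lcosets H) (\<lambda>g C. g <# C)" for H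
    using v relatively_projective_iff[OF M that(1)] that by (auto simp: is_vertex_def)
  note gX = nofix_gset[OF X] and gQ = gset_lcosets[OF Q]
  interpret H: fgroup "G\<lparr>carrier := Q\<rparr>" by (rule fgroup_subgroup[OF Q])
  \<comment> \<open>A p-subgroup fixing a coset of \<open>Q\<close> is conjugate into
    \<open>Q\<close> and therefore fixes a coset of the Sylow subgroup \<open>P\<close> of
    \<open>Q\<close>; so \<open>M\<close> is projective relative to \<open>P\<close>.\<close>
  obtain P n where P: "subgroup P (G\<lparr>carrier := Q\<rparr>)" "card P = p ^ n" "\<not> p dvd card (lcosets\<^bsub>G\<lparr>carrier := Q\<rparr>\<^esub> P)"
    using H.ex_sylow[OF prime_p] by blast
  have PQ: "P \<subseteq> Q" using subgroup.subset[OF P(1)] by simp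
  have PG: "subgroup P G" by (rule incl_subgroup[OF Q P(1)])
  have "proj M (lcosets P) (\<lambda>g C. g <# C)"
  proof (rule proj_family[OF prime_p ch M pQ gset_lcosets[OF PG]])
    fix B C assume B: "p_subgroup G p B" and C: "C \<in> lcosets Q" and fx: "\<forall>r\<in>B. r <# C = C"
    obtain a where a: "a \<in> carrier G" and sub: "(\<lambda>r. inv a \<otimes> r \<otimes> a) ` B \<subseteq> Q" and cR: "card ((\<lambda>r. inv a \<otimes> r \<otimes> a) ` B) = card B"
      using lcoset_fix_card[OF Q C p_subgroupD(1)[OF B] fx] by blast
    let ?B = "(\<lambda>r. inv a \<otimes> r \<otimes> a) ` B"
    have "subgroup ?B G" using conj_subgroup(1)[OF p_subgroupD(1)[OF B] inv_closed[OF a]] a by simp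
    then have RQ: "subgroup ?B (G\<lparr>carrier := Q\<rparr>)" using subgroup_incl[OF _ Q sub] by blast
    obtain m where m: "card ?B = p ^ m" using p_subgroupD(2)[OF B] cR by auto
    obtain D where D: "D \<in> lcosets\<^bsub>G\<lparr>carrier := Q\<rparr>\<^esub> P" "\<forall>r\<in>?B. r <#\<^bsub>G\<lparr>carrier := Q\<rparr>\<^esub> D = D"
      using H.p_subgroup_fix[OF prime_p RQ m H.gset_lcosets[OF P(1)] P(3)] by blast
    obtain b where b: "b \<in> Q" "D = b <# P" using H.lcosetsE[OF D(1)] by (auto simp: l_coset_def)
    have bG: "b \<in> carrier G" using subgroup.mem_carrier[OF Q b(1)] .
    have "r <# ((a \<otimes> b) <# P) = (a \<otimes> b) <# P" if r: "r \<in> B" for r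
    proof -
      have rG: "r \<in> carrier G" using subgroup.mem_carrier[OF p_subgroupD(1)[OF B] r] .
      have "(inv a \<otimes> r \<otimes> a) <# (b <# P) = b <# P" using D(2) r b(2) by (auto simp: l_coset_def)
      then have "inv b \<otimes> (inv a \<otimes> r \<otimes> a) \<otimes> b \<in> P" using lcoset_fix_iff[OF PG bG] a rG by simp
      then show ?thesis using lcoset_fix_iff[OF PG m_closed[OF a bG] rG] a bG rG by (simp add: inv_mult_group m_assoc)
    qed
    then show "\<exists>C\<in>lcosets P. \<forall>q\<in>B. q <# C = C" using lcosetsI[OF m_closed[OF a bG], of P] by blast
  qed
  then have "P = Q" using min[OF PG PQ] by blast
  then have psQ: "p_subgroup G p Q" using Q P(2) by (auto simp: p_subgroup_def)
  have "\<not> sylow_subgroup G p Q"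
  proof
    assume sy: "sylow_subgroup G p Q"
    \<comment> \<open>\<open>M\<close> is projective relative to both factors, hence to their
      product, hence to a single orbit of it. Moving the base point of this orbit to the coset
      \<open>Q\<close> itself puts its stabiliser \<open>K\<close> inside \<open>Q\<close>.\<close>
    let ?T = "X \<times> lcosets Q" and ?a = "\<lambda>g. map_prod (\<phi> g) (\<lambda>C. g <# C)"
    note gT = gset_Times[OF gX gQ]
    obtain x C where xC: "x \<in> X" "C \<in> lcosets Q" and po: "proj M (orb ?a (x, C)) ?a"
      using proj_orbit[OF ind proj_Times[OF M p pQ]] by auto
    obtain a where a: "a \<in> carrier G" "C = a <# Q" using lcosetsE[OF xC(2)] by blast
    define y where "y = \<phi> (inv a) x"
    have y: "y \<in> X" unfolding y_def by (rule gsetD(2)[OF gX inv_closed[OF a(1)] xC(1)])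
    have yT: "(y, Q) \<in> ?T" using y lcoset_self[OF Q] by simp
    have "(x, C) = ?a a (y, Q)" using gset_inv(2)[OF gX a(1) xC(1)] a(2) by (simp add: y_def)
    then have oe: "orb ?a (x, C) = orb ?a (y, Q)" using orb_eq[OF gT yT a(1)] by simp
    define K where "K = stab ?a (y, Q)"
    have K: "subgroup K G" unfolding K_def by (rule subgroup_stab[OF gT yT])
    have KQ: "K \<subseteq> Q" using lcoset_fix_self[OF Q] by (auto simp: K_def stab_def)
    have "proj M (lcosets K) (\<lambda>g C. g <# C)"
    proof (rule proj_family[OF prime_p ch M po gset_lcosets[OF K]])
      fix B z assume B: "p_subgroup G p B" and z: "z \<in> orb ?a (x, C)" and fx: "\<forall>r\<in>B. ?a r z = z"
      obtain g where g: "g \<in> carrier G" "z = ?a g (y, Q)" using z unfolding oe by (auto simp: orb_def)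
      have "r <# (g <# K) = g <# K" if r: "r \<in> B" for r
      proof -
        have rG: "r \<in> carrier G" using subgroup.mem_carrier[OF p_subgroupD(1)[OF B] r] .
        have "?a (inv g \<otimes> (r \<otimes> g)) (y, Q) = ?a (inv g) (?a r (?a g (y, Q)))"
          using gsetD(4)[OF gT inv_closed[OF g(1)] m_closed[OF rG g(1)] yT] gsetD(4)[OF gT rG g(1) yT] by simp
        also have "\<dots> = (y, Q)" using fx r g gset_inv(1)[OF gT g(1) yT] by simp
        finally have "inv g \<otimes> r \<otimes> g \<in> K" using g(1) rG by (simp add: K_def stab_def m_assoc)
        then show ?thesis using lcoset_fix_iff[OF K g(1) rG] by simp
      qed
      then show "\<exists>C\<in>lcosets K. \<forall>q\<in>B. q <# C = C" using lcosetsI[OF g(1)] by blast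
    qed
    then have "K = Q" by (rule min[OF K KQ])
    then have Qy: "\<phi> q y = y" if "q \<in> Q" for q using that by (auto simp: K_def stab_def)
    \<comment> \<open>Now \<open>Q\<close> fixes \<open>y\<close>. Since \<open>S\<close> fixes a
      coset of \<open>Q\<close> with representative \<open>b\<close>, it fixes the translate of
      \<open>y\<close> by \<open>b\<close>, although \<open>X\<close> has no S-fixed points.\<close>
    obtain D where D: "D \<in> lcosets Q" "\<forall>s\<in>S. s <# D = D" using sylow_fix[OF sy p_subgroup_S] by blast
    obtain b where b: "b \<in> carrier G" "D = b <# Q" using lcosetsE[OF D(1)] by blast
    have "\<phi> s (\<phi> b y) = \<phi> b y" if s: "s \<in> S" for s
    proof -
      note sG = S_carrier[OF s]
      have "inv b \<otimes> s \<otimes> b \<in> Q" using lcoset_fix_iff[OF Q b(1) sG] D(2) s b(2) by simp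
      then have "\<phi> b (\<phi> (inv b \<otimes> s \<otimes> b) y) = \<phi> b y" using Qy by simp
      moreover have "\<phi> b (\<phi> (inv b \<otimes> s \<otimes> b) y) = \<phi> s (\<phi> b y)"
        using gsetD(4)[OF gX b(1) _ y, of "inv b \<otimes> s \<otimes> b"] gsetD(4)[OF gX sG b(1) y] b(1) sG
        by (simp add: m_assoc[symmetric])
      ultimately show ?thesis by simp
    qed
    then show False using X gsetD(2)[OF gX b(1) y] by (auto simp: nofix_def)
  qed
  then show ?thesis using psQ by (simp add: non_sylow_p_subgroups_def)
qed

lemma vertex_S_absurd:
  assumes "indecomposable G M" "nofix X \<phi>" "proj M X \<phi>" "is_vertex G S M" shows False
  using vertex_non_sylow[OF assms] sylow_S by (simp add: non_sylow_p_subgroups_def)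

text \<open>
  If the fixed part of a permuted frame cannot split off, the operator \<open>\<Theta>\<close> that it defines squares
  to zero, so \<open>1 + \<Theta>\<close> corrects the remaining vectors to a frame.
\<close>

lemma perm_frame_nofix:
  assumes p: "perm_frame M Z \<phi> e l" and gd: "good Z \<phi>"
    and nt: "\<And>a b. a \<in> vecs M \<Longrightarrow> \<forall>g\<in>carrier G. act M g a = a \<Longrightarrow> ghom M kmod b \<Longrightarrow> b a = 0"
  shows "\<exists>X e'. nofix X \<phi> \<and> perm_frame M X \<phi> e' l"
proof -
  note gZ = perm_frameD(1)[OF p] and F = perm_frameD(2)[OF p]
  define X where "X = {z \<in> Z. \<exists>s\<in>S. \<phi> s z \<noteq> z}"
  define A where "A = {z \<in> Z. \<forall>g\<in>carrier G. \<phi> g z = z}"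
  have ZA: "Z - X = A" "X \<subseteq> Z" "A \<subseteq> Z" "A \<inter> X = {}" using gd S_carrier by (auto simp: good_def X_def A_def)
  have Xc: "\<phi> g z \<in> X" if g: "g \<in> carrier G" and z: "z \<in> X" for g z
  proof (rule ccontr)
    assume "\<phi> g z \<notin> X"
    then have "\<phi> g z \<in> A" using ZA gsetD(2)[OF gZ g] z by blast
    then have "\<phi> (inv g) (\<phi> g z) = \<phi> g z" using g by (auto simp: A_def)
    then have "z = \<phi> g z" using gset_inv(1)[OF gZ g] z ZA(2) by auto
    then show False using \<open>\<phi> g z \<notin> X\<close> z by simp
  qed
  have gX: "gset X \<phi>" by (rule gset_subset[OF gZ ZA(2) Xc])
  have gA: "gset A \<phi>" by (rule gset_subset[OF gZ ZA(3)]) (auto simp: A_def)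
  define \<Theta> where "\<Theta> = (\<lambda>v. \<Sum>z\<in>A. scl M (l z v) (e z))"
  have e: "e z \<in> vecs M" if "z \<in> Z" for z using frameD(2)[OF F that] .
  have l: "lin M kmod (l z)" if "z \<in> Z" for z using frameD(3)[OF F that] .
  have \<Theta>: "ghom M M \<Theta>" unfolding \<Theta>_def
  proof (rule fam_sum_ghom[OF M M gA, of "\<lambda>z v. scl M (l z v) (e z)"], rule famI)
    show "lin M M (\<lambda>v. scl M (l z v) (e z))" if "z \<in> A" for z
      using that ZA(3) by (intro lin_fscl[OF M] l e) auto
    show "scl M (l (\<phi> g z) (act M g v)) (e (\<phi> g z)) = act M g (scl M (l z v) (e z))"
      if "g \<in> carrier G" "z \<in> A" "v \<in> vecs M" for g z v
      using that ZA(3) by (auto simp: perm_frameD(3,5)[OF p] lin_scl[OF mdl_act_lin[OF M] e] subset_iff)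
  qed
  note \<Theta>l = ghomD(1)[OF \<Theta>]
  \<comment> \<open>At fixed points the frame vector is invariant and so is the form, so
    \<open>nt\<close> applies to the pair.\<close>
  have lA: "l z (e z') = 0" if z: "z \<in> A" and z': "z' \<in> A" for z z'
  proof (rule nt)
    show "e z' \<in> vecs M" using e z' ZA(3) by blast
    show "\<forall>g\<in>carrier G. act M g (e z') = e z'"
      using perm_frameD(3)[OF p] z' by (force simp: A_def)
    show "ghom M kmod (l z)" unfolding ghom_def
    proof (intro conjI ballI)
      show "lin M kmod (l z)" using l z ZA(3) by blast
      fix g x assume "g \<in> carrier G" "x \<in> vecs M"
      then show "l z (act M g x) = act kmod g (l z x)"
        using perm_frameD(5)[OF p, of g z x] z by (auto simp: A_def)
    qed
  qed
  have \<Theta>\<Theta>: "\<Theta> (\<Theta> v) = 0" if v: "v \<in> vecs M" for v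
  proof -
    have "l z (\<Theta> v) = 0" if z: "z \<in> A" for z
      unfolding \<Theta>_def using lin_lincomb[OF M mdl_kmod l[of z], of A e "\<lambda>z. l z v"] e lA[OF z] z ZA(3) by auto
    then show ?thesis by (subst \<Theta>_def) (simp add: scl_0[OF M])
  qed
  have sumX: "(\<Sum>z\<in>X. scl M (l z v) (e z)) = v - \<Theta> v" if v: "v \<in> vecs M" for v
    using frameD(4)[OF F v] sum.subset_diff[OF ZA(2) gsetD(1)[OF gZ], of "\<lambda>z. scl M (l z v) (e z)"] ZA(1)
    by (simp add: \<Theta>_def algebra_simps)
  have eX: "e z \<in> vecs M" if "z \<in> X" for z using e that ZA(2) by blast
  have "perm_frame M X \<phi> (\<lambda>z. e z + \<Theta> (e z)) l"
    unfolding perm_frame_def frame_def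
  proof (intro conjI ballI)
    show "e z + \<Theta> (e z) \<in> vecs M" if "z \<in> X" for z
      using that ZA(2) by (intro mdl_add[OF M] lin_in[OF \<Theta>l] e) auto
    show "v = (\<Sum>z\<in>X. scl M (l z v) (e z + \<Theta> (e z)))" if v: "v \<in> vecs M" for v
    proof -
      have "(\<Sum>z\<in>X. scl M (l z v) (\<Theta> (e z))) = \<Theta> (\<Sum>z\<in>X. scl M (l z v) (e z))"
        using lin_lincomb[OF M M \<Theta>l eX, where c = "\<lambda>z. l z v"] by simp
      also have "\<dots> = \<Theta> v" using sumX[OF v] lin_diff[OF M M \<Theta>l v lin_in[OF \<Theta>l v]] \<Theta>\<Theta>[OF v] by simp
      finally show ?thesis using sumX[OF v] by (simp add: scl_add[OF M] sum.distrib)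
    qed
    show "e (\<phi> g z) + \<Theta> (e (\<phi> g z)) = act M g (e z + \<Theta> (e z))" if g: "g \<in> carrier G" and z: "z \<in> X" for g z
    proof -
      have z: "z \<in> Z" using z ZA(2) by blast
      show ?thesis
        using perm_frameD(3)[OF p g z] ghomD(2)[OF \<Theta> g e[OF z]] lin_add[OF mdl_act_lin[OF M g] e[OF z] lin_in[OF \<Theta>l e[OF z]]] by simp
    qed
    show "fam M kmod X \<phi> l" using perm_frameD(4)[OF p] ZA(2) by (auto simp: fam_def)
  qed (use gX gsetD(1)[OF gX] l ZA(2) in auto)
  moreover have "nofix X \<phi>" using gX by (auto simp: nofix_def X_def)
  ultimately show ?thesis by blast
qed

end

text \<open>Every module is projective relative to \<open>S\<close>, so a vertex can be found inside
  \<open>S\<close>; the hypothesis then makes it non-Sylow.\<close>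

lemma indec_proj_non_sylow_cosets:
  fixes U :: "('a, 'k::field, 'v::ab_group_add) gmod"
  assumes U: "mdl U" and ch: "CHAR('k) = p" and v: "\<And>Q. Q \<subseteq> S \<Longrightarrow> is_vertex G Q U \<Longrightarrow> Q \<in> non_sylow_p_subgroups G p"
  shows "proj U non_sylow_cosets (\<lambda>g C. g <# C)"
proof -
  have "relatively_projective G S U"
    using relatively_projective_iff[OF U subgroup_S] proj_lcosets_S[OF U ch] by blast
  then obtain Q where Q: "Q \<subseteq> S" "is_vertex G Q U" using ex_vertex[OF U subgroup_S] by blast
  then have "subgroup Q G" "relatively_projective G Q U" by (auto simp: is_vertex_def)
  then show ?thesis
    using proj_non_sylow_cosets[OF U ch v[OF Q]] relatively_projective_iff[OF U] by blast
qed

text \<open>Forwards, the vertex condition makes \<open>W\<close> projective relative to the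
  non-Sylow subgroups, so its permuted frame can be refined to one without S-fixed points, and k^n
  adds n fixed points. Backwards, split all trivial summands off End(M); the rest has a permuted
  frame without S-fixed points, which rules out Sylow vertices.\<close>

lemma Dade_module_iff:
  fixes M :: "('a, 'k::field, 'v::ab_group_add) gmod"
  assumes ch: "CHAR('k) = p"
  shows "Dade_module G p M \<longleftrightarrow> mdl M \<and> linked M M"
proof (cases "mdl M")
  case M: True
  note E = mdl_End[OF M]
  show ?thesis
  proof
    assume "Dade_module G p M"
    then obtain n and W :: "('a, 'k) std_gmod" where pp: "p_permutation G W"
      and v: "\<And>(U :: ('a, 'k) std_gmod) Q. indecomposable G U \<Longrightarrow> gmod_summand G U W \<Longrightarrow> is_vertex G Q U \<Longrightarrow> Q \<in> non_sylow_p_subgroups G p"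
      and iso: "gmod_iso G (End_gmod G M) (direct_sum (trivial_gmod n) W)"
      unfolding Dade_module_def by blast
    have W: "mdl W" using pp by (auto simp: p_permutation_def gmod_summand_def)
    have "proj W non_sylow_cosets (\<lambda>g C. g <# C)"
    proof (rule proj_of_summands[OF W nofix_gset[OF nofix_non_sylow_cosets]])
      fix U :: "('a, 'k) std_gmod" assume U: "indecomposable G U" "gmod_summand G U W"
      show "proj U non_sylow_cosets (\<lambda>g C. g <# C)"
        using U v[OF U] by (intro indec_proj_non_sylow_cosets[OF _ ch]) (auto simp: indecomposable_def)
    qed
    moreover obtain X :: "nat set" and \<phi> e l where p: "perm_frame W X \<phi> e l" using p_permutation_perm_frame[OF W pp] by blast
    ultimately obtain e l where p2: "perm_frame W (X \<times> non_sylow_cosets) (\<lambda>g. map_prod (\<phi> g) (\<lambda>C. g <# C)) e l"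
      using perm_frame_Times[OF W p] by blast
    have p1: "perm_frame (trivial_gmod n :: ('a, 'k) std_gmod) {..<n} (\<lambda>g z. z) (\<lambda>i j. if j = i then 1 else 0) (\<lambda>i f. f i)"
      using trivial_frame frameD(3)[OF trivial_frame]
      by (auto simp: perm_frame_def gset_point trivial_gmod_simps intro!: famI linI)
    note T = mdl_direct_sum[OF mdl_trivial W]
    obtain e l where p3: "perm_frame (direct_sum (trivial_gmod n) W) ({..<n} <+> X \<times> non_sylow_cosets) (\<lambda>g. map_sum (\<lambda>z. z) (map_prod (\<phi> g) (\<lambda>C. g <# C))) e l"
      using perm_frame_direct_sum[OF mdl_trivial W p1 p2] by blast
    have gd: "good ({..<n} <+> X \<times> non_sylow_cosets) (\<lambda>g. map_sum (\<lambda>z. z) (map_prod (\<phi> g) (\<lambda>C. g <# C)))"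
      using good_Plus[OF good_point[of "{..<n}"] nofix_good[OF nofix_Times2[OF perm_frameD(1)[OF p] nofix_non_sylow_cosets]]] by simp
    obtain f h where "ginv (End_gmod G M) (direct_sum (trivial_gmod n) W) f h" using iso gmod_iso_iff[OF E T] by blast
    from perm_frame_retr[OF ginv_retr[OF this] E T p3] have "linked M M" using linked_of_End[OF M _ gd] by blast
    then show "mdl M \<and> linked M M" using M by simp
  next
    assume "mdl M \<and> linked M M"
    then obtain Z :: "nat set" and \<phi> f h where D: "linking M M Z \<phi> f h" using linkedE by blast
    obtain I :: "nat set" and u m where Fr: "frame M I u m" using ex_frame[OF M] by blast
    obtain n and W :: "('a, 'k) std_gmod" and F H where W: "mdl W" and g: "ginv (End_gmod G M) (direct_sum (trivial_gmod n) W) F H"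
      and nt: "\<And>a b. a \<in> vecs W \<Longrightarrow> \<forall>g\<in>carrier G. act W g a = a \<Longrightarrow> ghom W kmod b \<Longrightarrow> b a = 0"
      using split_trivial[OF E] by metis
    note T = mdl_direct_sum[OF mdl_trivial W]
    have "retr W (direct_sum (trivial_gmod n :: ('a, 'k) std_gmod) W) (\<lambda>w. (0, w)) snd"
      by (auto simp: retr_def ghom_def trivial_gmod_simps fun_eq_iff intro!: linI)
    from perm_frame_retr[OF retr_trans[OF this ginv_retr[OF ginv_sym[OF g]]] W E End_of_linking[OF M D Fr]]
    obtain e l where pW: "perm_frame W Z \<phi> e l" by blast
    then have pp: "p_permutation G W" by (rule perm_frame_p_permutation[OF W])
    obtain X :: "nat set" and e' where X: "nofix X \<phi>" "perm_frame W X \<phi> e' l"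
      using perm_frame_nofix[OF W ch pW linkingD(1)[OF D]] nt by blast
    have v: "Q \<in> non_sylow_p_subgroups G p"
      if U: "indecomposable G U" "gmod_summand G U W" and Q: "is_vertex G Q U" for U :: "('a, 'k) std_gmod" and Q
    proof -
      have mU: "mdl U" using U(1) by (simp add: indecomposable_def)
      obtain i q where "retr U W i q" using U(2) gmod_summand_iff[OF mU W] by blast
      from proj_retr[OF mU W this perm_frame_proj[OF W X(2)]]
      show ?thesis using vertex_non_sylow[OF mU ch U(1) X(1) _ Q] by blast
    qed
    have "gmod_iso G (End_gmod G M) (direct_sum (trivial_gmod n) W)" using gmod_iso_iff[OF E T] g by blast
    then show "Dade_module G p M" unfolding Dade_module_def using M pp v by blast
  qed
qed (simp add: Dade_module_def)

text \<open>Inserting the identity map into the linking writes it as the sum of the maps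
  \<open>f z\<close> with coefficients tr(h z). At a fixed point \<open>h z\<close> is equivariant,
  so if \<open>M\<close> were not traced these coefficients would vanish and \<open>M\<close> would
  be projective relative to a set without S-fixed points.\<close>

lemma traced_of_vertex_S:
  fixes M :: "('a, 'k::field, 'v::ab_group_add) gmod" and U :: "('a, 'k, 'u::ab_group_add) gmod"
  assumes ch: "CHAR('k) = p" and M: "mdl M" and linked: "linked M M" and U: "indecomposable G U" "gmod_summand G U M" "is_vertex G S U"
  shows "traced M"
proof (rule ccontr)
  assume nt: "\<not> traced M"
  obtain Z :: "nat set" and \<phi> f h where D: "linking M M Z \<phi> f h" using linkedE[OF linked] by blast
  obtain I :: "nat set" and e l where F: "frame M I e l" using ex_frame[OF M] by blast
  note gZ = good_gset[OF linkingD(1)[OF D]] and fh = famD[OF linkingD(3)[OF D]] and ff = famD[OF linkingD(2)[OF D]]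
  \<comment> \<open>The trace of \<open>h z\<close>, which is constant on orbits.\<close>
  define t where "t = (\<lambda>z. \<Sum>i\<in>I. l i (h z (e i)))"
  have tinv: "t (\<phi> g z) = t z" if "g \<in> carrier G" "z \<in> Z" for g z
    unfolding t_def by (rule trace_fam[OF M F linkingD(3)[OF D] that gsetD(2)[OF gZ that]])
  have sum: "(\<Sum>z\<in>Z. scl M (t z) (f z v)) = v" if v: "v \<in> vecs M" for v
  proof -
    have "(\<Sum>z\<in>Z. scl M (t z) (f z v)) = (\<Sum>i\<in>I. \<Sum>z\<in>Z. scl M (l i (h z (e i))) (f z v))"
      by (subst sum.swap) (simp add: t_def scl_sum_left[OF M])
    also have "\<dots> = (\<Sum>i\<in>I. scl M (l i v) (e i))"
      using linkingD(4)[OF D frameD(3)[OF F] v frameD(2)[OF F]] by simp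
    finally show ?thesis using frameD(4)[OF F v] by simp
  qed
  have tA: "t z = 0" if z: "z \<in> Z" and fx: "\<forall>s\<in>S. \<phi> s z = z" for z
  proof -
    have "ghom M M (h z)" unfolding ghom_def
    proof (intro conjI ballI fh(1)[OF z])
      fix g x assume "g \<in> carrier G" "x \<in> vecs M"
      then show "h z (act M g x) = act M g (h z x)"
        using fh(2)[of g z x] z linkingD(1)[OF D] fx by (auto simp: good_def)
    qed
    then show ?thesis using nt tracedI[OF F] unfolding t_def by blast
  qed
  define X where "X = {z \<in> Z. t z \<noteq> 0}"
  have gX: "gset X \<phi>" by (rule gset_subset[OF gZ]) (auto simp: X_def tinv gsetD(2)[OF gZ])
  have nX: "nofix X \<phi>" using gX tA by (auto simp: nofix_def X_def)
  have "proj M X \<phi>"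
  proof (rule projI[OF gX])
    show "fam M M X \<phi> (\<lambda>z v. scl M (t z) (f z v))"
      by (rule famI) (auto simp: X_def tinv ff(2) lin_scl[OF mdl_act_lin[OF M] lin_in[OF ff(1)]] intro!: lin_smult[OF M] ff(1))
    show "(\<Sum>z\<in>X. scl M (t z) (f z v)) = v" if v: "v \<in> vecs M" for v
      using sum[OF v] sum.mono_neutral_right[OF gsetD(1)[OF gZ], of X "\<lambda>z. scl M (t z) (f z v)"] by (simp add: X_def scl_0[OF M])
  qed
  moreover have mU: "mdl U" using U(1) by (simp add: indecomposable_def)
  moreover obtain i q where "retr U M i q" using U(2) gmod_summand_iff[OF mU M] by blast
  ultimately have "proj U X \<phi>" using proj_retr[OF mU M] by blast
  then show False using vertex_S_absurd[OF mU ch U(1) nX _ U(3)] by blast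
qed

text \<open>Composing with the family expresses the trace of \<open>c\<close> as a sum over
  \<open>X\<close> of traces that are constant on orbits, and such a sum vanishes in characteristic
  p.\<close>

lemma not_traced_of_proj:
  fixes M :: "('a, 'k::field, 'v::ab_group_add) gmod"
  assumes ch: "CHAR('k) = p" and M: "mdl M" and X: "nofix X \<phi>" and p: "proj M X \<phi>"
  shows "\<not> traced M"
proof
  assume "traced M"
  then obtain I :: "nat set" and e l c where F: "frame M I e l" and c: "ghom M M c" and nz: "(\<Sum>i\<in>I. l i (c (e i))) \<noteq> 0"
    unfolding traced_def by blast
  obtain \<alpha> where gX: "gset X \<phi>" and a: "fam M M X \<phi> \<alpha>" "\<And>v. v \<in> vecs M \<Longrightarrow> (\<Sum>x\<in>X. \<alpha> x v) = v"
    using projE[OF p] by blast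
  note ac = fam_comp[OF c a(1) ghom_id]
  define w where "w = (\<lambda>x. \<Sum>i\<in>I. l i (\<alpha> x (c (e i))))"
  have "w (\<phi> g x) = w x" if "g \<in> carrier G" "x \<in> X" for g x
    unfolding w_def by (rule trace_fam[OF M F ac that gsetD(2)[OF gX that]])
  moreover obtain n where "card S = p ^ n" using p_subgroupD(2)[OF p_subgroup_S] by blast
  ultimately have "(\<Sum>x\<in>X. w x) = 0"
    using p_subgroup_nofix(2)[OF prime_p subgroup_S _ gX _ _ ch] X by (auto simp: nofix_def)
  moreover have "(\<Sum>x\<in>X. w x) = (\<Sum>i\<in>I. l i (c (e i)))"
  proof -
    have "(\<Sum>x\<in>X. w x) = (\<Sum>i\<in>I. \<Sum>x\<in>X. l i (\<alpha> x (c (e i))))" unfolding w_def by (rule sum.swap)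
    also have "\<dots> = (\<Sum>i\<in>I. l i (c (e i)))"
    proof (rule sum.cong[OF refl])
      fix i assume i: "i \<in> I"
      note ci = lin_in[OF ghomD(1)[OF c] frameD(2)[OF F i]]
      show "(\<Sum>x\<in>X. l i (\<alpha> x (c (e i)))) = l i (c (e i))"
        using lin_sum[OF M mdl_kmod frameD(3)[OF F i], of X "\<lambda>x. \<alpha> x (c (e i))"] lin_in[OF famD(1)[OF a(1)] ci] a(2)[OF ci] by simp
    qed
    finally show ?thesis .
  qed
  ultimately show False using nz by simp
qed

text \<open>If no indecomposable summand had vertex \<open>S\<close>, each would have a vertex
  properly contained in \<open>S\<close>. Then \<open>M\<close> would be projective relative to
  non-Sylow subgroups, and every equivariant endomorphism would have trace 0.\<close>

lemma capped_iff:
  fixes M :: "('a, 'k::field, 'v::ab_group_add) gmod"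
  assumes ch: "CHAR('k) = p"
  shows "capped_Dade_module G p S M \<longleftrightarrow> mdl M \<and> linked M M \<and> traced M"
proof
  assume "capped_Dade_module G p S M"
  then show "mdl M \<and> linked M M \<and> traced M"
    unfolding capped_Dade_module_def Dade_module_iff[OF ch] using traced_of_vertex_S[OF ch] by blast
next
  assume *: "mdl M \<and> linked M M \<and> traced M"
  then have M: "mdl M" by simp
  have "\<exists>U :: ('a, 'k, 'v) gmod. indecomposable G U \<and> gmod_summand G U M \<and> is_vertex G S U"
  proof (rule ccontr)
    assume no: "\<nexists>U :: ('a, 'k, 'v) gmod. indecomposable G U \<and> gmod_summand G U M \<and> is_vertex G S U"
    have "proj M non_sylow_cosets (\<lambda>g C. g <# C)"
    proof (rule proj_of_summands[OF M nofix_gset[OF nofix_non_sylow_cosets]])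
      fix U :: "('a, 'k, 'v) gmod" assume U: "indecomposable G U" "gmod_summand G U M"
      show "proj U non_sylow_cosets (\<lambda>g C. g <# C)"
      proof (rule indec_proj_non_sylow_cosets[OF _ ch])
        show "mdl U" using U(1) by (simp add: indecomposable_def)
        fix Q assume Q: "Q \<subseteq> S" "is_vertex G Q U"
        then have "Q \<subset> S" "subgroup Q G" using no U by (auto simp: is_vertex_def)
        then show "Q \<in> non_sylow_p_subgroups G p"
          using p_subgroup_sub[OF p_subgroup_S] psubset_card_mono[OF finite_subgroup[OF subgroup_S]] Q(1)
          by (simp add: non_sylow_iff)
      qed
    qed
    then show False using not_traced_of_proj[OF ch M nofix_non_sylow_cosets] * by blast
  qed
  then show "capped_Dade_module G p S M" using * by (simp add: capped_Dade_module_def Dade_module_iff[OF ch])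
qed

lemma compatible_iff:
  fixes M :: "('a, 'k::field, 'v::ab_group_add) gmod" and N :: "('a, 'k, 'w::ab_group_add) gmod"
  assumes "CHAR('k) = p" "mdl M" "mdl N"
  shows "compatible G p M N \<longleftrightarrow> linked M M \<and> linked N N \<and> linked M N"
  unfolding compatible_def Dade_module_iff[OF assms(1)] linked_direct_sum[OF assms(2,3)]
  using mdl_direct_sum[OF assms(2,3)] by simp

end

section \<open>Relative syzygies\<close>

abbreviation kron :: "'x \<Rightarrow> 'x \<Rightarrow> 'k::field"
  where "kron x y \<equiv> if y = x then 1 else 0"

lemma sum_kron [simp]: "finite X \<Longrightarrow> (\<Sum>x\<in>X. f x * kron x y) = (if y \<in> X then f y else (0::'k::field))"
  by (simp add: if_distrib cong: if_cong)

lemma sum_kron' [simp]: "finite X \<Longrightarrow> (\<Sum>y\<in>X. f y * kron x y) = (if x \<in> X then f x else (0::'k::field))"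
  by (simp add: if_distrib cong: if_cong)

context fgroup
begin

text \<open>The submodules of permutation modules used below all have this form, so the module
  axioms are verified once, in \<open>mdl_psub\<close>.\<close>

definition psub :: "'x set \<Rightarrow> ('a \<Rightarrow> 'x \<Rightarrow> 'x) \<Rightarrow> ('x \<Rightarrow> 'k::field) set \<Rightarrow> ('a, 'k, 'x \<Rightarrow> 'k) gmod"
  where "psub X \<phi> V = (perm_gmod G X \<phi>)\<lparr>vecs := V\<rparr>"

lemma psub_simps: "vecs (psub X \<phi> V) = V" "scl (psub X \<phi> V) = (\<lambda>c f x. c * f x)"
  "act (psub X \<phi> V) g f = (\<lambda>x. if x \<in> X then f (\<phi> (inv g) x) else 0)"
  by (simp_all add: psub_def perm_gmod_simps)

lemma mdl_psub:
  assumes X: "gset X \<phi>" and V: "\<And>f x. f \<in> V \<Longrightarrow> x \<notin> X \<Longrightarrow> f x = 0" "(\<lambda>_. 0) \<in> V"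
    "\<And>f h. f \<in> V \<Longrightarrow> h \<in> V \<Longrightarrow> (\<lambda>x. f x + h x) \<in> V" "\<And>c f. f \<in> V \<Longrightarrow> (\<lambda>x. c * f x) \<in> V"
    and act: "\<And>g f. g \<in> carrier G \<Longrightarrow> f \<in> V \<Longrightarrow> (\<lambda>x. if x \<in> X then f (\<phi> (inv g) x) else 0) \<in> V"
    and fr: "frame (psub X \<phi> V) I e l"
  shows "mdl (psub X \<phi> V)"
proof (rule mdlI_frame[OF _ _ _ _ _ _ _ fr])
  show "vector_space (scl (psub X \<phi> V))" unfolding psub_simps by (rule vs_fun)
  show "0 \<in> vecs (psub X \<phi> V)" using V(2) by (simp add: psub_simps zero_fun_def)
  show "x + y \<in> vecs (psub X \<phi> V)" if "x \<in> vecs (psub X \<phi> V)" "y \<in> vecs (psub X \<phi> V)" for x y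
    using that V(3) by (simp add: psub_simps plus_fun_def)
  show "scl (psub X \<phi> V) c x \<in> vecs (psub X \<phi> V)" if "x \<in> vecs (psub X \<phi> V)" for c x
    using that V(4) by (simp add: psub_simps)
  show "lin (psub X \<phi> V) (psub X \<phi> V) (act (psub X \<phi> V) g)" if "g \<in> carrier G" for g
    using act[OF that] by (intro linI) (auto simp: psub_simps fun_eq_iff)
  show "act (psub X \<phi> V) \<one> v = v" if "v \<in> vecs (psub X \<phi> V)" for v
    using that V(1) gsetD(3)[OF X] by (auto simp: psub_simps fun_eq_iff)
  show "act (psub X \<phi> V) (g \<otimes> h) v = act (psub X \<phi> V) g (act (psub X \<phi> V) h v)"
    if "g \<in> carrier G" "h \<in> carrier G" "v \<in> vecs (psub X \<phi> V)" for g h v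
    using that gsetD(2,4)[OF X] by (auto simp: psub_simps fun_eq_iff inv_mult_group)
qed

lemma psub_lin_eval: "lin (psub X \<phi> V) kmod (\<lambda>f. f x)"
  by (rule linI) (auto simp: psub_simps)

definition Dvecs :: "'x set \<Rightarrow> ('x \<Rightarrow> 'k::field) set"
  where "Dvecs X = {f. (\<forall>x. x \<notin> X \<longrightarrow> f x = 0) \<and> (\<Sum>x\<in>X. f x) = 0}"

lemma Delta_psub: "Delta_gmod G X \<phi> = psub X \<phi> (Dvecs X)"
  by (auto simp: Delta_gmod_def psub_def Dvecs_def perm_gmod_simps)

lemma perm_psub: "perm_gmod G X \<phi> = psub X \<phi> {f. \<forall>x. x \<notin> X \<longrightarrow> f x = 0}"
  by (simp add: psub_def perm_gmod_def)

text \<open>The frame vectors are x - b for an arbitrary element \<open>b\<close> of augmentation 1;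
  \<open>b\<close> cancels in the expansion because the coefficients sum to 0. The freedom in
  \<open>b\<close> allows it to vary equivariantly with a parameter later.\<close>

lemma Delta_frame:
  fixes b :: "'x \<Rightarrow> 'k::field"
  assumes X: "finite X" and b: "\<And>x. x \<notin> X \<Longrightarrow> b x = 0" "(\<Sum>x\<in>X. b x) = 1"
  shows "frame (Delta_gmod G X \<phi>) X (\<lambda>x y. kron x y - b y) (\<lambda>x f. f x)"
  unfolding frame_def Delta_psub
proof (intro conjI ballI)
  show "(\<lambda>y. kron x y - b y) \<in> vecs (psub X \<phi> (Dvecs X))" if "x \<in> X" for x
    using that b X sum_kron'[OF X, of "\<lambda>_. 1" x] by (auto simp: psub_simps Dvecs_def sum_subtractf)
  show "v = (\<Sum>x\<in>X. scl (psub X \<phi> (Dvecs X)) (v x) (\<lambda>y. kron x y - b y))" if "v \<in> vecs (psub X \<phi> (Dvecs X))" for v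
  proof
    fix y
    have "(\<Sum>x\<in>X. v x * (kron x y - b y)) = (\<Sum>x\<in>X. v x * kron x y) - (\<Sum>x\<in>X. v x) * b y"
      by (simp add: right_diff_distrib sum_subtractf sum_distrib_right)
    then show "v y = (\<Sum>x\<in>X. scl (psub X \<phi> (Dvecs X)) (v x) (\<lambda>y. kron x y - b y)) y"
      using that X by (simp add: psub_simps sum_fun_apply Dvecs_def)
  qed
qed (use X psub_lin_eval in auto)

context
  fixes X :: "'x set" and \<phi>
  assumes X: "gset X \<phi>"
begin

lemma inv_bij: "g \<in> carrier G \<Longrightarrow> (\<Sum>x\<in>X. f (\<phi> (inv g) x)) = (\<Sum>x\<in>X. f x)"
  by (rule gset_sum[OF X]) simp

lemma mdl_Delta:
  assumes "X \<noteq> {}" shows "mdl (Delta_gmod G X \<phi> :: ('a, 'k::field, 'x \<Rightarrow> 'k) gmod)"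
proof -
  obtain x0 where x0: "x0 \<in> X" using assms by blast
  have f: "finite X" by (rule gsetD(1)[OF X])
  have "frame (Delta_gmod G X \<phi>) X (\<lambda>x y. kron x y - kron x0 y :: 'k) (\<lambda>x f. f x)"
    by (rule Delta_frame) (use f x0 in auto)
  then show ?thesis unfolding Delta_psub
    by (rule mdl_psub[OF X, rotated -1])
      (auto simp: Dvecs_def sum.distrib sum_distrib_left[symmetric] inv_bij)
qed

lemma act_kron: "g \<in> carrier G \<Longrightarrow> x \<in> X \<Longrightarrow> y \<in> X \<Longrightarrow> kron x (\<phi> (inv g) y) = (kron (\<phi> g x) y :: 'k::field)"
  using gset_inv[OF X] by auto

end

end

section \<open>Linkedness and trace of augmentation kernels\<close>

context sylow_context
begin

text \<open>Hom(M, N) is the dual of M tensor N. As \<open>N\<close> is a summand of kT, it suffices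
  that \<open>M\<close> has a frame permuted by the stabiliser of each point of \<open>T\<close>,
  that is, a frame \<open>e t\<close> depending equivariantly on \<open>t\<close>; \<open>M\<close>
  itself need not be a p-permutation module.\<close>

lemma linked_frames:
  fixes M :: "('a, 'k::field, 'v::ab_group_add) gmod" and N :: "('a, 'k, 'w::ab_group_add) gmod"
  assumes M: "mdl M" and N: "mdl N" and p: "perm_frame N T \<psi> e' l'" and A: "gset A \<phi>"
    and gd: "good (A \<times> T) (\<lambda>g. map_prod (\<phi> g) (\<psi> g))"
    and F: "\<And>t. t \<in> T \<Longrightarrow> frame M A (e t) l"
    and eq: "\<And>g t a. g \<in> carrier G \<Longrightarrow> t \<in> T \<Longrightarrow> a \<in> A \<Longrightarrow> e (\<psi> g t) (\<phi> g a) = act M g (e t a)"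
    and l: "\<And>g a v. g \<in> carrier G \<Longrightarrow> a \<in> A \<Longrightarrow> v \<in> vecs M \<Longrightarrow> l (\<phi> g a) (act M g v) = l a v"
  shows "linked M N"
proof (rule linkedI)
  note F' = perm_frameD(2)[OF p]
  show "linking M N (A \<times> T) (\<lambda>g. map_prod (\<phi> g) (\<psi> g)) (\<lambda>(a, t) m. scl N (l a m) (e' t)) (\<lambda>(a, t) n. scl M (l' t n) (e t a))"
    unfolding linking_def
  proof (intro conjI allI impI)
    show "fam M N (A \<times> T) (\<lambda>g. map_prod (\<phi> g) (\<psi> g)) (\<lambda>(a, t) m. scl N (l a m) (e' t))"
      by (rule famI) (auto simp: l perm_frameD(3)[OF p] lin_scl[OF mdl_act_lin[OF N] frameD(2)[OF F']]
         intro!: lin_fscl[OF N] frameD(3)[OF F] frameD(2)[OF F'])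
    show "fam N M (A \<times> T) (\<lambda>g. map_prod (\<phi> g) (\<psi> g)) (\<lambda>(a, t) n. scl M (l' t n) (e t a))"
      by (rule famI) (auto simp: eq perm_frameD(5)[OF p] lin_scl[OF mdl_act_lin[OF M] frameD(2)[OF F]]
         intro!: lin_fscl[OF M] frameD(3)[OF F'] frameD(2)[OF F])
    fix m v w assume m: "lin M kmod m" and v: "v \<in> vecs M" and w: "w \<in> vecs N"
    have "(\<Sum>z\<in>A \<times> T. scl N (m ((case z of (a, t) \<Rightarrow> \<lambda>n. scl M (l' t n) (e t a)) w)) ((case z of (a, t) \<Rightarrow> \<lambda>m. scl N (l a m) (e' t)) v))
      = (\<Sum>t\<in>T. \<Sum>a\<in>A. scl N (m (scl M (l' t w) (e t a))) (scl N (l a v) (e' t)))"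
      by (subst sum.swap) (simp add: sum.cartesian_product split_def)
    also have "\<dots> = (\<Sum>t\<in>T. scl N (m v) (scl N (l' t w) (e' t)))"
    proof (rule sum.cong[OF refl])
      fix t assume t: "t \<in> T"
      have "(\<Sum>a\<in>A. scl N (m (scl M (l' t w) (e t a))) (scl N (l a v) (e' t))) = (\<Sum>a\<in>A. scl N (l a v * m (e t a)) (scl N (l' t w) (e' t)))"
        using lin_scl[OF m frameD(2)[OF F[OF t]]] by (intro sum.cong) (simp_all add: scl_scl[OF N] mult_ac)
      also have "\<dots> = scl N (m v) (scl N (l' t w) (e' t))"
        using linK_expand[OF M F[OF t] m v] by (simp add: scl_sum_left[OF N, symmetric])
      finally show "(\<Sum>a\<in>A. scl N (m (scl M (l' t w) (e t a))) (scl N (l a v) (e' t))) = scl N (m v) (scl N (l' t w) (e' t))" .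
    qed
    also have "\<dots> = scl N (m v) w" using frameD(4)[OF F' w] by (simp add: scl_sum[OF N, symmetric])
    finally show "(\<Sum>z\<in>A \<times> T. scl N (m ((case z of (a, t) \<Rightarrow> \<lambda>n. scl M (l' t n) (e t a)) w)) ((case z of (a, t) \<Rightarrow> \<lambda>m. scl N (l a m) (e' t)) v)) = scl N (m v) w" .
  qed (rule gd)
qed

context
  fixes X :: "'x set" and \<phi>
  assumes nX: "nofix X \<phi>" and ne: "X \<noteq> {}"
begin

text \<open>The identity of \<open>\<Delta>(X)\<close> accounts for one fixed point, the rank-one
  maps built from differences of two points for the set X x X, which has no S-fixed points.\<close>

lemma linked_Delta: "linked (Delta_gmod G X \<phi> :: ('a, 'k::field, 'x \<Rightarrow> 'k) gmod) (Delta_gmod G X \<phi> :: ('a, 'k, 'x \<Rightarrow> 'k) gmod)"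
proof (rule linkedI)
  let ?D = "Delta_gmod G X \<phi> :: ('a, 'k, 'x \<Rightarrow> 'k) gmod"
  note gX = nofix_gset[OF nX] and fX = gsetD(1)[OF nofix_gset[OF nX]]
  note D = mdl_Delta[OF gX ne, where 'k = 'k]
  obtain x0 where x0: "x0 \<in> X" using ne by blast
  have Fr: "frame ?D X (\<lambda>x y. kron x y - kron x0 y) (\<lambda>x f. f x)"
    by (rule Delta_frame) (use fX x0 in auto)
  \<comment> \<open>The pair (x, y) contributes v(x)(y - x) against w(y)(x - y). As \<open>v\<close>
    and \<open>w\<close> have augmentation 0, the double sum is \<open>l v\<close> times
    \<open>w\<close> plus \<open>l w\<close> times \<open>v\<close>; the extra index 0 with sign -1
    in \<open>H\<close> removes the second term.\<close>
  define F where "F = case_sum (\<lambda>(_ :: nat) v. v) (\<lambda>(x, y) (v :: 'x \<Rightarrow> 'k) t. v x * (kron y t - kron x t))"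
  define H where "H = case_sum (\<lambda>(_ :: nat) v. - v) (\<lambda>(x, y) (v :: 'x \<Rightarrow> 'k) t. v y * (kron x t - kron y t))"
  have din: "(\<lambda>t. c * (kron x t - kron y t)) \<in> vecs ?D" if "x \<in> X" "y \<in> X" for x y and c :: 'k
    using that fX sum_kron'[OF fX, of "\<lambda>_. 1 :: 'k"] by (auto simp: Delta_psub psub_simps Dvecs_def sum_distrib_left[symmetric] sum_subtractf)
  have actd: "(\<lambda>t. c * (kron (\<phi> g x) t - kron (\<phi> g y) t)) = act ?D g (\<lambda>t. c * (kron x t - kron y t))"
    if g: "g \<in> carrier G" and x: "x \<in> X" and y: "y \<in> X" for g x y and c :: 'k
    using act_kron[OF gX g x, where 'k = 'k] act_kron[OF gX g y, where 'k = 'k] gsetD(2)[OF gX g x] gsetD(2)[OF gX g y]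
    by (auto simp: Delta_psub psub_simps fun_eq_iff)
  have ev: "act ?D g v (\<phi> g x) = v x" if "g \<in> carrier G" "x \<in> X" for g x v
    using gset_inv(1)[OF gX that] gsetD(2)[OF gX that] by (simp add: Delta_psub psub_simps)
  have gd: "good ({0::nat} <+> X \<times> X) (\<lambda>g. map_sum (\<lambda>z. z) (map_prod (\<phi> g) (\<phi> g)))"
    using good_Plus[OF good_point[of "{0::nat}"] nofix_good[OF nofix_Times1[OF nX gX]]] by simp
  show "linking ?D ?D ({0::nat} <+> X \<times> X) (\<lambda>g. map_sum (\<lambda>z. z) (map_prod (\<phi> g) (\<phi> g))) F H"
    unfolding linking_def
  proof (intro conjI allI impI)
    show "fam ?D ?D ({0::nat} <+> X \<times> X) (\<lambda>g. map_sum (\<lambda>z. z) (map_prod (\<phi> g) (\<phi> g))) F"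
    proof (rule famI)
      show "lin ?D ?D (F z)" if "z \<in> {0::nat} <+> X \<times> X" for z
        using that din by (auto simp: F_def lin_id intro!: linI) (auto simp: Delta_psub psub_simps fun_eq_iff algebra_simps)
    qed (auto simp: F_def ev actd)
    show "fam ?D ?D ({0::nat} <+> X \<times> X) (\<lambda>g. map_sum (\<lambda>z. z) (map_prod (\<phi> g) (\<phi> g))) H"
    proof (rule famI)
      show "lin ?D ?D (H z)" if "z \<in> {0::nat} <+> X \<times> X" for z
        using that din mdl_neg[OF D] by (auto simp: H_def intro!: linI) (auto simp: Delta_psub psub_simps fun_eq_iff algebra_simps)
    qed (auto simp: H_def ev actd lin_neg[OF D D mdl_act_lin[OF D]])
    fix l v w assume l: "lin ?D kmod l" and v: "v \<in> vecs ?D" and w: "w \<in> vecs ?D"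
    define a where "a = (\<lambda>x. l (\<lambda>y. kron x y - kron x0 y))"
    have lv: "l u = (\<Sum>x\<in>X. u x * a x)" if "u \<in> vecs ?D" for u
      using linK_expand[OF D Fr l that] by (simp add: a_def)
    have ld: "l (\<lambda>t. c * (kron x t - kron y t)) = c * (a x - a y)" if "x \<in> X" "y \<in> X" for x y c
    proof -
      have "l (\<lambda>t. c * (kron x t - kron y t)) = (\<Sum>z\<in>X. (c * a z) * kron x z - (c * a z) * kron y z)"
        unfolding lv[OF din[OF that]] by (intro sum.cong) (auto simp: algebra_simps)
      also have "\<dots> = c * a x - c * a y"
        unfolding sum_subtractf sum_kron'[OF fX] using that by simp
      finally show ?thesis by (simp add: right_diff_distrib)
    qed
    have v0: "(\<Sum>x\<in>X. v x) = 0" "(\<Sum>x\<in>X. w x) = 0" "\<And>t. t \<notin> X \<Longrightarrow> v t = 0" "\<And>t. t \<notin> X \<Longrightarrow> w t = 0"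
      using v w by (auto simp: Delta_psub psub_simps Dvecs_def)
    show "(\<Sum>z\<in>{0::nat} <+> X \<times> X. scl ?D (l (H z w)) (F z v)) = scl ?D (l v) w"
    proof
      fix t
      have e1: "(\<Sum>x\<in>X. \<Sum>y\<in>X. (w y * (a x - a y)) * (v x * (kron y t - kron x t))) =
         (\<Sum>x\<in>X. \<Sum>y\<in>X. (v x * a x) * (w y * kron y t) - (v x * a x * kron x t) * w y - v x * (w y * a y * kron y t) + (v x * kron x t) * (w y * a y))"
        by (intro sum.cong refl) (simp add: algebra_simps del: sum_kron sum_kron')
      have e2: "(\<Sum>x\<in>X. \<Sum>y\<in>X. (v x * a x) * (w y * kron y t)) = l v * w t"
        unfolding sum_product[symmetric] sum_kron[OF fX] lv[OF v] using v0(4) by auto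
      have e3: "(\<Sum>x\<in>X. \<Sum>y\<in>X. (v x * a x * kron x t) * w y) = 0" "(\<Sum>x\<in>X. \<Sum>y\<in>X. v x * (w y * a y * kron y t)) = 0"
        unfolding sum_product[symmetric] v0(1,2) by simp_all
      have e4: "(\<Sum>x\<in>X. \<Sum>y\<in>X. (v x * kron x t) * (w y * a y)) = v t * l w"
        unfolding sum_product[symmetric] sum_kron[OF fX] lv[OF w] using v0(3) by auto
      have e5: "(\<Sum>xy\<in>X \<times> X. l (H (Inr xy) w) * F (Inr xy) v t) = (\<Sum>x\<in>X. \<Sum>y\<in>X. (w y * (a x - a y)) * (v x * (kron y t - kron x t)))"
        unfolding sum.cartesian_product by (rule sum.cong[OF refl]) (auto simp: H_def F_def ld)
      have "(\<Sum>xy\<in>X \<times> X. l (H (Inr xy) w) * F (Inr xy) v t) = l v * w t + v t * l w"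
        unfolding e5 e1 sum.distrib sum_subtractf e2 e3 e4 by simp
      moreover have "(\<Sum>z\<in>{0::nat} <+> X \<times> X. scl ?D (l (H z w)) (F z v)) t = l (- w) * v t + (\<Sum>xy\<in>X \<times> X. l (H (Inr xy) w) * F (Inr xy) v t)"
        using fX by (simp add: sum.Plus sum_fun_apply Delta_psub psub_simps) (simp add: H_def F_def)
      moreover have "l (- w) = - l w" by (rule lin_neg[OF D mdl_kmod l w])
      ultimately show "(\<Sum>z\<in>{0::nat} <+> X \<times> X. scl ?D (l (H z w)) (F z v)) t = scl ?D (l v) w t"
        by (simp add: Delta_psub psub_simps)
    qed
  qed (rule gd)
qed

text \<open>Without S-fixed points p divides the cardinality of \<open>X\<close>, so the dimension,
  which is the trace of the identity, equals -1 in the field.\<close>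

lemma traced_Delta:
  assumes ch: "CHAR('k::field) = p" shows "traced (Delta_gmod G X \<phi> :: ('a, 'k, 'x \<Rightarrow> 'k) gmod)"
proof -
  note gX = nofix_gset[OF nX] and fX = gsetD(1)[OF nofix_gset[OF nX]]
  obtain x0 where x0: "x0 \<in> X" using ne by blast
  obtain n where n: "card S = p ^ n" using p_subgroupD(2)[OF p_subgroup_S] by blast
  have "p dvd card X"
    using p_subgroup_nofix(1)[OF prime_p subgroup_S n gX, of "\<lambda>_. 0 :: nat"] nX by (auto simp: nofix_def)
  then have c0: "of_nat (card X) = (0 :: 'k)" using ch by (simp add: of_nat_eq_0_iff_char_dvd)
  have Fr: "frame (Delta_gmod G X \<phi>) X (\<lambda>x y. kron x y - kron x0 y :: 'k) (\<lambda>x f. f x)"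
    by (rule Delta_frame) (use fX x0 in auto)
  have sm: "(\<Sum>x\<in>X. kron x x - kron x0 x :: 'k) = - 1"
    unfolding sum_subtractf using sum_kron'[OF fX, of "\<lambda>_. 1 :: 'k" x0] x0 c0 by simp
  show ?thesis by (rule tracedI[OF Fr ghom_id], subst sm) simp
qed

end

end

section \<open>Augmentation-preserving maps between permutation modules\<close>

context fgroup
begin

definition wmap :: "'x set \<Rightarrow> 'y set \<Rightarrow> ('y \<Rightarrow> 'x \<Rightarrow> 'k::field) \<Rightarrow> ('x \<Rightarrow> 'k) \<Rightarrow> 'y \<Rightarrow> 'k"
  where "wmap X Y U v = (\<lambda>y. if y \<in> Y then \<Sum>x\<in>X. U y x * v x else 0)"

text \<open>The matrices of the equivariant maps from kX to kY that commute with the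
  augmentations.\<close>

definition weights :: "'x set \<Rightarrow> ('a \<Rightarrow> 'x \<Rightarrow> 'x) \<Rightarrow> 'y set \<Rightarrow> ('a \<Rightarrow> 'y \<Rightarrow> 'y) \<Rightarrow> ('y \<Rightarrow> 'x \<Rightarrow> 'k::field) \<Rightarrow> bool"
  where "weights X \<phi> Y \<psi> U \<longleftrightarrow> (\<forall>g\<in>carrier G. \<forall>y\<in>Y. \<forall>x\<in>X. U (\<psi> g y) (\<phi> g x) = U y x) \<and> (\<forall>x\<in>X. (\<Sum>y\<in>Y. U y x) = 1)"

lemma wmap_sum:
  assumes "finite X" "finite Y" "weights X \<phi> Y \<psi> U" shows "(\<Sum>y\<in>Y. wmap X Y U v y) = (\<Sum>x\<in>X. v x)"
proof -
  have "(\<Sum>y\<in>Y. wmap X Y U v y) = (\<Sum>x\<in>X. (\<Sum>y\<in>Y. U y x) * v x)"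
    unfolding wmap_def by (simp add: sum_distrib_right) (rule sum.swap)
  then show ?thesis using assms(3) by (simp add: weights_def)
qed

lemma ghom_psubI:
  assumes "\<And>f. f \<in> V \<Longrightarrow> F f \<in> W"
    "\<And>f h. F (\<lambda>x. f x + h x) = (\<lambda>y. F f y + F h y)" "\<And>c f. F (\<lambda>x. c * f x) = (\<lambda>y. c * F f y)"
    "\<And>g f. g \<in> carrier G \<Longrightarrow> f \<in> V \<Longrightarrow> F (\<lambda>x. if x \<in> X then f (\<phi> (inv g) x) else 0) = (\<lambda>y. if y \<in> Y then F f (\<psi> (inv g) y) else 0)"
  shows "ghom (psub X \<phi> V :: ('a, 'k::field, 'x \<Rightarrow> 'k) gmod) (psub Y \<psi> W) F"
  using assms unfolding ghom_def by (intro conjI linI ballI) (simp_all add: psub_simps plus_fun_def)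

lemma wmap_act:
  assumes X: "gset X \<phi>" and Y: "gset Y \<psi>" and U: "weights X \<phi> Y \<psi> U" and g: "g \<in> carrier G"
  shows "wmap X Y U (\<lambda>x. if x \<in> X then f (\<phi> (inv g) x) else 0) = (\<lambda>y. if y \<in> Y then wmap X Y U f (\<psi> (inv g) y) else 0)"
proof
  fix y
  show "wmap X Y U (\<lambda>x. if x \<in> X then f (\<phi> (inv g) x) else 0) y = (if y \<in> Y then wmap X Y U f (\<psi> (inv g) y) else 0)"
  proof (cases "y \<in> Y")
    case True
    note g' = inv_closed[OF g]
    have "(\<Sum>x\<in>X. U y x * f (\<phi> (inv g) x)) = (\<Sum>x\<in>X. U (\<psi> (inv g) y) (\<phi> (inv g) x) * f (\<phi> (inv g) x))"
      using U True g' by (intro sum.cong) (auto simp: weights_def)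
    also have "\<dots> = (\<Sum>x\<in>X. U (\<psi> (inv g) y) x * f x)" by (rule gset_sum[OF X g'])
    finally show ?thesis using True gsetD(2)[OF Y g' True] by (simp add: wmap_def)
  qed (simp add: wmap_def)
qed

lemma wmap_lin: "wmap X Y U (\<lambda>x. f x + h x) = (\<lambda>y. wmap X Y U f y + wmap X Y U h y)"
  "wmap X Y U (\<lambda>x. c * f x) = (\<lambda>y. c * wmap X Y U f y)"
  by (auto simp: wmap_def fun_eq_iff sum.distrib algebra_simps sum_distrib_left)

lemma wmap_Delta:
  assumes X: "gset X \<phi>" and Y: "gset Y \<psi>" and U: "weights X \<phi> Y \<psi> U"
  shows "ghom (Delta_gmod G X \<phi>) (Delta_gmod G Y \<psi>) (wmap X Y U)"
  unfolding Delta_psub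
proof (rule ghom_psubI)
  show "wmap X Y U f \<in> Dvecs Y" if "f \<in> Dvecs X" for f
    using that wmap_sum[OF gsetD(1)[OF X] gsetD(1)[OF Y] U] by (simp add: Dvecs_def) (simp add: wmap_def)
qed (simp_all add: wmap_lin wmap_act[OF X Y U])

end

context sylow_context
begin

text \<open>\<open>linked_frames\<close> with the frame over \<open>y\<close> based at the column of
  \<open>V\<close> belonging to \<open>y\<close>: it has augmentation 1 and moves equivariantly with
  \<open>y\<close>.\<close>

lemma linked_Delta_perm:
  fixes X :: "'x set" and Y :: "'y set" and V :: "'x \<Rightarrow> 'y \<Rightarrow> 'k::field"
  assumes nX: "nofix X \<phi>" and Y: "gset Y \<psi>" and ne: "X \<noteq> {}" and V: "weights Y \<psi> X \<phi> V"
  shows "linked (Delta_gmod G X \<phi> :: ('a, 'k, 'x \<Rightarrow> 'k) gmod) (perm_gmod G Y \<psi> :: ('a, 'k, 'y \<Rightarrow> 'k) gmod)"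
proof (rule linked_frames[OF mdl_Delta mdl_perm perm_frame_perm_gmod])
  note gX = nofix_gset[OF nX]
  show "good (X \<times> Y) (\<lambda>g. map_prod (\<phi> g) (\<psi> g))" using nofix_good[OF nofix_Times1[OF nX Y]] .
  show "frame (Delta_gmod G X \<phi>) X (\<lambda>x z. kron x z - (if z \<in> X then V z y else 0)) (\<lambda>x f. f x)" if y: "y \<in> Y" for y
    using y V by (intro Delta_frame gsetD(1)[OF gX]) (auto simp: weights_def)
  show "(\<lambda>z. kron (\<phi> g x) z - (if z \<in> X then V z (\<psi> g y) else 0)) = act (Delta_gmod G X \<phi>) g (\<lambda>z. kron x z - (if z \<in> X then V z y else 0))"
    if g: "g \<in> carrier G" and y: "y \<in> Y" and x: "x \<in> X" for g x y
  proof
    fix z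
    note g' = inv_closed[OF g]
    have "V z (\<psi> g y) = V (\<phi> (inv g) z) y" if "z \<in> X"
    proof -
      have "V (\<phi> (inv g) z) (\<psi> (inv g) (\<psi> g y)) = V z (\<psi> g y)"
        using V g' gsetD(2)[OF Y g y] that unfolding weights_def by blast
      then show ?thesis using gset_inv(1)[OF Y g y] by simp
    qed
    then show "kron (\<phi> g x) z - (if z \<in> X then V z (\<psi> g y) else 0) = act (Delta_gmod G X \<phi>) g (\<lambda>z. kron x z - (if z \<in> X then V z y else 0)) z"
      using act_kron[OF gX g x, where 'k = 'k] gsetD(2)[OF gX g x] gsetD(2)[OF gX g'] by (auto simp: Delta_psub psub_simps)
  qed
  show "act (Delta_gmod G X \<phi>) g v (\<phi> g x) = v x" if "g \<in> carrier G" "x \<in> X" for g x and v :: "'x \<Rightarrow> 'k"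
    using gset_inv(1)[OF gX that] gsetD(2)[OF gX that] by (simp add: Delta_psub psub_simps)
qed (rule nofix_gset[OF nX] ne Y)+

text \<open>\<open>\<Delta>(Y)\<close> is a summand of \<open>\<Delta>(X)\<close> + kY. Its identity
  is U V + (1 - U V), where 1 - U V maps all of kY into \<open>\<Delta>(Y)\<close> because U V
  preserves the augmentation; both modules in the sum are linked to
  \<open>\<Delta>(X)\<close>.\<close>

lemma linked_Delta_weights:
  fixes X :: "'x set" and Y :: "'y set" and U :: "'y \<Rightarrow> 'x \<Rightarrow> 'k::field" and V :: "'x \<Rightarrow> 'y \<Rightarrow> 'k"
  assumes nX: "nofix X \<phi>" and nY: "nofix Y \<psi>" and ne: "X \<noteq> {}" "Y \<noteq> {}"
    and U: "weights X \<phi> Y \<psi> U" and V: "weights Y \<psi> X \<phi> V"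
  shows "linked (Delta_gmod G Y \<psi> :: ('a, 'k, 'y \<Rightarrow> 'k) gmod) (Delta_gmod G X \<phi> :: ('a, 'k, 'x \<Rightarrow> 'k) gmod)"
proof -
  note gX = nofix_gset[OF nX] and gY = nofix_gset[OF nY]
  let ?DX = "Delta_gmod G X \<phi> :: ('a, 'k, 'x \<Rightarrow> 'k) gmod" and ?DY = "Delta_gmod G Y \<psi> :: ('a, 'k, 'y \<Rightarrow> 'k) gmod"
  let ?P = "perm_gmod G Y \<psi> :: ('a, 'k, 'y \<Rightarrow> 'k) gmod"
  note mX = mdl_Delta[OF gX ne(1), where 'k = 'k] and mP = mdl_perm[OF gY, where 'k = 'k]
  have RP: "linked ?P ?DX" by (rule linked_sym[OF mX mP linked_Delta_perm[OF nX gY ne(1) V]])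
  show ?thesis
  proof (rule linked_glue[OF linked_Delta[OF nX ne(1)] RP mX wmap_Delta[OF gY gX V] wmap_Delta[OF gX gY U]])
    show "ghom ?DY ?P (\<lambda>v. v)" unfolding Delta_psub perm_psub
      by (rule ghom_psubI) (auto simp: Dvecs_def)
    show "ghom ?P ?DY (\<lambda>n y. n y - wmap X Y U (wmap Y X V n) y)" unfolding Delta_psub perm_psub
    proof (rule ghom_psubI)
      show "(\<lambda>y. n y - wmap X Y U (wmap Y X V n) y) \<in> Dvecs Y" if "n \<in> {f. \<forall>x. x \<notin> Y \<longrightarrow> f x = 0}" for n
        using that wmap_sum[OF gsetD(1)[OF gX] gsetD(1)[OF gY] U] wmap_sum[OF gsetD(1)[OF gY] gsetD(1)[OF gX] V]
        by (auto simp: Dvecs_def sum_subtractf) (simp add: wmap_def)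
    qed (auto simp: wmap_lin wmap_act[OF gX gY U] wmap_act[OF gY gX V] algebra_simps fun_eq_iff)
    show "wmap X Y U (wmap Y X V v) + (\<lambda>y. v y - wmap X Y U (wmap Y X V v) y) = v" for v by auto
  qed
qed

end

subsection \<open>Products of augmentation kernels\<close>

text \<open>A model of \<open>\<Delta>(A)\<close> tensor \<open>\<Delta>(B)\<close> by functions on
  the product (\<open>Box_tensor\<close>), in which maps can be given by formulas.\<close>

definition Bvecs :: "'x set \<Rightarrow> 'y set \<Rightarrow> ('x \<times> 'y \<Rightarrow> 'k::field) set"
  where "Bvecs A B = {f. (\<forall>z. z \<notin> A \<times> B \<longrightarrow> f z = 0) \<and> (\<forall>b. (\<Sum>a\<in>A. f (a, b)) = 0) \<and> (\<forall>a. (\<Sum>b\<in>B. f (a, b)) = 0)}"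

text \<open>The model of kA tensor \<open>\<Delta>(B)\<close>: only the sums over the second
  variable vanish.\<close>

definition Qvecs :: "'x set \<Rightarrow> 'y set \<Rightarrow> ('x \<times> 'y \<Rightarrow> 'k::field) set"
  where "Qvecs A B = {f. (\<forall>z. z \<notin> A \<times> B \<longrightarrow> f z = 0) \<and> (\<forall>a. (\<Sum>b\<in>B. f (a, b)) = 0)}"

abbreviation box :: "'x \<Rightarrow> 'y \<Rightarrow> 'x \<times> 'y \<Rightarrow> 'x \<times> 'y \<Rightarrow> 'k::field"
  where "box a0 b0 \<equiv> \<lambda>xy ab. (kron (fst xy) (fst ab) - kron a0 (fst ab)) * (kron (snd xy) (snd ab) - kron b0 (snd ab))"

context fgroup
begin

abbreviation Box :: "'x set \<Rightarrow> ('a \<Rightarrow> 'x \<Rightarrow> 'x) \<Rightarrow> 'y set \<Rightarrow> ('a \<Rightarrow> 'y \<Rightarrow> 'y) \<Rightarrow> ('a, 'k::field, 'x \<times> 'y \<Rightarrow> 'k) gmod"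
  where "Box A \<alpha> B \<beta> \<equiv> psub (A \<times> B) (\<lambda>g. map_prod (\<alpha> g) (\<beta> g)) (Bvecs A B)"

abbreviation Qmod :: "'x set \<Rightarrow> ('a \<Rightarrow> 'x \<Rightarrow> 'x) \<Rightarrow> 'y set \<Rightarrow> ('a \<Rightarrow> 'y \<Rightarrow> 'y) \<Rightarrow> ('a, 'k::field, 'x \<times> 'y \<Rightarrow> 'k) gmod"
  where "Qmod A \<alpha> B \<beta> \<equiv> psub (A \<times> B) (\<lambda>g. map_prod (\<alpha> g) (\<beta> g)) (Qvecs A B)"

lemma sum_dl_diff:
  assumes "finite B"
  shows "(\<Sum>y\<in>B. h y * (kron y b - kron b0 b)) = (if b \<in> B then h b else 0) - kron b0 b * (\<Sum>y\<in>B. h y :: 'k::field)"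
  unfolding right_diff_distrib sum_subtractf sum_kron[OF assms] by (simp add: sum_distrib_left mult.commute)

lemma sum_box:
  assumes "finite A" "finite B"
  shows "(\<Sum>xy\<in>A \<times> B. f xy * box a0 b0 xy (a, b)) =
    (if a \<in> A \<and> b \<in> B then f (a, b) else 0) - kron b0 b * (if a \<in> A then \<Sum>y\<in>B. f (a, y) else 0)
      - kron a0 a * (if b \<in> B then \<Sum>x\<in>A. f (x, b) else 0) + kron a0 a * kron b0 b * (\<Sum>x\<in>A. \<Sum>y\<in>B. f (x, y) :: 'k::field)"
proof -
  have "(\<Sum>xy\<in>A \<times> B. f xy * box a0 b0 xy (a, b)) = (\<Sum>x\<in>A. (\<Sum>y\<in>B. f (x, y) * (kron y b - kron b0 b)) * (kron x a - kron a0 a))"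
    unfolding sum_distrib_right sum.cartesian_product
    by (rule sum.cong[OF refl]) (simp only: split_def fst_conv snd_conv prod.collapse mult_ac)
  then show ?thesis
    unfolding sum_dl_diff[OF assms(1)] sum_dl_diff[OF assms(2)]
    by (auto simp: sum_subtractf sum_distrib_left algebra_simps)
qed

lemma box_Bvecs:
  assumes "finite A" "finite B" "a0 \<in> A" "b0 \<in> B" "xy \<in> A \<times> B" shows "box a0 b0 xy \<in> (Bvecs A B :: ('x \<times> 'y \<Rightarrow> 'k::field) set)"
proof -
  have 1: "(\<Sum>a\<in>A. kron (fst xy) a - kron a0 a) = (0 :: 'k)" "(\<Sum>b\<in>B. kron (snd xy) b - kron b0 b) = (0 :: 'k)"
    using sum_kron'[OF assms(1), of "\<lambda>_. 1 :: 'k"] sum_kron'[OF assms(2), of "\<lambda>_. 1 :: 'k"] assms by (auto simp: sum_subtractf)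
  show ?thesis using assms 1 unfolding Bvecs_def
    by (auto simp: sum_distrib_left[symmetric] sum_distrib_right[symmetric])
qed

lemma Box_frame:
  assumes "finite A" "finite B" "a0 \<in> A" "b0 \<in> B"
  shows "frame (Box A \<alpha> B \<beta> :: ('a, 'k::field, 'x \<times> 'y \<Rightarrow> 'k) gmod) (A \<times> B) (box a0 b0) (\<lambda>xy f. f xy)"
  unfolding frame_def
proof (intro conjI ballI)
  show "v = (\<Sum>xy\<in>A \<times> B. scl (Box A \<alpha> B \<beta>) (v xy) (box a0 b0 xy))" if v: "v \<in> vecs (Box A \<alpha> B \<beta>)" for v :: "'x \<times> 'y \<Rightarrow> 'k"
  proof
    fix ab :: "'x \<times> 'y"
    obtain a b where ab: "ab = (a, b)" by (cases ab)
    have "(\<Sum>x\<in>A. \<Sum>y\<in>B. v (x, y)) = 0" using v by (simp add: psub_simps Bvecs_def)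
    then have "(\<Sum>xy\<in>A \<times> B. v xy * box a0 b0 xy (a, b)) = v (a, b)"
      unfolding sum_box[OF assms(1,2)] using v by (auto simp: psub_simps Bvecs_def)
    then show "v ab = (\<Sum>xy\<in>A \<times> B. scl (Box A \<alpha> B \<beta>) (v xy) (box a0 b0 xy)) ab"
      by (simp add: psub_simps sum_fun_apply ab)
  qed
qed (use assms box_Bvecs[OF assms] psub_lin_eval in \<open>auto simp: psub_simps\<close>)

context
  fixes A :: "'x set" and \<alpha> and B :: "'y set" and \<beta>
  assumes A: "gset A \<alpha>" and B: "gset B \<beta>" and ne: "A \<noteq> {}" "B \<noteq> {}"
begin

lemma mdl_Box: "mdl (Box A \<alpha> B \<beta> :: ('a, 'k::field, 'x \<times> 'y \<Rightarrow> 'k) gmod)"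
proof -
  obtain a0 b0 where ab: "a0 \<in> A" "b0 \<in> B" using ne by blast
  show ?thesis
  proof (rule mdl_psub[OF gset_Times[OF A B] _ _ _ _ _ Box_frame[OF gsetD(1)[OF A] gsetD(1)[OF B] ab]])
    show "(\<lambda>z. if z \<in> A \<times> B then f (map_prod (\<alpha> (inv g)) (\<beta> (inv g)) z) else 0) \<in> Bvecs A B"
      if g: "g \<in> carrier G" and f: "f \<in> Bvecs A B" for g and f :: "'x \<times> 'y \<Rightarrow> 'k"
      unfolding Bvecs_def mem_Collect_eq
    proof (intro conjI allI impI)
      show "(\<Sum>a\<in>A. if (a, b) \<in> A \<times> B then f (map_prod (\<alpha> (inv g)) (\<beta> (inv g)) (a, b)) else 0) = 0" for b
        using f inv_bij[OF A g, of "\<lambda>a. f (a, \<beta> (inv g) b)"] by (cases "b \<in> B") (simp_all add: Bvecs_def)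
      show "(\<Sum>b\<in>B. if (a, b) \<in> A \<times> B then f (map_prod (\<alpha> (inv g)) (\<beta> (inv g)) (a, b)) else 0) = 0" for a
        using f inv_bij[OF B g, of "\<lambda>b. f (\<alpha> (inv g) a, b)"] by (cases "a \<in> A") (simp_all add: Bvecs_def)
    qed simp
  qed (auto simp: Bvecs_def sum.distrib sum_distrib_left[symmetric])
qed

lemma act_box:
  assumes g: "g \<in> carrier G" and x: "xy \<in> A \<times> B" and ab: "a0 \<in> A" "b0 \<in> B" and z: "z \<in> A \<times> B"
  shows "(box a0 b0 xy (map_prod (\<alpha> (inv g)) (\<beta> (inv g)) z) :: 'k::field) = box (\<alpha> g a0) (\<beta> g b0) (map_prod (\<alpha> g) (\<beta> g) xy) z"
  using act_kron[OF A g, where 'k = 'k] act_kron[OF B g, where 'k = 'k] x ab z by (simp add: mem_Times_iff)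

lemma Box_tensor: "\<exists>f h. ginv (Box A \<alpha> B \<beta> :: ('a, 'k::field, 'x \<times> 'y \<Rightarrow> 'k) gmod)
   (tensor_gmod (Delta_gmod G A \<alpha> :: ('a, 'k, 'x \<Rightarrow> 'k) gmod) (Delta_gmod G B \<beta> :: ('a, 'k, 'y \<Rightarrow> 'k) gmod)) f h"
proof -
  obtain a0 b0 where ab: "a0 \<in> A" "b0 \<in> B" using ne by blast
  note fA = gsetD(1)[OF A] and fB = gsetD(1)[OF B]
  note mA = mdl_Delta[OF A ne(1), where 'k = 'k] and mB = mdl_Delta[OF B ne(2), where 'k = 'k]
  have FA: "frame (Delta_gmod G A \<alpha>) A (\<lambda>x y. kron x y - kron a0 y :: 'k) (\<lambda>x f. f x)"
    by (rule Delta_frame) (use fA ab in auto)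
  have FB: "frame (Delta_gmod G B \<beta>) B (\<lambda>x y. kron x y - kron b0 y :: 'k) (\<lambda>x f. f x)"
    by (rule Delta_frame) (use fB ab in auto)
  show ?thesis
  proof (rule ginv_frames[OF mdl_Box mdl_tensor[OF mA mB] Box_frame[OF fA fB ab] tensor_frame[OF mA mB FA FB]])
    fix g i j assume g: "g \<in> carrier G" and i: "i \<in> A \<times> B" and j: "j \<in> A \<times> B"
    obtain i1 i2 j1 j2 where ij: "i = (i1, i2)" "j = (j1, j2)" "i1 \<in> A" "i2 \<in> B" "j1 \<in> A" "j2 \<in> B" using i j by auto
    show "act (Box A \<alpha> B \<beta>) g (box a0 b0 j) i = tframe (\<lambda>x f. f x) (\<lambda>x f. f x) i (act (tensor_gmod (Delta_gmod G A \<alpha>) (Delta_gmod G B \<beta>)) g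
       (case j of (i, j) \<Rightarrow> pure_tensor (Delta_gmod G A \<alpha>) (Delta_gmod G B \<beta>) (\<lambda>y. kron i y - kron a0 y) (\<lambda>y. kron j y - kron b0 y :: 'k)))"
      unfolding ij prod.case tensor_matrix[OF mA mB FA FB g ij(3,4,5,6)] using ij(3,4)
      by (simp only: Delta_psub psub_simps mem_Times_iff fst_conv snd_conv map_prod_simp simp_thms if_True)
  qed
qed

end

end

lemma Bvecs_zero: "f \<in> Bvecs A B \<Longrightarrow> z \<notin> A \<times> B \<Longrightarrow> f z = 0"
  and Qvecs_zero: "f \<in> Qvecs A B \<Longrightarrow> z \<notin> A \<times> B \<Longrightarrow> f z = 0"
  unfolding Bvecs_def Qvecs_def by blast+

context fgroup
begin

text \<open>The vector t tensor (z - \<open>\<tau>\<close> t). A base point in \<open>Z\<close>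
  depending equivariantly on \<open>t\<close> makes these vectors permuted by the group, whereas a
  constant one would have to be fixed.\<close>

abbreviation qvec :: "('t \<Rightarrow> 'z) \<Rightarrow> 't \<times> 'z \<Rightarrow> 't \<times> 'z \<Rightarrow> 'k::field"
  where "qvec \<tau> \<equiv> \<lambda>tz ab. (kron (snd tz) (snd ab) - kron (\<tau> (fst tz)) (snd ab)) * kron (fst tz) (fst ab)"

context
  fixes T :: "'t set" and \<alpha> and Z :: "'z set" and \<beta> and \<tau>
  assumes T: "gset T \<alpha>" and Z: "gset Z \<beta>" and \<tau>: "\<And>t. t \<in> T \<Longrightarrow> \<tau> t \<in> Z"
    and \<tau>_act: "\<And>g t. g \<in> carrier G \<Longrightarrow> t \<in> T \<Longrightarrow> \<tau> (\<alpha> g t) = \<beta> g (\<tau> t)"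
begin

lemma Qmod_frame: "frame (Qmod T \<alpha> Z \<beta> :: ('a, 'k::field, 't \<times> 'z \<Rightarrow> 'k) gmod) (T \<times> Z) (qvec \<tau>) (\<lambda>tz f. f tz)"
  unfolding frame_def
proof (intro conjI ballI)
  note fT = gsetD(1)[OF T] and fZ = gsetD(1)[OF Z]
  show "qvec \<tau> tz \<in> vecs (Qmod T \<alpha> Z \<beta> :: ('a, 'k, 't \<times> 'z \<Rightarrow> 'k) gmod)" if tz: "tz \<in> T \<times> Z" for tz
  proof -
    have "(\<Sum>b\<in>Z. kron (snd tz) b - kron (\<tau> (fst tz)) b) = (0 :: 'k)"
      using sum_kron'[OF fZ, of "\<lambda>_. 1 :: 'k"] \<tau> tz by (auto simp: sum_subtractf)
    then show ?thesis using tz \<tau> by (auto simp: psub_simps Qvecs_def sum_distrib_right[symmetric])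
  qed
  show "v = (\<Sum>tz\<in>T \<times> Z. scl (Qmod T \<alpha> Z \<beta>) (v tz) (qvec \<tau> tz))" if v: "v \<in> vecs (Qmod T \<alpha> Z \<beta>)" for v :: "'t \<times> 'z \<Rightarrow> 'k"
  proof
    fix ab :: "'t \<times> 'z"
    obtain a b where ab: "ab = (a, b)" by (cases ab)
    have v0: "(\<Sum>z\<in>Z. v (t, z)) = 0" "(t, z) \<notin> T \<times> Z \<Longrightarrow> v (t, z) = 0" for t z
      using v by (auto simp: psub_simps Qvecs_def)
    have "(\<Sum>tz\<in>T \<times> Z. v tz * qvec \<tau> tz (a, b)) = (\<Sum>t\<in>T. (\<Sum>z\<in>Z. v (t, z) * (kron z b - kron (\<tau> t) b)) * kron t a)"
      unfolding sum_distrib_right sum.cartesian_product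
      by (rule sum.cong[OF refl]) (simp only: split_def fst_conv snd_conv prod.collapse mult_ac)
    also have "\<dots> = v (a, b)"
      unfolding sum_dl_diff[OF fZ] v0(1) sum_kron[OF fT] using v0(2)[of a b] by auto
    finally show "v ab = (\<Sum>tz\<in>T \<times> Z. scl (Qmod T \<alpha> Z \<beta>) (v tz) (qvec \<tau> tz)) ab"
      by (simp add: psub_simps sum_fun_apply ab)
  qed
qed (use gsetD(1)[OF T] gsetD(1)[OF Z] psub_lin_eval in auto)

lemma mdl_Qmod: "mdl (Qmod T \<alpha> Z \<beta> :: ('a, 'k::field, 't \<times> 'z \<Rightarrow> 'k) gmod)"
proof (rule mdl_psub[OF gset_Times[OF T Z] _ _ _ _ _ Qmod_frame])
  show "(\<lambda>z. if z \<in> T \<times> Z then f (map_prod (\<alpha> (inv g)) (\<beta> (inv g)) z) else 0) \<in> Qvecs T Z"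
    if g: "g \<in> carrier G" and f: "f \<in> Qvecs T Z" for g and f :: "'t \<times> 'z \<Rightarrow> 'k"
    unfolding Qvecs_def mem_Collect_eq
  proof (intro conjI allI impI)
    show "(\<Sum>b\<in>Z. if (a, b) \<in> T \<times> Z then f (map_prod (\<alpha> (inv g)) (\<beta> (inv g)) (a, b)) else 0) = 0" for a
      using f inv_bij[OF Z g, of "\<lambda>b. f (\<alpha> (inv g) a, b)"] by (cases "a \<in> T") (simp_all add: Qvecs_def)
  qed simp
qed (auto simp: Qvecs_def sum.distrib sum_distrib_left[symmetric])

lemma perm_frame_Qmod: "perm_frame (Qmod T \<alpha> Z \<beta> :: ('a, 'k::field, 't \<times> 'z \<Rightarrow> 'k) gmod) (T \<times> Z)
    (\<lambda>g. map_prod (\<alpha> g) (\<beta> g)) (qvec \<tau>) (\<lambda>tz f. f tz)"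
  unfolding perm_frame_def
proof (intro conjI ballI)
  let ?Q = "Qmod T \<alpha> Z \<beta> :: ('a, 'k, 't \<times> 'z \<Rightarrow> 'k) gmod"
  show gTZ: "gset (T \<times> Z) (\<lambda>g. map_prod (\<alpha> g) (\<beta> g))" by (rule gset_Times[OF T Z])
  show "frame ?Q (T \<times> Z) (qvec \<tau>) (\<lambda>tz f. f tz)" by (rule Qmod_frame)
  show "fam ?Q kmod (T \<times> Z) (\<lambda>g. map_prod (\<alpha> g) (\<beta> g)) (\<lambda>tz f. f tz)"
  proof (rule famI)
    show "act ?Q g v (map_prod (\<alpha> g) (\<beta> g) z) = act kmod g (v z)" if "g \<in> carrier G" "z \<in> T \<times> Z" for g z v
      using gset_inv(1)[OF gTZ that] gsetD(2)[OF gTZ that] by (simp add: psub_simps)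
  qed (rule psub_lin_eval)
  show "qvec \<tau> (map_prod (\<alpha> g) (\<beta> g) tz) = act ?Q g (qvec \<tau> tz)" if g: "g \<in> carrier G" and tz: "tz \<in> T \<times> Z" for g tz
  proof
    fix ab
    show "qvec \<tau> (map_prod (\<alpha> g) (\<beta> g) tz) ab = act ?Q g (qvec \<tau> tz) ab"
    proof (cases "ab \<in> T \<times> Z")
      case True
      then show ?thesis using tz act_kron[OF T g, where 'k = 'k] act_kron[OF Z g, where 'k = 'k] \<tau> \<tau>_act[OF g]
        by (simp add: psub_simps mem_Times_iff)
    next
      case False
      have *: "(qvec \<tau> (map_prod (\<alpha> g) (\<beta> g) tz) :: _ \<Rightarrow> 'k) \<in> Qvecs T Z"
        using frameD(2)[OF Qmod_frame[where 'k = 'k] gsetD(2)[OF gTZ g tz]] by (simp only: psub_simps)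
      show ?thesis unfolding psub_simps if_not_P[OF False] by (rule Qvecs_zero[OF * False])
    qed
  qed
qed

end

end

section \<open>A relation of Schanuel type between products of augmentation kernels\<close>

context sylow_context
begin

text \<open>Again \<open>linked_frames\<close>: the frame of the left module over a point ((x, y),
  z) takes the pair (x, y) itself as its base point.\<close>

lemma linked_Box_Q:
  fixes X :: "'x set" and Y :: "'y set" and Z :: "'z set"
  assumes nX: "nofix X \<phi>" and nY: "nofix Y \<psi>" and ne: "X \<noteq> {}" "Y \<noteq> {}" and Z: "gset Z \<beta>"
    and \<tau>: "\<And>t. t \<in> X \<times> Y \<Longrightarrow> \<tau> t \<in> Z"
    and \<tau>_act: "\<And>g t. g \<in> carrier G \<Longrightarrow> t \<in> X \<times> Y \<Longrightarrow> \<tau> (map_prod (\<phi> g) (\<psi> g) t) = \<beta> g (\<tau> t)"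
  shows "linked (Box X \<phi> Y \<psi> :: ('a, 'k::field, 'x \<times> 'y \<Rightarrow> 'k) gmod)
    (Qmod (X \<times> Y) (\<lambda>g. map_prod (\<phi> g) (\<psi> g)) Z \<beta> :: ('a, 'k, ('x \<times> 'y) \<times> 'z \<Rightarrow> 'k) gmod)"
proof -
  note X = nofix_gset[OF nX] and Y = nofix_gset[OF nY]
  note gT = gset_Times[OF X Y]
  let ?B = "Box X \<phi> Y \<psi> :: ('a, 'k, 'x \<times> 'y \<Rightarrow> 'k) gmod"
  let ?e = "\<lambda>tz :: ('x \<times> 'y) \<times> 'z. box (fst (fst tz)) (snd (fst tz)) :: 'x \<times> 'y \<Rightarrow> 'x \<times> 'y \<Rightarrow> 'k"
  have mB: "mdl ?B" by (rule mdl_Box[OF X Y ne])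
  have mQ: "mdl (Qmod (X \<times> Y) (\<lambda>g. map_prod (\<phi> g) (\<psi> g)) Z \<beta> :: ('a, 'k, ('x \<times> 'y) \<times> 'z \<Rightarrow> 'k) gmod)"
    by (rule mdl_Qmod[OF gT Z]) (fact \<tau> \<tau>_act)+
  have pQ: "perm_frame (Qmod (X \<times> Y) (\<lambda>g. map_prod (\<phi> g) (\<psi> g)) Z \<beta> :: ('a, 'k, ('x \<times> 'y) \<times> 'z \<Rightarrow> 'k) gmod)
     ((X \<times> Y) \<times> Z) (\<lambda>g. map_prod (map_prod (\<phi> g) (\<psi> g)) (\<beta> g)) (qvec \<tau>) (\<lambda>tz f. f tz)"
    by (rule perm_frame_Qmod[OF gT Z]) (fact \<tau> \<tau>_act)+
  show ?thesis
  proof (rule linked_frames[OF mB mQ pQ gT, where e = ?e and l = "\<lambda>xy f. f xy"])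
    show "good ((X \<times> Y) \<times> (X \<times> Y) \<times> Z) (\<lambda>g. map_prod (map_prod (\<phi> g) (\<psi> g)) (map_prod (map_prod (\<phi> g) (\<psi> g)) (\<beta> g)))"
      by (rule nofix_good[OF nofix_Times1[OF nofix_Times1[OF nX Y] gset_Times[OF gT Z]]])
    show fr: "frame ?B (X \<times> Y) (?e tz) (\<lambda>xy f. f xy)" if "tz \<in> (X \<times> Y) \<times> Z" for tz
      using that by (intro Box_frame gsetD(1)[OF X] gsetD(1)[OF Y]) auto
    show "?e (map_prod (map_prod (\<phi> g) (\<psi> g)) (\<beta> g) tz) (map_prod (\<phi> g) (\<psi> g) xy) = act ?B g (?e tz xy)"
      if g: "g \<in> carrier G" and tz: "tz \<in> (X \<times> Y) \<times> Z" and xy: "xy \<in> X \<times> Y" for g tz xy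
    proof
      fix z
      have tz': "map_prod (map_prod (\<phi> g) (\<psi> g)) (\<beta> g) tz \<in> (X \<times> Y) \<times> Z"
        by (rule gsetD(2)[OF gset_Times[OF gT Z] g tz])
      show "?e (map_prod (map_prod (\<phi> g) (\<psi> g)) (\<beta> g) tz) (map_prod (\<phi> g) (\<psi> g) xy) z = act ?B g (?e tz xy) z"
      proof (cases "z \<in> X \<times> Y")
        case True
        have t: "fst (fst tz) \<in> X" "snd (fst tz) \<in> Y" using tz by auto
        show ?thesis unfolding psub_simps if_P[OF True] act_box[OF X Y ne g xy t True] by (simp only: fst_map_prod snd_map_prod)
      next
        case False
        have *: "?e (map_prod (map_prod (\<phi> g) (\<psi> g)) (\<beta> g) tz) (map_prod (\<phi> g) (\<psi> g) xy) \<in> Bvecs X Y"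
          using frameD(2)[OF fr[OF tz'] gsetD(2)[OF gT g xy]] by (simp only: psub_simps)
        show ?thesis unfolding psub_simps if_not_P[OF False] by (rule Bvecs_zero[OF * False])
      qed
    qed
    show "act ?B g v (map_prod (\<phi> g) (\<psi> g) xy) = v xy" if "g \<in> carrier G" "xy \<in> X \<times> Y" for g xy v
      using gset_inv(1)[OF gT that] gsetD(2)[OF gT that] by (simp add: psub_simps)
  qed
qed

text \<open>
  With \<open>T = X \<times> Y\<close> and \<open>Z = X + Y\<close>, the module \<open>K = \<Delta>(X) \<otimes> \<Delta>(Y)\<close> consists of the functions on \<open>X \<times> Y\<close>
  with vanishing row and column sums, and similarly \<open>L = \<Delta>(T) \<otimes> \<Delta>(Z)\<close>; let \<open>Q = kT \<otimes> \<Delta>(Z)\<close>. The map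
  \<open>t \<mapsto> t \<otimes> (x - y)\<close> for \<open>t = (x, y)\<close> sends \<open>K\<close> into \<open>L\<close>; it extends to \<open>u: kT \<rightarrow> Q\<close>, and \<open>v: Q \<rightarrow> kT\<close> sends
  \<open>L\<close> into \<open>K\<close> such that \<open>1 - u v\<close> maps \<open>Q\<close> into \<open>L\<close>. As \<open>u v + (1 - u v) = 1\<close> on \<open>L\<close>, the module \<open>L\<close> is a
  summand of \<open>K \<oplus> Q\<close>. Below, \<open>u\<close> is \<open>schanuel_in\<close> and \<open>v\<close> is \<open>schanuel_out\<close>.
\<close>

definition schanuel_in :: "'x set \<Rightarrow> 'y set \<Rightarrow> ('x \<times> 'y \<Rightarrow> 'k::field) \<Rightarrow> ('x \<times> 'y) \<times> ('x + 'y) \<Rightarrow> 'k"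
  where "schanuel_in X Y m = (\<lambda>(t, z). if t \<in> X \<times> Y \<and> z \<in> X <+> Y then m t * (kron (Inl (fst t)) z - kron (Inr (snd t)) z) else 0)"

text \<open>On basis elements: (x, y) tensor x' goes to (x', y), and (x, y) tensor y' goes to (x, y)
  - (x, y'), for x' in \<open>X\<close> and y' in \<open>Y\<close>.\<close>

definition schanuel_out :: "'x set \<Rightarrow> 'y set \<Rightarrow> (('x \<times> 'y) \<times> ('x + 'y) \<Rightarrow> 'k::field) \<Rightarrow> 'x \<times> 'y \<Rightarrow> 'k"
  where "schanuel_out X Y n = (\<lambda>(a, b). if a \<in> X \<and> b \<in> Y then
     (\<Sum>x\<in>X. n ((x, b), Inl a)) + (\<Sum>y\<in>Y. n ((a, b), Inr y)) - (\<Sum>y\<in>Y. n ((a, y), Inr b)) else 0)"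

context
  fixes X :: "'x set" and Y :: "'y set" and \<phi> \<psi>
  assumes X: "gset X \<phi>" and Y: "gset Y \<psi>"
begin

lemma schanuel_in_lin: "schanuel_in X Y (\<lambda>x. f x + h x) = (\<lambda>y. schanuel_in X Y f y + schanuel_in X Y h y)" "schanuel_in X Y (\<lambda>x. c * f x) = (\<lambda>y. c * schanuel_in X Y f y)"
  by (auto simp: schanuel_in_def fun_eq_iff algebra_simps)

lemma schanuel_out_lin: "schanuel_out X Y (\<lambda>x. f x + h x) = (\<lambda>y. schanuel_out X Y f y + schanuel_out X Y h y)" "schanuel_out X Y (\<lambda>x. c * f x) = (\<lambda>y. c * schanuel_out X Y f y)"
  by (auto simp: schanuel_out_def fun_eq_iff sum.distrib sum_distrib_left algebra_simps)

lemma schanuel_in_act: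
  assumes g: "g \<in> carrier G"
  shows "schanuel_in X Y (\<lambda>t. if t \<in> X \<times> Y then m (map_prod (\<phi> (inv g)) (\<psi> (inv g)) t) else 0) =
    (\<lambda>tz. if tz \<in> (X \<times> Y) \<times> (X <+> Y) then schanuel_in X Y m (map_prod (map_prod (\<phi> (inv g)) (\<psi> (inv g))) (map_sum (\<phi> (inv g)) (\<psi> (inv g))) tz) else (0 :: 'k::field))"
proof
  fix tz :: "('x \<times> 'y) \<times> ('x + 'y)"
  have eqX: "\<phi> (inv g) a = \<phi> (inv g) b \<longleftrightarrow> a = b" if "a \<in> X" "b \<in> X" for a b
    using gset_inv(2)[OF X g that(1)] gset_inv(2)[OF X g that(2)] by metis
  have eqY: "\<psi> (inv g) a = \<psi> (inv g) b \<longleftrightarrow> a = b" if "a \<in> Y" "b \<in> Y" for a b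
    using gset_inv(2)[OF Y g that(1)] gset_inv(2)[OF Y g that(2)] by metis
  obtain a b z where tz: "tz = ((a, b), z)" by (metis prod.collapse)
  show "schanuel_in X Y (\<lambda>t. if t \<in> X \<times> Y then m (map_prod (\<phi> (inv g)) (\<psi> (inv g)) t) else 0) tz =
     (if tz \<in> (X \<times> Y) \<times> (X <+> Y) then schanuel_in X Y m (map_prod (map_prod (\<phi> (inv g)) (\<psi> (inv g))) (map_sum (\<phi> (inv g)) (\<psi> (inv g))) tz) else (0 :: 'k))"
    using gsetD(2)[OF X inv_closed[OF g]] gsetD(2)[OF Y inv_closed[OF g]]
    by (cases z) (auto simp: schanuel_in_def tz eqX eqY)
qed

lemma schanuel_out_act:
  assumes g: "g \<in> carrier G"
  shows "schanuel_out X Y (\<lambda>tz. if tz \<in> (X \<times> Y) \<times> (X <+> Y) then n (map_prod (map_prod (\<phi> (inv g)) (\<psi> (inv g))) (map_sum (\<phi> (inv g)) (\<psi> (inv g))) tz) else 0) =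
    (\<lambda>t. if t \<in> X \<times> Y then schanuel_out X Y n (map_prod (\<phi> (inv g)) (\<psi> (inv g)) t) else (0 :: 'k::field))"
proof
  fix t :: "'x \<times> 'y"
  obtain a b where t: "t = (a, b)" by (cases t)
  show "schanuel_out X Y (\<lambda>tz. if tz \<in> (X \<times> Y) \<times> (X <+> Y) then n (map_prod (map_prod (\<phi> (inv g)) (\<psi> (inv g))) (map_sum (\<phi> (inv g)) (\<psi> (inv g))) tz) else 0) t =
    (if t \<in> X \<times> Y then schanuel_out X Y n (map_prod (\<phi> (inv g)) (\<psi> (inv g)) t) else (0 :: 'k))"
    using gsetD(2)[OF X inv_closed[OF g]] gsetD(2)[OF Y inv_closed[OF g]]
      inv_bij[OF X g, of "\<lambda>x. n ((x, \<psi> (inv g) b), Inl (\<phi> (inv g) a))"]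
      inv_bij[OF Y g, of "\<lambda>y. n ((\<phi> (inv g) a, \<psi> (inv g) b), Inr y)"]
      inv_bij[OF Y g, of "\<lambda>y. n ((\<phi> (inv g) a, y), Inr (\<psi> (inv g) b))"]
    by (auto simp: schanuel_out_def t InlI InrI cong: if_cong)
qed

lemma schanuel_in_sums:
  fixes m :: "'x \<times> 'y \<Rightarrow> 'k::field"
  shows "(\<Sum>z\<in>X <+> Y. schanuel_in X Y m (t, z)) = 0"
    "a \<in> X \<Longrightarrow> (\<Sum>t\<in>X \<times> Y. schanuel_in X Y m (t, Inl a)) = (\<Sum>y\<in>Y. m (a, y))"
    "b \<in> Y \<Longrightarrow> (\<Sum>t\<in>X \<times> Y. schanuel_in X Y m (t, Inr b)) = - (\<Sum>x\<in>X. m (x, b))"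
proof -
  note fX = gsetD(1)[OF X] and fY = gsetD(1)[OF Y]
  show "(\<Sum>z\<in>X <+> Y. schanuel_in X Y m (t, z)) = 0"
  proof (cases "t \<in> X \<times> Y")
    case True
    then have "(\<Sum>z\<in>X <+> Y. schanuel_in X Y m (t, z)) = (\<Sum>z\<in>X <+> Y. m t * kron (Inl (fst t)) z) - (\<Sum>z\<in>X <+> Y. m t * kron (Inr (snd t)) z)"
      unfolding sum_subtractf[symmetric] by (intro sum.cong) (auto simp: schanuel_in_def algebra_simps)
    then show ?thesis using True fX fY sum_kron'[of "X <+> Y" "\<lambda>_. m t"] by auto
  qed (simp add: schanuel_in_def)
  show "(\<Sum>t\<in>X \<times> Y. schanuel_in X Y m (t, Inl a)) = (\<Sum>y\<in>Y. m (a, y))" if a: "a \<in> X"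
  proof -
    have "(\<Sum>t\<in>X \<times> Y. schanuel_in X Y m (t, Inl a)) = (\<Sum>x\<in>X. \<Sum>y\<in>Y. m (x, y) * kron x a)"
      unfolding sum.cartesian_product using a by (intro sum.cong) (auto simp: schanuel_in_def)
    also have "\<dots> = (\<Sum>x\<in>X. (\<Sum>y\<in>Y. m (x, y)) * kron x a)" by (simp only: sum_distrib_right)
    finally show ?thesis unfolding sum_kron[OF fX] using a by simp
  qed
  show "(\<Sum>t\<in>X \<times> Y. schanuel_in X Y m (t, Inr b)) = - (\<Sum>x\<in>X. m (x, b))" if b: "b \<in> Y"
  proof -
    have "(\<Sum>t\<in>X \<times> Y. schanuel_in X Y m (t, Inr b)) = (\<Sum>x\<in>X. \<Sum>y\<in>Y. (- m (x, y)) * kron y b)"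
      unfolding sum.cartesian_product using b by (intro sum.cong) (auto simp: schanuel_in_def)
    then show ?thesis unfolding sum_kron[OF fY] using b by (simp add: sum_negf)
  qed
qed

text \<open>Row and column sums of v n are, up to sign, the sums of n over \<open>T\<close> at the
  points of \<open>Z\<close>, and by \<open>schanuel_in_sums\<close> the map u undoes the sign. So n
  and u v n have equal sums over \<open>T\<close>, which puts their difference into L.\<close>

lemma schanuel_out_sums:
  fixes n :: "('x \<times> 'y) \<times> ('x + 'y) \<Rightarrow> 'k::field"
  assumes n: "\<And>t. (\<Sum>z\<in>X <+> Y. n (t, z)) = 0"
  shows "b \<in> Y \<Longrightarrow> (\<Sum>a\<in>X. schanuel_out X Y n (a, b)) = - (\<Sum>t\<in>X \<times> Y. n (t, Inr b))"
    "a \<in> X \<Longrightarrow> (\<Sum>b\<in>Y. schanuel_out X Y n (a, b)) = (\<Sum>t\<in>X \<times> Y. n (t, Inl a))"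
proof -
  note fX = gsetD(1)[OF X] and fY = gsetD(1)[OF Y]
  have n': "(\<Sum>a\<in>X. n (t, Inl a)) + (\<Sum>y\<in>Y. n (t, Inr y)) = 0" for t using n[of t] fX fY by (simp add: sum.Plus)
  show "(\<Sum>a\<in>X. schanuel_out X Y n (a, b)) = - (\<Sum>t\<in>X \<times> Y. n (t, Inr b))" if b: "b \<in> Y"
  proof -
    have "(\<Sum>a\<in>X. schanuel_out X Y n (a, b)) = (\<Sum>a\<in>X. \<Sum>x\<in>X. n ((x, b), Inl a)) + (\<Sum>a\<in>X. \<Sum>y\<in>Y. n ((a, b), Inr y)) - (\<Sum>a\<in>X. \<Sum>y\<in>Y. n ((a, y), Inr b))"
      using b by (simp add: schanuel_out_def sum.distrib sum_subtractf)
    also have "(\<Sum>a\<in>X. \<Sum>x\<in>X. n ((x, b), Inl a)) = (\<Sum>x\<in>X. \<Sum>a\<in>X. n ((x, b), Inl a))" by (rule sum.swap)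
    also have "(\<Sum>x\<in>X. \<Sum>a\<in>X. n ((x, b), Inl a)) + (\<Sum>a\<in>X. \<Sum>y\<in>Y. n ((a, b), Inr y)) = 0"
      unfolding sum.distrib[symmetric] by (simp add: n')
    finally show ?thesis by (simp add: sum.cartesian_product split_def)
  qed
  show "(\<Sum>b\<in>Y. schanuel_out X Y n (a, b)) = (\<Sum>t\<in>X \<times> Y. n (t, Inl a))" if a: "a \<in> X"
  proof -
    have "(\<Sum>b\<in>Y. schanuel_out X Y n (a, b)) = (\<Sum>b\<in>Y. \<Sum>x\<in>X. n ((x, b), Inl a)) + (\<Sum>b\<in>Y. \<Sum>y\<in>Y. n ((a, b), Inr y)) - (\<Sum>b\<in>Y. \<Sum>y\<in>Y. n ((a, y), Inr b))"
      using a by (simp add: schanuel_out_def sum.distrib sum_subtractf)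
    also have "(\<Sum>b\<in>Y. \<Sum>y\<in>Y. n ((a, y), Inr b)) = (\<Sum>b\<in>Y. \<Sum>y\<in>Y. n ((a, b), Inr y))" by (rule sum.swap)
    also have "(\<Sum>b\<in>Y. \<Sum>x\<in>X. n ((x, b), Inl a)) = (\<Sum>x\<in>X. \<Sum>b\<in>Y. n ((x, b), Inl a))" by (rule sum.swap)
    finally show ?thesis by (simp add: sum.cartesian_product split_def)
  qed
qed

end

lemma linked_Delta_product:
  fixes X :: "'x set" and Y :: "'y set"
  assumes nX: "nofix X \<phi>" and nY: "nofix Y \<psi>" and ne: "X \<noteq> {}" "Y \<noteq> {}"
  defines "T \<equiv> X \<times> Y" and "Z \<equiv> X <+> Y" and "\<theta> \<equiv> \<lambda>g. map_prod (\<phi> g) (\<psi> g)" and "\<zeta> \<equiv> \<lambda>g. map_sum (\<phi> g) (\<psi> g)"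
  shows "linked (tensor_gmod (Delta_gmod G T \<theta> :: ('a, 'k::field, 'x \<times> 'y \<Rightarrow> 'k) gmod) (Delta_gmod G Z \<zeta> :: ('a, 'k, 'x + 'y \<Rightarrow> 'k) gmod))
    (tensor_gmod (Delta_gmod G X \<phi> :: ('a, 'k, 'x \<Rightarrow> 'k) gmod) (Delta_gmod G Y \<psi> :: ('a, 'k, 'y \<Rightarrow> 'k) gmod))"
proof -
  note X = nofix_gset[OF nX] and Y = nofix_gset[OF nY]
  have gT: "gset T \<theta>" and gZ: "gset Z \<zeta>" unfolding T_def Z_def \<theta>_def \<zeta>_def
    using gset_Times[OF X Y] gset_Plus[OF X Y] by auto
  have neT: "T \<noteq> {}" "Z \<noteq> {}" using ne by (auto simp: T_def Z_def)
  let ?K = "Box X \<phi> Y \<psi> :: ('a, 'k, 'x \<times> 'y \<Rightarrow> 'k) gmod"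
  let ?L = "Box T \<theta> Z \<zeta> :: ('a, 'k, ('x \<times> 'y) \<times> ('x + 'y) \<Rightarrow> 'k) gmod"
  let ?Q = "Qmod T \<theta> Z \<zeta> :: ('a, 'k, ('x \<times> 'y) \<times> ('x + 'y) \<Rightarrow> 'k) gmod"
  note mK = mdl_Box[OF X Y ne, where 'k = 'k] and mL = mdl_Box[OF gT gZ neT, where 'k = 'k]
  \<comment> \<open>Q needs an equivariant base point in \<open>Z\<close>; the first coordinate of
    \<open>t\<close> provides one.\<close>
  have \<tau>: "\<And>t. t \<in> T \<Longrightarrow> Inl (fst t) \<in> Z" "\<And>g t. g \<in> carrier G \<Longrightarrow> t \<in> T \<Longrightarrow> Inl (fst (\<theta> g t)) = \<zeta> g (Inl (fst t))"
    by (auto simp: T_def Z_def \<theta>_def \<zeta>_def)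
  have mQ: "mdl ?Q" by (rule mdl_Qmod[OF gT gZ, of "\<lambda>t. Inl (fst t)"]) (use \<tau> in auto)
  have RKQ: "linked ?K ?Q"
    unfolding T_def Z_def \<theta>_def \<zeta>_def by (rule linked_Box_Q[OF nX nY ne gset_Plus[OF X Y], of "\<lambda>t. Inl (fst t)"]) auto
  have mDX: "mdl (Delta_gmod G X \<phi> :: ('a, 'k, 'x \<Rightarrow> 'k) gmod)" and mDY: "mdl (Delta_gmod G Y \<psi> :: ('a, 'k, 'y \<Rightarrow> 'k) gmod)"
    and mDT: "mdl (Delta_gmod G T \<theta> :: ('a, 'k, 'x \<times> 'y \<Rightarrow> 'k) gmod)" and mDZ: "mdl (Delta_gmod G Z \<zeta> :: ('a, 'k, 'x + 'y \<Rightarrow> 'k) gmod)"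
    using mdl_Delta[OF X ne(1)] mdl_Delta[OF Y ne(2)] mdl_Delta[OF gT neT(1)] mdl_Delta[OF gZ neT(2)] by auto
  note tXY = mdl_tensor[OF mDX mDY] and tTZ = mdl_tensor[OF mDT mDZ]
  obtain f h where fh: "ginv ?K (tensor_gmod (Delta_gmod G X \<phi> :: ('a, 'k, 'x \<Rightarrow> 'k) gmod) (Delta_gmod G Y \<psi> :: ('a, 'k, 'y \<Rightarrow> 'k) gmod)) f h"
    using Box_tensor[OF X Y ne] by blast
  obtain f' h' where fh': "ginv ?L (tensor_gmod (Delta_gmod G T \<theta> :: ('a, 'k, 'x \<times> 'y \<Rightarrow> 'k) gmod) (Delta_gmod G Z \<zeta> :: ('a, 'k, 'x + 'y \<Rightarrow> 'k) gmod)) f' h'"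
    using Box_tensor[OF gT gZ neT] by blast
  note rXY = linked_tensor[OF mDX mDY mDX mDY linked_Delta[OF nX ne(1)] linked_Delta[OF nY ne(2)]]
  have RKK: "linked ?K ?K" using linked_retr2[OF ginv_retr[OF fh] linked_retr[OF ginv_retr[OF fh] rXY mK tXY] mK mK tXY] .
  have QD: "(\<Sum>z\<in>Z. n (t, z)) = 0" if "n \<in> Qvecs T Z" for n :: "('x \<times> 'y) \<times> ('x + 'y) \<Rightarrow> 'k" and t
    using that unfolding Qvecs_def by blast
  note vs = schanuel_out_sums[OF X Y, folded T_def Z_def] and us = schanuel_in_sums[OF X Y, folded T_def Z_def]
  have va: "schanuel_out X Y (\<lambda>x. if x \<in> T \<times> Z then n (map_prod (\<theta> (inv g)) (\<zeta> (inv g)) x) else 0) =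
      (\<lambda>y. if y \<in> X \<times> Y then schanuel_out X Y n (map_prod (\<phi> (inv g)) (\<psi> (inv g)) y) else 0)"
    if "g \<in> carrier G" for g and n :: "('x \<times> 'y) \<times> ('x + 'y) \<Rightarrow> 'k"
    using schanuel_out_act[OF X Y that, of n] unfolding T_def Z_def \<theta>_def \<zeta>_def .
  have ua: "schanuel_in X Y (\<lambda>x. if x \<in> X \<times> Y then m (map_prod (\<phi> (inv g)) (\<psi> (inv g)) x) else 0) =
      (\<lambda>y. if y \<in> T \<times> Z then schanuel_in X Y m (map_prod (\<theta> (inv g)) (\<zeta> (inv g)) y) else 0)"
    if "g \<in> carrier G" for g and m :: "'x \<times> 'y \<Rightarrow> 'k"
    using schanuel_in_act[OF X Y that, of m] unfolding T_def Z_def \<theta>_def \<zeta>_def .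
  have BQ: "Bvecs T Z \<subseteq> (Qvecs T Z :: (('x \<times> 'y) \<times> ('x + 'y) \<Rightarrow> 'k) set)" by (auto simp: Bvecs_def Qvecs_def)
  have v0: "schanuel_out X Y n (a, b) = 0" if "(a, b) \<notin> X \<times> Y" for n :: "('x \<times> 'y) \<times> ('x + 'y) \<Rightarrow> 'k" and a b
    using that by (auto simp: schanuel_out_def)
  have u0: "schanuel_in X Y m (t, z) = 0" if "(t, z) \<notin> T \<times> Z" for m :: "'x \<times> 'y \<Rightarrow> 'k" and t z
    using that by (auto simp: schanuel_in_def T_def Z_def)
  have gv: "ghom ?L ?K (schanuel_out X Y)"
  proof (rule ghom_psubI)
    fix n :: "('x \<times> 'y) \<times> ('x + 'y) \<Rightarrow> 'k" assume n: "n \<in> Bvecs T Z"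
    have nQ: "\<And>t. (\<Sum>z\<in>Z. n (t, z)) = 0" and nT: "\<And>z. (\<Sum>t\<in>T. n (t, z)) = 0" using n unfolding Bvecs_def by blast+
    show "schanuel_out X Y n \<in> Bvecs X Y" unfolding Bvecs_def mem_Collect_eq
    proof (intro conjI allI impI)
      show "schanuel_out X Y n z = 0" if "z \<notin> X \<times> Y" for z using v0 that by (cases z) auto
      show "(\<Sum>a\<in>X. schanuel_out X Y n (a, b)) = 0" for b
        using vs(1)[OF nQ, of b] nT v0 by (cases "b \<in> Y") auto
      show "(\<Sum>b\<in>Y. schanuel_out X Y n (a, b)) = 0" for a
        using vs(2)[OF nQ, of a] nT v0 by (cases "a \<in> X") auto
    qed
  qed (simp_all add: schanuel_out_lin[OF X Y] va)
  have gu: "ghom ?K ?L (schanuel_in X Y)"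
  proof (rule ghom_psubI)
    fix m :: "'x \<times> 'y \<Rightarrow> 'k" assume m: "m \<in> Bvecs X Y"
    show "schanuel_in X Y m \<in> Bvecs T Z" unfolding Bvecs_def mem_Collect_eq
    proof (intro conjI allI impI)
      show "schanuel_in X Y m z = 0" if "z \<notin> T \<times> Z" for z using u0 that by (cases z) auto
      show "(\<Sum>t\<in>T. schanuel_in X Y m (t, z)) = 0" for z
      proof (cases "z \<in> Z")
        case True
        then show ?thesis using m us(2,3)[of _ m] by (auto simp: Bvecs_def Z_def)
      qed (simp add: u0)
      show "(\<Sum>z\<in>Z. schanuel_in X Y m (t, z)) = 0" for t by (rule us(1))
    qed
  qed (simp_all add: schanuel_in_lin[OF X Y] ua)
  have gw: "ghom ?Q ?L (\<lambda>n z. n z - schanuel_in X Y (schanuel_out X Y n) z)"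
  proof (rule ghom_psubI)
    fix n :: "('x \<times> 'y) \<times> ('x + 'y) \<Rightarrow> 'k" assume n: "n \<in> Qvecs T Z"
    note nQ = QD[OF n]
    show "(\<lambda>z. n z - schanuel_in X Y (schanuel_out X Y n) z) \<in> Bvecs T Z" unfolding Bvecs_def mem_Collect_eq
    proof (intro conjI allI impI)
      have n0: "n z = 0" if "z \<notin> T \<times> Z" for z by (rule Qvecs_zero[OF n that])
      show "n z - schanuel_in X Y (schanuel_out X Y n) z = 0" if "z \<notin> T \<times> Z" for z using n0 u0 that by (cases z) auto
      show "(\<Sum>t\<in>T. n (t, z) - schanuel_in X Y (schanuel_out X Y n) (t, z)) = 0" for z
      proof (cases "z \<in> Z")
        case True
        then consider a where "z = Inl a" "a \<in> X" | b where "z = Inr b" "b \<in> Y" by (auto simp: Z_def)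
        then show ?thesis
        proof cases
          case 1
          then show ?thesis using us(2)[OF 1(2), of "schanuel_out X Y n"] vs(2)[OF nQ 1(2)] by (simp add: sum_subtractf)
        next
          case 2
          then show ?thesis using us(3)[OF 2(2), of "schanuel_out X Y n"] vs(1)[OF nQ 2(2)] by (simp add: sum_subtractf)
        qed
      qed (simp add: u0 n0)
      show "(\<Sum>z\<in>Z. n (t, z) - schanuel_in X Y (schanuel_out X Y n) (t, z)) = 0" for t by (simp add: sum_subtractf nQ us(1))
    qed
  qed (auto simp: schanuel_in_lin[OF X Y] schanuel_out_lin[OF X Y] va ua algebra_simps fun_eq_iff)
  have gi: "ghom ?L ?Q (\<lambda>n. n)"
    by (rule ghom_psubI) (use BQ in auto)
  \<comment> \<open>Both K and Q are linked to K, hence so is L, a summand of their sum.\<close>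
  have "linked ?L ?K"
    by (rule linked_glue[OF RKK linked_sym[OF mK mQ RKQ] mK gv gu gi gw]) auto
  then have "linked ?L (tensor_gmod (Delta_gmod G X \<phi> :: ('a, 'k, 'x \<Rightarrow> 'k) gmod) (Delta_gmod G Y \<psi> :: ('a, 'k, 'y \<Rightarrow> 'k) gmod))"
    using linked_retr2[OF ginv_retr[OF ginv_sym[OF fh]] _ mL tXY mK] by blast
  then show ?thesis using linked_retr[OF ginv_retr[OF ginv_sym[OF fh']] _ tTZ tXY] by blast
qed

end

section \<open>The Dade group\<close>

text \<open>\<open>dummy\<close> ties the field type \<open>'k\<close> to the locale.\<close>

locale dade = sylow_context G p S for G (structure) and p S +
  fixes dummy :: "'k::field itself"
  assumes char_k: "CHAR('k) = p"
begin

definition capped :: "('a, 'k, 'v::ab_group_add) gmod \<Rightarrow> bool"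
  where "capped M \<longleftrightarrow> mdl M \<and> linked M M \<and> traced M"

abbreviation dclass :: "('a, 'k, 'v::ab_group_add) gmod \<Rightarrow> ('a, 'k) std_gmod set"
  where "dclass M \<equiv> Dade_class G p S M"

abbreviation \<D> :: "('a, 'k) std_gmod set monoid"
  where "\<D> \<equiv> Dade_group G p S"

lemma cappedD: "capped M \<Longrightarrow> mdl M" "capped M \<Longrightarrow> linked M M" "capped M \<Longrightarrow> traced M"
  by (auto simp: capped_def)

lemma mem_dclass:
  fixes M :: "('a, 'k, 'v::ab_group_add) gmod"
  assumes "capped M" shows "N \<in> dclass M \<longleftrightarrow> capped N \<and> linked M N"
  using capped_iff[OF char_k, of N] compatible_iff[OF char_k cappedD(1)[OF assms], of N] cappedD[OF assms]
  by (auto simp: Dade_class_def capped_def)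

lemma dclass_eq:
  fixes M :: "('a, 'k, 'v::ab_group_add) gmod" and N :: "('a, 'k, 'w::ab_group_add) gmod"
  assumes M: "capped M" and N: "capped N" and linked: "linked M N" shows "dclass M = dclass N"
proof -
  note m = cappedD(1)[OF M] cappedD(1)[OF N]
  have "linked M L \<longleftrightarrow> linked N L" if L: "mdl L" for L :: "('a, 'k) std_gmod"
    using linked_trans[OF m(2,1) L cappedD(3)[OF M] linked_sym[OF m linked]] linked_trans[OF m L cappedD(3)[OF N] linked] by blast
  then show ?thesis using mem_dclass[OF M] mem_dclass[OF N] cappedD(1) by blast
qed

lemma capped_ginv:
  fixes M :: "('a, 'k, 'v::ab_group_add) gmod" and N :: "('a, 'k, 'w::ab_group_add) gmod"
  assumes M: "capped M" and N: "mdl N" and fh: "ginv M N f h" shows "capped N" "linked M N" "dclass M = dclass N"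
proof -
  note m = cappedD(1)[OF M] and r = ginv_retr[OF ginv_sym[OF fh]]
  show linked: "linked M N" by (rule linked_retr2[OF r cappedD(2)[OF M] m N m])
  show "capped N" using linked_retr[OF r linked N N] traced_ginv[OF fh m N cappedD(3)[OF M]] N by (simp add: capped_def)
  from dclass_eq[OF M this linked] show "dclass M = dclass N" .
qed

lemma std_capped:
  fixes M :: "('a, 'k, 'v::ab_group_add) gmod"
  assumes M: "capped M" obtains N :: "('a, 'k) std_gmod" where "capped N" "linked M N" "dclass M = dclass N"
proof -
  obtain N :: "('a, 'k) std_gmod" and f h where N: "mdl N" "ginv M N f h" using std_copy[OF cappedD(1)[OF M]] .
  show ?thesis by (rule that[OF capped_ginv[OF M N]])
qed

lemma carrier_D: "A \<in> carrier \<D> \<longleftrightarrow> (\<exists>M :: ('a, 'k) std_gmod. capped M \<and> A = dclass M)"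
  using capped_iff[OF char_k, where ?'v = "nat \<Rightarrow> 'k"] by (auto simp: Dade_group_def capped_def)

lemma dclass_carrier: "capped (M :: ('a, 'k, 'v::ab_group_add) gmod) \<Longrightarrow> dclass M \<in> carrier \<D>"
  using std_capped[of M] carrier_D by metis

lemma capped_tensor:
  fixes M :: "('a, 'k, 'v::ab_group_add) gmod" and N :: "('a, 'k, 'w::ab_group_add) gmod"
  assumes M: "capped M" and N: "capped N" shows "capped (tensor_gmod M N)"
  using mdl_tensor[OF cappedD(1)[OF M] cappedD(1)[OF N]] traced_tensor_gmod[OF cappedD(1)[OF M] cappedD(1)[OF N] cappedD(3)[OF M] cappedD(3)[OF N]]
    linked_tensor[OF cappedD(1)[OF M] cappedD(1)[OF N] cappedD(1)[OF M] cappedD(1)[OF N] cappedD(2)[OF M] cappedD(2)[OF N]]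
  by (simp add: capped_def)

text \<open>The product in \<open>Dade_group\<close> is a union over all representatives. By
  \<open>linked_tensor\<close> all its members coincide, and by \<open>std_capped\<close> there is
  at least one.\<close>

lemma mult_dclass:
  fixes M :: "('a, 'k, 'v::ab_group_add) gmod" and N :: "('a, 'k, 'w::ab_group_add) gmod"
  assumes M: "capped M" and N: "capped N" shows "dclass M \<otimes>\<^bsub>\<D>\<^esub> dclass N = dclass (tensor_gmod M N)"
proof -
  have eq: "dclass (tensor_gmod M' N') = dclass (tensor_gmod M N)" if "M' \<in> dclass M" "N' \<in> dclass N" for M' N'
  proof -
    have M': "capped M'" "linked M M'" and N': "capped N'" "linked N N'" using that mem_dclass[OF M] mem_dclass[OF N] by auto
    have "linked (tensor_gmod M N) (tensor_gmod M' N')"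
      by (rule linked_tensor[OF cappedD(1)[OF M] cappedD(1)[OF N] cappedD(1)[OF M'(1)] cappedD(1)[OF N'(1)] M'(2) N'(2)])
    then show ?thesis using dclass_eq[OF capped_tensor[OF M N] capped_tensor[OF M'(1) N'(1)]] by simp
  qed
  obtain M' :: "('a, 'k) std_gmod" where M': "M' \<in> dclass M" using std_capped[OF M] mem_dclass[OF M] by metis
  obtain N' :: "('a, 'k) std_gmod" where N': "N' \<in> dclass N" using std_capped[OF N] mem_dclass[OF N] by metis
  have "dclass M \<otimes>\<^bsub>\<D>\<^esub> dclass N = (\<Union>M'\<in>dclass M. \<Union>N'\<in>dclass N. dclass (tensor_gmod M' N'))"
    by (simp add: Dade_group_def)
  also have "\<dots> = (\<Union>M'\<in>dclass M. \<Union>N'\<in>dclass N. dclass (tensor_gmod M N))" using eq by simp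
  also have "\<dots> = dclass (tensor_gmod M N)" using M' N' by auto
  finally show ?thesis .
qed

lemma capped_trivial: "capped (trivial_gmod 1 :: ('a, 'k) std_gmod)"
proof -
  let ?T = "trivial_gmod 1 :: ('a, 'k) std_gmod"
  obtain f h where fh: "ginv ?T kmod f h" using ginv_trivial_kmod by blast
  have "linked (kmod :: ('a, 'k, 'k) gmod) kmod"
  proof (rule linkedI)
    show "linking (kmod :: ('a, 'k, 'k) gmod) kmod {0::nat} (\<lambda>g z. z) (\<lambda>z x. x) (\<lambda>z x. x)"
      unfolding linking_def
    proof (intro conjI allI impI)
      fix l :: "'k \<Rightarrow> 'k" and v w assume l: "lin (kmod :: ('a, 'k, 'k) gmod) kmod l"
      have "l x = x * l 1" for x using lin_scl[OF l, of 1 x] by simp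
      then have "l w * v = l v * w" by (metis mult.commute mult.left_commute)
      then show "(\<Sum>z\<in>{0::nat}. scl (kmod :: ('a, 'k, 'k) gmod) (l w) v) = scl (kmod :: ('a, 'k, 'k) gmod) (l v) w" by simp
    qed (auto intro!: good_point famI lin_id)
  qed
  moreover have "traced ?T" by (rule tracedI[OF trivial_frame ghom_id]) simp
  ultimately show ?thesis
    using linked_retr2[OF ginv_retr[OF fh] linked_retr[OF ginv_retr[OF fh] _ mdl_trivial mdl_kmod] mdl_trivial mdl_trivial mdl_kmod] mdl_trivial
    by (simp add: capped_def)
qed

lemma one_D: "\<one>\<^bsub>\<D>\<^esub> = dclass (trivial_gmod 1 :: ('a, 'k) std_gmod)"
  by (simp add: Dade_group_def)

text \<open>The product is the class of End(M). As \<open>M\<close> is linked to itself, End(M) is a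
  summand of a permutation module whose S-fixed points are G-fixed, and that is linkedness of k with
  End(M).\<close>

lemma dual_inverse:
  fixes M :: "('a, 'k, 'v::ab_group_add) gmod"
  assumes M: "capped M" shows "capped (dual_gmod M)" "dclass (dual_gmod M) \<otimes>\<^bsub>\<D>\<^esub> dclass M = \<one>\<^bsub>\<D>\<^esub>"
proof -
  note m = cappedD(1)[OF M] and mE = mdl_End[OF cappedD(1)[OF M]]
  show D: "capped (dual_gmod M)"
    using mdl_dual[OF m] linked_dual[OF m cappedD(2)[OF M]] traced_dual[OF m cappedD(3)[OF M]] by (simp add: capped_def)
  note mT = mdl_tensor[OF mdl_dual[OF m] m]
  obtain Z :: "nat set" and \<phi> f h where Rd: "linking M M Z \<phi> f h" using linkedE[OF cappedD(2)[OF M]] by blast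
  obtain I :: "nat set" and e l where F: "frame M I e l" using ex_frame[OF m] by blast
  have "linked kmod (End_gmod G M)" by (rule linked_kmod[OF mE End_of_linking[OF m Rd F] linkingD(1)[OF Rd]])
  moreover obtain f h where "ginv (trivial_gmod 1 :: ('a, 'k) std_gmod) kmod f h" using ginv_trivial_kmod by blast
  ultimately have "linked (trivial_gmod 1 :: ('a, 'k) std_gmod) (End_gmod G M)"
    using linked_retr[OF ginv_retr _ mdl_trivial mE] by blast
  moreover obtain f h where "ginv (tensor_gmod (dual_gmod M) M) (End_gmod G M) f h" using dual_tensor_End[OF m] by blast
  ultimately have "linked (trivial_gmod 1 :: ('a, 'k) std_gmod) (tensor_gmod (dual_gmod M) M)"
    using linked_retr2[OF ginv_retr _ mdl_trivial mT mE] by blast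
  from dclass_eq[OF capped_trivial capped_tensor[OF D M] this]
  show "dclass (dual_gmod M) \<otimes>\<^bsub>\<D>\<^esub> dclass M = \<one>\<^bsub>\<D>\<^esub>" by (simp only: mult_dclass[OF D M] one_D)
qed

lemma comm_group_D: "comm_group \<D>"
proof (rule comm_groupI)
  fix A assume "A \<in> carrier \<D>"
  then obtain M :: "('a, 'k) std_gmod" where M: "capped M" "A = dclass M" using carrier_D by blast
  note m = cappedD(1)[OF M(1)]
  show "\<exists>B\<in>carrier \<D>. B \<otimes>\<^bsub>\<D>\<^esub> A = \<one>\<^bsub>\<D>\<^esub>"
    using dual_inverse[OF M(1)] dclass_carrier M(2) by blast
  obtain f h where "ginv (tensor_gmod (trivial_gmod 1 :: ('a, 'k) std_gmod) M) M f h" using tensor_unit[OF m] by blast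
  from capped_ginv(3)[OF capped_tensor[OF capped_trivial M(1)] m this]
  show "\<one>\<^bsub>\<D>\<^esub> \<otimes>\<^bsub>\<D>\<^esub> A = A" by (simp only: M(2) one_D mult_dclass[OF capped_trivial M(1)])
  fix B assume "B \<in> carrier \<D>"
  then obtain N :: "('a, 'k) std_gmod" where N: "capped N" "B = dclass N" using carrier_D by blast
  note n = cappedD(1)[OF N(1)]
  show "A \<otimes>\<^bsub>\<D>\<^esub> B \<in> carrier \<D>"
    using dclass_carrier[OF capped_tensor[OF M(1) N(1)]] by (simp only: M(2) N(2) mult_dclass[OF M(1) N(1)])
  obtain f h where "ginv (tensor_gmod M N) (tensor_gmod N M) f h" using tensor_comm[OF m n] by blast
  from capped_ginv(3)[OF capped_tensor[OF M(1) N(1)] mdl_tensor[OF n m] this]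
  show "A \<otimes>\<^bsub>\<D>\<^esub> B = B \<otimes>\<^bsub>\<D>\<^esub> A" by (simp only: M(2) N(2) mult_dclass[OF M(1) N(1)] mult_dclass[OF N(1) M(1)])
  fix C assume "C \<in> carrier \<D>"
  then obtain L :: "('a, 'k) std_gmod" where L: "capped L" "C = dclass L" using carrier_D by blast
  note l = cappedD(1)[OF L(1)] and MN = capped_tensor[OF M(1) N(1)] and NL = capped_tensor[OF N(1) L(1)]
  obtain f h where "ginv (tensor_gmod (tensor_gmod M N) L) (tensor_gmod M (tensor_gmod N L)) f h"
    using tensor_assoc[OF m n l] by blast
  from capped_ginv(3)[OF capped_tensor[OF MN L(1)] mdl_tensor[OF m mdl_tensor[OF n l]] this]
  show "A \<otimes>\<^bsub>\<D>\<^esub> B \<otimes>\<^bsub>\<D>\<^esub> C = A \<otimes>\<^bsub>\<D>\<^esub> (B \<otimes>\<^bsub>\<D>\<^esub> C)"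
    by (simp only: M(2) N(2) L(2) mult_dclass[OF M(1) N(1)] mult_dclass[OF N(1) L(1)] mult_dclass[OF MN L(1)] mult_dclass[OF M(1) NL])
qed (simp only: one_D dclass_carrier[OF capped_trivial])

section \<open>Relations between the relative syzygies\<close>

abbreviation \<Omega> :: "'x set \<Rightarrow> ('a \<Rightarrow> 'x \<Rightarrow> 'x) \<Rightarrow> ('a, 'k) std_gmod set"
  where "\<Omega> X \<phi> \<equiv> Omega G p S X \<phi>"

definition fixers :: "'x set \<Rightarrow> ('a \<Rightarrow> 'x \<Rightarrow> 'x) \<Rightarrow> 'a set set"
  where "fixers X \<phi> = {Q. p_subgroup G p Q \<and> (\<exists>x\<in>X. \<forall>q\<in>Q. \<phi> q x = x)}"

lemma capped_Delta: "nofix X \<phi> \<Longrightarrow> X \<noteq> {} \<Longrightarrow> capped (Delta_gmod G X \<phi> :: ('a, 'k, 'x \<Rightarrow> 'k) gmod)"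
  using mdl_Delta[OF nofix_gset, of X \<phi>] linked_Delta[of X \<phi>] traced_Delta[of X \<phi>, OF _ _ char_k] by (simp add: capped_def)

lemma Omega_carrier: "nofix X \<phi> \<Longrightarrow> X \<noteq> {} \<Longrightarrow> \<Omega> X \<phi> \<in> carrier \<D>"
  unfolding Omega_def by (rule dclass_carrier[OF capped_Delta])

text \<open>Equal families allow averaging in both directions, so there are weight matrices from
  \<open>X\<close> to \<open>Y\<close> and back.\<close>

lemma Omega_family:
  fixes X :: "'x set" and Y :: "'y set"
  assumes nX: "nofix X \<phi>" and nY: "nofix Y \<psi>" and ne: "X \<noteq> {}" "Y \<noteq> {}" and eq: "fixers X \<phi> = fixers Y \<psi>"
  shows "\<Omega> X \<phi> = \<Omega> Y \<psi>"
proof -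
  note gX = nofix_gset[OF nX] and gY = nofix_gset[OF nY]
  have 1: "\<exists>y\<in>Y. \<forall>q\<in>Q. \<psi> q y = y" if "p_subgroup G p Q" "x \<in> X" "\<forall>q\<in>Q. \<phi> q x = x" for Q x
  proof -
    have "Q \<in> fixers X \<phi>" using that by (auto simp: fixers_def)
    then show ?thesis unfolding eq by (simp add: fixers_def)
  qed
  have 2: "\<exists>x\<in>X. \<forall>q\<in>Q. \<phi> q x = x" if "p_subgroup G p Q" "y \<in> Y" "\<forall>q\<in>Q. \<psi> q y = y" for Q y
  proof -
    have "Q \<in> fixers Y \<psi>" using that by (auto simp: fixers_def)
    then show ?thesis unfolding eq[symmetric] by (simp add: fixers_def)
  qed
  have W1: "\<exists>U :: 'y \<Rightarrow> 'x \<Rightarrow> 'k. (\<forall>g\<in>carrier G. \<forall>y\<in>Y. \<forall>x\<in>X. U (\<psi> g y) (\<phi> g x) = U y x) \<and> (\<forall>x\<in>X. (\<Sum>y\<in>Y. U y x) = 1)"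
    by (rule ex_weights[OF prime_p char_k gX gY]) (rule 1)
  have W2: "\<exists>V :: 'x \<Rightarrow> 'y \<Rightarrow> 'k. (\<forall>g\<in>carrier G. \<forall>x\<in>X. \<forall>y\<in>Y. V (\<phi> g x) (\<psi> g y) = V x y) \<and> (\<forall>y\<in>Y. (\<Sum>x\<in>X. V x y) = 1)"
    by (rule ex_weights[OF prime_p char_k gY gX]) (rule 2)
  obtain U :: "'y \<Rightarrow> 'x \<Rightarrow> 'k" where U: "weights X \<phi> Y \<psi> U"
    using W1 unfolding weights_def by blast
  obtain V :: "'x \<Rightarrow> 'y \<Rightarrow> 'k" where V: "weights Y \<psi> X \<phi> V"
    using W2 unfolding weights_def by blast
  show ?thesis unfolding Omega_def
    by (rule dclass_eq[OF capped_Delta[OF nX ne(1)] capped_Delta[OF nY ne(2)] linked_Delta_weights[OF nY nX ne(2,1) V U]])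
qed

lemma Omega_product:
  fixes X :: "'x set" and Y :: "'y set"
  assumes nX: "nofix X \<phi>" and nY: "nofix Y \<psi>" and ne: "X \<noteq> {}" "Y \<noteq> {}"
  shows "\<Omega> (X \<times> Y) (\<lambda>g. map_prod (\<phi> g) (\<psi> g)) \<otimes>\<^bsub>\<D>\<^esub> \<Omega> (X <+> Y) (\<lambda>g. map_sum (\<phi> g) (\<psi> g)) = \<Omega> X \<phi> \<otimes>\<^bsub>\<D>\<^esub> \<Omega> Y \<psi>"
proof -
  note X = nofix_gset[OF nX] and Y = nofix_gset[OF nY]
  have neT: "X \<times> Y \<noteq> {}" "X <+> Y \<noteq> {}" using ne by auto
  note cX = capped_Delta[OF nX ne(1)] and cY = capped_Delta[OF nY ne(2)]
  note cT = capped_Delta[OF nofix_Times1[OF nX Y] neT(1)] and cZ = capped_Delta[OF nofix_Plus[OF nX nY] neT(2)]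
  show ?thesis unfolding Omega_def mult_dclass[OF cX cY] mult_dclass[OF cT cZ]
    by (rule dclass_eq[OF capped_tensor[OF cT cZ] capped_tensor[OF cX cY] linked_Delta_product[OF nX nY ne]])
qed

lemma fix_conj:
  assumes X: "gset X \<phi>" and x: "x \<in> X" and b: "b \<in> carrier G" and s: "s \<in> carrier G" and fx: "\<phi> (inv b \<otimes> s \<otimes> b) x = x"
  shows "\<phi> s (\<phi> b x) = \<phi> b x"
proof -
  have "\<phi> b (\<phi> (inv b \<otimes> s \<otimes> b) x) = \<phi> s (\<phi> b x)"
    using gsetD(4)[OF X b _ x, of "inv b \<otimes> s \<otimes> b"] gsetD(4)[OF X s b x] b s by (simp add: m_assoc[symmetric])
  then show ?thesis using fx by simp
qed

text \<open>The G-map from G/Q to \<open>X\<close> that sends the coset of \<open>a\<close> to the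
  translate of \<open>x\<close> by \<open>a\<close> carries points fixed by \<open>H\<close> to
  points fixed by \<open>H\<close>.\<close>

lemma coset_fix_transfer:
  assumes X: "gset X \<phi>" and x: "x \<in> X" and Q: "subgroup Q G" and fQ: "\<forall>q\<in>Q. \<phi> q x = x"
    and C: "C \<in> lcosets Q" and H: "subgroup H G" and fH: "\<forall>h\<in>H. h <# C = C"
  shows "\<exists>y\<in>X. \<forall>h\<in>H. \<phi> h y = y"
proof -
  obtain a where a: "a \<in> carrier G" "C = a <# Q" using lcosetsE[OF C] by blast
  have "\<phi> h (\<phi> a x) = \<phi> a x" if h: "h \<in> H" for h
  proof -
    note hG = subgroup.mem_carrier[OF H h]
    have "inv a \<otimes> h \<otimes> a \<in> Q" using lcoset_fix_iff[OF Q a(1) hG] fH h a(2) by simp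
    then show ?thesis using fix_conj[OF X x a(1) hG] fQ by blast
  qed
  then show ?thesis using gsetD(2)[OF X a(1) x] by blast
qed

lemma fixers_Plus: "fixers (X <+> Y) (\<lambda>g. map_sum (\<phi> g) (\<psi> g)) = fixers X \<phi> \<union> fixers Y \<psi>"
proof -
  have "(\<exists>z\<in>X <+> Y. \<forall>q\<in>Q. map_sum (\<phi> q) (\<psi> q) z = z) \<longleftrightarrow> (\<exists>x\<in>X. \<forall>q\<in>Q. \<phi> q x = x) \<or> (\<exists>y\<in>Y. \<forall>q\<in>Q. \<psi> q y = y)" for Q
    unfolding Plus_def bex_Un bex_simps(7) map_sum.simps sum.inject ..
  then show ?thesis by (auto simp only: fixers_def)
qed

text \<open>If \<open>Q\<close> is Sylow then \<open>S\<close> fixes a coset of \<open>Q\<close>, so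
  a point fixed by \<open>Q\<close> yields one fixed by \<open>S\<close>.\<close>

lemma fixers_non_sylow:
  assumes nX: "nofix X \<phi>" shows "fixers X \<phi> \<subseteq> non_sylow_p_subgroups G p"
proof
  fix Q assume "Q \<in> fixers X \<phi>"
  then obtain x where Q: "p_subgroup G p Q" and x: "x \<in> X" "\<forall>q\<in>Q. \<phi> q x = x" by (auto simp: fixers_def)
  have "\<not> sylow_subgroup G p Q"
  proof
    assume sy: "sylow_subgroup G p Q"
    obtain C where C: "C \<in> lcosets Q" "\<forall>s\<in>S. s <# C = C" using sylow_fix[OF sy p_subgroup_S] by blast
    have "\<exists>y\<in>X. \<forall>s\<in>S. \<phi> s y = y"
      by (rule coset_fix_transfer[OF nofix_gset[OF nX] x(1) p_subgroupD(1)[OF Q] x(2) C(1) subgroup_S C(2)])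
    then show False using nX by (auto simp: nofix_def)
  qed
  then show "Q \<in> non_sylow_p_subgroups G p" using Q by (simp add: non_sylow_p_subgroups_def)
qed

lemma finite_fixers: "finite (fixers X \<phi>)"
proof -
  have "fixers X \<phi> \<subseteq> Pow (carrier G)" by (auto simp: fixers_def p_subgroup_def dest: subgroup.mem_carrier)
  then show ?thesis using finite_carrier finite_subset by blast
qed

lemma fixers_cosets:
  assumes nX: "nofix X \<phi>" and F: "F \<subseteq> fixers X \<phi>"
  shows "fixers (\<Union>Q\<in>F. lcosets Q) (\<lambda>g C. g <# C) \<subseteq> fixers X \<phi>" "F \<subseteq> fixers (\<Union>Q\<in>F. lcosets Q) (\<lambda>g C. g <# C)"
proof
  fix H assume "H \<in> fixers (\<Union>Q\<in>F. lcosets Q) (\<lambda>g C. g <# C)"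
  then obtain Q C where H: "p_subgroup G p H" and Q: "Q \<in> F" and C: "C \<in> lcosets Q" "\<forall>h\<in>H. h <# C = C" by (auto simp: fixers_def)
  obtain x where x: "p_subgroup G p Q" "x \<in> X" "\<forall>q\<in>Q. \<phi> q x = x" using Q F by (auto simp: fixers_def)
  from coset_fix_transfer[OF nofix_gset[OF nX] x(2) p_subgroupD(1)[OF x(1)] x(3) C(1) p_subgroupD(1)[OF H] C(2)]
  show "H \<in> fixers X \<phi>" using H by (simp add: fixers_def)
next
  show "F \<subseteq> fixers (\<Union>Q\<in>F. lcosets Q) (\<lambda>g C. g <# C)"
  proof
    fix Q assume Q: "Q \<in> F"
    then have p: "p_subgroup G p Q" using F by (auto simp: fixers_def)
    note sQ = p_subgroupD(1)[OF p]
    have "q <# Q = Q" if "q \<in> Q" for q using lcoset_fix_self[OF sQ subgroup.mem_carrier[OF sQ that]] that by simp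
    then show "Q \<in> fixers (\<Union>Q\<in>F. lcosets Q) (\<lambda>g C. g <# C)" using p Q lcoset_self[OF sQ] by (auto simp: fixers_def)
  qed
qed

text \<open>The generators of \<open>D_Omega\<close> come from sets of naturals, whereas cosets,
  products and disjoint unions live in other types.\<close>

lemma nat_model:
  assumes nX: "nofix X \<phi>" and ne: "X \<noteq> {}"
  obtains N :: "nat set" and \<psi> where "finite_gset G N \<psi>" "fixed_points S N \<psi> = {}" "nofix N \<psi>" "N \<noteq> {}"
    "fixers N \<psi> = fixers X \<phi>" "\<Omega> X \<phi> = \<Omega> N \<psi>"
proof -
  note gX = nofix_gset[OF nX]
  let ?N = "{0..<card X}"
  obtain b \<theta> where b: "bij_betw b ?N X" and gN: "gset ?N \<theta>"
    and act: "\<And>g n. g \<in> carrier G \<Longrightarrow> n \<in> ?N \<Longrightarrow> b (\<theta> g n) = \<phi> g (b n)"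
    using gset_nat[OF gX] by blast
  define \<psi> where "\<psi> = (\<lambda>g. restrict (\<theta> g) ?N)"
  have neN: "?N \<noteq> {}" using ne gsetD(1)[OF gX] by simp
  have fg: "finite_gset G ?N \<psi>"
    using gset_group_action[OF gN] neN by (simp add: finite_gset_def \<psi>_def)
  then have gN': "gset ?N \<psi>" using group_action_gset by (auto simp: finite_gset_def)
  have bin: "b n \<in> X" if "n \<in> ?N" for n using bij_betwE[OF b] that by blast
  have fix_iff: "\<psi> g n = n \<longleftrightarrow> \<phi> g (b n) = b n" if "g \<in> carrier G" "n \<in> ?N" for g n
    using act[OF that] inj_on_eq_iff[OF bij_betw_imp_inj_on[OF b] gsetD(2)[OF gN that] that(2)] that(2) by (auto simp: \<psi>_def)
  have surj: "\<exists>n\<in>?N. b n = x" if "x \<in> X" for x using bij_betw_imp_surj_on[OF b] that by (metis imageE)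
  have nN: "nofix ?N \<psi>" unfolding nofix_def
    using gN' fix_iff[OF S_carrier] bin nX by (auto simp: nofix_def simp del: atLeastLessThan_iff)
  have fam: "fixers ?N \<psi> = fixers X \<phi>"
  proof (intro equalityI subsetI)
    fix Q assume "Q \<in> fixers ?N \<psi>"
    then obtain n where Q: "p_subgroup G p Q" and n: "n \<in> ?N" "\<forall>q\<in>Q. \<psi> q n = n" unfolding fixers_def by blast
    have "\<forall>q\<in>Q. \<phi> q (b n) = b n" using n fix_iff[OF subgroup.mem_carrier[OF p_subgroupD(1)[OF Q]] n(1)] by blast
    then show "Q \<in> fixers X \<phi>" using Q bin[OF n(1)] unfolding fixers_def by blast
  next
    fix Q assume "Q \<in> fixers X \<phi>"
    then obtain x where Q: "p_subgroup G p Q" and x: "x \<in> X" "\<forall>q\<in>Q. \<phi> q x = x" unfolding fixers_def by blast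
    obtain n where n: "n \<in> ?N" "b n = x" using surj[OF x(1)] by blast
    have "\<forall>q\<in>Q. \<psi> q n = n" using n x fix_iff[OF subgroup.mem_carrier[OF p_subgroupD(1)[OF Q]] n(1)] by blast
    then show "Q \<in> fixers ?N \<psi>" using Q n(1) unfolding fixers_def by blast
  qed
  have "fixed_points S ?N \<psi> = {}" using nN unfolding nofix_def fixed_points_def by blast
  then show ?thesis using that[OF fg _ nN neN fam Omega_family[OF nX nN ne neN fam[symmetric]]] by blast
qed

definition Gamma :: "('a, 'k) std_gmod set set"
  where "Gamma = {\<Omega> (lcosets P) (\<lambda>g C. g <# C) | P. P \<in> non_sylow_p_subgroups G p}"

lemma nofix_lcosets: "P \<in> non_sylow_p_subgroups G p \<Longrightarrow> nofix (lcosets P) (\<lambda>g C. g <# C)"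
  using nofix_cosets_family[of "{P}"] by simp

lemma lcosets_nonempty: "subgroup P G \<Longrightarrow> lcosets P \<noteq> {}"
  using lcoset_self by blast

lemma Gamma_carrier: "Gamma \<subseteq> carrier \<D>"
  unfolding Gamma_def using Omega_carrier[OF nofix_lcosets lcosets_nonempty[OF non_sylow_subgroup]] by blast

sublocale D: comm_group \<D>
  by (rule comm_group_D)

lemma Omega_generate:
  fixes X :: "nat set"
  assumes "nofix X \<phi>" "X \<noteq> {}" shows "\<Omega> X \<phi> \<in> generate \<D> Gamma"
  using assms
proof (induction "card (fixers X \<phi>)" arbitrary: X \<phi> rule: less_induct)
  case less
  note nX = less(2) and ne = less(3)
  note gX = nofix_gset[OF nX]
  let ?F = "fixers X \<phi>" and ?c = "\<lambda>(g :: 'a) (C :: 'a set). g <# C"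
  \<comment> \<open>The induction hypothesis concerns sets of naturals; \<open>nat_model\<close>
    extends it to all types.\<close>
  have IH: "\<Omega> Y \<psi> \<in> generate \<D> Gamma" if Y: "nofix Y \<psi>" "Y \<noteq> {}" "fixers Y \<psi> \<subset> ?F" for Y :: "'y set" and \<psi>
  proof -
    obtain N :: "nat set" and \<theta> where N: "nofix N \<theta>" "N \<noteq> {}" "fixers N \<theta> = fixers Y \<psi>" "\<Omega> Y \<psi> = \<Omega> N \<theta>"
      using nat_model[OF Y(1,2)] by metis
    have "card (fixers N \<theta>) < card ?F" unfolding N(3) by (rule psubset_card_mono[OF finite_fixers Y(3)])
    from less(1)[OF this N(1,2)] show ?thesis by (simp add: N(4))
  qed
  obtain x0 where x0: "x0 \<in> X" using ne by blast
  \<comment> \<open>The trivial subgroup fixes every point, so the family is non-empty and has a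
    member of maximal order.\<close>
  have "p_subgroup G p {\<one>}" using triv_subgroup by (auto simp: p_subgroup_def intro: exI[of _ 0])
  then have "{\<one>} \<in> ?F" using x0 gsetD(3)[OF gX x0] by (auto simp: fixers_def)
  then have "card ` ?F \<noteq> {}" "finite (card ` ?F)" using finite_fixers by auto
  then obtain P where P: "P \<in> ?F" and max: "\<And>Q. Q \<in> ?F \<Longrightarrow> card Q \<le> card P"
    using Max_in[of "card ` ?F"] Max_ge[of "card ` ?F"] by (metis (no_types, lifting) imageE imageI)
  have Pn: "P \<in> non_sylow_p_subgroups G p" using fixers_non_sylow[OF nX] P by blast
  note sP = non_sylow_subgroup[OF Pn] and nP = nofix_lcosets[OF Pn]
  note neP = lcosets_nonempty[OF sP]
  have famP: "fixers (lcosets P) ?c \<subseteq> ?F" using fixers_cosets(1)[OF nX, of "{P}"] P by simp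
  show ?case
  proof (cases "?F \<subseteq> fixers (lcosets P) ?c")
    case True
    then have "\<Omega> X \<phi> = \<Omega> (lcosets P) ?c" using famP by (intro Omega_family[OF nX nP ne neP]) blast
    then show ?thesis using Pn by (intro generate.incl) (auto simp: Gamma_def)
  next
    case False
    define F' where "F' = ?F - fixers (lcosets P) ?c"
    define Y where "Y = (\<Union>Q\<in>F'. lcosets Q)"
    have F': "F' \<subseteq> ?F" "F' \<noteq> {}" using False by (auto simp: F'_def)
    have F'n: "F' \<subseteq> non_sylow_p_subgroups G p" using F'(1) fixers_non_sylow[OF nX] by blast
    have nY: "nofix Y ?c" unfolding Y_def by (rule nofix_cosets_family[OF F'n])
    have neY: "Y \<noteq> {}" using F'(2) F'n lcosets_nonempty[OF non_sylow_subgroup] unfolding Y_def by blast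
    have famY: "fixers Y ?c \<subseteq> ?F" "F' \<subseteq> fixers Y ?c" using fixers_cosets[OF nX F'(1)] by (simp_all add: Y_def)
    \<comment> \<open>If \<open>P\<close> fixes a coset of some \<open>Q\<close> in
      \<open>F'\<close>, a conjugate of \<open>P\<close> lies in \<open>Q\<close> and equals it by
      maximality. Then \<open>Q\<close> fixes a coset of \<open>P\<close>, against the choice of
      \<open>F'\<close>.\<close>
    have "P \<notin> fixers Y ?c"
    proof
      assume "P \<in> fixers Y ?c"
      then obtain Q C where Q: "Q \<in> F'" and C: "C \<in> lcosets Q" "\<forall>q\<in>P. q <# C = C" by (auto simp: fixers_def Y_def)
      have sQ: "subgroup Q G" using F'n Q non_sylow_subgroup by blast
      obtain a where a: "a \<in> carrier G" and sub: "(\<lambda>r. inv a \<otimes> r \<otimes> a) ` P \<subseteq> Q" and c: "card ((\<lambda>r. inv a \<otimes> r \<otimes> a) ` P) = card P"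
        using lcoset_fix_card[OF sQ C(1) sP C(2)] by blast
      have eq: "(\<lambda>r. inv a \<otimes> r \<otimes> a) ` P = Q"
        using card_seteq[OF finite_subgroup[OF sQ] sub] max[of Q] Q F'(1) c by auto
      have "q <# (inv a <# P) = inv a <# P" if q: "q \<in> Q" for q
      proof -
        obtain r where r: "r \<in> P" "q = inv a \<otimes> r \<otimes> a" using q eq by blast
        have rG: "r \<in> carrier G" using subgroup.mem_carrier[OF sP r(1)] .
        have "inv (inv a) \<otimes> q \<otimes> inv a = r" using a rG unfolding r(2) by (simp add: m_assoc[symmetric]) (simp add: m_assoc)
        then show ?thesis using lcoset_fix_iff[OF sP inv_closed[OF a], of q] r a rG by simp
      qed
      then have "Q \<in> fixers (lcosets P) ?c"
        using Q F'n lcosetsI[OF inv_closed[OF a], of P] by (auto simp: fixers_def non_sylow_p_subgroups_def)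
      then show False using Q by (simp add: F'_def)
    qed
    then have ltY: "fixers Y ?c \<subset> ?F" using famY P by blast
    have ltP: "fixers (lcosets P) ?c \<subset> ?F" using famP False by blast
    let ?s = "\<lambda>g. map_sum (?c g) (?c g)" and ?t = "\<lambda>g. map_prod (?c g) (?c g)"
    note gP = nofix_gset[OF nP] and gY = nofix_gset[OF nY]
    have nT: "nofix (Y \<times> lcosets P) ?t" by (rule nofix_Times1[OF nY gP])
    have nZ: "nofix (Y <+> lcosets P) ?s" by (rule nofix_Plus[OF nY nP])
    have neT: "Y \<times> lcosets P \<noteq> {}" "Y <+> lcosets P \<noteq> {}" using neY neP by auto
    have "fixers (Y \<times> lcosets P) ?t \<subseteq> fixers (lcosets P) ?c" by (auto simp: fixers_def)
    then have ltT: "fixers (Y \<times> lcosets P) ?t \<subset> ?F" using ltP by blast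
    have "fixers (Y <+> lcosets P) ?s = fixers Y ?c \<union> fixers (lcosets P) ?c" by (rule fixers_Plus)
    also have "\<dots> = ?F" using famY famP by (auto simp: F'_def)
    finally have eq: "\<Omega> X \<phi> = \<Omega> (Y <+> lcosets P) ?s" by (intro Omega_family[OF nX nZ ne neT(2)]) simp
    note IY = IH[OF nY neY ltY] and IP = IH[OF nP neP ltP] and IT = IH[OF nT neT(1) ltT]
    note cT = Omega_carrier[OF nT neT(1)] and cZ = Omega_carrier[OF nZ neT(2)]
      and cY = Omega_carrier[OF nY neY] and cP = Omega_carrier[OF nP neP]
    have "\<Omega> X \<phi> = inv\<^bsub>\<D>\<^esub> \<Omega> (Y \<times> lcosets P) ?t \<otimes>\<^bsub>\<D>\<^esub> (\<Omega> Y ?c \<otimes>\<^bsub>\<D>\<^esub> \<Omega> (lcosets P) ?c)"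
      using Omega_product[OF nY nP neY neP] D.inv_solve_left[OF cZ cT D.m_closed[OF cY cP]] unfolding eq by simp
    then show ?thesis
      using subgroup.m_closed[OF D.generate_is_subgroup[OF Gamma_carrier]] subgroup.m_inv_closed[OF D.generate_is_subgroup[OF Gamma_carrier]]
        IY IP IT by simp
  qed
qed

lemma Omega_coset_action: "\<Omega> (lcosets P) (coset_action G P) = \<Omega> (lcosets P) (\<lambda>g C. g <# C)"
proof -
  have "Delta_gmod G (lcosets P) (coset_action G P) = (Delta_gmod G (lcosets P) (\<lambda>g C. g <# C) :: ('a, 'k, 'a set \<Rightarrow> 'k) gmod)"
    by (auto simp: Delta_gmod_def perm_gmod_def coset_action_def fun_eq_iff)
  then show ?thesis by (simp add: Omega_def)
qed

text \<open>Being a non-Sylow p-subgroup is invariant under conjugation, so the classes together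
  contain exactly these subgroups.\<close>

lemma conj_class_eq:
  "(\<exists>C. C \<in> non_sylow_p_subgroup_classes G p \<and> P \<in> C) \<longleftrightarrow> P \<in> non_sylow_p_subgroups G p"
proof
  assume "\<exists>C. C \<in> non_sylow_p_subgroup_classes G p \<and> P \<in> C"
  then obtain Q g where Q: "Q \<in> non_sylow_p_subgroups G p" and g: "g \<in> carrier G" and P: "P = g <# Q #> inv g"
    by (auto simp: non_sylow_p_subgroup_classes_def orbits_def orbit_def)
  have "P = (\<lambda>r. g \<otimes> r \<otimes> inv g) ` Q" unfolding P by (auto simp: l_coset_def r_coset_def)
  then have "subgroup P G" "card P = card Q" using conj_subgroup[OF non_sylow_subgroup[OF Q] g] by auto
  then show "P \<in> non_sylow_p_subgroups G p" using Q by (simp add: non_sylow_p_subgroups_def p_subgroup_def sylow_subgroup_def)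
next
  assume P: "P \<in> non_sylow_p_subgroups G p"
  have "P \<subseteq> carrier G" using subgroup.subset[OF non_sylow_subgroup[OF P]] .
  then have "P = \<one> <# P #> inv \<one>" by (simp add: lcos_mult_one coset_mult_one)
  then show "\<exists>C. C \<in> non_sylow_p_subgroup_classes G p \<and> P \<in> C"
    using P one_closed unfolding non_sylow_p_subgroup_classes_def orbits_def orbit_def by blast
qed

lemma generate_Gamma: "generate \<D> Gamma = D_Omega G p S"
proof
  let ?H = "{\<Omega> X \<phi> | (X :: nat set) \<phi>. finite_gset G X \<phi> \<and> fixed_points S X \<phi> = {}}"
  have nf: "nofix X \<phi> \<and> X \<noteq> {}" if "finite_gset G X \<phi>" "fixed_points S X \<phi> = {}" for X :: "nat set" and \<phi>
    using that group_action_gset unfolding nofix_def finite_gset_def fixed_points_def by blast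
  have H: "?H \<subseteq> carrier \<D>" using Omega_carrier nf by blast
  have "Gamma \<subseteq> ?H"
  proof
    fix A assume "A \<in> Gamma"
    then obtain P where P: "P \<in> non_sylow_p_subgroups G p" "A = \<Omega> (lcosets P) (\<lambda>g C. g <# C)" by (auto simp: Gamma_def)
    obtain N :: "nat set" and \<psi> where "finite_gset G N \<psi>" "fixed_points S N \<psi> = {}" "A = \<Omega> N \<psi>"
      using nat_model[OF nofix_lcosets[OF P(1)] lcosets_nonempty[OF non_sylow_subgroup[OF P(1)]]] P(2) by metis
    then show "A \<in> ?H" by blast
  qed
  then show "generate \<D> Gamma \<subseteq> D_Omega G p S" unfolding D_Omega_def by (rule D.mono_generate)
  have "?H \<subseteq> generate \<D> Gamma" using Omega_generate nf by blast
  then show "D_Omega G p S \<subseteq> generate \<D> Gamma" unfolding D_Omega_def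
    by (rule D.generate_subgroup_incl[OF _ D.generate_is_subgroup[OF Gamma_carrier]])
qed

end

theorem proposition5p14:
  fixes G :: "('g, 'm) monoid_scheme" and p :: nat and S :: "'g set"
  assumes "group G" and "finite (carrier G)"
    and "prime p" and "sylow_subgroup G p S"
    and "CHAR('k::alg_closed_field) = p"
  shows "generate (Dade_group G p S)
           {Omega G p S (lcosets\<^bsub>G\<^esub> P) (coset_action G P) | P C.
              C \<in> non_sylow_p_subgroup_classes G p \<and> P \<in> C}
         = (D_Omega G p S :: ('g, 'k) std_gmod set set)"
proof -
  interpret dade G p S "TYPE('k)"
    using assms by (simp add: dade_def dade_axioms_def sylow_context_def sylow_context_axioms_def fgroup_def fgroup_axioms_def)
  have "{Omega G p S (lcosets\<^bsub>G\<^esub> P) (coset_action G P) | P C. C \<in> non_sylow_p_subgroup_classes G p \<and> P \<in> C} = Gamma"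
    unfolding Gamma_def Omega_coset_action using conj_class_eq by blast
  then show ?thesis using generate_Gamma by simp
qed

end
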